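(* Let $(X,T^*_{X,-})$ be a good model with ${\bf H}^1_\partial(X,\mathcal A_{T^*_{X,-}})=(0)$. Then $(X,T^*_{X,-})$ is split, i.e. every supermanifold modelled on $(X,T^*_{X,-})$ is split.
   Context: A model $(X,T^*_{X,-})$ is a complex manifold $X$ with a holomorphic vector bundle $T^*_{X,-}$ (identified with its locally free sheaf of sections). Let $J=\bigoplus_{j>0}\wedge^jT^*_{X,-}\subset\wedge^\bullet T^*_{X,-}$ and $J^k=\bigoplus_{j\ge k}\wedge^jT^*_{X,-}$. For $k\ge2$ let $\mathrm G_k=\mathrm G_{T^*_{X,-},k}$ be the sheaf of groups of automorphisms $\alpha$ of $\wedge^\bullet T^*_{X,-}$ (as a sheaf of $\mathbb C$-algebras, preserving the $\mathbb Z_2$-grading) with $\alpha(u)-u\in J^k$ for all $u$. Then $\mathrm G_2\supseteq\mathrm G_3\supseteq\cdots$ is a descending series of sheaves of normal subgroups of $\mathrm G_2$, trivial for $k>\operatorname{rank}T^*_{X,-}$, and the quotients $\mathrm G_j/\mathrm G_{j+1},\dots,\mathrm G_j/\mathrm G_{j+4}$ are abelian. The obstruction sheaf is the $\mathbb Z$-graded abelian sheaf $\mathcal A_{T^*_{X,-}}=\bigoplus_j\mathcal A_j$, with $\mathcal A_j=\mathrm G_j/\mathrm G_{j+1}$ for $j\ge2$ and $\mathcal A_j=0$ for $j<2$. Obstruction complex: $\partial:H^n(X,\mathcal A_j)\to H^{n+1}(X,\mathcal A_{j+1})$ is the connecting map of $0\to\mathcal A_{j+1}\to\mathrm G_j/\mathrm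 G_{j+2}\to\mathcal A_j\to0$ (zero for $j<2$); $\partial\circ\partial=0$. The first obstruction cohomology is ${\bf H}^1_\partial=\bigoplus_j\ker\{\partial:H^1(X,\mathcal A_j)\to H^2(X,\mathcal A_{j+1})\}/\operatorname{im}\{\partial:H^0(X,\mathcal A_{j-1})\to H^1(X,\mathcal A_j)\}$. A $j$-th order supermanifold atlas ($j\ge2$) modelled on $(X,T^*_{X,-})$ is a representative of an element of the non-abelian Čech cohomology set $\check H^1(X,\mathrm G_j)$. Its obstruction to splitting is its image under $\omega_{j*}:\check H^1(X,\mathrm G_j)\to H^1(X,\mathcal A_j)$ induced by $\mathrm G_j\to\mathcal A_j$. It is strongly split if its image under the map $\check H^1(X,\mathrm G_j)\to\check H^1(X,\mathrm G_2)$ induced by inclusion is the base-point. It is exotic if it is strongly split and its obstruction to splitting is non-zero. The model is good if there are no exotic supermanifold atlases (of any order $j$) modelled on it. A supermanifold $\mathfrak X=(X,\mathcal O_{\mathfrak X})$ modelled on $(X,T^*_{X,-})$ is a locally ringed space with $\mathbb Z_2$-graded (supercommutative) structure sheaf, locally isomorphic to the split model $(X,\wedge^\bullet T^*_{X,-})$; with $\mathcal J\subset\mathcal O_{\mathfrak X}$ the ideal generated by odd sections, $\mathcal O_{\mathfrak X}/\mathcal J=\mathcal O_X$ and $\mathcal J/\mathcal J^2\cong T^*_{X,-}$. It is split if it is isomorphic to the split model. Isomorphism classes of supermanifolds modelled on $(X,T^*_{X,-})$ correspond bijectively to the orbit set $\check H^1(X,\mathrm G_2)/\operatorname{Aut}T^*_{X,-}$,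 the base-point corresponding to the split model (Green). *)

theory Defs
  imports
    "HOL-Analysis.Analysis"
    "HOL-Algebra.Algebra"
begin

section \<open>Complex manifolds\<close>

(* C^n sits in nat => complex as the sequences vanishing from index n on, so that n is an
   ordinary natural number and n = 0 is allowed.  Its topology is the subspace topology of the
   product topology, i.e. the usual one. *)
definition Cn :: "nat \<Rightarrow> (nat \<Rightarrow> complex) set" where
  "Cn n = {z. \<forall>i\<ge>n. z i = 0}"

(* Complex (Frechet) differentiability at every point of S; S is meant to be open in Cn n. *)
definition holo :: "nat \<Rightarrow> ((nat \<Rightarrow> complex) \<Rightarrow> complex) \<Rightarrow> (nat \<Rightarrow> complex) set \<Rightarrow> bool" where
  "holo n f S \<longleftrightarrow> (\<forall>z\<in>S. \<exists>L :: nat \<Rightarrow> complex. \<forall>e>0. \<exists>d>0. \<forall>w\<in>S.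
     (\<forall>i<n. cmod (w i - z i) < d) \<longrightarrow>
       cmod (f w - f z - (\<Sum>i<n. L i * (w i - z i))) \<le> e * (\<Sum>i<n. cmod (w i - z i)))"

type_synonym 'x atlas = "('x set \<times> ('x \<Rightarrow> nat \<Rightarrow> complex)) set"

definition complex_atlas :: "nat \<Rightarrow> 'x::topological_space atlas \<Rightarrow> bool" where
  "complex_atlas n \<A> \<longleftrightarrow>
     (\<Union>(D, \<phi>)\<in>\<A>. D) = UNIV \<and>
     (\<forall>(D, \<phi>)\<in>\<A>. open D \<and> openin (top_of_set (Cn n)) (\<phi> ` D) \<and>
        homeomorphism D (\<phi> ` D) \<phi> (inv_into D \<phi>)) \<and>
     (\<forall>(D, \<phi>)\<in>\<A>. \<forall>(E, \<psi>)\<in>\<A>. \<forall>k<n.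
        holo n (\<lambda>z. \<psi> (inv_into D \<phi> z) k) (\<phi> ` (D \<inter> E)))"

definition holo_on :: "nat \<Rightarrow> 'x atlas \<Rightarrow> 'x set \<Rightarrow> ('x \<Rightarrow> complex) \<Rightarrow> bool" where
  "holo_on n \<A> U f \<longleftrightarrow> (\<forall>(D, \<phi>)\<in>\<A>. holo n (\<lambda>z. f (inv_into D \<phi> z)) (\<phi> ` (D \<inter> U)))"

section \<open>Models: a complex manifold with a holomorphic vector bundle\<close>

(* The manifold is the whole type 'x.  The bundle is given by a trivialising cover triv_dom i
   (i in triv_idx) and holomorphic transition matrices: on triv_dom i \<inter> triv_dom j the frames
   are related by theta^j_l = (SUM k < brank. transf i j x k l * theta^i_k), so coordinate
   columns satisfy s_i = (transf i j) s_j. *)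
record ('x, 'i) model =
  cdim :: nat
  charts :: "'x atlas"
  brank :: nat
  triv_idx :: "'i set"
  triv_dom :: "'i \<Rightarrow> 'x set"
  transf :: "'i \<Rightarrow> 'i \<Rightarrow> 'x \<Rightarrow> nat \<Rightarrow> nat \<Rightarrow> complex"

definition is_model :: "('x::{t2_space,second_countable_topology}, 'i) model \<Rightarrow> bool" where
  "is_model M \<longleftrightarrow>
     complex_atlas (cdim M) (charts M) \<and>
     (\<forall>i\<in>triv_idx M. open (triv_dom M i)) \<and>
     (\<Union>i\<in>triv_idx M. triv_dom M i) = UNIV \<and>
     (\<forall>i\<in>triv_idx M. \<forall>j\<in>triv_idx M. \<forall>k<brank M. \<forall>l<brank M.
        holo_on (cdim M) (charts M) (triv_dom M i \<inter> triv_dom M j) (\<lambda>x. transf M i j x k l)) \<and>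
     (\<forall>i\<in>triv_idx M. \<forall>x\<in>triv_dom M i. \<forall>k<brank M. \<forall>l<brank M.
        transf M i i x k l = (if k = l then 1 else 0)) \<and>
     (\<forall>i\<in>triv_idx M. \<forall>j\<in>triv_idx M. \<forall>m\<in>triv_idx M.
        \<forall>x\<in>triv_dom M i \<inter> triv_dom M j \<inter> triv_dom M m. \<forall>k<brank M. \<forall>l<brank M.
          transf M i m x k l = (\<Sum>p<brank M. transf M i j x k p * transf M j m x p l))"

section \<open>Exterior algebra in coordinates\<close>

(* a :: nat set => complex stands for SUM K. a K * theta_K with theta_K the product of the
   theta_k, k in K, in increasing order. *)
type_synonym ext = "nat set \<Rightarrow> complex"

(* theta_I theta_J = ext_sign I J * theta_(I \<union> J) for disjoint I and J *)
definition ext_sign :: "nat set \<Rightarrow> nat set \<Rightarrow> complex" where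
  "ext_sign I J = (- 1) ^ card {(p, q). p \<in> I \<and> q \<in> J \<and> q < p}"

definition ext_mult :: "ext \<Rightarrow> ext \<Rightarrow> ext" where
  "ext_mult a b = (\<lambda>K. \<Sum>I\<in>Pow K. ext_sign I (K - I) * a I * b (K - I))"

definition ext_one :: ext where
  "ext_one = (\<lambda>K. if K = {} then 1 else 0)"

definition ext_column :: "nat \<Rightarrow> (nat \<Rightarrow> nat \<Rightarrow> complex) \<Rightarrow> nat \<Rightarrow> ext" where
  "ext_column r g l = (\<lambda>K. \<Sum>k<r. if K = {k} then g k l else 0)"

(* The algebra map induced by the linear map g: it substitutes (SUM k < r. g k l * theta_k)
   for theta_l. *)
definition ext_map :: "nat \<Rightarrow> (nat \<Rightarrow> nat \<Rightarrow> complex) \<Rightarrow> ext \<Rightarrow> ext" where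
  "ext_map r g a = (\<lambda>K. \<Sum>J\<in>Pow {..<r}.
     a J * foldr ext_mult (map (ext_column r g) (sorted_list_of_set J)) ext_one K)"

section \<open>Superalgebras and sheaves of superalgebras\<close>

(* part False is the even part, part True the odd part. *)
record 's salg = "'s ring" +
  scal :: "complex \<Rightarrow> 's \<Rightarrow> 's"
  part :: "bool \<Rightarrow> 's set"

definition superalgebra :: "'s salg \<Rightarrow> bool" where
  "superalgebra A \<longleftrightarrow>
     ring A \<and>
     (\<forall>c d. \<forall>a\<in>carrier A. \<forall>b\<in>carrier A.
        scal A c a \<in> carrier A \<and>
        scal A c (a \<oplus>\<^bsub>A\<^esub> b) = scal A c a \<oplus>\<^bsub>A\<^esub> scal A c b \<and>
        scal A (c + d) a = scal A c a \<oplus>\<^bsub>A\<^esub> scal A d a \<and>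
        scal A (c * d) a = scal A c (scal A d a) \<and>
        scal A 1 a = a \<and>
        scal A c a \<otimes>\<^bsub>A\<^esub> b = scal A c (a \<otimes>\<^bsub>A\<^esub> b) \<and>
        a \<otimes>\<^bsub>A\<^esub> scal A c b = scal A c (a \<otimes>\<^bsub>A\<^esub> b)) \<and>
     (\<forall>p. subgroup (part A p) (add_monoid A) \<and> (\<forall>c. \<forall>a\<in>part A p. scal A c a \<in> part A p)) \<and>
     carrier A = part A False <+>\<^bsub>A\<^esub> part A True \<and>
     part A False \<inter> part A True = {\<zero>\<^bsub>A\<^esub>} \<and>
     \<one>\<^bsub>A\<^esub> \<in> part A False \<and>
     (\<forall>p q. \<forall>a\<in>part A p. \<forall>b\<in>part A q.
        a \<otimes>\<^bsub>A\<^esub> b \<in> part A (p \<noteq> q) \<and>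
        a \<otimes>\<^bsub>A\<^esub> b = (if p \<and> q then \<ominus>\<^bsub>A\<^esub> (b \<otimes>\<^bsub>A\<^esub> a) else b \<otimes>\<^bsub>A\<^esub> a))"

definition salg_hom :: "'s salg \<Rightarrow> 't salg \<Rightarrow> ('s \<Rightarrow> 't) set" where
  "salg_hom A B = {h \<in> ring_hom A B.
     (\<forall>c. \<forall>a\<in>carrier A. h (scal A c a) = scal B c (h a)) \<and> (\<forall>p. h ` part A p \<subseteq> part B p)}"

(* srs F U V restricts sections from U to V. *)
record ('x, 's) salg_sheaf =
  salg :: "'x set \<Rightarrow> 's salg"
  srs :: "'x set \<Rightarrow> 'x set \<Rightarrow> 's \<Rightarrow> 's"

definition is_salg_sheaf :: "('x::topological_space, 's) salg_sheaf \<Rightarrow> bool" where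
  "is_salg_sheaf F \<longleftrightarrow>
     (\<forall>U. open U \<longrightarrow> superalgebra (salg F U)) \<and>
     (\<forall>U V. open U \<and> open V \<and> V \<subseteq> U \<longrightarrow> srs F U V \<in> salg_hom (salg F U) (salg F V)) \<and>
     (\<forall>U. open U \<longrightarrow> (\<forall>s\<in>carrier (salg F U). srs F U U s = s)) \<and>
     (\<forall>U V W. open U \<and> open V \<and> open W \<and> W \<subseteq> V \<and> V \<subseteq> U \<longrightarrow>
        (\<forall>s\<in>carrier (salg F U). srs F V W (srs F U V s) = srs F U W s)) \<and>
     (\<forall>\<W> s. (\<forall>W\<in>\<W>. open W \<and> s W \<in> carrier (salg F W)) \<and>
        (\<forall>W\<in>\<W>. \<forall>W'\<in>\<W>. srs F W (W \<inter> W') (s W) = srs F W' (W \<inter> W') (s W')) \<longrightarrow>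
        (\<exists>!t. t \<in> carrier (salg F (\<Union>\<W>)) \<and> (\<forall>W\<in>\<W>. srs F (\<Union>\<W>) W t = s W)))"

(* Compatible superalgebra isomorphisms h V from A over V to B over the preimage of V, for all
   open V contained in U. *)
definition sheaf_iso ::
  "('x::topological_space \<Rightarrow> 'x) \<Rightarrow> 'x set \<Rightarrow> ('x, 's) salg_sheaf \<Rightarrow> ('x, 't) salg_sheaf \<Rightarrow>
   ('x set \<Rightarrow> 's \<Rightarrow> 't) \<Rightarrow> bool" where
  "sheaf_iso f U A B h \<longleftrightarrow>
     (\<forall>V. open V \<and> V \<subseteq> U \<longrightarrow>
        h V \<in> salg_hom (salg A V) (salg B (f -` V)) \<and>
        bij_betw (h V) (carrier (salg A V)) (carrier (salg B (f -` V)))) \<and>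
     (\<forall>V W. open V \<and> open W \<and> W \<subseteq> V \<and> V \<subseteq> U \<longrightarrow>
        (\<forall>s\<in>carrier (salg A V). srs B (f -` V) (f -` W) (h V s) = h W (srs A V W s)))"

(* s is a unit in the stalk at x *)
definition unit_at :: "('x::topological_space, 's) salg_sheaf \<Rightarrow> 'x \<Rightarrow> 'x set \<Rightarrow> 's \<Rightarrow> bool" where
  "unit_at F x U s \<longleftrightarrow> (\<exists>V. open V \<and> x \<in> V \<and> V \<subseteq> U \<and> srs F U V s \<in> Units (salg F V))"

(* Every stalk is a local ring: it is non-zero and the sum of two non-units is a non-unit. *)
definition locally_ringed :: "('x::topological_space, 's) salg_sheaf \<Rightarrow> bool" where
  "locally_ringed F \<longleftrightarrow>
     (\<forall>U x. open U \<and> x \<in> U \<longrightarrow>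
        \<one>\<^bsub>salg F U\<^esub> \<noteq> \<zero>\<^bsub>salg F U\<^esub> \<and>
        (\<forall>s\<in>carrier (salg F U). \<forall>t\<in>carrier (salg F U).
           unit_at F x U (s \<oplus>\<^bsub>salg F U\<^esub> t) \<longrightarrow> unit_at F x U s \<or> unit_at F x U t))"

section \<open>The structure sheaf of the manifold and the split model\<close>

(* Sections over U are extended by 0 outside U, which makes them determined by their values
   on U. *)
definition struct_sheaf ::
  "('x::topological_space, 'i) model \<Rightarrow> ('x, 'x \<Rightarrow> complex) salg_sheaf" where
  "struct_sheaf M =
     \<lparr>salg = (\<lambda>U.
        let C = {f. holo_on (cdim M) (charts M) U f \<and> (\<forall>x. x \<notin> U \<longrightarrow> f x = 0)} in
        \<lparr>carrier = C,
         monoid.mult = (\<lambda>f g x. f x * g x),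
         monoid.one = (\<lambda>x. if x \<in> U then 1 else 0),
         ring.zero = (\<lambda>x. 0),
         ring.add = (\<lambda>f g x. f x + g x),
         scal = (\<lambda>c f x. c * f x),
         part = (\<lambda>p. if p then {\<lambda>x. 0} else C)\<rparr>),
      srs = (\<lambda>U V f x. if x \<in> V then f x else 0)\<rparr>"

(* s i x K is the coefficient of theta^i_K at x, in the i-th trivialisation. *)
type_synonym ('x, 'i) ext_section = "'i \<Rightarrow> 'x \<Rightarrow> ext"

definition ext_sections :: "('x, 'i) model \<Rightarrow> 'x set \<Rightarrow> ('x, 'i) ext_section set" where
  "ext_sections M U = {s.
     (\<forall>i x K. \<not> (i \<in> triv_idx M \<and> x \<in> U \<inter> triv_dom M i \<and> K \<subseteq> {..<brank M}) \<longrightarrow> s i x K = 0) \<and>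
     (\<forall>i\<in>triv_idx M. \<forall>K\<subseteq>{..<brank M}.
        holo_on (cdim M) (charts M) (U \<inter> triv_dom M i) (\<lambda>x. s i x K)) \<and>
     (\<forall>i\<in>triv_idx M. \<forall>j\<in>triv_idx M. \<forall>x\<in>U \<inter> triv_dom M i \<inter> triv_dom M j.
        s i x = ext_map (brank M) (transf M i j x) (s j x))}"

definition split_model ::
  "('x::topological_space, 'i) model \<Rightarrow> ('x, ('x, 'i) ext_section) salg_sheaf" where
  "split_model M =
     \<lparr>salg = (\<lambda>U.
        \<lparr>carrier = ext_sections M U,
         monoid.mult = (\<lambda>s t i x. ext_mult (s i x) (t i x)),
         monoid.one = (\<lambda>i x. if i \<in> triv_idx M \<and> x \<in> U \<inter> triv_dom M i then ext_one else (\<lambda>K. 0)),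
         ring.zero = (\<lambda>i x K. 0),
         ring.add = (\<lambda>s t i x K. s i x K + t i x K),
         scal = (\<lambda>c s i x K. c * s i x K),
         part = (\<lambda>p. {s \<in> ext_sections M U. \<forall>i x K. s i x K \<noteq> 0 \<longrightarrow> odd (card K) = p})\<rparr>),
      srs = (\<lambda>U V s i x. if x \<in> V then s i x else (\<lambda>K. 0))\<rparr>"

(* The bundle itself is the degree-one part of its exterior algebra. *)
definition bundle_sections :: "('x, 'i) model \<Rightarrow> 'x set \<Rightarrow> ('x, 'i) ext_section set" where
  "bundle_sections M U = {s \<in> ext_sections M U. \<forall>i x K. s i x K \<noteq> 0 \<longrightarrow> card K = 1}"

definition J_pow :: "('x, 'i) model \<Rightarrow> nat \<Rightarrow> 'x set \<Rightarrow> ('x, 'i) ext_section set" where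
  "J_pow M k U = {s \<in> ext_sections M U. \<forall>i x K. s i x K \<noteq> 0 \<longrightarrow> k \<le> card K}"

section \<open>Supermanifolds\<close>

definition odd_ideal :: "('x::topological_space, 's) salg_sheaf \<Rightarrow> 'x set \<Rightarrow> 's set" where
  "odd_ideal F U = {s \<in> carrier (salg F U). \<forall>x\<in>U. \<exists>V. open V \<and> x \<in> V \<and> V \<subseteq> U \<and>
     srs F U V s \<in> Idl\<^bsub>salg F V\<^esub> (part (salg F V) True)}"

definition odd_ideal_sq :: "('x::topological_space, 's) salg_sheaf \<Rightarrow> 'x set \<Rightarrow> 's set" where
  "odd_ideal_sq F U = {s \<in> carrier (salg F U). \<forall>x\<in>U. \<exists>V. open V \<and> x \<in> V \<and> V \<subseteq> U \<and>
     srs F U V s \<in> Idl\<^bsub>salg F V\<^esub> (odd_ideal F V <#>\<^bsub>salg F V\<^esub> odd_ideal F V)}"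

(* pi exhibits the structure sheaf of the manifold as the quotient sheaf O/J: it is locally
   surjective with kernel J. *)
definition reduction ::
  "('x::topological_space, 'i) model \<Rightarrow> ('x, 's) salg_sheaf \<Rightarrow> ('x set \<Rightarrow> 's \<Rightarrow> 'x \<Rightarrow> complex) \<Rightarrow> bool"
where
  "reduction M F \<pi> \<longleftrightarrow>
     (\<forall>U. open U \<longrightarrow> \<pi> U \<in> salg_hom (salg F U) (salg (struct_sheaf M) U)) \<and>
     (\<forall>U V. open U \<and> open V \<and> V \<subseteq> U \<longrightarrow> (\<forall>s\<in>carrier (salg F U).
        srs (struct_sheaf M) U V (\<pi> U s) = \<pi> V (srs F U V s))) \<and>
     (\<forall>U f x. open U \<and> f \<in> carrier (salg (struct_sheaf M) U) \<and> x \<in> U \<longrightarrow>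
        (\<exists>V. open V \<and> x \<in> V \<and> V \<subseteq> U \<and>
          srs (struct_sheaf M) U V f \<in> \<pi> V ` carrier (salg F V))) \<and>
     (\<forall>U. open U \<longrightarrow> {s \<in> carrier (salg F U). \<pi> U s = \<zero>\<^bsub>salg (struct_sheaf M) U\<^esub>} = odd_ideal F U)"

(* tau exhibits the bundle as the quotient sheaf J/J^2: it is additive, linear over the structure
   sheaf (through pi), locally surjective and has kernel J^2. *)
definition conormal ::
  "('x::topological_space, 'i) model \<Rightarrow> ('x, 's) salg_sheaf \<Rightarrow> ('x set \<Rightarrow> 's \<Rightarrow> 'x \<Rightarrow> complex) \<Rightarrow>
   ('x set \<Rightarrow> 's \<Rightarrow> ('x, 'i) ext_section) \<Rightarrow> bool"
where
  "conormal M F \<pi> \<tau> \<longleftrightarrow>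
     (\<forall>U. open U \<longrightarrow> \<tau> U ` odd_ideal F U \<subseteq> bundle_sections M U) \<and>
     (\<forall>U. open U \<longrightarrow> (\<forall>s\<in>odd_ideal F U. \<forall>t\<in>odd_ideal F U. \<forall>a\<in>carrier (salg F U).
        \<tau> U (s \<oplus>\<^bsub>salg F U\<^esub> t) = (\<lambda>i x K. \<tau> U s i x K + \<tau> U t i x K) \<and>
        \<tau> U (a \<otimes>\<^bsub>salg F U\<^esub> s) = (\<lambda>i x K. \<pi> U a x * \<tau> U s i x K))) \<and>
     (\<forall>U V. open U \<and> open V \<and> V \<subseteq> U \<longrightarrow> (\<forall>s\<in>odd_ideal F U.
        srs (split_model M) U V (\<tau> U s) = \<tau> V (srs F U V s))) \<and>
     (\<forall>U v x. open U \<and> v \<in> bundle_sections M U \<and> x \<in> U \<longrightarrow>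
        (\<exists>V. open V \<and> x \<in> V \<and> V \<subseteq> U \<and> srs (split_model M) U V v \<in> \<tau> V ` odd_ideal F V)) \<and>
     (\<forall>U. open U \<longrightarrow> {s \<in> odd_ideal F U. \<tau> U s = (\<lambda>i x K. 0)} = odd_ideal_sq F U)"

definition supermanifold :: "('x::topological_space, 'i) model \<Rightarrow> ('x, 's) salg_sheaf \<Rightarrow> bool" where
  "supermanifold M F \<longleftrightarrow>
     is_salg_sheaf F \<and> locally_ringed F \<and>
     (\<forall>x. \<exists>U h. open U \<and> x \<in> U \<and> sheaf_iso id U F (split_model M) h) \<and>
     (\<exists>\<pi> \<tau>. reduction M F \<pi> \<and> conormal M F \<pi> \<tau>)"

(* isomorphic to the split model as a (super) ringed space *)
definition is_split :: "('x::topological_space, 'i) model \<Rightarrow> ('x, 's) salg_sheaf \<Rightarrow> bool" where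
  "is_split M F \<longleftrightarrow>
     (\<exists>f g h. homeomorphism UNIV UNIV f g \<and> sheaf_iso f UNIV F (split_model M) h)"

section \<open>Sheaves of groups, quotient sheaves\<close>

(* grs F U V restricts sections from U to V; groups are written multiplicatively throughout,
   also when they are abelian. *)
record ('x, 'g) grp_sheaf =
  grp :: "'x set \<Rightarrow> 'g monoid"
  grs :: "'x set \<Rightarrow> 'x set \<Rightarrow> 'g \<Rightarrow> 'g"

(* A section of the quotient sheaf F/N (N a sheaf of normal subgroups of F) over U is a family of
   elements of the quotients F_x/N_x of the stalks, x in U, locally induced by sections of F.
   An element of F_x/N_x is represented by the set of all sections of F near x with the given
   germ modulo N_x. *)
type_synonym ('x, 'g) quot = "'x \<Rightarrow> ('x set \<times> 'g) set"

definition germ_class ::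
  "('x::topological_space, 'g) grp_sheaf \<Rightarrow> ('x set \<Rightarrow> 'g set) \<Rightarrow> 'x \<Rightarrow> 'x set \<times> 'g \<Rightarrow> ('x set \<times> 'g) set"
where
  "germ_class F N x = (\<lambda>(V, f). {(W, g). open W \<and> x \<in> W \<and> g \<in> carrier (grp F W) \<and>
     (\<exists>Z. open Z \<and> x \<in> Z \<and> Z \<subseteq> V \<inter> W \<and>
       (\<exists>n\<in>N Z. grs F W Z g = grs F V Z f \<otimes>\<^bsub>grp F Z\<^esub> n))})"

definition quot_proj ::
  "('x::topological_space, 'g) grp_sheaf \<Rightarrow> ('x set \<Rightarrow> 'g set) \<Rightarrow> 'x set \<Rightarrow> 'g \<Rightarrow> ('x, 'g) quot"
where
  "quot_proj F N U f = (\<lambda>x\<in>U. germ_class F N x (U, f))"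

definition quot_sheaf ::
  "('x::topological_space, 'g) grp_sheaf \<Rightarrow> ('x set \<Rightarrow> 'g set) \<Rightarrow> ('x, ('x, 'g) quot) grp_sheaf"
where
  "quot_sheaf F N =
     \<lparr>grp = (\<lambda>U.
        \<lparr>carrier = {s \<in> extensional U. \<forall>x\<in>U. \<exists>V f. open V \<and> x \<in> V \<and> V \<subseteq> U \<and>
            f \<in> carrier (grp F V) \<and> restrict s V = quot_proj F N V f},
         monoid.mult = (\<lambda>s t. \<lambda>x\<in>U. \<Union>{germ_class F N x (V, f \<otimes>\<^bsub>grp F V\<^esub> g) | V f g.
            (V, f) \<in> s x \<and> (V, g) \<in> t x}),
         one = quot_proj F N U \<one>\<^bsub>grp F U\<^esub>\<rparr>),
      grs = (\<lambda>U V s. restrict s V)\<rparr>"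

(* The map F/N -> F'/N' induced by an inclusion F <= F' with N <= N'. *)
definition quot_map ::
  "('x::topological_space, 'g) grp_sheaf \<Rightarrow> ('x set \<Rightarrow> 'g set) \<Rightarrow> 'x set \<Rightarrow> ('x, 'g) quot \<Rightarrow> ('x, 'g) quot"
where
  "quot_map F' N' U s = (\<lambda>x\<in>U. \<Union>(germ_class F' N' x ` s x))"

section \<open>Cech cohomology\<close>

definition open_cover :: "'x::topological_space set set \<Rightarrow> bool" where
  "open_cover \<U> \<longleftrightarrow> (\<forall>U\<in>\<U>. open U) \<and> \<Union>\<U> = UNIV"

type_synonym ('x, 'g) cocycle1 = "'x set set \<times> ('x set \<Rightarrow> 'x set \<Rightarrow> 'g)"
type_synonym ('x, 'g) cocycle2 = "'x set set \<times> ('x set \<Rightarrow> 'x set \<Rightarrow> 'x set \<Rightarrow> 'g)"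

(* Covers are sets of open sets, indexed by themselves; values of cochains outside the cover are
   irrelevant. *)
definition Z1 :: "('x::topological_space, 'g) grp_sheaf \<Rightarrow> ('x, 'g) cocycle1 set" where
  "Z1 F = {(\<U>, g). open_cover \<U> \<and>
     (\<forall>U\<in>\<U>. \<forall>V\<in>\<U>. g U V \<in> carrier (grp F (U \<inter> V))) \<and>
     (\<forall>U\<in>\<U>. \<forall>V\<in>\<U>. \<forall>W\<in>\<U>.
        grs F (U \<inter> V) (U \<inter> V \<inter> W) (g U V) \<otimes>\<^bsub>grp F (U \<inter> V \<inter> W)\<^esub>
        grs F (V \<inter> W) (U \<inter> V \<inter> W) (g V W) = grs F (U \<inter> W) (U \<inter> V \<inter> W) (g U W))}"

(* Equality in the direct limit over covers: on a common refinement, h = l^-1 g l. *)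
definition H1_rel ::
  "('x::topological_space, 'g) grp_sheaf \<Rightarrow> (('x, 'g) cocycle1 \<times> ('x, 'g) cocycle1) set" where
  "H1_rel F = {((\<U>, g), (\<V>, h)). (\<U>, g) \<in> Z1 F \<and> (\<V>, h) \<in> Z1 F \<and>
     (\<exists>\<W> \<tau> \<sigma> l. open_cover \<W> \<and>
       (\<forall>W\<in>\<W>. \<tau> W \<in> \<U> \<and> W \<subseteq> \<tau> W \<and> \<sigma> W \<in> \<V> \<and> W \<subseteq> \<sigma> W \<and> l W \<in> carrier (grp F W)) \<and>
       (\<forall>W\<in>\<W>. \<forall>W'\<in>\<W>.
          grs F (\<tau> W \<inter> \<tau> W') (W \<inter> W') (g (\<tau> W) (\<tau> W')) \<otimes>\<^bsub>grp F (W \<inter> W')\<^esub>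
          grs F W' (W \<inter> W') (l W') =
          grs F W (W \<inter> W') (l W) \<otimes>\<^bsub>grp F (W \<inter> W')\<^esub>
          grs F (\<sigma> W \<inter> \<sigma> W') (W \<inter> W') (h (\<sigma> W) (\<sigma> W'))))}"

definition H1_class ::
  "('x::topological_space, 'g) grp_sheaf \<Rightarrow> ('x, 'g) cocycle1 \<Rightarrow> ('x, 'g) cocycle1 set" where
  "H1_class F c = H1_rel F `` {c}"

definition H1_base :: "('x::topological_space, 'g) grp_sheaf \<Rightarrow> ('x, 'g) cocycle1 set" where
  "H1_base F = H1_class F ({UNIV}, \<lambda>U V. \<one>\<^bsub>grp F UNIV\<^esub>)"

(* For abelian F: classes are multiplied by multiplying representatives on one cover. *)
definition H1 :: "('x::topological_space, 'g) grp_sheaf \<Rightarrow> ('x, 'g) cocycle1 set monoid" where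
  "H1 F = \<lparr>carrier = Z1 F // H1_rel F,
     monoid.mult = (\<lambda>C D. \<Union>{H1_class F (\<W>, \<lambda>U V. a U V \<otimes>\<^bsub>grp F (U \<inter> V)\<^esub> b U V) | \<W> a b.
        (\<W>, a) \<in> C \<and> (\<W>, b) \<in> D}),
     one = H1_base F\<rparr>"

definition Z2 :: "('x::topological_space, 'g) grp_sheaf \<Rightarrow> ('x, 'g) cocycle2 set" where
  "Z2 F = {(\<U>, b). open_cover \<U> \<and>
     (\<forall>U\<in>\<U>. \<forall>V\<in>\<U>. \<forall>W\<in>\<U>. b U V W \<in> carrier (grp F (U \<inter> V \<inter> W))) \<and>
     (\<forall>U\<in>\<U>. \<forall>V\<in>\<U>. \<forall>W\<in>\<U>. \<forall>Y\<in>\<U>. let I = U \<inter> V \<inter> W \<inter> Y in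
        grs F (V \<inter> W \<inter> Y) I (b V W Y) \<otimes>\<^bsub>grp F I\<^esub> grs F (U \<inter> V \<inter> Y) I (b U V Y) =
        grs F (U \<inter> W \<inter> Y) I (b U W Y) \<otimes>\<^bsub>grp F I\<^esub> grs F (U \<inter> V \<inter> W) I (b U V W))}"

(* On a common refinement, d = b * (coboundary of l). *)
definition H2_rel ::
  "('x::topological_space, 'g) grp_sheaf \<Rightarrow> (('x, 'g) cocycle2 \<times> ('x, 'g) cocycle2) set" where
  "H2_rel F = {((\<U>, b), (\<V>, d)). (\<U>, b) \<in> Z2 F \<and> (\<V>, d) \<in> Z2 F \<and>
     (\<exists>\<W> \<tau> \<sigma> l. open_cover \<W> \<and>
       (\<forall>W\<in>\<W>. \<tau> W \<in> \<U> \<and> W \<subseteq> \<tau> W \<and> \<sigma> W \<in> \<V> \<and> W \<subseteq> \<sigma> W) \<and>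
       (\<forall>W\<in>\<W>. \<forall>W'\<in>\<W>. l W W' \<in> carrier (grp F (W \<inter> W'))) \<and>
       (\<forall>W\<in>\<W>. \<forall>W'\<in>\<W>. \<forall>W''\<in>\<W>. let I = W \<inter> W' \<inter> W'' in
          grs F (\<sigma> W \<inter> \<sigma> W' \<inter> \<sigma> W'') I (d (\<sigma> W) (\<sigma> W') (\<sigma> W'')) \<otimes>\<^bsub>grp F I\<^esub>
          grs F (W \<inter> W'') I (l W W'') =
          grs F (\<tau> W \<inter> \<tau> W' \<inter> \<tau> W'') I (b (\<tau> W) (\<tau> W') (\<tau> W'')) \<otimes>\<^bsub>grp F I\<^esub>
          (grs F (W' \<inter> W'') I (l W' W'') \<otimes>\<^bsub>grp F I\<^esub> grs F (W \<inter> W') I (l W W'))))}"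

definition H2_class ::
  "('x::topological_space, 'g) grp_sheaf \<Rightarrow> ('x, 'g) cocycle2 \<Rightarrow> ('x, 'g) cocycle2 set" where
  "H2_class F c = H2_rel F `` {c}"

definition H2_zero :: "('x::topological_space, 'g) grp_sheaf \<Rightarrow> ('x, 'g) cocycle2 set" where
  "H2_zero F = H2_class F ({UNIV}, \<lambda>U V W. \<one>\<^bsub>grp F UNIV\<^esub>)"

section \<open>The sheaves of automorphisms and the obstruction complex\<close>

type_synonym ('x, 'i) aut = "'x set \<Rightarrow> ('x, 'i) ext_section \<Rightarrow> ('x, 'i) ext_section"

(* A section over U is a family of automorphisms over all open subsets of U. *)
definition G_sheaf ::
  "('x::topological_space, 'i) model \<Rightarrow> nat \<Rightarrow> ('x, ('x, 'i) aut) grp_sheaf" where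
  "G_sheaf M k =
     \<lparr>grp = (\<lambda>U.
        (product_group {V. open V \<and> V \<subseteq> U} (\<lambda>V. BijGroup (ext_sections M V)))
        \<lparr>carrier := {\<alpha> \<in> carrier (product_group {V. open V \<and> V \<subseteq> U}
                                    (\<lambda>V. BijGroup (ext_sections M V))).
            sheaf_iso id U (split_model M) (split_model M) \<alpha> \<and>
            (\<forall>V. open V \<and> V \<subseteq> U \<longrightarrow> (\<forall>u\<in>ext_sections M V.
               (\<lambda>i x K. \<alpha> V u i x K - u i x K) \<in> J_pow M k V))}\<rparr>),
      grs = (\<lambda>U V \<alpha>. restrict \<alpha> {W. open W \<and> W \<subseteq> V})\<rparr>"

definition G_sec :: "('x::topological_space, 'i) model \<Rightarrow> nat \<Rightarrow> 'x set \<Rightarrow> ('x, 'i) aut set" where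
  "G_sec M k U = carrier (grp (G_sheaf M k) U)"

definition G_quot ::
  "('x::topological_space, 'i) model \<Rightarrow> nat \<Rightarrow> nat \<Rightarrow> ('x, ('x, ('x, 'i) aut) quot) grp_sheaf" where
  "G_quot M j m = quot_sheaf (G_sheaf M j) (G_sec M m)"

definition trivial_sheaf :: "('x, ('x, 'g) quot) grp_sheaf" where
  "trivial_sheaf =
     \<lparr>grp = (\<lambda>U. \<lparr>carrier = {\<lambda>x\<in>U. {}}, monoid.mult = (\<lambda>s t. \<lambda>x\<in>U. {}), one = (\<lambda>x\<in>U. {})\<rparr>),
      grs = (\<lambda>U V s. restrict s V)\<rparr>"

definition obstr_sheaf ::
  "('x::topological_space, 'i) model \<Rightarrow> int \<Rightarrow> ('x, ('x, ('x, 'i) aut) quot) grp_sheaf" where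
  "obstr_sheaf M j = (if j \<ge> 2 then G_quot M (nat j) (nat j + 1) else trivial_sheaf)"

(* Graph of the connecting map H^0(A_j) -> H^1(A_(j+1)): lift theta locally to
   t U in G_j/G_(j+2); the coboundary t_U^-1 t_V comes from a cocycle a of A_(j+1). *)
definition conn0 ::
  "('x::topological_space, 'i) model \<Rightarrow> int \<Rightarrow>
   (('x, ('x, 'i) aut) quot \<times> ('x, ('x, ('x, 'i) aut) quot) cocycle1 set) set" where
  "conn0 M j =
     (if j < 2 then carrier (grp (obstr_sheaf M j) UNIV) \<times> {\<one>\<^bsub>H1 (obstr_sheaf M (j + 1))\<^esub>}
      else let k = nat j; Q = G_quot M k (k + 2) in
        {(\<theta>, H1_class (obstr_sheaf M (j + 1)) (\<U>, a)) | \<theta> \<U> a.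
           \<theta> \<in> carrier (grp (obstr_sheaf M j) UNIV) \<and>
           (\<U>, a) \<in> Z1 (obstr_sheaf M (j + 1)) \<and>
           (\<exists>t. (\<forall>U\<in>\<U>. t U \<in> carrier (grp Q U) \<and>
                   quot_map (G_sheaf M k) (G_sec M (k + 1)) U (t U) =
                   grs (obstr_sheaf M j) UNIV U \<theta>) \<and>
                (\<forall>U\<in>\<U>. \<forall>V\<in>\<U>.
                   grs Q U (U \<inter> V) (t U) \<otimes>\<^bsub>grp Q (U \<inter> V)\<^esub>
                   quot_map (G_sheaf M k) (G_sec M (k + 2)) (U \<inter> V) (a U V) =
                   grs Q V (U \<inter> V) (t V)))})"

(* Graph of the connecting map H^1(A_j) -> H^2(A_(j+1)): lift a cocycle a to t U V in
   G_j/G_(j+2); the coboundary t_VW t_UW^-1 t_UV comes from a cocycle b of A_(j+1)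
   (G_j/G_(j+2) is abelian). *)
definition conn1 ::
  "('x::topological_space, 'i) model \<Rightarrow> int \<Rightarrow>
   (('x, ('x, ('x, 'i) aut) quot) cocycle1 set \<times> ('x, ('x, ('x, 'i) aut) quot) cocycle2 set) set"
where
  "conn1 M j =
     (if j < 2 then carrier (H1 (obstr_sheaf M j)) \<times> {H2_zero (obstr_sheaf M (j + 1))}
      else let k = nat j; Q = G_quot M k (k + 2) in
        {(H1_class (obstr_sheaf M j) (\<U>, a), H2_class (obstr_sheaf M (j + 1)) (\<U>, b)) | \<U> a b.
           (\<U>, a) \<in> Z1 (obstr_sheaf M j) \<and>
           (\<U>, b) \<in> Z2 (obstr_sheaf M (j + 1)) \<and>
           (\<exists>t. (\<forall>U\<in>\<U>. \<forall>V\<in>\<U>. t U V \<in> carrier (grp Q (U \<inter> V)) \<and>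
                   quot_map (G_sheaf M k) (G_sec M (k + 1)) (U \<inter> V) (t U V) = a U V) \<and>
                (\<forall>U\<in>\<U>. \<forall>V\<in>\<U>. \<forall>W\<in>\<U>. let I = U \<inter> V \<inter> W in
                   grs Q (V \<inter> W) I (t V W) \<otimes>\<^bsub>grp Q I\<^esub> grs Q (U \<inter> V) I (t U V) =
                   grs Q (U \<inter> W) I (t U W) \<otimes>\<^bsub>grp Q I\<^esub>
                   quot_map (G_sheaf M k) (G_sec M (k + 2)) I (b U V W)))})"

definition ker1 ::
  "('x::topological_space, 'i) model \<Rightarrow> int \<Rightarrow> ('x, ('x, ('x, 'i) aut) quot) cocycle1 set set" where
  "ker1 M j = {c \<in> carrier (H1 (obstr_sheaf M j)). (c, H2_zero (obstr_sheaf M (j + 1))) \<in> conn1 M j}"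

(* im0 M j lies in H^1(A_j), hence the shift. *)
definition im0 ::
  "('x::topological_space, 'i) model \<Rightarrow> int \<Rightarrow> ('x, ('x, ('x, 'i) aut) quot) cocycle1 set set" where
  "im0 M j = conn0 M (j - 1) `` carrier (grp (obstr_sheaf M (j - 1)) UNIV)"

definition first_obstruction_cohomology ::
  "('x::topological_space, 'i) model \<Rightarrow>
   (int \<Rightarrow> ('x, ('x, ('x, 'i) aut) quot) cocycle1 set set) monoid" where
  "first_obstruction_cohomology M =
     sum_group UNIV (\<lambda>j. ((H1 (obstr_sheaf M j))\<lparr>carrier := ker1 M j\<rparr>) Mod im0 M j)"

section \<open>Atlases and good models\<close>

definition supermanifold_atlas ::
  "('x::topological_space, 'i) model \<Rightarrow> nat \<Rightarrow> ('x, ('x, 'i) aut) cocycle1 \<Rightarrow> bool" where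
  "supermanifold_atlas M j c \<longleftrightarrow> 2 \<le> j \<and> c \<in> Z1 (G_sheaf M j)"

definition obstruction ::
  "('x::topological_space, 'i) model \<Rightarrow> nat \<Rightarrow> ('x, ('x, 'i) aut) cocycle1 \<Rightarrow>
   ('x, ('x, ('x, 'i) aut) quot) cocycle1 set" where
  "obstruction M j = (\<lambda>(\<U>, g). H1_class (obstr_sheaf M (int j))
     (\<U>, \<lambda>U V. quot_proj (G_sheaf M j) (G_sec M (j + 1)) (U \<inter> V) (g U V)))"

definition strongly_split ::
  "('x::topological_space, 'i) model \<Rightarrow> ('x, ('x, 'i) aut) cocycle1 \<Rightarrow> bool" where
  "strongly_split M c \<longleftrightarrow> H1_class (G_sheaf M 2) c = H1_base (G_sheaf M 2)"

definition exotic ::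
  "('x::topological_space, 'i) model \<Rightarrow> nat \<Rightarrow> ('x, ('x, 'i) aut) cocycle1 \<Rightarrow> bool" where
  "exotic M j c \<longleftrightarrow> supermanifold_atlas M j c \<and> strongly_split M c \<and>
     obstruction M j c \<noteq> \<one>\<^bsub>H1 (obstr_sheaf M (int j))\<^esub>"

definition good_model :: "('x::topological_space, 'i) model \<Rightarrow> bool" where
  "good_model M \<longleftrightarrow> (\<forall>j c. \<not> exotic M j c)"

end

theory Submission imports Defs "Jordan_Normal_Form.Determinant" begin

text \<open>
  A supermanifold is locally isomorphic to the split model, and it is split as soon as these local
  isomorphisms can be chosen to agree on overlaps. Composing a local isomorphism with the automorphism
  of the exterior algebra given by an invertible matrix of functions, one may assume that it induces the
  given identification of the conormal sheaf with the bundle (\<open>normalized_exists\<close>). It also respects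
  the given reduction to the manifold, because the stalks are local rings (\<open>body\<close>). Hence two such
  isomorphisms differ by an automorphism that is the identity modulo the square of the odd ideal
  (\<open>transition_G\<close>), and all these differences form a cocycle with values in the first step G 2 of the
  filtration by the sheaves G j of automorphisms that are the identity modulo the j-th power.

  It remains to show that this cocycle is cohomologous to the trivial one. One climbs the filtration:
  a cocycle in G j is cohomologous to one in G (j + 1) if its obstruction, the class of its image in
  the quotient of G j by G (j + 1), vanishes (\<open>lift_cocycle\<close>). This class is closed
  (\<open>obstruction_closed\<close>), because the cocycle itself lifts it to the quotient of G j by G (j + 2), which
  is commutative. By the vanishing of cohomology it is then exact (\<open>ker1_im0\<close>). But an exact
  class is the obstruction of a strongly split atlas, namely of the coboundary of local lifts of the
  section whose connecting image it is (\<open>connecting_image\<close>); on a good model such an obstruction is zero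
  (\<open>good_im0_trivial\<close>). So one reaches every step (\<open>climb\<close>), and above the rank of the bundle the
  steps are trivial (\<open>G_sec_trivial\<close>). The 0-cochain that relates the original cocycle to the trivial
  one corrects the local isomorphisms so that they glue (\<open>split_of_vanishing\<close>).

  The structure of the filtration rests on one estimate, \<open>G_sec_raise\<close>: an automorphism in G 2,
  minus the identity, raises the order of every section by two, where the definition gives this only for sections of order
  zero. It makes the steps of the filtration normal subgroups and puts the commutators of step j into step j + 2.
  The climbing itself is carried out for any filtration of a presheaf of groups with these properties.
\<close>

section \<open>The exterior algebra in coordinates\<close>

definition Ext :: "nat \<Rightarrow> ext set" where
  "Ext r = {a. \<forall>K. \<not> K \<subseteq> {..<r} \<longrightarrow> a K = 0}"

lemma ExtD: "a \<in> Ext r \<Longrightarrow> \<not> K \<subseteq> {..<r} \<Longrightarrow> a K = 0"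
  by (simp add: Ext_def)

lemma ext_mult_infinite: "infinite K \<Longrightarrow> ext_mult a b K = 0"
  by (simp add: ext_mult_def)

lemma ext_mult_neq0:
  assumes "ext_mult a b K \<noteq> 0"
  obtains I where "finite K" "I \<subseteq> K" "a I \<noteq> 0" "b (K - I) \<noteq> 0"
proof -
  have "finite K" using assms ext_mult_infinite by blast
  moreover have "\<exists>I\<in>Pow K. a I \<noteq> 0 \<and> b (K - I) \<noteq> 0"
  proof (rule ccontr)
    assume "\<not> ?thesis"
    then have "ext_mult a b K = 0"
      unfolding ext_mult_def by (intro sum.neutral) auto
    with assms show False by simp
  qed
  ultimately show ?thesis using that by auto
qed

lemma ext_mult_Ext: "a \<in> Ext r \<Longrightarrow> b \<in> Ext r \<Longrightarrow> ext_mult a b \<in> Ext r"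
  unfolding Ext_def mem_Collect_eq
proof (intro allI impI)
  fix K assume h: "\<forall>K. \<not> K \<subseteq> {..<r} \<longrightarrow> a K = 0" "\<forall>K. \<not> K \<subseteq> {..<r} \<longrightarrow> b K = 0"
    "\<not> K \<subseteq> {..<r}"
  show "ext_mult a b K = 0"
  proof (rule ccontr)
    assume "ext_mult a b K \<noteq> 0"
    then obtain I where "I \<subseteq> K" "a I \<noteq> 0" "b (K - I) \<noteq> 0" by (rule ext_mult_neq0)
    with h have "I \<subseteq> {..<r}" "K - I \<subseteq> {..<r}" by metis+
    with h(3) show False by blast
  qed
qed

lemma ext_one_Ext [simp]: "ext_one \<in> Ext r"
  by (auto simp: ext_one_def Ext_def)

lemma ext_mult_sum_left:
  "ext_mult (\<lambda>K. \<Sum>i\<in>A. c i * f i K) b = (\<lambda>K. \<Sum>i\<in>A. c i * ext_mult (f i) b K)"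
  unfolding ext_mult_def
  by (rule ext) (simp add: sum_distrib_left sum_distrib_right sum.swap[of _ A] algebra_simps)

lemma ext_mult_sum_right:
  "ext_mult b (\<lambda>K. \<Sum>i\<in>A. c i * f i K) = (\<lambda>K. \<Sum>i\<in>A. c i * ext_mult b (f i) K)"
  unfolding ext_mult_def
  by (rule ext) (simp add: sum_distrib_left sum_distrib_right sum.swap[of _ A] algebra_simps)

lemma ext_mult_diff_left: "ext_mult (\<lambda>K. a K - b K) c = (\<lambda>K. ext_mult a c K - ext_mult b c K)"
  unfolding ext_mult_def by (rule ext) (simp add: sum_subtractf algebra_simps)

lemma ext_mult_diff_right: "ext_mult c (\<lambda>K. a K - b K) = (\<lambda>K. ext_mult c a K - ext_mult c b K)"
  unfolding ext_mult_def by (rule ext) (simp add: sum_subtractf algebra_simps)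

lemma ext_mult_scal_left: "ext_mult (\<lambda>K. c * a K) b = (\<lambda>K. c * ext_mult a b K)"
  unfolding ext_mult_def by (rule ext) (simp add: sum_distrib_left algebra_simps)

lemma ext_mult_scal_right: "ext_mult a (\<lambda>K. c * b K) = (\<lambda>K. c * ext_mult a b K)"
  unfolding ext_mult_def by (rule ext) (simp add: sum_distrib_left algebra_simps)

lemma ext_mult_zero [simp]:
  "ext_mult (\<lambda>K. 0) b = (\<lambda>K. 0)" "ext_mult b (\<lambda>K. 0) = (\<lambda>K. 0)"
  unfolding ext_mult_def by auto

lemma ext_sign_empty [simp]: "ext_sign {} J = 1" "ext_sign I {} = 1"
  by (auto simp: ext_sign_def)

lemma finite_inversions: "finite I \<Longrightarrow> finite J \<Longrightarrow> finite {(p, q). p \<in> I \<and> q \<in> J \<and> q < (p::nat)}"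
  by (rule finite_subset[of _ "I \<times> J"]) auto

lemma ext_sign_Un_left:
  assumes "finite A" "finite B" "finite C" "A \<inter> B = {}"
  shows "ext_sign (A \<union> B) C = ext_sign A C * ext_sign B C"
proof -
  have "{(p, q). p \<in> A \<union> B \<and> q \<in> C \<and> q < p} =
    {(p, q). p \<in> A \<and> q \<in> C \<and> q < p} \<union> {(p, q). p \<in> B \<and> q \<in> C \<and> q < p}" by auto
  moreover have "{(p, q). p \<in> A \<and> q \<in> C \<and> q < p} \<inter> {(p, q). p \<in> B \<and> q \<in> C \<and> q < p} = {}"
    using assms by auto
  ultimately show ?thesis
    by (simp add: ext_sign_def card_Un_disjoint finite_inversions assms power_add)
qed

lemma ext_sign_Un_right:
  assumes "finite A" "finite B" "finite C" "B \<inter> C = {}"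
  shows "ext_sign A (B \<union> C) = ext_sign A B * ext_sign A C"
proof -
  have "{(p, q). p \<in> A \<and> q \<in> B \<union> C \<and> q < p} =
    {(p, q). p \<in> A \<and> q \<in> B \<and> q < p} \<union> {(p, q). p \<in> A \<and> q \<in> C \<and> q < p}" by auto
  moreover have "{(p, q). p \<in> A \<and> q \<in> B \<and> q < p} \<inter> {(p, q). p \<in> A \<and> q \<in> C \<and> q < p} = {}"
    using assms by auto
  ultimately show ?thesis
    by (simp add: ext_sign_def card_Un_disjoint finite_inversions assms power_add)
qed

lemma ext_sign_less:
  assumes "\<And>p q. p \<in> I \<Longrightarrow> q \<in> J \<Longrightarrow> p < q"
  shows "ext_sign I J = 1"
proof -
  have "{(p, q). p \<in> I \<and> q \<in> J \<and> q < p} = {}" using assms by fastforce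
  then show ?thesis unfolding ext_sign_def by (simp only: card.empty power_0)
qed

lemma ext_sign_swap: "p \<noteq> q \<Longrightarrow> ext_sign {p} {q} = - ext_sign {q} {p}"
proof -
  assume "p \<noteq> q"
  have *: "ext_sign {a} {b} = -1" if "b < a" for a b
  proof -
    have "{(p, q). p \<in> {a} \<and> q \<in> {b} \<and> q < p} = {(a, b)}" using that by auto
    then show ?thesis by (simp add: ext_sign_def)
  qed
  from \<open>p \<noteq> q\<close> consider "p < q" | "q < p" by linarith
  then show ?thesis
    by cases (use *[of p q] *[of q p] ext_sign_less[of "{p}" "{q}"] ext_sign_less[of "{q}" "{p}"] in auto)
qed

lemma ext_mult_one_left: "a \<in> Ext r \<Longrightarrow> ext_mult ext_one a = a"
proof
  fix K assume a: "a \<in> Ext r"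
  show "ext_mult ext_one a K = a K"
  proof (cases "finite K")
    case True
    have "ext_mult ext_one a K = (\<Sum>I\<in>Pow K. if I = {} then a K else 0)"
      unfolding ext_mult_def ext_one_def by (rule sum.cong) auto
    then show ?thesis using True by (simp add: sum.delta)
  next
    case False
    then show ?thesis using ExtD[OF a, of K] finite_subset[of K "{..<r}"]
      by (auto simp: ext_mult_infinite)
  qed
qed

lemma ext_mult_one_right: "a \<in> Ext r \<Longrightarrow> ext_mult a ext_one = a"
proof
  fix K assume a: "a \<in> Ext r"
  show "ext_mult a ext_one K = a K"
  proof (cases "finite K")
    case True
    have "ext_mult a ext_one K = (\<Sum>I\<in>Pow K. if I = K then a K else 0)"
      unfolding ext_mult_def ext_one_def by (rule sum.cong) auto
    then show ?thesis using True by (simp add: sum.delta)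
  next
    case False
    then show ?thesis using ExtD[OF a, of K] finite_subset[of K "{..<r}"]
      by (auto simp: ext_mult_infinite)
  qed
qed

text \<open>
  Both bracketings expand to the sum over all ordered partitions of the index set into three
  blocks, and the signs agree because \<^const>\<open>ext_sign\<close> is multiplicative in each argument.
\<close>
lemma ext_mult_assoc: "ext_mult (ext_mult a b) c = ext_mult a (ext_mult b c)"
proof
  fix K :: "nat set"
  show "ext_mult (ext_mult a b) c K = ext_mult a (ext_mult b c) K"
  proof (cases "finite K")
    case False
    then show ?thesis by (simp add: ext_mult_infinite)
  next
    case fin: True
    let ?s = "\<lambda>A B C. ext_sign A B * ext_sign A C * ext_sign B C * a A * b B * c C"
    have "ext_mult (ext_mult a b) c K =
      (\<Sum>I\<in>Pow K. \<Sum>A\<in>Pow I. ext_sign I (K - I) * (ext_sign A (I - A) * a A * b (I - A)) * c (K - I))"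
      by (simp add: ext_mult_def sum_distrib_left sum_distrib_right)
    also have "\<dots> = (\<Sum>I\<in>Pow K. \<Sum>A\<in>Pow I. ?s A (I - A) (K - I))"
    proof (intro sum.cong refl)
      fix I A assume "I \<in> Pow K" "A \<in> Pow I"
      then have h: "I \<subseteq> K" "A \<subseteq> I" and fs: "finite I" "finite A"
        using fin by (auto intro: finite_subset)
      have "A \<union> (I - A) = I" using h by auto
      then have "ext_sign I (K - I) = ext_sign A (K - I) * ext_sign (I - A) (K - I)"
        using ext_sign_Un_left[of A "I - A" "K - I"] fs fin by (metis Diff_disjoint finite_Diff)
      then show "ext_sign I (K - I) * (ext_sign A (I - A) * a A * b (I - A)) * c (K - I) =
         ?s A (I - A) (K - I)"
        by (simp add: algebra_simps)
    qed
    also have "\<dots> = (\<Sum>(I, A)\<in>(SIGMA I:Pow K. Pow I). ?s A (I - A) (K - I))"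
      by (rule sum.Sigma) (use fin in \<open>auto intro: finite_subset\<close>)
    also have "\<dots> = (\<Sum>(A, B)\<in>(SIGMA A:Pow K. Pow (K - A)). ?s A B (K - A - B))"
    proof -
      have "K - A - (I - A) = K - I" if "A \<subseteq> I" for A I
        using that by auto
      then show ?thesis
        by (intro sum.reindex_bij_witness[of _ "\<lambda>(A, B). (A \<union> B, A)" "\<lambda>(I, A). (A, I - A)"])
           auto
    qed
    also have "\<dots> = (\<Sum>A\<in>Pow K. \<Sum>B\<in>Pow (K - A). ?s A B (K - A - B))"
      by (rule sum.Sigma[symmetric]) (use fin in auto)
    also have "\<dots> = (\<Sum>A\<in>Pow K. \<Sum>B\<in>Pow (K - A).
        ext_sign A (K - A) * a A * (ext_sign B (K - A - B) * b B * c (K - A - B)))"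
    proof (intro sum.cong refl)
      fix A B assume "A \<in> Pow K" "B \<in> Pow (K - A)"
      then have h: "A \<subseteq> K" "B \<subseteq> K - A" and fs: "finite B" "finite A"
        using fin by (auto intro: finite_subset)
      have "B \<union> (K - A - B) = K - A" using h by auto
      then have "ext_sign A (K - A) = ext_sign A B * ext_sign A (K - A - B)"
        using ext_sign_Un_right[of A B "K - A - B"] fs fin by (metis Diff_disjoint finite_Diff)
      then show "?s A B (K - A - B) =
         ext_sign A (K - A) * a A * (ext_sign B (K - A - B) * b B * c (K - A - B))"
        by (simp add: algebra_simps)
    qed
    also have "\<dots> = ext_mult a (ext_mult b c) K"
      by (simp add: ext_mult_def sum_distrib_left)
    finally show ?thesis .
  qed
qed

definition ext_hom :: "nat \<Rightarrow> ext \<Rightarrow> bool" where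
  "ext_hom d a \<longleftrightarrow> (\<forall>K. a K \<noteq> 0 \<longrightarrow> card K = d)"

definition ext_order :: "nat \<Rightarrow> ext \<Rightarrow> bool" where
  "ext_order m a \<longleftrightarrow> (\<forall>K. a K \<noteq> 0 \<longrightarrow> m \<le> card K)"

definition ext_parity :: "bool \<Rightarrow> ext \<Rightarrow> bool" where
  "ext_parity p a \<longleftrightarrow> (\<forall>K. a K \<noteq> 0 \<longrightarrow> odd (card K) = p)"

lemma card_split: "finite K \<Longrightarrow> I \<subseteq> K \<Longrightarrow> card K = card I + card (K - I)"
  by (metis card_Diff_subset card_mono finite_subset le_add_diff_inverse)

lemma ext_hom_mult: "ext_hom d a \<Longrightarrow> ext_hom e b \<Longrightarrow> ext_hom (d + e) (ext_mult a b)"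
  unfolding ext_hom_def by (metis ext_mult_neq0 card_split)

lemma ext_order_mult: "ext_order d a \<Longrightarrow> ext_order e b \<Longrightarrow> ext_order (d + e) (ext_mult a b)"
  unfolding ext_order_def by (metis ext_mult_neq0 card_split add_mono)

lemma ext_hom_one: "ext_hom 0 ext_one"
  by (auto simp: ext_hom_def ext_one_def)

lemma ext_mult_body: "ext_mult a b {} = a {} * b {}"
  by (simp add: ext_mult_def)

text \<open>Complementation exchanges the two factors of each term; for a pair of distinct indices it reverses
  the only possible inversion and hence the sign.\<close>
lemma ext_mult_anticommute:
  assumes "ext_hom 1 v" "ext_hom 1 w"
  shows "ext_mult v w = (\<lambda>K. - ext_mult w v K)"
proof
  fix K
  have "ext_mult v w K = (\<Sum>I\<in>Pow K. - (ext_sign I (K - I) * w I * v (K - I)))"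
    unfolding ext_mult_def
  proof (rule sum.reindex_bij_witness[of _ "\<lambda>I. K - I" "\<lambda>I. K - I"])
    fix I assume I: "I \<in> Pow K"
    then have KI: "K - (K - I) = I" by auto
    show "- (ext_sign (K - I) (K - (K - I)) * w (K - I) * v (K - (K - I))) = ext_sign I (K - I) * v I * w (K - I)"
    proof (cases "v I = 0 \<or> w (K - I) = 0")
      case False
      then obtain p q where "I = {p}" "K - I = {q}"
        using assms unfolding ext_hom_def by (metis card_1_singletonE)
      moreover from this have "p \<noteq> q" by blast
      moreover have "K - {q} = {p}" using calculation I by blast
      ultimately show ?thesis using ext_sign_swap[of p q] KI by simp
    qed (auto simp: KI)
  qed auto
  then show "ext_mult v w K = - ext_mult w v K"
    by (simp add: ext_mult_def sum_negf)
qed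

lemma ext_mult_square_zero: "ext_hom 1 v \<Longrightarrow> ext_mult v v = (\<lambda>K. 0)"
proof
  fix K assume "ext_hom 1 v"
  from fun_cong[OF ext_mult_anticommute[OF this this], of K] show "ext_mult v v K = 0" by simp
qed

definition ext_prod :: "(nat \<Rightarrow> ext) \<Rightarrow> nat set \<Rightarrow> ext" where
  "ext_prod e J = foldr ext_mult (map e (sorted_list_of_set J)) ext_one"

lemma ext_map_prod: "ext_map r g a = (\<lambda>K. \<Sum>J\<in>Pow {..<r}. a J * ext_prod (ext_column r g) J K)"
  by (simp add: ext_map_def ext_prod_def)

lemma ext_prod_empty [simp]: "ext_prod e {} = ext_one"
  by (simp add: ext_prod_def)

lemma ext_prod_insert:
  assumes "finite J" "\<And>j. j \<in> J \<Longrightarrow> q < j"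
  shows "ext_prod e (insert q J) = ext_mult (e q) (ext_prod e J)"
proof -
  have "Min (insert q J) = q" using assms by (intro Min_eqI) (auto simp: less_imp_le)
  moreover have "insert q J - {q} = J" using assms(2) by auto
  ultimately have "sorted_list_of_set (insert q J) = q # sorted_list_of_set J"
    using sorted_list_of_set_nonempty[of "insert q J"] assms(1) by auto
  then show ?thesis by (simp add: ext_prod_def)
qed

text \<open>Induction on finite sets that adds a new minimum, matching the increasing order in
  which the generators are multiplied.\<close>
lemma finite_min_induct [consumes 1, case_names empty insert]:
  assumes "finite (J :: nat set)" and "P {}"
    and step: "\<And>q J. finite J \<Longrightarrow> (\<And>j. j \<in> J \<Longrightarrow> q < j) \<Longrightarrow> P J \<Longrightarrow> P (insert q J)"
  shows "P J"
  using assms(1)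
proof (induction "card J" arbitrary: J)
  case 0
  then show ?case using assms(2) by simp
next
  case (Suc n)
  let ?q = "Min J"
  have ne: "J \<noteq> {}" using Suc by auto
  have "card (J - {?q}) = n" using Suc ne by (simp add: card_Diff_singleton)
  then have "P (J - {?q})" using Suc by auto
  then have "P (insert ?q (J - {?q}))"
    using Suc by (intro step) (auto simp: order.strict_iff_order)
  then show ?case using Suc.prems ne by (simp add: insert_absorb)
qed

lemma ext_prod_hom:
  assumes "finite J" "\<And>l. ext_hom 1 (e l)"
  shows "ext_hom (card J) (ext_prod e J)"
  using assms(1)
proof (induction rule: finite_min_induct)
  case empty
  then show ?case by (simp add: ext_hom_one)
next
  case (insert q J)
  then have "q \<notin> J" by auto
  then show ?case using insert ext_hom_mult[OF assms(2), of "card J" _ q]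
    by (simp add: ext_prod_insert)
qed

lemma ext_prod_Ext:
  assumes "finite J" "\<And>l. e l \<in> Ext r"
  shows "ext_prod e J \<in> Ext r"
  using assms(1)
  by (induction rule: finite_min_induct) (auto simp: ext_prod_insert ext_mult_Ext assms)

text \<open>The new factor is moved past all factors with smaller index, each exchange contributing a sign, and
  it is annihilated if it meets itself.\<close>
lemma ext_prod_mult_single:
  assumes hom: "\<And>l. ext_hom 1 (e l)" and "\<And>l. e l \<in> Ext r" and "finite J"
  shows "ext_mult (e p) (ext_prod e J) =
    (\<lambda>K. if p \<in> J then 0 else ext_sign {p} J * ext_prod e (insert p J) K)"
  using \<open>finite J\<close>
proof (induction rule: finite_min_induct)
  case empty
  show ?case using ext_prod_insert[of "{}" p e] by simp
next
  case (insert q J)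
  note E = ext_prod_insert[OF insert(1,2), of e]
  have qJ: "q \<notin> J" using insert(2) by auto
  consider "p < q" | "p = q" | "q < p" by linarith
  then show ?case
  proof cases
    case 1
    then have less: "\<And>j. j \<in> insert q J \<Longrightarrow> p < j" using insert(2) by force
    then have "p \<notin> insert q J" by auto
    moreover have "ext_sign {p} (insert q J) = 1" by (rule ext_sign_less) (use less in auto)
    ultimately show ?thesis using ext_prod_insert[of "insert q J" p e] less insert(1) by simp
  next
    case 2
    then show ?thesis
      by (simp add: E ext_mult_assoc[symmetric] ext_mult_square_zero[OF hom])
  next
    case 3
    have "ext_mult (e p) (ext_prod e (insert q J)) = ext_mult (ext_mult (e p) (e q)) (ext_prod e J)"
      by (simp add: E ext_mult_assoc)
    also have "\<dots> = (\<lambda>K. - 1 * ext_mult (ext_mult (e q) (e p)) (ext_prod e J) K)"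
      by (subst ext_mult_anticommute[OF hom hom])
         (use ext_mult_scal_left[of "-1" "ext_mult (e q) (e p)" "ext_prod e J"] in simp)
    also have "\<dots> = (\<lambda>K. - 1 * ext_mult (e q) (ext_mult (e p) (ext_prod e J)) K)"
      by (simp add: ext_mult_assoc)
    also have "\<dots> = (\<lambda>K. if p \<in> insert q J then 0
        else ext_sign {p} (insert q J) * ext_prod e (insert p (insert q J)) K)"
    proof (cases "p \<in> J")
      case True
      then show ?thesis by (simp add: insert)
    next
      case False
      have "ext_sign {p} ({q} \<union> J) = ext_sign {p} {q} * ext_sign {p} J"
        by (rule ext_sign_Un_right) (use insert qJ in auto)
      moreover have "ext_sign {p} {q} = -1"
        using ext_sign_swap[of p q] ext_sign_less[of "{q}" "{p}"] 3 by simp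
      ultimately have s: "ext_sign {p} (insert q J) = - ext_sign {p} J" by simp
      have "ext_prod e (insert q (insert p J)) = ext_mult (e q) (ext_prod e (insert p J))"
        by (rule ext_prod_insert) (use insert 3 in auto)
      then show ?thesis using False 3
        by (simp add: insert s ext_mult_scal_right insert_commute)
    qed
    finally show ?thesis .
  qed
qed

text \<open>Products of elements of degree one obey the multiplication table of the monomials in the generators,
  whatever the elements are.\<close>
lemma ext_prod_mult:
  assumes hom: "\<And>l. ext_hom 1 (e l)" and Ex: "\<And>l. e l \<in> Ext r" and "finite I" "finite J"
  shows "ext_mult (ext_prod e I) (ext_prod e J) =
    (\<lambda>K. if I \<inter> J = {} then ext_sign I J * ext_prod e (I \<union> J) K else 0)"
  using \<open>finite I\<close>
proof (induction rule: finite_min_induct)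
  case empty
  have "ext_prod e J \<in> Ext r" by (rule ext_prod_Ext) (use assms in auto)
  then show ?case by (simp add: ext_mult_one_left)
next
  case (insert q I)
  have qI: "q \<notin> I" using insert(2) by auto
  have "ext_mult (ext_prod e (insert q I)) (ext_prod e J) =
      ext_mult (e q) (ext_mult (ext_prod e I) (ext_prod e J))"
    by (simp add: ext_prod_insert insert ext_mult_assoc)
  also have "\<dots> = (\<lambda>K. if insert q I \<inter> J = {} then ext_sign (insert q I) J * ext_prod e (insert q I \<union> J) K else 0)"
  proof (cases "I \<inter> J = {}")
    case False
    then show ?thesis using insert(3) by auto
  next
    case True
    have "ext_mult (e q) (ext_mult (ext_prod e I) (ext_prod e J)) =
      (\<lambda>K. ext_sign I J * (if q \<in> I \<union> J then 0 else ext_sign {q} (I \<union> J) * ext_prod e (insert q (I \<union> J)) K))"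
      using True insert assms
      by (simp add: ext_mult_scal_right ext_prod_mult_single[where e = e, OF hom Ex])
    moreover have "ext_sign {q} (I \<union> J) = ext_sign {q} J"
    proof -
      have "ext_sign {q} (I \<union> J) = ext_sign {q} I * ext_sign {q} J"
        by (rule ext_sign_Un_right) (use insert assms True in auto)
      then show ?thesis using ext_sign_less[of "{q}" I] insert(2) by simp
    qed
    moreover have "ext_sign ({q} \<union> I) J = ext_sign {q} J * ext_sign I J"
      by (rule ext_sign_Un_left) (use insert assms qI in auto)
    ultimately show ?thesis using True qI by (auto simp: mult_ac)
  qed
  finally show ?case .
qed

lemma ext_column_eq: "ext_column r g l = (\<lambda>K. \<Sum>k<r. g k l * (if K = {k} then 1 else 0))"
  unfolding ext_column_def by (rule ext, rule sum.cong) auto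

lemma ext_column_singleton: "ext_column r g l {k} = (if k < r then g k l else 0)"
  by (simp add: ext_column_def sum.delta)

lemma ext_column_hom: "ext_hom 1 (ext_column r g l)"
  unfolding ext_hom_def ext_column_def
proof clarify
  fix K assume "(\<Sum>k<r. if K = {k} then g k l else 0) \<noteq> 0"
  then have "\<exists>k. K = {k}" by (rule contrapos_np) simp
  then show "card K = 1" by auto
qed

lemma ext_column_Ext: "ext_column r g l \<in> Ext r"
  unfolding Ext_def ext_column_def mem_Collect_eq
proof (intro allI impI)
  fix K assume "\<not> K \<subseteq> {..<r}"
  then show "(\<Sum>k<r. if K = {k} then g k l else 0) = 0"
    by (intro sum.neutral) auto
qed

lemmas ext_column_simps = ext_column_hom ext_column_Ext

lemma ext_map_Ext: "ext_map r g a \<in> Ext r"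
  unfolding ext_map_prod
proof -
  have "ext_prod (ext_column r g) J \<in> Ext r" if "J \<subseteq> {..<r}" for J
    by (rule ext_prod_Ext) (use that finite_subset in \<open>auto simp: ext_column_simps\<close>)
  then show "(\<lambda>K. \<Sum>J\<in>Pow {..<r}. a J * ext_prod (ext_column r g) J K) \<in> Ext r"
    by (auto simp: Ext_def intro!: sum.neutral)
qed

text \<open>
  The substitution is multiplicative because the columns, being of degree one, satisfy the same
  relations as the generators; this is the universal property of the exterior algebra.
\<close>
lemma ext_map_mult:
  assumes a: "a \<in> Ext r" and b: "b \<in> Ext r"
  shows "ext_map r g (ext_mult a b) = ext_mult (ext_map r g a) (ext_map r g b)"
proof
  fix K
  let ?E = "ext_prod (ext_column r g)"
  let ?P = "Pow {..<r}"
  have fin: "finite I" if "I \<subseteq> {..<r}" for I using that finite_subset by auto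
  have "ext_mult (ext_map r g a) (ext_map r g b) K =
    (\<Sum>I\<in>?P. \<Sum>L\<in>?P. a I * b L * ext_mult (?E I) (?E L) K)"
    unfolding ext_map_prod ext_mult_sum_left ext_mult_sum_right
    by (simp add: sum_distrib_left mult_ac)
  also have "\<dots> = (\<Sum>I\<in>?P. \<Sum>L\<in>?P. if I \<inter> L = {} then a I * b L * (ext_sign I L * ?E (I \<union> L) K) else 0)"
    by (intro sum.cong refl)
       (use ext_prod_mult[where e = "ext_column r g", OF ext_column_hom ext_column_Ext] fin in auto)
  also have "\<dots> = (\<Sum>(I, L)\<in>?P \<times> ?P. if I \<inter> L = {} then a I * b L * (ext_sign I L * ?E (I \<union> L) K) else 0)"
    by (simp add: sum.cartesian_product)
  also have "\<dots> = (\<Sum>(I, L)\<in>{(I, L). I \<subseteq> {..<r} \<and> L \<subseteq> {..<r} \<and> I \<inter> L = {}}.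
       a I * b L * (ext_sign I L * ?E (I \<union> L) K))"
    by (rule sum.mono_neutral_cong_right) (auto split: if_splits)
  also have "\<dots> = (\<Sum>(J, I)\<in>(SIGMA J:?P. Pow J). ext_sign I (J - I) * a I * b (J - I) * ?E J K)"
  proof -
    have "I \<union> L - I = L" if "I \<inter> L = {}" for I L :: "nat set"
      using that by auto
    then show ?thesis
      by (intro sum.reindex_bij_witness[of _ "\<lambda>(J, I). (I, J - I)" "\<lambda>(I, L). (I \<union> L, I)"])
         (auto simp del: Un_Diff)
  qed
  also have "\<dots> = (\<Sum>J\<in>?P. \<Sum>I\<in>Pow J. ext_sign I (J - I) * a I * b (J - I) * ?E J K)"
    by (subst sum.Sigma) (auto simp: fin)
  also have "\<dots> = ext_map r g (ext_mult a b) K"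
    by (simp add: ext_map_prod ext_mult_def sum_distrib_right)
  finally show "ext_map r g (ext_mult a b) K = ext_mult (ext_map r g a) (ext_map r g b) K" ..
qed

lemma ext_map_one: "ext_map r g ext_one = ext_one"
proof
  fix K
  have "ext_map r g ext_one K = (\<Sum>J\<in>Pow {..<r}. if J = {} then ext_one K else 0)"
    unfolding ext_map_prod by (rule sum.cong) (auto simp: ext_one_def)
  then show "ext_map r g ext_one K = ext_one K" by (simp add: sum.delta)
qed

lemma ext_map_sum:
  "ext_map r g (\<lambda>K. \<Sum>i\<in>A. c i * f i K) = (\<lambda>K. \<Sum>i\<in>A. c i * ext_map r g (f i) K)"
  unfolding ext_map_prod
  by (rule ext) (simp add: sum_distrib_left sum_distrib_right sum.swap[of _ A] algebra_simps)

lemma ext_map_add: "ext_map r g (\<lambda>K. a K + b K) = (\<lambda>K. ext_map r g a K + ext_map r g b K)"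
  unfolding ext_map_prod by (rule ext) (simp add: sum.distrib algebra_simps)

lemma ext_map_scal: "ext_map r g (\<lambda>K. c * a K) = (\<lambda>K. c * ext_map r g a K)"
  unfolding ext_map_prod by (rule ext) (simp add: sum_distrib_left algebra_simps)

lemma ext_map_zero [simp]: "ext_map r g (\<lambda>K. 0) = (\<lambda>K. 0)"
  unfolding ext_map_prod by simp

lemma ext_prod_column_neq0:
  assumes "J \<subseteq> {..<r}" "ext_prod (ext_column r g) J K \<noteq> 0"
  shows "card J = card K"
proof -
  have "finite J" using assms(1) finite_subset by auto
  from ext_prod_hom[OF this ext_column_hom] assms(2) show ?thesis by (simp add: ext_hom_def)
qed

lemma ext_map_neq0:
  assumes "ext_map r g a K \<noteq> 0"
  obtains J where "a J \<noteq> 0" "card J = card K"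
proof -
  have "\<exists>J\<in>Pow {..<r}. a J \<noteq> 0 \<and> ext_prod (ext_column r g) J K \<noteq> 0"
  proof (rule ccontr)
    assume "\<not> ?thesis"
    then have "ext_map r g a K = 0"
      unfolding ext_map_prod by (intro sum.neutral) auto
    with assms show False by simp
  qed
  then show ?thesis using that ext_prod_column_neq0 by blast
qed

lemma ext_map_order: "ext_order m a \<Longrightarrow> ext_order m (ext_map r g a)"
  unfolding ext_order_def by (metis ext_map_neq0)

lemma ext_map_parity: "ext_parity p a \<Longrightarrow> ext_parity p (ext_map r g a)"
  unfolding ext_parity_def by (metis ext_map_neq0)

lemma ext_map_hom: "ext_hom p a \<Longrightarrow> ext_hom p (ext_map r g a)"
  unfolding ext_hom_def by (metis ext_map_neq0)

text \<open>Used to split an element into its even and its odd part.\<close>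
definition ext_filter :: "(nat \<Rightarrow> bool) \<Rightarrow> ext \<Rightarrow> ext" where
  "ext_filter P a = (\<lambda>K. if P (card K) then a K else 0)"

lemma ext_map_filter: "ext_map r g (ext_filter P a) = ext_filter P (ext_map r g a)"
proof
  fix K
  have "ext_map r g (ext_filter P a) K =
    (\<Sum>J\<in>Pow {..<r}. if P (card K) then a J * ext_prod (ext_column r g) J K else 0)"
    unfolding ext_map_prod ext_filter_def
  proof (rule sum.cong[OF refl])
    fix J assume "J \<in> Pow {..<r}"
    then have "J \<subseteq> {..<r}" by simp
    from ext_prod_column_neq0[OF this, of g K]
    show "(if P (card J) then a J else 0) * ext_prod (ext_column r g) J K =
      (if P (card K) then a J * ext_prod (ext_column r g) J K else 0)"
      by (cases "ext_prod (ext_column r g) J K = 0") simp_all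
  qed
  then show "ext_map r g (ext_filter P a) K = ext_filter P (ext_map r g a) K"
    by (simp add: ext_map_prod ext_filter_def)
qed

lemma ext_prod_singleton: "e q \<in> Ext r \<Longrightarrow> ext_prod e {q} = e q"
  using ext_prod_insert[of "{}" q e] by (simp add: ext_mult_one_right)

lemma ext_map_degree_one:
  assumes "ext_hom 1 v" "v \<in> Ext r"
  shows "ext_map r g v = (\<lambda>K. \<Sum>k<r. v {k} * ext_column r g k K)"
proof
  fix K
  have "ext_map r g v K = (\<Sum>J\<in>(\<lambda>k. {k}) ` {..<r}. v J * ext_prod (ext_column r g) J K)"
    unfolding ext_map_prod
  proof (rule sum.mono_neutral_right)
    show "\<forall>J\<in>Pow {..<r} - (\<lambda>k. {k}) ` {..<r}. v J * ext_prod (ext_column r g) J K = 0"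
    proof clarify
      fix J assume J: "J \<subseteq> {..<r}" "J \<notin> (\<lambda>k. {k}) ` {..<r}"
      have "v J = 0"
      proof (rule ccontr)
        assume "v J \<noteq> 0"
        then have "card J = 1" using assms(1) by (simp add: ext_hom_def)
        then obtain k where "J = {k}" by (rule card_1_singletonE)
        then show False using J by auto
      qed
      then show "v J * ext_prod (ext_column r g) J K = 0" by simp
    qed
  qed auto
  also have "\<dots> = (\<Sum>k<r. v {k} * ext_prod (ext_column r g) {k} K)"
    by (subst sum.reindex) (auto simp: inj_on_def)
  finally show "ext_map r g v K = (\<Sum>k<r. v {k} * ext_column r g k K)"
    by (simp add: ext_prod_singleton[OF ext_column_Ext])
qed

lemma ext_map_column:
  assumes "l < r"
  shows "ext_map r g (ext_column r h l) = ext_column r (\<lambda>k l. \<Sum>p<r. g k p * h p l) l"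
proof
  fix K
  have "ext_map r g (ext_column r h l) K = (\<Sum>p<r. \<Sum>k<r. h p l * (g k p * (if K = {k} then 1 else 0)))"
    by (simp add: ext_map_degree_one[OF ext_column_hom ext_column_Ext] ext_column_singleton
        ext_column_eq[of r g] sum_distrib_left)
  also have "\<dots> = (\<Sum>k<r. (\<Sum>p<r. g k p * h p l) * (if K = {k} then 1 else 0))"
    by (subst sum.swap) (simp add: sum_distrib_right sum_distrib_left mult_ac)
  finally show "ext_map r g (ext_column r h l) K = ext_column r (\<lambda>k l. \<Sum>p<r. g k p * h p l) l K"
    by (simp add: ext_column_eq)
qed

text \<open>By multiplicativity it is enough that the composite sends each generator to the right column.\<close>
lemma ext_map_comp:
  "ext_map r g (ext_map r h a) = ext_map r (\<lambda>k l. \<Sum>p<r. g k p * h p l) a"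
proof -
  let ?gh = "\<lambda>k l. \<Sum>p<r. g k p * h p l"
  have E: "ext_map r g (ext_prod (ext_column r h) J) = ext_prod (ext_column r ?gh) J"
    if "J \<subseteq> {..<r}" for J
  proof -
    have "finite J" using that finite_subset by auto
    then show ?thesis using that
    proof (induction rule: finite_min_induct)
      case empty
      then show ?case by (simp add: ext_map_one)
    next
      case (insert q J)
      have "ext_map r g (ext_prod (ext_column r h) (insert q J)) =
        ext_mult (ext_map r g (ext_column r h q)) (ext_map r g (ext_prod (ext_column r h) J))"
        using insert by (simp add: ext_prod_insert ext_map_mult ext_column_simps ext_prod_Ext)
      then show ?case using insert by (simp add: ext_prod_insert ext_map_column)
    qed
  qed
  have "ext_map r g (ext_map r h a) =
    (\<lambda>K. \<Sum>J\<in>Pow {..<r}. a J * ext_map r g (ext_prod (ext_column r h) J) K)"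
    by (simp add: ext_map_prod[of r h] ext_map_sum)
  also have "\<dots> = (\<lambda>K. \<Sum>J\<in>Pow {..<r}. a J * ext_prod (ext_column r ?gh) J K)"
    by (rule ext, rule sum.cong) (auto simp: E)
  finally show ?thesis by (simp add: ext_map_prod)
qed

lemma ext_map_cong:
  assumes "\<And>k l. k < r \<Longrightarrow> l < r \<Longrightarrow> g k l = h k l"
  shows "ext_map r g a = ext_map r h a"
proof -
  have c: "ext_column r g l = ext_column r h l" if "l < r" for l
    unfolding ext_column_def by (rule ext, rule sum.cong) (use assms that in auto)
  have "ext_prod (ext_column r g) J = ext_prod (ext_column r h) J" if "J \<subseteq> {..<r}" for J
  proof -
    have "map (ext_column r g) (sorted_list_of_set J) = map (ext_column r h) (sorted_list_of_set J)"
      using that finite_subset[OF that] by (auto intro!: c)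
    then show ?thesis unfolding ext_prod_def by (rule arg_cong)
  qed
  then show ?thesis by (simp add: ext_map_prod)
qed

definition ext_gen :: "nat set \<Rightarrow> ext" where
  "ext_gen J = (\<lambda>K. if K = J then 1 else 0)"

lemma ext_gen_Ext: "J \<subseteq> {..<r} \<Longrightarrow> ext_gen J \<in> Ext r"
  by (auto simp: Ext_def ext_gen_def)

lemma ext_gen_hom: "ext_hom (card J) (ext_gen J)"
  by (auto simp: ext_hom_def ext_gen_def)

text \<open>Multiplication by a generator whose index is smaller than all indices that occur involves no
  signs.\<close>
lemma ext_gen_mult_less:
  assumes "finite J" "\<And>j. j \<in> J \<Longrightarrow> q < j"
  shows "ext_mult (ext_gen {q}) (ext_gen J) = ext_gen (insert q J)"
proof
  fix K
  have qJ: "q \<notin> J" using assms(2) by auto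
  show "ext_mult (ext_gen {q}) (ext_gen J) K = ext_gen (insert q J) K"
  proof (cases "finite K")
    case True
    have "ext_mult (ext_gen {q}) (ext_gen J) K =
      (\<Sum>I\<in>Pow K. if I = {q} then (if K - {q} = J then ext_sign {q} J else 0) else 0)"
      unfolding ext_mult_def ext_gen_def by (rule sum.cong) auto
    also have "\<dots> = (if q \<in> K \<and> K - {q} = J then ext_sign {q} J else 0)"
      using True by (simp add: sum.delta)
    also have "\<dots> = ext_gen (insert q J) K"
      using qJ ext_sign_less[of "{q}" J] assms(2) by (auto simp: ext_gen_def)
    finally show ?thesis .
  next
    case False
    then show ?thesis using assms(1) by (auto simp: ext_mult_infinite ext_gen_def)
  qed
qed

lemma ext_map_id:
  assumes "a \<in> Ext r" "\<And>k l. k < r \<Longrightarrow> l < r \<Longrightarrow> g k l = (if k = l then 1 else 0)"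
  shows "ext_map r g a = a"
proof -
  have c: "ext_column r g l = ext_gen {l}" if "l < r" for l
  proof
    fix K
    have "ext_column r g l K = (\<Sum>k<r. if k = l then (if K = {k} then 1 else 0) else 0)"
      unfolding ext_column_def by (rule sum.cong) (use assms that in auto)
    then show "ext_column r g l K = ext_gen {l} K" using that by (simp add: sum.delta ext_gen_def)
  qed
  have E: "ext_prod (ext_column r g) J = ext_gen J" if "J \<subseteq> {..<r}" for J
  proof -
    have "finite J" using that finite_subset by auto
    then show ?thesis using that
    proof (induction rule: finite_min_induct)
      case empty
      then show ?case by (auto simp: ext_one_def ext_gen_def)
    next
      case (insert q J)
      then show ?case by (simp add: ext_prod_insert c ext_gen_mult_less)
    qed
  qed
  show ?thesis
  proof
    fix K
    have "ext_map r g a K = (\<Sum>J\<in>Pow {..<r}. if K = J then a J else 0)"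
      unfolding ext_map_prod by (rule sum.cong) (auto simp: E ext_gen_def)
    also have "\<dots> = a K" using ExtD[OF assms(1), of K] by (simp add: sum.delta')
    finally show "ext_map r g a K = a K" .
  qed
qed

text \<open>Sorting the monomials by their smallest index writes an element without constant term as
  a combination of the generators with coefficients of order one less.\<close>
definition ext_cofactor :: "nat \<Rightarrow> ext \<Rightarrow> ext" where
  "ext_cofactor q a = (\<lambda>K. if finite K \<and> (\<forall>j\<in>K. q < j) then a (insert q K) else 0)"

lemma ext_cofactor_Ext: "a \<in> Ext r \<Longrightarrow> ext_cofactor q a \<in> Ext r"
  by (auto simp: Ext_def ext_cofactor_def)

lemma ext_cofactor_order:
  assumes "ext_order (Suc m) a"
  shows "ext_order m (ext_cofactor q a)"
  unfolding ext_order_def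
proof clarify
  fix K assume "ext_cofactor q a K \<noteq> 0"
  then have h: "finite K" "\<forall>j\<in>K. q < j" "a (insert q K) \<noteq> 0"
    unfolding ext_cofactor_def by presburger+
  then have "q \<notin> K" by blast
  then show "m \<le> card K" using assms h unfolding ext_order_def by fastforce
qed

lemma ext_cofactor_expand:
  assumes a: "a \<in> Ext r" and "ext_order 1 a"
  shows "a = (\<lambda>K. \<Sum>q<r. ext_mult (ext_gen {q}) (ext_cofactor q a) K)"
proof
  fix K
  have *: "ext_mult (ext_gen {q}) (ext_cofactor q a) K =
    (if finite K \<and> q \<in> K \<and> (\<forall>j\<in>K - {q}. q < j) then a K else 0)" for q
  proof (cases "finite K")
    case True
    have "ext_mult (ext_gen {q}) (ext_cofactor q a) K =
      (\<Sum>I\<in>Pow K. if I = {q} then ext_sign {q} (K - {q}) * ext_cofactor q a (K - {q}) else 0)"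
      unfolding ext_mult_def ext_gen_def by (rule sum.cong) auto
    also have "\<dots> = (if q \<in> K then ext_sign {q} (K - {q}) * ext_cofactor q a (K - {q}) else 0)"
      using True by (simp add: sum.delta)
    also have "\<dots> = (if q \<in> K \<and> (\<forall>j\<in>K - {q}. q < j) then a K else 0)"
      using True ext_sign_less[of "{q}" "K - {q}"] by (auto simp: ext_cofactor_def insert_absorb)
    finally show ?thesis using True by simp
  qed (simp add: ext_mult_infinite)
  show "a K = (\<Sum>q<r. ext_mult (ext_gen {q}) (ext_cofactor q a) K)"
  proof (cases "a K = 0")
    case True
    show ?thesis unfolding * True by simp
  next
    case False
    then have K: "K \<subseteq> {..<r}" "1 \<le> card K" using ExtD[OF a] assms(2) by (auto simp: ext_order_def)
    then have fin: "finite K" "K \<noteq> {}" using finite_subset by auto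
    have "(finite K \<and> q \<in> K \<and> (\<forall>j\<in>K - {q}. q < j)) \<longleftrightarrow> q = Min K" for q
    proof
      assume q: "finite K \<and> q \<in> K \<and> (\<forall>j\<in>K - {q}. q < j)"
      show "q = Min K"
      proof (rule Min_eqI[symmetric])
        show "q \<le> y" if "y \<in> K" for y
        proof -
          have "y = q \<or> q < y" using q that by blast
          then show ?thesis by auto
        qed
      qed (use q in auto)
    next
      assume "q = Min K"
      then show "finite K \<and> q \<in> K \<and> (\<forall>j\<in>K - {q}. q < j)"
        using fin by (auto simp: order.strict_iff_order)
    qed
    moreover have "Min K < r" using K(1) Min_in[OF fin] by blast
    ultimately show ?thesis by (simp add: * sum.delta)
  qed
qed

lemma matrix_right_inverse_left:
  fixes g v :: "nat \<Rightarrow> nat \<Rightarrow> complex"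
  assumes "\<And>k l. k < r \<Longrightarrow> l < r \<Longrightarrow> (\<Sum>p<r. g k p * v p l) = (if k = l then 1 else 0)"
    and "k < r" "l < r"
  shows "(\<Sum>p<r. v k p * g p l) = (if k = l then 1 else 0)"
proof -
  define A where "A = mat r r (\<lambda>(k, l). g k l)"
  define B where "B = mat r r (\<lambda>(k, l). v k l)"
  have [simp]: "A \<in> carrier_mat r r" "B \<in> carrier_mat r r" by (auto simp: A_def B_def)
  have "A * B = 1\<^sub>m r"
    by (rule eq_matI) (auto simp: A_def B_def scalar_prod_def assms(1) atLeast0LessThan)
  then have "B * A = 1\<^sub>m r" by (rule mat_mult_left_right_inverse[rotated 2]) auto
  then have "(B * A) $$ (k, l) = (if k = l then 1 else 0)" using assms by simp
  then show ?thesis using assms(2,3) by (simp add: A_def B_def scalar_prod_def atLeast0LessThan)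
qed

section \<open>Holomorphic functions\<close>

lemma holo_subset: "holo n f S \<Longrightarrow> T \<subseteq> S \<Longrightarrow> holo n f T"
  unfolding holo_def by (meson subsetD)

lemma holo_cong: "(\<And>z. z \<in> S \<Longrightarrow> f z = g z) \<Longrightarrow> holo n f S = holo n g S"
  unfolding holo_def by simp

lemma holo_const: "holo n (\<lambda>z. c) S"
  unfolding holo_def
proof (intro ballI exI[of _ "\<lambda>i. 0"] allI impI)
  fix z and e :: real assume "0 < e"
  then show "\<exists>d>0. \<forall>w\<in>S. (\<forall>i<n. cmod (w i - z i) < d) \<longrightarrow>
    cmod (c - c - (\<Sum>i<n. 0 * (w i - z i))) \<le> e * (\<Sum>i<n. cmod (w i - z i))"
    by (intro exI[of _ 1]) (auto simp: sum_nonneg)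
qed

lemma holoD:
  assumes "holo n f S" "z \<in> S"
  obtains L where "\<And>e. e > 0 \<Longrightarrow> \<exists>d>0. \<forall>w\<in>S. (\<forall>i<n. cmod (w i - z i) < d) \<longrightarrow>
       cmod (f w - f z - (\<Sum>i<n. L i * (w i - z i))) \<le> e * (\<Sum>i<n. cmod (w i - z i))"
  using assms unfolding holo_def by blast

lemma holo_add:
  assumes "holo n f S" "holo n g S"
  shows "holo n (\<lambda>z. f z + g z) S"
  unfolding holo_def
proof
  fix z assume "z \<in> S"
  obtain L where L: "\<And>e. e > 0 \<Longrightarrow> \<exists>d>0. \<forall>w\<in>S. (\<forall>i<n. cmod (w i - z i) < d) \<longrightarrow>
       cmod (f w - f z - (\<Sum>i<n. L i * (w i - z i))) \<le> e * (\<Sum>i<n. cmod (w i - z i))"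
    using holoD[OF assms(1) \<open>z \<in> S\<close>] by blast
  obtain M where M: "\<And>e. e > 0 \<Longrightarrow> \<exists>d>0. \<forall>w\<in>S. (\<forall>i<n. cmod (w i - z i) < d) \<longrightarrow>
       cmod (g w - g z - (\<Sum>i<n. M i * (w i - z i))) \<le> e * (\<Sum>i<n. cmod (w i - z i))"
    using holoD[OF assms(2) \<open>z \<in> S\<close>] by blast
  show "\<exists>L. \<forall>e>0. \<exists>d>0. \<forall>w\<in>S. (\<forall>i<n. cmod (w i - z i) < d) \<longrightarrow>
     cmod (f w + g w - (f z + g z) - (\<Sum>i<n. L i * (w i - z i))) \<le> e * (\<Sum>i<n. cmod (w i - z i))"
  proof (intro exI[of _ "\<lambda>i. L i + M i"] allI impI)
    fix e :: real assume "0 < e"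
    then have "e / 2 > 0" by simp
    then obtain d1 d2 where d1: "d1 > 0" "\<And>w. w \<in> S \<Longrightarrow> \<forall>i<n. cmod (w i - z i) < d1 \<Longrightarrow>
       cmod (f w - f z - (\<Sum>i<n. L i * (w i - z i))) \<le> e / 2 * (\<Sum>i<n. cmod (w i - z i))"
      and d2: "d2 > 0" "\<And>w. w \<in> S \<Longrightarrow> \<forall>i<n. cmod (w i - z i) < d2 \<Longrightarrow>
       cmod (g w - g z - (\<Sum>i<n. M i * (w i - z i))) \<le> e / 2 * (\<Sum>i<n. cmod (w i - z i))"
      using L[of "e / 2"] M[of "e / 2"] by blast
    show "\<exists>d>0. \<forall>w\<in>S. (\<forall>i<n. cmod (w i - z i) < d) \<longrightarrow>
      cmod (f w + g w - (f z + g z) - (\<Sum>i<n. (L i + M i) * (w i - z i)))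
        \<le> e * (\<Sum>i<n. cmod (w i - z i))"
    proof (intro exI[of _ "min d1 d2"] conjI ballI impI)
      fix w assume "w \<in> S" "\<forall>i<n. cmod (w i - z i) < min d1 d2"
      then have 1: "cmod (f w - f z - (\<Sum>i<n. L i * (w i - z i))) \<le> e / 2 * (\<Sum>i<n. cmod (w i - z i))"
        and 2: "cmod (g w - g z - (\<Sum>i<n. M i * (w i - z i))) \<le> e / 2 * (\<Sum>i<n. cmod (w i - z i))"
        using d1 d2 by auto
      have "f w + g w - (f z + g z) - (\<Sum>i<n. (L i + M i) * (w i - z i)) =
        (f w - f z - (\<Sum>i<n. L i * (w i - z i))) + (g w - g z - (\<Sum>i<n. M i * (w i - z i)))"
        by (simp add: distrib_right sum.distrib)
      then have "cmod (f w + g w - (f z + g z) - (\<Sum>i<n. (L i + M i) * (w i - z i)))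
        \<le> e / 2 * (\<Sum>i<n. cmod (w i - z i)) + e / 2 * (\<Sum>i<n. cmod (w i - z i))"
        using norm_triangle_mono[OF 1 2] by (simp only:)
      then show "cmod (f w + g w - (f z + g z) - (\<Sum>i<n. (L i + M i) * (w i - z i)))
        \<le> e * (\<Sum>i<n. cmod (w i - z i))" by simp
    qed (use d1 d2 in auto)
  qed
qed

text \<open>The linear term is estimated coordinatewise; the hypothesis is differentiability with error
  constant 1.\<close>
lemma holo_lipschitz_at:
  fixes f :: "(nat \<Rightarrow> complex) \<Rightarrow> complex"
  assumes "cmod (f w - f z - (\<Sum>i<n. L i * (w i - z i))) \<le> 1 * (\<Sum>i<n. cmod (w i - z i))"
  shows "cmod (f w - f z) \<le> ((\<Sum>i<n. cmod (L i)) + 1) * (\<Sum>i<n. cmod (w i - z i))"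
proof -
  let ?N = "\<Sum>i<n. cmod (w i - z i)"
  have "cmod (\<Sum>i<n. L i * (w i - z i)) \<le> (\<Sum>i<n. cmod (L i) * cmod (w i - z i))"
    using norm_sum[of "\<lambda>i. L i * (w i - z i)" "{..<n}"] by (simp add: norm_mult)
  also have "\<dots> \<le> (\<Sum>i<n. cmod (L i) * ?N)"
  proof (intro sum_mono mult_left_mono)
    fix i assume "i \<in> {..<n}"
    then show "cmod (w i - z i) \<le> ?N"
      by (intro member_le_sum[of i "{..<n}" "\<lambda>i. cmod (w i - z i)"]) auto
  qed auto
  finally have "cmod (\<Sum>i<n. L i * (w i - z i)) \<le> (\<Sum>i<n. cmod (L i)) * ?N"
    by (simp add: sum_distrib_right)
  with assms have "cmod ((f w - f z - (\<Sum>i<n. L i * (w i - z i))) + (\<Sum>i<n. L i * (w i - z i)))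
    \<le> 1 * ?N + (\<Sum>i<n. cmod (L i)) * ?N"
    by (rule norm_triangle_mono)
  then show ?thesis by (simp add: algebra_simps)
qed

lemma holo_mult:
  assumes "holo n f S" "holo n g S"
  shows "holo n (\<lambda>z. f z * g z) S"
  unfolding holo_def
proof
  fix z assume "z \<in> S"
  obtain L where L: "\<And>e. e > 0 \<Longrightarrow> \<exists>d>0. \<forall>w\<in>S. (\<forall>i<n. cmod (w i - z i) < d) \<longrightarrow>
       cmod (f w - f z - (\<Sum>i<n. L i * (w i - z i))) \<le> e * (\<Sum>i<n. cmod (w i - z i))"
    using holoD[OF assms(1) \<open>z \<in> S\<close>] by blast
  obtain M where M: "\<And>e. e > 0 \<Longrightarrow> \<exists>d>0. \<forall>w\<in>S. (\<forall>i<n. cmod (w i - z i) < d) \<longrightarrow>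
       cmod (g w - g z - (\<Sum>i<n. M i * (w i - z i))) \<le> e * (\<Sum>i<n. cmod (w i - z i))"
    using holoD[OF assms(2) \<open>z \<in> S\<close>] by blast
  \<comment> \<open>A weighs the two remainder terms of the product rule; B bounds the product of the two increments,
    which is quadratic in the displacement and becomes negligible below the bound d5.\<close>
  define A where "A = cmod (f z) + cmod (g z) + 1"
  define B where "B = ((\<Sum>i<n. cmod (L i)) + 1) * ((\<Sum>i<n. cmod (M i)) + 1)"
  have "A > 0" by (simp add: A_def add_nonneg_pos)
  have "B > 0" by (simp add: B_def add_nonneg_pos sum_nonneg)
  show "\<exists>L. \<forall>e>0. \<exists>d>0. \<forall>w\<in>S. (\<forall>i<n. cmod (w i - z i) < d) \<longrightarrow>
     cmod (f w * g w - f z * g z - (\<Sum>i<n. L i * (w i - z i))) \<le> e * (\<Sum>i<n. cmod (w i - z i))"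
  proof (intro exI[of _ "\<lambda>i. g z * L i + f z * M i"] allI impI)
    fix e :: real assume "0 < e"
    let ?e = "e / (2 * A)"
    have e: "?e > 0" using \<open>0 < e\<close> \<open>A > 0\<close> by simp
    obtain d1 where d1: "d1 > 0" "\<And>w. w \<in> S \<Longrightarrow> \<forall>i<n. cmod (w i - z i) < d1 \<Longrightarrow>
       cmod (f w - f z - (\<Sum>i<n. L i * (w i - z i))) \<le> ?e * (\<Sum>i<n. cmod (w i - z i))"
      using L[OF e] by blast
    obtain d2 where d2: "d2 > 0" "\<And>w. w \<in> S \<Longrightarrow> \<forall>i<n. cmod (w i - z i) < d2 \<Longrightarrow>
       cmod (g w - g z - (\<Sum>i<n. M i * (w i - z i))) \<le> ?e * (\<Sum>i<n. cmod (w i - z i))"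
      using M[OF e] by blast
    have one: "(0::real) < 1" by simp
    obtain d3 where d3: "d3 > 0" "\<And>w. w \<in> S \<Longrightarrow> \<forall>i<n. cmod (w i - z i) < d3 \<Longrightarrow>
       cmod (f w - f z - (\<Sum>i<n. L i * (w i - z i))) \<le> 1 * (\<Sum>i<n. cmod (w i - z i))"
      using L[OF one] by blast
    obtain d4 where d4: "d4 > 0" "\<And>w. w \<in> S \<Longrightarrow> \<forall>i<n. cmod (w i - z i) < d4 \<Longrightarrow>
       cmod (g w - g z - (\<Sum>i<n. M i * (w i - z i))) \<le> 1 * (\<Sum>i<n. cmod (w i - z i))"
      using M[OF one] by blast
    define d5 where "d5 = e / (2 * B * (real n + 1))"
    have "d5 > 0" using \<open>0 < e\<close> \<open>B > 0\<close> by (simp add: d5_def)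
    show "\<exists>d>0. \<forall>w\<in>S. (\<forall>i<n. cmod (w i - z i) < d) \<longrightarrow>
      cmod (f w * g w - f z * g z - (\<Sum>i<n. (g z * L i + f z * M i) * (w i - z i)))
        \<le> e * (\<Sum>i<n. cmod (w i - z i))"
    proof (intro exI[of _ "min (min d1 d2) (min (min d3 d4) d5)"] conjI ballI impI)
      fix w assume w: "w \<in> S" "\<forall>i<n. cmod (w i - z i) < min (min d1 d2) (min (min d3 d4) d5)"
      define N where "N = (\<Sum>i<n. cmod (w i - z i))"
      have N0: "N \<ge> 0" by (simp add: N_def sum_nonneg)
      have "N \<le> (\<Sum>i<n. d5)" unfolding N_def using w by (intro sum_mono) auto
      also have "\<dots> \<le> (real n + 1) * d5" using \<open>d5 > 0\<close> by (simp add: algebra_simps)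
      also have "\<dots> = e / (2 * B)" proof -
        have "x * (e / (2 * B * x)) = e / (2 * B)" if "x \<noteq> 0" for x :: real
          using that by simp
        moreover have "real n + 1 \<noteq> 0" by linarith
        ultimately show ?thesis unfolding d5_def by blast
      qed
      finally have N: "B * N \<le> e / 2" using \<open>B > 0\<close> by (simp add: field_simps)
      have 1: "cmod (f w - f z - (\<Sum>i<n. L i * (w i - z i))) \<le> ?e * N"
        and 2: "cmod (g w - g z - (\<Sum>i<n. M i * (w i - z i))) \<le> ?e * N"
        using d1 d2 w by (auto simp: N_def)
      have 3: "cmod (f w - f z) \<le> ((\<Sum>i<n. cmod (L i)) + 1) * N"
        unfolding N_def by (rule holo_lipschitz_at[of f w z L n, OF d3(2)]) (use w in auto)
      have 4: "cmod (g w - g z) \<le> ((\<Sum>i<n. cmod (M i)) + 1) * N"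
        unfolding N_def by (rule holo_lipschitz_at[of g w z M n, OF d4(2)]) (use w in auto)
      have "cmod ((f w - f z) * (g w - g z)) \<le> (((\<Sum>i<n. cmod (L i)) + 1) * N) * (((\<Sum>i<n. cmod (M i)) + 1) * N)"
        unfolding norm_mult
        by (intro mult_mono 3 4) (auto intro!: mult_nonneg_nonneg N0 add_nonneg_nonneg sum_nonneg)
      also have "\<dots> = (B * N) * N" by (simp add: B_def algebra_simps)
      also have "\<dots> \<le> e / 2 * N" using N N0 by (intro mult_right_mono) auto
      finally have 5: "cmod ((f w - f z) * (g w - g z)) \<le> e / 2 * N" .
      have 6: "cmod (g z * (f w - f z - (\<Sum>i<n. L i * (w i - z i)))) \<le> cmod (g z) * (?e * N)"
        unfolding norm_mult by (intro mult_left_mono 1) auto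
      have 7: "cmod (f z * (g w - g z - (\<Sum>i<n. M i * (w i - z i)))) \<le> cmod (f z) * (?e * N)"
        unfolding norm_mult by (intro mult_left_mono 2) auto
      have "(\<Sum>i<n. (g z * L i + f z * M i) * (w i - z i)) =
        g z * (\<Sum>i<n. L i * (w i - z i)) + f z * (\<Sum>i<n. M i * (w i - z i))"
        by (simp add: sum_distrib_left sum.distrib distrib_right mult.assoc)
      then have eq: "f w * g w - f z * g z - (\<Sum>i<n. (g z * L i + f z * M i) * (w i - z i)) =
        (f w - f z) * (g w - g z) + (g z * (f w - f z - (\<Sum>i<n. L i * (w i - z i)))
          + f z * (g w - g z - (\<Sum>i<n. M i * (w i - z i))))"
        by (simp add: algebra_simps)
      have "cmod (f w * g w - f z * g z - (\<Sum>i<n. (g z * L i + f z * M i) * (w i - z i)))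
        \<le> e / 2 * N + (cmod (g z) * (?e * N) + cmod (f z) * (?e * N))"
        unfolding eq by (intro norm_triangle_mono 5 6 7)
      also have "\<dots> \<le> e / 2 * N + A * (?e * N)"
      proof -
        have "0 \<le> ?e * N" using e N0 by (intro mult_nonneg_nonneg) auto
        then have "(cmod (g z) + cmod (f z)) * (?e * N) \<le> A * (?e * N)"
          by (rule mult_right_mono[rotated]) (simp add: A_def)
        then show ?thesis by (simp only: distrib_right add_left_mono)
      qed
      also have "\<dots> = e * N" using \<open>A > 0\<close> by simp
      finally show "cmod (f w * g w - f z * g z - (\<Sum>i<n. (g z * L i + f z * M i) * (w i - z i)))
        \<le> e * (\<Sum>i<n. cmod (w i - z i))" by (simp add: N_def)
    qed (use d1 d2 d3 d4 \<open>d5 > 0\<close> in auto)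
  qed
qed

text \<open>Coordinates from index n on vanish, so finitely many coordinates control the topology.\<close>
lemma openin_Cn:
  assumes "openin (top_of_set (Cn n)) T" "z \<in> T"
  obtains d where "d > 0" "\<And>w. w \<in> Cn n \<Longrightarrow> (\<And>i. i < n \<Longrightarrow> cmod (w i - z i) < d) \<Longrightarrow> w \<in> T"
proof -
  obtain W where W: "open W" "T = Cn n \<inter> W" using assms(1) by (auto simp: openin_open)
  then have "openin (product_topology (\<lambda>i. euclidean) UNIV) W" "z \<in> W" using assms(2)
    by (auto simp: open_fun_def)
  then obtain B where B: "z \<in> PiE UNIV B" "\<And>i. open (B i)" "PiE UNIV B \<subseteq> W"
    using product_topology_open_contains_basis[of "\<lambda>i. euclidean" UNIV W z] by auto
  have "\<forall>i. \<exists>d>0. ball (z i) d \<subseteq> B i" using B by (auto simp: open_contains_ball)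
  then obtain d where d: "\<And>i. d i > 0" "\<And>i. ball (z i) (d i) \<subseteq> B i" by metis
  let ?d = "Min (insert 1 (d ` {..<n}))"
  show ?thesis
  proof (rule that[of ?d])
    show "?d > 0" using d by simp
    fix w assume w: "w \<in> Cn n" "\<And>i. i < n \<Longrightarrow> cmod (w i - z i) < ?d"
    have "w i \<in> B i" for i
    proof (cases "i < n")
      case True
      then have "cmod (w i - z i) < d i" using w(2)[OF True] by simp
      then have "w i \<in> ball (z i) (d i)" by (simp add: dist_norm norm_minus_commute)
      then show ?thesis using d by blast
    next
      case False
      then have "w i = z i" using w(1) W assms(2) by (simp add: Cn_def)
      then show ?thesis using d[of i] by auto
    qed
    then show "w \<in> T" using B W w by auto
  qed
qed

lemma holo_local:
  assumes "S \<subseteq> Cn n"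
    and "\<And>z. z \<in> S \<Longrightarrow> \<exists>T. openin (top_of_set (Cn n)) T \<and> z \<in> T \<and> holo n f (S \<inter> T)"
  shows "holo n f S"
  unfolding holo_def
proof
  fix z assume z: "z \<in> S"
  obtain T where T: "openin (top_of_set (Cn n)) T" "z \<in> T" "holo n f (S \<inter> T)"
    using assms(2)[OF z] by blast
  obtain d0 where d0: "d0 > 0" "\<And>w. w \<in> Cn n \<Longrightarrow> (\<And>i. i < n \<Longrightarrow> cmod (w i - z i) < d0) \<Longrightarrow> w \<in> T"
    using openin_Cn[OF T(1,2)] by blast
  obtain L where L: "\<And>e. e > 0 \<Longrightarrow> \<exists>d>0. \<forall>w\<in>S \<inter> T. (\<forall>i<n. cmod (w i - z i) < d) \<longrightarrow>
       cmod (f w - f z - (\<Sum>i<n. L i * (w i - z i))) \<le> e * (\<Sum>i<n. cmod (w i - z i))"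
    using holoD[OF T(3), of z] z T(2) by blast
  show "\<exists>L. \<forall>e>0. \<exists>d>0. \<forall>w\<in>S. (\<forall>i<n. cmod (w i - z i) < d) \<longrightarrow>
     cmod (f w - f z - (\<Sum>i<n. L i * (w i - z i))) \<le> e * (\<Sum>i<n. cmod (w i - z i))"
  proof (intro exI[of _ L] allI impI)
    fix e :: real assume "e > 0"
    then obtain d where d: "d > 0" "\<And>w. w \<in> S \<inter> T \<Longrightarrow> (\<forall>i<n. cmod (w i - z i) < d) \<Longrightarrow>
       cmod (f w - f z - (\<Sum>i<n. L i * (w i - z i))) \<le> e * (\<Sum>i<n. cmod (w i - z i))"
      using L[of e] by blast
    show "\<exists>d>0. \<forall>w\<in>S. (\<forall>i<n. cmod (w i - z i) < d) \<longrightarrow>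
     cmod (f w - f z - (\<Sum>i<n. L i * (w i - z i))) \<le> e * (\<Sum>i<n. cmod (w i - z i))"
    proof (intro exI[of _ "min d d0"] conjI ballI impI)
      fix w assume w: "w \<in> S" "\<forall>i<n. cmod (w i - z i) < min d d0"
      then have "w \<in> T" using d0(2)[of w] assms(1) by auto
      then show "cmod (f w - f z - (\<Sum>i<n. L i * (w i - z i))) \<le> e * (\<Sum>i<n. cmod (w i - z i))"
        using d(2)[of w] w by auto
    qed (use d d0 in auto)
  qed
qed

lemma holo_on_subset: "holo_on n A U f \<Longrightarrow> V \<subseteq> U \<Longrightarrow> holo_on n A V f"
  unfolding holo_on_def
proof clarify
  fix D \<phi> assume h: "\<forall>(D, \<phi>)\<in>A. holo n (\<lambda>z. f (inv_into D \<phi> z)) (\<phi> ` (D \<inter> U))"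
    "V \<subseteq> U" "(D, \<phi>) \<in> A"
  then have "holo n (\<lambda>z. f (inv_into D \<phi> z)) (\<phi> ` (D \<inter> U))" by blast
  then show "holo n (\<lambda>z. f (inv_into D \<phi> z)) (\<phi> ` (D \<inter> V))"
    by (rule holo_subset) (use h(2) in blast)
qed

lemma holo_on_cong:
  assumes "\<And>x. x \<in> U \<Longrightarrow> f x = g x" and "complex_atlas n A"
  shows "holo_on n A U f = holo_on n A U g"
proof -
  have "inv_into D \<phi> (\<phi> x) = x" if "(D, \<phi>) \<in> A" "x \<in> D" for D \<phi> x
    using assms(2) that unfolding complex_atlas_def homeomorphism_def by fastforce
  then have "holo n (\<lambda>z. f (inv_into D \<phi> z)) (\<phi> ` (D \<inter> U)) = holo n (\<lambda>z. g (inv_into D \<phi> z)) (\<phi> ` (D \<inter> U))"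
    if "(D, \<phi>) \<in> A" for D \<phi>
    using that assms(1) by (intro holo_cong) auto
  then show ?thesis unfolding holo_on_def by auto
qed

lemma holo_on_const: "holo_on n A U (\<lambda>x. c)"
  by (auto simp: holo_on_def holo_const)

lemma holo_on_add: "holo_on n A U f \<Longrightarrow> holo_on n A U g \<Longrightarrow> holo_on n A U (\<lambda>x. f x + g x)"
  unfolding holo_on_def by (auto intro!: holo_add)

lemma holo_on_mult: "holo_on n A U f \<Longrightarrow> holo_on n A U g \<Longrightarrow> holo_on n A U (\<lambda>x. f x * g x)"
  unfolding holo_on_def by (auto intro!: holo_mult)

lemma holo_on_sum:
  "(\<And>i. i \<in> I \<Longrightarrow> holo_on n A U (f i)) \<Longrightarrow> holo_on n A U (\<lambda>x. \<Sum>i\<in>I. f i x)"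
  by (induction I rule: infinite_finite_induct) (auto intro: holo_on_const holo_on_add)

lemma holo_on_local:
  assumes at: "complex_atlas n A"
    and loc: "\<And>x. x \<in> U \<Longrightarrow> \<exists>V. open V \<and> x \<in> V \<and> holo_on n A (U \<inter> V) f"
  shows "holo_on n A U f"
  unfolding holo_on_def
proof clarify
  fix D \<phi> assume D: "(D, \<phi>) \<in> A"
  then have h: "open D" "openin (top_of_set (Cn n)) (\<phi> ` D)" "homeomorphism D (\<phi> ` D) \<phi> (inv_into D \<phi>)"
    using at unfolding complex_atlas_def by fast+
  have op: "openin (top_of_set (Cn n)) (\<phi> ` (D \<inter> V))" if "open V" for V
  proof -
    have "openin (top_of_set (\<phi> ` D)) (\<phi> ` (D \<inter> V))"
      by (rule homeomorphism_imp_open_map[OF h(3)]) (use that in \<open>simp add: openin_open_Int\<close>)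
    then show ?thesis using h(2) openin_trans by blast
  qed
  have inj: "inj_on \<phi> D" using h(3) unfolding homeomorphism_def by (metis inj_on_inverseI)
  show "holo n (\<lambda>z. f (inv_into D \<phi> z)) (\<phi> ` (D \<inter> U))"
  proof (rule holo_local)
    show "\<phi> ` (D \<inter> U) \<subseteq> Cn n" using openin_imp_subset[OF h(2)] by auto
    fix z assume "z \<in> \<phi> ` (D \<inter> U)"
    then obtain x where x: "z = \<phi> x" "x \<in> D" "x \<in> U" by auto
    obtain V where V: "open V" "x \<in> V" "holo_on n A (U \<inter> V) f" using loc[OF x(3)] by auto
    have "\<phi> ` (D \<inter> U) \<inter> \<phi> ` (D \<inter> V) = \<phi> ` (D \<inter> (U \<inter> V))"
      using inj by (auto simp: inj_on_def)
    then have "holo n (\<lambda>z. f (inv_into D \<phi> z)) (\<phi> ` (D \<inter> U) \<inter> \<phi> ` (D \<inter> V))"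
      using V(3) D unfolding holo_on_def by auto
    then show "\<exists>T. openin (top_of_set (Cn n)) T \<and> z \<in> T \<and>
      holo n (\<lambda>z. f (inv_into D \<phi> z)) (\<phi> ` (D \<inter> U) \<inter> T)"
      using op[OF V(1)] V(2) x by blast
  qed
qed

lemma holo_on_ext_mult:
  assumes "\<And>K. holo_on n A U (\<lambda>x. a x K)" "\<And>K. holo_on n A U (\<lambda>x. b x K)"
  shows "holo_on n A U (\<lambda>x. ext_mult (a x) (b x) K)"
  unfolding ext_mult_def
  by (intro holo_on_sum holo_on_mult assms holo_on_const)

lemma holo_on_ext_map:
  assumes g: "\<And>k l. k < r \<Longrightarrow> l < r \<Longrightarrow> holo_on n A U (\<lambda>x. g x k l)"
    and a: "\<And>K. holo_on n A U (\<lambda>x. a x K)"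
  shows "holo_on n A U (\<lambda>x. ext_map r (g x) (a x) K)"
proof -
  have c: "holo_on n A U (\<lambda>x. ext_column r (g x) l K)" if "l < r" for l K
  proof -
    have "holo_on n A U (\<lambda>x. if K = {k} then g x k l else 0)" if "k < r" for k
      using g[OF that \<open>l < r\<close>] by (cases "K = {k}") (auto intro: holo_on_const)
    then show ?thesis unfolding ext_column_def by (intro holo_on_sum) auto
  qed
  have "holo_on n A U (\<lambda>x. ext_prod (ext_column r (g x)) J K)" if "J \<subseteq> {..<r}" for J K
  proof -
    have "finite J" using that finite_subset by auto
    then show ?thesis using that
    proof (induction arbitrary: K rule: finite_min_induct)
      case empty
      then show ?case by (simp add: holo_on_const)
    next
      case (insert q J)
      then show ?case by (simp add: ext_prod_insert holo_on_ext_mult c)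
    qed
  qed
  then show ?thesis unfolding ext_map_prod by (intro holo_on_sum holo_on_mult a) auto
qed

section \<open>Sections of the exterior algebra of the bundle\<close>

lemma split_model_simps [simp]:
  "carrier (salg (split_model M) U) = ext_sections M U"
  "s \<otimes>\<^bsub>salg (split_model M) U\<^esub> t = (\<lambda>i x. ext_mult (s i x) (t i x))"
  "\<one>\<^bsub>salg (split_model M) U\<^esub> = (\<lambda>i x. if i \<in> triv_idx M \<and> x \<in> U \<inter> triv_dom M i then ext_one else (\<lambda>K. 0))"
  "\<zero>\<^bsub>salg (split_model M) U\<^esub> = (\<lambda>i x K. 0)"
  "s \<oplus>\<^bsub>salg (split_model M) U\<^esub> t = (\<lambda>i x K. s i x K + t i x K)"
  "scal (salg (split_model M) U) c s = (\<lambda>i x K. c * s i x K)"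
  "part (salg (split_model M) U) p = {s \<in> ext_sections M U. \<forall>i x K. s i x K \<noteq> 0 \<longrightarrow> odd (card K) = p}"
  "srs (split_model M) U V s = (\<lambda>i x. if x \<in> V then s i x else (\<lambda>K. 0))"
  by (simp_all add: split_model_def)

lemma part_split_model:
  "part (salg (split_model M) U) p = {s \<in> ext_sections M U. \<forall>i x. ext_parity p (s i x)}"
  by (auto simp: ext_parity_def)

lemma J_pow_order: "J_pow M k U = {s \<in> ext_sections M U. \<forall>i x. ext_order k (s i x)}"
  by (auto simp: J_pow_def ext_order_def)

text \<open>The section with coefficients c in the i-th trivialisation, which the transition matrices carry to
  all the others.\<close>
definition triv_section :: "('x, 'i) model \<Rightarrow> 'i \<Rightarrow> 'x set \<Rightarrow> ('x \<Rightarrow> ext) \<Rightarrow> ('x, 'i) ext_section" where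
  "triv_section M i U c = (\<lambda>j x. if j \<in> triv_idx M \<and> x \<in> U \<inter> triv_dom M j
     then ext_map (brank M) (transf M j i x) (c x) else (\<lambda>K. 0))"

definition sec_rs :: "'x set \<Rightarrow> ('x, 'i) ext_section \<Rightarrow> ('x, 'i) ext_section" where
  "sec_rs V s = (\<lambda>i x. if x \<in> V then s i x else (\<lambda>K. 0))"

lemma srs_split_model: "srs (split_model M) U V s = sec_rs V s"
  by (simp add: sec_rs_def)

locale bundle_model =
  fixes M :: "('x::{t2_space,second_countable_topology}, 'i) model"
  assumes model: "is_model M"
begin

abbreviation r where "r \<equiv> brank M"
abbreviation D where "D \<equiv> triv_dom M"
abbreviation Idx where "Idx \<equiv> triv_idx M"
abbreviation tr where "tr \<equiv> transf M"
abbreviation hol where "hol \<equiv> holo_on (cdim M) (charts M)"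
abbreviation sections where "sections \<equiv> ext_sections M"

lemma atlas: "complex_atlas (cdim M) (charts M)"
  using model by (simp add: is_model_def)

lemma D_open: "i \<in> Idx \<Longrightarrow> open (D i)"
  using model by (simp add: is_model_def)

lemma D_cover: obtains i where "i \<in> Idx" "x \<in> D i"
proof -
  have "x \<in> (\<Union>i\<in>Idx. D i)" using model by (simp add: is_model_def)
  then show ?thesis using that by blast
qed

lemma tr_hol:
  "i \<in> Idx \<Longrightarrow> j \<in> Idx \<Longrightarrow> k < r \<Longrightarrow> l < r \<Longrightarrow> hol (D i \<inter> D j) (\<lambda>x. tr i j x k l)"
  using model unfolding is_model_def by blast

lemma tr_id: "i \<in> Idx \<Longrightarrow> x \<in> D i \<Longrightarrow> k < r \<Longrightarrow> l < r \<Longrightarrow> tr i i x k l = (if k = l then 1 else 0)"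
  using model unfolding is_model_def by blast

lemma tr_comp:
  assumes "i \<in> Idx" "j \<in> Idx" "m \<in> Idx" "x \<in> D i" "x \<in> D j" "x \<in> D m"
  shows "ext_map r (tr i j x) (ext_map r (tr j m x) a) = ext_map r (tr i m x) a"
proof -
  have "tr i m x k l = (\<Sum>p<r. tr i j x k p * tr j m x p l)" if "k < r" "l < r" for k l
    using model assms that unfolding is_model_def by blast
  then have "ext_map r (\<lambda>k l. \<Sum>p<r. tr i j x k p * tr j m x p l) a = ext_map r (tr i m x) a"
    by (intro ext_map_cong) simp
  then show ?thesis by (simp add: ext_map_comp)
qed

lemma hol_local: "(\<And>x. x \<in> U \<Longrightarrow> \<exists>V. open V \<and> x \<in> V \<and> hol (U \<inter> V) f) \<Longrightarrow> hol U f"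
  using holo_on_local[OF atlas] by blast

lemma hol_cong: "(\<And>x. x \<in> U \<Longrightarrow> f x = g x) \<Longrightarrow> hol U f = hol U g"
  using holo_on_cong[OF _ atlas] by blast

subsection \<open>Membership and closure properties\<close>

lemma sections_out: "s \<in> sections U \<Longrightarrow> \<not> (i \<in> Idx \<and> x \<in> U \<and> x \<in> D i) \<Longrightarrow> s i x = (\<lambda>K. 0)"
  unfolding ext_sections_def by auto

lemma sections_Ext: "s \<in> sections U \<Longrightarrow> s i x \<in> Ext r"
  unfolding ext_sections_def Ext_def by auto

lemma sections_hol: "s \<in> sections U \<Longrightarrow> i \<in> Idx \<Longrightarrow> hol (U \<inter> D i) (\<lambda>x. s i x K)"
proof (cases "K \<subseteq> {..<r}")
  case False
  assume "s \<in> sections U"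
  then have "(\<lambda>x. s i x K) = (\<lambda>x. 0)" using False sections_Ext ExtD by blast
  then show ?thesis by (simp add: holo_on_const)
qed (auto simp: ext_sections_def)

lemma sections_tr:
  "s \<in> sections U \<Longrightarrow> i \<in> Idx \<Longrightarrow> j \<in> Idx \<Longrightarrow> x \<in> U \<Longrightarrow> x \<in> D i \<Longrightarrow> x \<in> D j \<Longrightarrow>
     s i x = ext_map r (tr i j x) (s j x)"
  unfolding ext_sections_def by blast

lemma sectionsI:
  assumes "\<And>i x. \<not> (i \<in> Idx \<and> x \<in> U \<and> x \<in> D i) \<Longrightarrow> s i x = (\<lambda>K. 0)"
    and "\<And>i x. i \<in> Idx \<Longrightarrow> x \<in> U \<Longrightarrow> x \<in> D i \<Longrightarrow> s i x \<in> Ext r"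
    and "\<And>i K. i \<in> Idx \<Longrightarrow> hol (U \<inter> D i) (\<lambda>x. s i x K)"
    and "\<And>i j x. i \<in> Idx \<Longrightarrow> j \<in> Idx \<Longrightarrow> x \<in> U \<Longrightarrow> x \<in> D i \<Longrightarrow> x \<in> D j \<Longrightarrow>
      s i x = ext_map r (tr i j x) (s j x)"
  shows "s \<in> sections U"
  unfolding ext_sections_def
proof (intro CollectI conjI allI impI ballI)
  fix i x K assume h: "\<not> (i \<in> Idx \<and> x \<in> U \<inter> D i \<and> K \<subseteq> {..<r})"
  show "s i x K = 0"
  proof (cases "i \<in> Idx \<and> x \<in> U \<and> x \<in> D i")
    case True
    then show ?thesis using h assms(2)[of i x] ExtD by blast
  qed (simp add: assms(1))
next
  fix i j x assume "i \<in> Idx" "j \<in> Idx" "x \<in> U \<inter> D i \<inter> D j"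
  then show "s i x = ext_map r (tr i j x) (s j x)" by (intro assms(4)) auto
qed (simp add: assms(3))

text \<open>At each point, the value in one trivialisation determines the values in all others through the
  transition matrices.\<close>
lemma sections_eqI:
  assumes "s \<in> sections U" "t \<in> sections U"
    and "\<And>x. x \<in> U \<Longrightarrow> \<exists>i\<in>Idx. x \<in> D i \<and> s i x = t i x"
  shows "s = t"
proof (intro ext)
  fix j x K
  show "s j x K = t j x K"
  proof (cases "j \<in> Idx \<and> x \<in> U \<and> x \<in> D j")
    case True
    then obtain i where "i \<in> Idx" "x \<in> D i" "s i x = t i x" using assms(3) by blast
    then have "s j x = t j x" using True sections_tr[OF assms(1)] sections_tr[OF assms(2)] by metis
    then show ?thesis by simp
  next
    case False
    then show ?thesis using sections_out assms(1,2) by simp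
  qed
qed

lemma sections_add:
  assumes s: "s \<in> sections U" and t: "t \<in> sections U"
  shows "(\<lambda>i x K. s i x K + t i x K) \<in> sections U"
proof (rule sectionsI)
  fix i j x assume "i \<in> Idx" "j \<in> Idx" "x \<in> U" "x \<in> D i" "x \<in> D j"
  then show "(\<lambda>K. s i x K + t i x K) = ext_map r (tr i j x) (\<lambda>K. s j x K + t j x K)"
    using sections_tr[OF s, of i j x] sections_tr[OF t, of i j x] by (simp add: ext_map_add)
next
  show "hol (U \<inter> D i) (\<lambda>x. s i x K + t i x K)" if "i \<in> Idx" for i K
    using that s t by (intro holo_on_add sections_hol)
next
  show "(\<lambda>K. s i x K + t i x K) \<in> Ext r" for i x
    using sections_Ext[OF s, of i x] sections_Ext[OF t, of i x] by (simp add: Ext_def)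
qed (simp add: sections_out[OF s] sections_out[OF t])

lemma sections_scal:
  assumes s: "s \<in> sections U"
  shows "(\<lambda>i x K. c * s i x K) \<in> sections U"
proof (rule sectionsI)
  fix i j x assume "i \<in> Idx" "j \<in> Idx" "x \<in> U" "x \<in> D i" "x \<in> D j"
  then show "(\<lambda>K. c * s i x K) = ext_map r (tr i j x) (\<lambda>K. c * s j x K)"
    using sections_tr[OF s, of i j x] by (simp add: ext_map_scal)
next
  show "hol (U \<inter> D i) (\<lambda>x. c * s i x K)" if "i \<in> Idx" for i K
    using that s by (intro holo_on_mult holo_on_const sections_hol)
next
  show "(\<lambda>K. c * s i x K) \<in> Ext r" for i x
    using sections_Ext[OF s, of i x] by (simp add: Ext_def)
qed (simp add: sections_out[OF s])

lemma sections_zero: "(\<lambda>i x K. 0) \<in> sections U"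
  by (rule sectionsI) (auto simp: Ext_def holo_on_const)

lemma sections_diff: "s \<in> sections U \<Longrightarrow> t \<in> sections U \<Longrightarrow> (\<lambda>i x K. s i x K - t i x K) \<in> sections U"
  using sections_add[of s U "\<lambda>i x K. - 1 * t i x K"] sections_scal[of t U "- 1"] by simp

lemma sections_sum:
  "(\<And>k. k \<in> F \<Longrightarrow> f k \<in> sections U) \<Longrightarrow> (\<lambda>i x K. \<Sum>k\<in>F. f k i x K) \<in> sections U"
  by (induction F rule: infinite_finite_induct) (auto intro: sections_zero sections_add)

lemma sections_mult:
  assumes s: "s \<in> sections U" and t: "t \<in> sections U"
  shows "(\<lambda>i x. ext_mult (s i x) (t i x)) \<in> sections U"
proof (rule sectionsI)
  fix i j x assume "i \<in> Idx" "j \<in> Idx" "x \<in> U" "x \<in> D i" "x \<in> D j"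
  then show "ext_mult (s i x) (t i x) = ext_map r (tr i j x) (ext_mult (s j x) (t j x))"
    using sections_tr[OF s, of i j x] sections_tr[OF t, of i j x]
    by (simp add: ext_map_mult sections_Ext[OF s] sections_Ext[OF t])
next
  show "hol (U \<inter> D i) (\<lambda>x. ext_mult (s i x) (t i x) K)" if "i \<in> Idx" for i K
    using that s t by (intro holo_on_ext_mult sections_hol)
next
  show "ext_mult (s i x) (t i x) \<in> Ext r" for i x
    by (intro ext_mult_Ext sections_Ext[OF s] sections_Ext[OF t])
qed (simp add: sections_out[OF s])

lemma sections_filter: "s \<in> sections U \<Longrightarrow> (\<lambda>i x. ext_filter P (s i x)) \<in> sections U"
proof (rule sectionsI)
  fix i j x assume h: "s \<in> sections U" "i \<in> Idx" "j \<in> Idx" "x \<in> U" "x \<in> D i" "x \<in> D j"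
  then show "ext_filter P (s i x) = ext_map r (tr i j x) (ext_filter P (s j x))"
    using sections_tr[OF h] by (simp add: ext_map_filter)
next
  fix i K assume "s \<in> sections U" "i \<in> Idx"
  then show "hol (U \<inter> D i) (\<lambda>x. ext_filter P (s i x) K)"
    by (cases "P (card K)") (simp_all add: ext_filter_def sections_hol holo_on_const)
qed (auto simp: sections_out ext_filter_def Ext_def ExtD[OF sections_Ext])

lemma triv_section:
  assumes i: "i \<in> Idx" and U: "U \<subseteq> D i" and h: "\<And>K. hol U (\<lambda>x. c x K)"
  shows "triv_section M i U c \<in> sections U"
proof (rule sectionsI)
  fix j K assume j: "j \<in> Idx"
  have "hol (U \<inter> D j) (\<lambda>x. ext_map r (tr j i x) (c x) K)"
  proof (rule holo_on_ext_map)
    show "hol (U \<inter> D j) (\<lambda>x. tr j i x k l)" if "k < r" "l < r" for k l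
      using tr_hol[OF j i that] by (rule holo_on_subset) (use U in auto)
    show "hol (U \<inter> D j) (\<lambda>x. c x K)" for K using h by (rule holo_on_subset) auto
  qed
  then show "hol (U \<inter> D j) (\<lambda>x. triv_section M i U c j x K)"
    by (subst hol_cong[where g = "\<lambda>x. ext_map r (tr j i x) (c x) K"]) (simp_all add: triv_section_def j)
next
  fix j k x assume "j \<in> Idx" "k \<in> Idx" "x \<in> U" "x \<in> D j" "x \<in> D k"
  then show "triv_section M i U c j x = ext_map r (tr j k x) (triv_section M i U c k x)"
    using i U by (auto simp: triv_section_def tr_comp)
qed (auto simp: triv_section_def ext_map_Ext)

lemma triv_section_same:
  assumes "i \<in> Idx" "U \<subseteq> D i" "x \<in> U" "c x \<in> Ext r"
  shows "triv_section M i U c i x = c x"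
  unfolding triv_section_def using assms ext_map_id[OF assms(4) tr_id[OF assms(1)]] by auto

lemma sections_one: "(\<lambda>i x. if i \<in> Idx \<and> x \<in> U \<inter> D i then ext_one else (\<lambda>K. 0)) \<in> sections U"
proof (rule sectionsI)
  fix i K assume i: "i \<in> Idx"
  show "hol (U \<inter> D i) (\<lambda>x. (if i \<in> Idx \<and> x \<in> U \<inter> D i then ext_one else (\<lambda>K. 0)) K)"
    by (subst hol_cong[where g = "\<lambda>x. ext_one K"]) (simp_all add: i holo_on_const)
qed (auto simp: ext_map_one)

subsection \<open>Restriction and gluing\<close>

lemma sec_rs_sections: "s \<in> sections U \<Longrightarrow> V \<subseteq> U \<Longrightarrow> sec_rs V s \<in> sections V"
proof (rule sectionsI)
  fix i K assume s: "s \<in> sections U" "V \<subseteq> U" and i: "i \<in> Idx"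
  have "hol (V \<inter> D i) (\<lambda>x. s i x K)"
    using sections_hol[OF s(1) i] by (rule holo_on_subset) (use s in auto)
  then show "hol (V \<inter> D i) (\<lambda>x. sec_rs V s i x K)"
    by (subst hol_cong[where g = "\<lambda>x. s i x K"]) (simp_all add: sec_rs_def)
qed (auto simp: sec_rs_def sections_out sections_Ext intro!: sections_tr)

lemma sec_rs_eqI:
  assumes "s \<in> sections U" "t \<in> sections U"
    and "\<And>x. x \<in> U \<Longrightarrow> \<exists>V. x \<in> V \<and> sec_rs V s = sec_rs V t"
  shows "s = t"
proof (rule sections_eqI[OF assms(1,2)])
  fix x assume "x \<in> U"
  then obtain V where V: "x \<in> V" "sec_rs V s = sec_rs V t" using assms(3) by blast
  obtain i where i: "i \<in> Idx" "x \<in> D i" by (rule D_cover)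
  have "sec_rs V s i x = sec_rs V t i x" using V by simp
  then show "\<exists>i\<in>Idx. x \<in> D i \<and> s i x = t i x" using V i by (auto simp: sec_rs_def)
qed

lemma sections_glue:
  assumes op: "\<And>a. a \<in> A \<Longrightarrow> open (W a)" and s: "\<And>a. a \<in> A \<Longrightarrow> s a \<in> sections (W a)"
    and agree: "\<And>a b x i. a \<in> A \<Longrightarrow> b \<in> A \<Longrightarrow> x \<in> W a \<Longrightarrow> x \<in> W b \<Longrightarrow> s a i x = s b i x"
  obtains t where "t \<in> sections (\<Union>a\<in>A. W a)" "\<And>a. a \<in> A \<Longrightarrow> sec_rs (W a) t = s a"
proof -
  define t where "t = (\<lambda>i x. if \<exists>a\<in>A. x \<in> W a then s (SOME a. a \<in> A \<and> x \<in> W a) i x else (\<lambda>K. 0))"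
  have t: "t i x = s a i x" if "a \<in> A" "x \<in> W a" for a i x
  proof -
    have "(SOME a. a \<in> A \<and> x \<in> W a) \<in> A \<and> x \<in> W (SOME a. a \<in> A \<and> x \<in> W a)"
      by (rule someI[of _ a]) (use that in auto)
    then have "s (SOME a. a \<in> A \<and> x \<in> W a) i x = s a i x" using that agree by blast
    moreover have "\<exists>a\<in>A. x \<in> W a" using that by blast
    ultimately show ?thesis by (simp only: t_def if_True)
  qed
  have t0: "t i x = (\<lambda>K. 0)" if "\<forall>a\<in>A. x \<notin> W a" for i x
    using that by (simp add: t_def)
  show ?thesis
  proof (rule that)
    show "t \<in> sections (\<Union>a\<in>A. W a)"
    proof (rule sectionsI)
      fix i x assume n: "\<not> (i \<in> Idx \<and> x \<in> (\<Union>a\<in>A. W a) \<and> x \<in> D i)"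
      show "t i x = (\<lambda>K. 0)"
      proof (cases "\<exists>a\<in>A. x \<in> W a")
        case True
        then obtain a where a: "a \<in> A" "x \<in> W a" by blast
        then have "\<not> (i \<in> Idx \<and> x \<in> W a \<and> x \<in> D i)" using n by blast
        then show ?thesis using t[OF a] sections_out[OF s[OF a(1)]] by simp
      qed (simp add: t0)
    next
      fix i x assume "x \<in> (\<Union>a\<in>A. W a)"
      then obtain a where "a \<in> A" "x \<in> W a" by blast
      then show "t i x \<in> Ext r" using t sections_Ext[OF s] by simp
    next
      fix i K assume i: "i \<in> Idx"
      show "hol ((\<Union>a\<in>A. W a) \<inter> D i) (\<lambda>x. t i x K)"
      proof (rule hol_local)
        fix x assume "x \<in> (\<Union>a\<in>A. W a) \<inter> D i"
        then obtain a where a: "a \<in> A" "x \<in> W a" by blast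
        have "hol (W a \<inter> D i) (\<lambda>x. t i x K)"
          using sections_hol[OF s[OF a(1)] i, of K]
          by (subst hol_cong[where g = "\<lambda>x. s a i x K"]) (simp_all add: t[OF a(1)])
        then have "hol ((\<Union>a\<in>A. W a) \<inter> D i \<inter> W a) (\<lambda>x. t i x K)"
          by (rule holo_on_subset) auto
        then show "\<exists>V. open V \<and> x \<in> V \<and> hol ((\<Union>a\<in>A. W a) \<inter> D i \<inter> V) (\<lambda>x. t i x K)"
          using a op by blast
      qed
    next
      fix i j x assume ij: "i \<in> Idx" "j \<in> Idx" "x \<in> D i" "x \<in> D j" and "x \<in> (\<Union>a\<in>A. W a)"
      then obtain a where a: "a \<in> A" "x \<in> W a" by blast
      then show "t i x = ext_map r (tr i j x) (t j x)"
        using sections_tr[OF s[OF a(1)] ij(1,2) a(2) ij(3,4)] t by simp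
    qed
    fix a assume a: "a \<in> A"
    show "sec_rs (W a) t = s a"
    proof (intro ext)
      fix i x K
      show "sec_rs (W a) t i x K = s a i x K"
        using t[OF a] sections_out[OF s[OF a], of i x] by (auto simp: sec_rs_def)
    qed
  qed
qed

subsection \<open>The filtration by powers of the odd ideal\<close>

lemma J_powI:
  assumes "s \<in> sections U" "\<And>x. x \<in> U \<Longrightarrow> \<exists>i\<in>Idx. x \<in> D i \<and> ext_order m (s i x)"
  shows "s \<in> J_pow M m U"
  unfolding J_pow_order
proof (intro CollectI conjI allI assms(1))
  fix j x
  show "ext_order m (s j x)"
  proof (cases "j \<in> Idx \<and> x \<in> U \<and> x \<in> D j")
    case True
    then obtain i where "i \<in> Idx" "x \<in> D i" "ext_order m (s i x)" using assms(2) by blast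
    then show ?thesis using True sections_tr[OF assms(1), of j i x] ext_map_order by metis
  next
    case False
    then show ?thesis using sections_out[OF assms(1)] by (simp add: ext_order_def)
  qed
qed

lemma J_pow_sections: "s \<in> J_pow M m U \<Longrightarrow> s \<in> sections U"
  by (simp add: J_pow_def)

lemma J_pow_local:
  assumes "s \<in> sections U" "\<And>x. x \<in> U \<Longrightarrow> \<exists>V. x \<in> V \<and> sec_rs V s \<in> J_pow M m V"
  shows "s \<in> J_pow M m U"
proof (rule J_powI[OF assms(1)])
  fix x assume "x \<in> U"
  then obtain V where V: "x \<in> V" "sec_rs V s \<in> J_pow M m V" using assms(2) by blast
  obtain i where i: "i \<in> Idx" "x \<in> D i" by (rule D_cover)
  have "ext_order m (sec_rs V s i x)" using V by (simp add: J_pow_order)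
  then show "\<exists>i\<in>Idx. x \<in> D i \<and> ext_order m (s i x)" using V i by (auto simp: sec_rs_def)
qed

lemma J_pow_mono: "m \<le> m' \<Longrightarrow> J_pow M m' U \<subseteq> J_pow M m U"
  unfolding J_pow_def using order_trans by blast

lemma J_pow_0: "J_pow M 0 U = sections U"
  by (auto simp: J_pow_def)

lemma J_pow_add: "s \<in> J_pow M m U \<Longrightarrow> t \<in> J_pow M m U \<Longrightarrow> (\<lambda>i x K. s i x K + t i x K) \<in> J_pow M m U"
  unfolding J_pow_def by (auto simp: sections_add) (metis add_0)

lemma J_pow_scal: "s \<in> J_pow M m U \<Longrightarrow> (\<lambda>i x K. c * s i x K) \<in> J_pow M m U"
  unfolding J_pow_def by (auto simp: sections_scal)

lemma J_pow_diff: "s \<in> J_pow M m U \<Longrightarrow> t \<in> J_pow M m U \<Longrightarrow> (\<lambda>i x K. s i x K - t i x K) \<in> J_pow M m U"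
  using J_pow_add[of s m U "\<lambda>i x K. - 1 * t i x K"] J_pow_scal[of t m U "- 1"] by simp

lemma J_pow_zero: "(\<lambda>i x K. 0) \<in> J_pow M m U"
  unfolding J_pow_def by (simp add: sections_zero)

lemma J_pow_sum:
  "(\<And>k. k \<in> F \<Longrightarrow> f k \<in> J_pow M m U) \<Longrightarrow> (\<lambda>i x K. \<Sum>k\<in>F. f k i x K) \<in> J_pow M m U"
  by (induction F rule: infinite_finite_induct) (auto intro: J_pow_zero J_pow_add)

lemma J_pow_mult:
  "s \<in> J_pow M m U \<Longrightarrow> t \<in> J_pow M l U \<Longrightarrow> (\<lambda>i x. ext_mult (s i x) (t i x)) \<in> J_pow M (m + l) U"
  unfolding J_pow_order by (auto simp: sections_mult ext_order_mult)

lemma J_pow_rs: "s \<in> J_pow M m U \<Longrightarrow> V \<subseteq> U \<Longrightarrow> sec_rs V s \<in> J_pow M m V"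
  unfolding J_pow_order by (auto simp: sec_rs_sections) (auto simp: sec_rs_def ext_order_def)

lemma J_pow_above_rank: "r < m \<Longrightarrow> s \<in> J_pow M m U \<Longrightarrow> s = (\<lambda>i x K. 0)"
proof (intro ext)
  fix i x K assume h: "r < m" "s \<in> J_pow M m U"
  show "s i x K = 0"
  proof (rule ccontr)
    assume n: "s i x K \<noteq> 0"
    then have "K \<subseteq> {..<r}" using sections_Ext[OF J_pow_sections[OF h(2)], of i x] ExtD by blast
    then have "card K \<le> card {..<r}" by (intro card_mono) auto
    moreover have "m \<le> card K" using h n by (auto simp: J_pow_def)
    ultimately show False using h by simp
  qed
qed

definition frame :: "'i \<Rightarrow> 'x set \<Rightarrow> nat \<Rightarrow> ('x, 'i) ext_section" where
  "frame i U k = triv_section M i U (\<lambda>x. ext_gen {k})"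

lemma frame_sections: "i \<in> Idx \<Longrightarrow> U \<subseteq> D i \<Longrightarrow> frame i U k \<in> sections U"
  unfolding frame_def by (intro triv_section holo_on_const)

lemma frame_same: "i \<in> Idx \<Longrightarrow> U \<subseteq> D i \<Longrightarrow> x \<in> U \<Longrightarrow> k < r \<Longrightarrow> frame i U k i x = ext_gen {k}"
  unfolding frame_def by (intro triv_section_same) (auto intro: ext_gen_Ext)

lemma frame_hom: "ext_hom 1 (frame i U k j x)"
  unfolding frame_def triv_section_def
  using ext_map_hom[OF ext_gen_hom[of "{k}"]] by (auto simp: ext_hom_def)

lemma frame_J: "i \<in> Idx \<Longrightarrow> U \<subseteq> D i \<Longrightarrow> frame i U k \<in> J_pow M 1 U"
  unfolding J_pow_order using frame_hom[of i U k] frame_sections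
  by (auto simp: ext_hom_def ext_order_def)

lemma frame_odd: "i \<in> Idx \<Longrightarrow> U \<subseteq> D i \<Longrightarrow> frame i U k \<in> part (salg (split_model M) U) True"
  unfolding part_split_model using frame_hom[of i U k] frame_sections
  by (auto simp: ext_hom_def ext_parity_def)

text \<open>The coefficients are the cofactors in the i-th trivialisation: they are holomorphic, being
  coefficients of the section or zero, and of order one less.\<close>
lemma J_pow_Suc_expand:
  assumes i: "i \<in> Idx" "U \<subseteq> D i" and s: "s \<in> J_pow M (Suc m) U"
  obtains u where "\<And>k. u k \<in> J_pow M m U"
    "s = (\<lambda>j x K. \<Sum>k<r. ext_mult (frame i U k j x) (u k j x) K)"
proof -
  note ss = J_pow_sections[OF s]
  define u where "u k = triv_section M i U (\<lambda>x. ext_cofactor k (s i x))" for k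
  have hol_c: "hol U (\<lambda>x. ext_cofactor k (s i x) K)" for k K
  proof -
    have "hol U (\<lambda>x. s i x L)" for L
      using sections_hol[OF ss i(1), of L] i(2) by (simp add: inf.absorb1)
    moreover have "(\<lambda>x. ext_cofactor k (s i x) K) = (\<lambda>x. s i x (insert k K))"
      if "finite K \<and> (\<forall>j\<in>K. k < j)"
      unfolding ext_cofactor_def using that by (intro ext if_P)
    moreover have "(\<lambda>x. ext_cofactor k (s i x) K) = (\<lambda>x. 0)"
      if "\<not> (finite K \<and> (\<forall>j\<in>K. k < j))"
      unfolding ext_cofactor_def using that by (intro ext if_not_P)
    ultimately show ?thesis by (metis holo_on_const)
  qed
  have us: "u k \<in> sections U" for k unfolding u_def by (intro triv_section i hol_c)
  have ui: "u k i x = ext_cofactor k (s i x)" if "x \<in> U" for k x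
    unfolding u_def by (rule triv_section_same) (use i that sections_Ext[OF ss] in \<open>auto intro: ext_cofactor_Ext\<close>)
  have ord: "ext_order (Suc m) (s i x)" for x using s by (simp add: J_pow_order)
  show ?thesis
  proof (rule that[of u])
    show "u k \<in> J_pow M m U" for k
      by (rule J_powI[OF us]) (use ui i ord ext_cofactor_order in \<open>auto intro!: bexI[of _ i]\<close>)
    show "s = (\<lambda>j x K. \<Sum>k<r. ext_mult (frame i U k j x) (u k j x) K)"
    proof (rule sections_eqI[OF ss])
      show "(\<lambda>j x K. \<Sum>k<r. ext_mult (frame i U k j x) (u k j x) K) \<in> sections U"
        by (intro sections_sum sections_mult frame_sections us i)
      fix x assume x: "x \<in> U"
      have "ext_order 1 (s i x)" using ord[of x] by (force simp: ext_order_def)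
      from ext_cofactor_expand[OF sections_Ext[OF ss] this]
      have "s i x = (\<lambda>K. \<Sum>k<r. ext_mult (frame i U k i x) (u k i x) K)"
        using i x by (simp add: frame_same ui)
      then show "\<exists>i'\<in>Idx. x \<in> D i' \<and> s i' x = (\<lambda>K. \<Sum>k<r. ext_mult (frame i U k i' x) (u k i' x) K)"
        using i x by blast
    qed
  qed
qed

end

section \<open>Isomorphisms of sheaves of superalgebras\<close>

text \<open>The part of the structure of a superalgebra on which composing and inverting homomorphisms depends.\<close>
definition salg_closed :: "'s salg \<Rightarrow> bool" where
  "salg_closed A \<longleftrightarrow> (\<forall>a\<in>carrier A. \<forall>b\<in>carrier A. a \<otimes>\<^bsub>A\<^esub> b \<in> carrier A \<and> a \<oplus>\<^bsub>A\<^esub> b \<in> carrier A) \<and>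
     \<one>\<^bsub>A\<^esub> \<in> carrier A \<and> (\<forall>c. \<forall>a\<in>carrier A. scal A c a \<in> carrier A) \<and> (\<forall>p. part A p \<subseteq> carrier A) \<and>
     (\<forall>a\<in>carrier A. \<exists>b\<in>part A False. \<exists>c\<in>part A True. a = b \<oplus>\<^bsub>A\<^esub> c)"

lemma salg_closedD:
  assumes "salg_closed A"
  shows "a \<in> carrier A \<Longrightarrow> b \<in> carrier A \<Longrightarrow> a \<otimes>\<^bsub>A\<^esub> b \<in> carrier A"
    and "a \<in> carrier A \<Longrightarrow> b \<in> carrier A \<Longrightarrow> a \<oplus>\<^bsub>A\<^esub> b \<in> carrier A"
    and "\<one>\<^bsub>A\<^esub> \<in> carrier A" and "a \<in> carrier A \<Longrightarrow> scal A c a \<in> carrier A"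
    and "a \<in> part A p \<Longrightarrow> a \<in> carrier A"
    and "a \<in> carrier A \<Longrightarrow> \<exists>b\<in>part A False. \<exists>c\<in>part A True. a = b \<oplus>\<^bsub>A\<^esub> c"
  using assms unfolding salg_closed_def by blast+

lemma superalgebra_closed:
  assumes "superalgebra A"
  shows "salg_closed A"
proof -
  have R: "ring A" using assms by (simp add: superalgebra_def)
  interpret R: ring A by (rule R)
  have p: "subgroup (part A p) (add_monoid A)" for p
    using assms unfolding superalgebra_def by blast
  then have "part A p \<subseteq> carrier A" for p using subgroup.subset[OF p[of p]] by simp
  moreover have "carrier A = part A False <+>\<^bsub>A\<^esub> part A True" using assms by (simp add: superalgebra_def)
  then have "\<exists>b\<in>part A False. \<exists>c\<in>part A True. a = b \<oplus>\<^bsub>A\<^esub> c" if "a \<in> carrier A" for a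
    using that unfolding set_add_def set_mult_def by auto
  moreover have "scal A c a \<in> carrier A" if "a \<in> carrier A" for c a
    using assms that unfolding superalgebra_def by blast
  ultimately show ?thesis unfolding salg_closed_def by auto
qed

lemma salg_homI:
  assumes "\<And>a. a \<in> carrier A \<Longrightarrow> h a \<in> carrier B"
    and "\<And>a b. a \<in> carrier A \<Longrightarrow> b \<in> carrier A \<Longrightarrow> h (a \<otimes>\<^bsub>A\<^esub> b) = h a \<otimes>\<^bsub>B\<^esub> h b"
    and "\<And>a b. a \<in> carrier A \<Longrightarrow> b \<in> carrier A \<Longrightarrow> h (a \<oplus>\<^bsub>A\<^esub> b) = h a \<oplus>\<^bsub>B\<^esub> h b"
    and "h \<one>\<^bsub>A\<^esub> = \<one>\<^bsub>B\<^esub>" and "\<And>a c. a \<in> carrier A \<Longrightarrow> h (scal A c a) = scal B c (h a)"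
    and "\<And>a p. a \<in> part A p \<Longrightarrow> h a \<in> part B p"
  shows "h \<in> salg_hom A B"
  using assms by (auto simp: salg_hom_def Ring.ring_hom_def)

lemma salg_homD:
  assumes "h \<in> salg_hom A B"
  shows "a \<in> carrier A \<Longrightarrow> h a \<in> carrier B"
    and "a \<in> carrier A \<Longrightarrow> b \<in> carrier A \<Longrightarrow> h (a \<otimes>\<^bsub>A\<^esub> b) = h a \<otimes>\<^bsub>B\<^esub> h b"
    and "a \<in> carrier A \<Longrightarrow> b \<in> carrier A \<Longrightarrow> h (a \<oplus>\<^bsub>A\<^esub> b) = h a \<oplus>\<^bsub>B\<^esub> h b"
    and "h \<one>\<^bsub>A\<^esub> = \<one>\<^bsub>B\<^esub>" and "a \<in> carrier A \<Longrightarrow> h (scal A c a) = scal B c (h a)"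
    and "a \<in> part A p \<Longrightarrow> h a \<in> part B p"
  using assms unfolding salg_hom_def Ring.ring_hom_def by blast+

lemma salg_hom_comp: "h \<in> salg_hom A B \<Longrightarrow> k \<in> salg_hom B C \<Longrightarrow> (\<lambda>s. k (h s)) \<in> salg_hom A C"
  by (rule salg_homI) (simp_all add: salg_homD[of h A B] salg_homD[of k B C])

lemma salg_hom_cong:
  assumes "salg_closed A" "h \<in> salg_hom A B" "\<And>a. a \<in> carrier A \<Longrightarrow> h a = k a"
  shows "k \<in> salg_hom A B"
proof (rule salg_homI)
  note c = salg_closedD[OF assms(1)] and h = salg_homD[OF assms(2)] and e = assms(3)[symmetric]
  show "k a \<in> carrier B" if "a \<in> carrier A" for a by (simp only: e[OF that] h(1)[OF that])
  show "k (a \<otimes>\<^bsub>A\<^esub> b) = k a \<otimes>\<^bsub>B\<^esub> k b" if "a \<in> carrier A" "b \<in> carrier A" for a b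
    by (simp only: e that c h)
  show "k (a \<oplus>\<^bsub>A\<^esub> b) = k a \<oplus>\<^bsub>B\<^esub> k b" if "a \<in> carrier A" "b \<in> carrier A" for a b
    by (simp only: e that c h)
  show "k \<one>\<^bsub>A\<^esub> = \<one>\<^bsub>B\<^esub>" by (simp only: e c h)
  show "k (scal A r a) = scal B r (k a)" if "a \<in> carrier A" for a r by (simp only: e that c h)
  show "k a \<in> part B p" if "a \<in> part A p" for a p
    using h(6)[OF that] e[OF c(5)[OF that]] by simp
qed

definition presheaf_closed :: "('x::topological_space, 's) salg_sheaf \<Rightarrow> bool" where
  "presheaf_closed F \<longleftrightarrow> (\<forall>U. open U \<longrightarrow> salg_closed (salg F U)) \<and>
     (\<forall>U V. open U \<and> open V \<and> V \<subseteq> U \<longrightarrow> srs F U V ` carrier (salg F U) \<subseteq> carrier (salg F V))"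

lemma presheaf_closedD:
  assumes "presheaf_closed F"
  shows "open U \<Longrightarrow> salg_closed (salg F U)"
    and "open U \<Longrightarrow> open V \<Longrightarrow> V \<subseteq> U \<Longrightarrow> s \<in> carrier (salg F U) \<Longrightarrow> srs F U V s \<in> carrier (salg F V)"
  using assms unfolding presheaf_closed_def by blast+

lemma salg_sheaf_closed: "is_salg_sheaf F \<Longrightarrow> presheaf_closed F"
  unfolding is_salg_sheaf_def presheaf_closed_def
  by (auto intro: superalgebra_closed salg_homD(1))

lemma sheaf_iso_idI:
  assumes "\<And>V. open V \<Longrightarrow> V \<subseteq> U \<Longrightarrow> h V \<in> salg_hom (salg A V) (salg B V)"
    and "\<And>V. open V \<Longrightarrow> V \<subseteq> U \<Longrightarrow> bij_betw (h V) (carrier (salg A V)) (carrier (salg B V))"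
    and "\<And>V W s. open V \<Longrightarrow> open W \<Longrightarrow> W \<subseteq> V \<Longrightarrow> V \<subseteq> U \<Longrightarrow> s \<in> carrier (salg A V) \<Longrightarrow>
        srs B V W (h V s) = h W (srs A V W s)"
  shows "sheaf_iso id U A B h"
  using assms by (auto simp: sheaf_iso_def)

lemma sheaf_iso_idD:
  assumes "sheaf_iso id U A B h"
  shows "open V \<Longrightarrow> V \<subseteq> U \<Longrightarrow> h V \<in> salg_hom (salg A V) (salg B V)"
    and "open V \<Longrightarrow> V \<subseteq> U \<Longrightarrow> bij_betw (h V) (carrier (salg A V)) (carrier (salg B V))"
    and "open V \<Longrightarrow> open W \<Longrightarrow> W \<subseteq> V \<Longrightarrow> V \<subseteq> U \<Longrightarrow> s \<in> carrier (salg A V) \<Longrightarrow>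
        srs B V W (h V s) = h W (srs A V W s)"
  using assms by (auto simp: sheaf_iso_def)

lemma sheaf_iso_comp:
  assumes "sheaf_iso id U A B h" "sheaf_iso id U B C k"
  shows "sheaf_iso id U A C (\<lambda>V s. k V (h V s))"
proof (rule sheaf_iso_idI)
  note h = sheaf_iso_idD[OF assms(1)] and k = sheaf_iso_idD[OF assms(2)]
  show "(\<lambda>s. k V (h V s)) \<in> salg_hom (salg A V) (salg C V)" if "open V" "V \<subseteq> U" for V
    using salg_hom_comp[OF h(1)[OF that] k(1)[OF that]] .
  show "bij_betw (\<lambda>s. k V (h V s)) (carrier (salg A V)) (carrier (salg C V))" if "open V" "V \<subseteq> U" for V
    using bij_betw_trans[OF h(2)[OF that] k(2)[OF that]] by (simp add: comp_def)
  show "srs C V W (k V (h V s)) = k W (h W (srs A V W s))"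
    if "open V" "open W" "W \<subseteq> V" "V \<subseteq> U" "s \<in> carrier (salg A V)" for V W s
    using h(3)[OF that] k(3)[OF that(1-4), of "h V s"] salg_homD(1)[OF h(1)[OF that(1,4)] that(5)] by simp
qed

lemma sheaf_iso_cong:
  assumes "presheaf_closed A" "sheaf_iso id U A B h"
    and e: "\<And>V s. open V \<Longrightarrow> V \<subseteq> U \<Longrightarrow> s \<in> carrier (salg A V) \<Longrightarrow> h V s = k V s"
  shows "sheaf_iso id U A B k"
proof (rule sheaf_iso_idI)
  note h = sheaf_iso_idD[OF assms(2)] and c = presheaf_closedD[OF assms(1)]
  show "k V \<in> salg_hom (salg A V) (salg B V)" if "open V" "V \<subseteq> U" for V
    by (rule salg_hom_cong[OF c(1) h(1)]) (use that e in auto)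
  show "bij_betw (k V) (carrier (salg A V)) (carrier (salg B V))" if "open V" "V \<subseteq> U" for V
    using h(2)[OF that] bij_betw_cong[of "carrier (salg A V)" "h V" "k V"] e that by blast
  show "srs B V W (k V s) = k W (srs A V W s)"
    if "open V" "open W" "W \<subseteq> V" "V \<subseteq> U" "s \<in> carrier (salg A V)" for V W s
    using h(3)[OF that] e[of V s] e[of W "srs A V W s"] c(2)[of V W s] that by auto
qed

lemma sheaf_iso_subset: "sheaf_iso id U A B h \<Longrightarrow> V \<subseteq> U \<Longrightarrow> sheaf_iso id V A B h"
  by (auto simp: sheaf_iso_def)

context bundle_model
begin

abbreviation SM where "SM \<equiv> split_model M"

lemma sections_parts:
  assumes "s \<in> sections U"
  obtains s0 s1 where "s0 \<in> part (salg SM U) False" "s1 \<in> part (salg SM U) True"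
    "s = (\<lambda>i x K. s0 i x K + s1 i x K)"
proof (rule that[of "\<lambda>i x. ext_filter even (s i x)" "\<lambda>i x. ext_filter odd (s i x)"])
  show "s = (\<lambda>i x K. ext_filter even (s i x) K + ext_filter odd (s i x) K)"
    by (auto simp: ext_filter_def fun_eq_iff)
  have f: "(\<lambda>i x. ext_filter P (s i x)) \<in> sections U" for P by (rule sections_filter[OF assms])
  show "(\<lambda>i x. ext_filter even (s i x)) \<in> part (salg SM U) False"
    "(\<lambda>i x. ext_filter odd (s i x)) \<in> part (salg SM U) True"
    unfolding split_model_simps by (intro CollectI conjI f; simp add: ext_filter_def)+
qed

lemma SM_closed: "presheaf_closed SM"
  unfolding presheaf_closed_def salg_closed_def
proof (intro conjI allI impI ballI)
  fix U :: "'x set" and p show "part (salg SM U) p \<subseteq> carrier (salg SM U)" by auto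
next
  fix U :: "'x set" and a assume "a \<in> carrier (salg SM U)"
  then have "a \<in> sections U" by simp
  then show "\<exists>b\<in>part (salg SM U) False. \<exists>c\<in>part (salg SM U) True. a = b \<oplus>\<^bsub>salg SM U\<^esub> c"
    by (rule sections_parts) (auto simp del: split_model_simps(7))
next
  fix U V :: "'x set" assume "open U \<and> open V \<and> V \<subseteq> U"
  then show "srs SM U V ` carrier (salg SM U) \<subseteq> carrier (salg SM V)"
    unfolding srs_split_model using sec_rs_sections by auto
qed (simp_all only: split_model_simps sections_mult sections_add sections_scal sections_one)

text \<open>The inverse preserves parity: if the image of a sum of an even and an odd element is
  homogeneous, then the image of the other component vanishes.\<close>
lemma salg_hom_inverse:
  assumes A: "salg_closed A" and f: "f \<in> salg_hom A (salg SM U)" and b: "bij_betw f (carrier A) (sections U)"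
  shows "inv_into (carrier A) f \<in> salg_hom (salg SM U) A"
proof -
  let ?g = "inv_into (carrier A) f"
  note c = salg_closedD[OF A] and h = salg_homD[OF f]
  have gc: "?g v \<in> carrier A" "f (?g v) = v" if "v \<in> sections U" for v
    using b that by (metis bij_betw_def inv_into_into, metis bij_betw_inv_into_right)
  have gf: "?g (f a) = a" if "a \<in> carrier A" for a
    using b that by (metis bij_betw_inv_into_left)
  show ?thesis
  proof (rule salg_homI)
    show "?g v \<in> carrier A" if "v \<in> carrier (salg SM U)" for v using gc that by simp
    show "?g (v \<otimes>\<^bsub>salg SM U\<^esub> w) = ?g v \<otimes>\<^bsub>A\<^esub> ?g w" if "v \<in> carrier (salg SM U)" "w \<in> carrier (salg SM U)" for v w
    proof -
      have vw: "v \<in> sections U" "w \<in> sections U" using that by auto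
      show ?thesis using gf[OF c(1)[OF gc(1)[OF vw(1)] gc(1)[OF vw(2)]]]
        h(2)[OF gc(1)[OF vw(1)] gc(1)[OF vw(2)]] gc(2)[OF vw(1)] gc(2)[OF vw(2)] by simp
    qed
    show "?g (v \<oplus>\<^bsub>salg SM U\<^esub> w) = ?g v \<oplus>\<^bsub>A\<^esub> ?g w" if "v \<in> carrier (salg SM U)" "w \<in> carrier (salg SM U)" for v w
    proof -
      have vw: "v \<in> sections U" "w \<in> sections U" using that by auto
      show ?thesis using gf[OF c(2)[OF gc(1)[OF vw(1)] gc(1)[OF vw(2)]]]
        h(3)[OF gc(1)[OF vw(1)] gc(1)[OF vw(2)]] gc(2)[OF vw(1)] gc(2)[OF vw(2)] by simp
    qed
    show "?g \<one>\<^bsub>salg SM U\<^esub> = \<one>\<^bsub>A\<^esub>" using gf[OF c(3)] h(4) by (simp del: split_model_simps)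
    show "?g (scal (salg SM U) r v) = scal A r (?g v)" if "v \<in> carrier (salg SM U)" for v r
    proof -
      have v: "v \<in> sections U" using that by auto
      show ?thesis using gf[OF c(4)[OF gc(1)[OF v]]] h(5)[OF gc(1)[OF v]] gc(2)[OF v] by simp
    qed
    fix v p assume v: "v \<in> part (salg SM U) p"
    then have vs: "v \<in> sections U" by simp
    obtain a0 a1 where a: "a0 \<in> part A False" "a1 \<in> part A True" "?g v = a0 \<oplus>\<^bsub>A\<^esub> a1"
      using c(6)[OF gc(1)[OF vs]] by blast
    have e: "v = (\<lambda>i x K. f a0 i x K + f a1 i x K)"
      using h(3)[OF c(5)[OF a(1)] c(5)[OF a(2)]] gc(2)[OF vs] a(3) by simp
    have f0: "odd (card K) \<Longrightarrow> f a0 i x K = 0" and f1: "even (card K) \<Longrightarrow> f a1 i x K = 0" for i x K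
      using h(6)[OF a(1)] h(6)[OF a(2)] unfolding split_model_simps by blast+
    have vp: "v i x K \<noteq> 0 \<Longrightarrow> odd (card K) = p" for i x K using v by simp
    show "?g v \<in> part A p"
    proof (cases p)
      case True
      have "f a0 i x K = 0" for i x K
        using vp[of i x K] f0[of K i x] f1[of K i x] True by (cases "odd (card K)") (auto simp: e)
      then have "v = f a1" unfolding e by (simp add: fun_eq_iff)
      then show ?thesis using a(2) gf[OF c(5)[OF a(2)]] True by simp
    next
      case False
      have "f a1 i x K = 0" for i x K
        using vp[of i x K] f0[of K i x] f1[of K i x] False by (cases "odd (card K)") (auto simp: e)
      then have "v = f a0" unfolding e by (simp add: fun_eq_iff)
      then show ?thesis using a(1) gf[OF c(5)[OF a(1)]] False by simp
    qed
  qed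
qed

lemma sheaf_iso_inverse:
  assumes A: "presheaf_closed A" and h: "sheaf_iso id U A SM h"
  shows "sheaf_iso id U SM A (\<lambda>V. inv_into (carrier (salg A V)) (h V))"
proof (rule sheaf_iso_idI)
  note h = sheaf_iso_idD[OF h] and c = presheaf_closedD[OF A]
  have b: "bij_betw (h V) (carrier (salg A V)) (sections V)" if "open V" "V \<subseteq> U" for V
    using h(2)[OF that] by simp
  show "inv_into (carrier (salg A V)) (h V) \<in> salg_hom (salg SM V) (salg A V)" if "open V" "V \<subseteq> U" for V
    by (rule salg_hom_inverse[OF c(1)[OF that(1)] h(1)[OF that] b[OF that]])
  show "bij_betw (inv_into (carrier (salg A V)) (h V)) (carrier (salg SM V)) (carrier (salg A V))"
    if "open V" "V \<subseteq> U" for V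
    using bij_betw_inv_into[OF b[OF that]] by simp
  fix V W s assume V: "open V" "open W" "W \<subseteq> V" "V \<subseteq> U" "s \<in> carrier (salg SM V)"
  have WU: "W \<subseteq> U" using V by simp
  define t where "t = inv_into (carrier (salg A V)) (h V) s"
  have t: "t \<in> carrier (salg A V)" "h V t = s"
    using b[OF V(1,4)] V(5) unfolding t_def
    by (metis bij_betw_def inv_into_into split_model_simps(1), metis bij_betw_inv_into_right split_model_simps(1))
  have "srs SM V W s = h W (srs A V W t)" using h(3)[OF V(1-4) t(1)] t(2) by simp
  moreover have "srs A V W t \<in> carrier (salg A W)" using c(2)[OF V(1-3) t(1)] .
  ultimately show "srs A V W t = inv_into (carrier (salg A W)) (h W) (srs SM V W s)"
    using bij_betw_inv_into_left[OF b[OF V(2) WU]] by metis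
qed

section \<open>The groups of automorphisms\<close>

definition opens :: "'x set \<Rightarrow> 'x set set" where
  "opens U = {V. open V \<and> V \<subseteq> U}"

text \<open>All families of bijections of the sections over the open subsets of U, under composition. The groups
  of automorphisms are subgroups of this group, so that membership is closed under composition and inverse
  is all that has to be shown for them.\<close>
definition families where
  "families U = product_group (opens U) (\<lambda>V. BijGroup (sections V))"

lemma families_group: "group (families U)"
  unfolding families_def by (rule product_group) (rule group_BijGroup)

lemma G_sheaf_grp: "grp (G_sheaf M k) U = (families U)\<lparr>carrier := G_sec M k U\<rparr>"
  by (simp add: G_sheaf_def G_sec_def families_def opens_def)

lemma G_sheaf_grs: "grs (G_sheaf M k) U V \<alpha> = restrict \<alpha> (opens V)"
  by (simp add: G_sheaf_def opens_def)

lemma G_sec_iff: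
  "\<alpha> \<in> G_sec M k U \<longleftrightarrow> \<alpha> \<in> carrier (families U) \<and> sheaf_iso id U SM SM \<alpha> \<and>
     (\<forall>V\<in>opens U. \<forall>u\<in>sections V. (\<lambda>i x K. \<alpha> V u i x K - u i x K) \<in> J_pow M k V)"
  by (auto simp: G_sheaf_def G_sec_def families_def opens_def)

lemma familiesD:
  assumes "\<alpha> \<in> carrier (families U)"
  shows "V \<in> opens U \<Longrightarrow> bij_betw (\<alpha> V) (sections V) (sections V)"
    and "V \<in> opens U \<Longrightarrow> \<alpha> V \<in> extensional (sections V)" and "\<alpha> \<in> extensional (opens U)"
proof -
  have "\<alpha> \<in> (\<Pi>\<^sub>E V\<in>opens U. Bij (sections V))" using assms by (simp add: families_def BijGroup_def)
  then show "V \<in> opens U \<Longrightarrow> bij_betw (\<alpha> V) (sections V) (sections V)"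
    "V \<in> opens U \<Longrightarrow> \<alpha> V \<in> extensional (sections V)" "\<alpha> \<in> extensional (opens U)"
    by (auto simp: Bij_def PiE_def)
qed

lemma familiesI:
  assumes "\<And>V. V \<in> opens U \<Longrightarrow> bij_betw (\<alpha> V) (sections V) (sections V)"
    and "\<And>V. V \<in> opens U \<Longrightarrow> \<alpha> V \<in> extensional (sections V)" and "\<alpha> \<in> extensional (opens U)"
  shows "\<alpha> \<in> carrier (families U)"
  using assms by (auto simp: families_def BijGroup_def Bij_def PiE_def)

lemma families_eqI:
  assumes "\<alpha> \<in> carrier (families U)" "\<beta> \<in> carrier (families U)"
    and "\<And>V u. V \<in> opens U \<Longrightarrow> u \<in> sections V \<Longrightarrow> \<alpha> V u = \<beta> V u"
  shows "\<alpha> = \<beta>"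
  by (intro extensionalityI[OF familiesD(3)[OF assms(1)] familiesD(3)[OF assms(2)]]
        extensionalityI[OF familiesD(2)[OF assms(1)] familiesD(2)[OF assms(2)]] assms(3))

lemma families_mult:
  assumes "\<alpha> \<in> carrier (families U)" "\<beta> \<in> carrier (families U)" "V \<in> opens U" "u \<in> sections V"
  shows "(\<alpha> \<otimes>\<^bsub>families U\<^esub> \<beta>) V u = \<alpha> V (\<beta> V u)"
proof -
  have "\<alpha> V \<in> Bij (sections V)" "\<beta> V \<in> Bij (sections V)"
    using familiesD[OF assms(1)] familiesD[OF assms(2)] assms(3) by (auto simp: Bij_def)
  then show ?thesis using assms(3,4) by (simp add: families_def BijGroup_def compose_def)
qed

lemma families_one: "V \<in> opens U \<Longrightarrow> u \<in> sections V \<Longrightarrow> \<one>\<^bsub>families U\<^esub> V u = u"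
  by (simp add: families_def BijGroup_def)

lemma families_inv:
  assumes "\<alpha> \<in> carrier (families U)" "V \<in> opens U" "u \<in> sections V"
  shows "(inv\<^bsub>families U\<^esub> \<alpha>) V u = inv_into (sections V) (\<alpha> V) u"
    and "(inv\<^bsub>families U\<^esub> \<alpha>) V u \<in> sections V" and "\<alpha> V ((inv\<^bsub>families U\<^esub> \<alpha>) V u) = u"
proof -
  note b = familiesD(1)[OF assms(1,2)]
  have B: "\<alpha> V \<in> Bij (sections V)" using familiesD[OF assms(1)] assms(2) by (auto simp: Bij_def)
  have "inv\<^bsub>families U\<^esub> \<alpha> = (\<lambda>V\<in>opens U. inv\<^bsub>BijGroup (sections V)\<^esub> (\<alpha> V))"
    unfolding families_def
    by (rule inv_product_group) (use assms(1) group_BijGroup in \<open>auto simp: families_def\<close>)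
  then show e: "(inv\<^bsub>families U\<^esub> \<alpha>) V u = inv_into (sections V) (\<alpha> V) u"
    using assms(2,3) inv_BijGroup[OF B] by simp
  show "(inv\<^bsub>families U\<^esub> \<alpha>) V u \<in> sections V" "\<alpha> V ((inv\<^bsub>families U\<^esub> \<alpha>) V u) = u"
    unfolding e using b assms(3) by (metis bij_betw_def inv_into_into, metis bij_betw_inv_into_right)
qed

lemma G_sec_families: "\<alpha> \<in> G_sec M k U \<Longrightarrow> \<alpha> \<in> carrier (families U)"
  by (simp add: G_sec_iff)

lemma G_sec_closed: "\<alpha> \<in> G_sec M k U \<Longrightarrow> V \<in> opens U \<Longrightarrow> u \<in> sections V \<Longrightarrow> \<alpha> V u \<in> sections V"
  using bij_betwE[OF familiesD(1)[OF G_sec_families]] by blast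

lemma G_sec_J: "\<alpha> \<in> G_sec M k U \<Longrightarrow> V \<in> opens U \<Longrightarrow> u \<in> sections V \<Longrightarrow>
    (\<lambda>i x K. \<alpha> V u i x K - u i x K) \<in> J_pow M k V"
  by (simp add: G_sec_iff)

lemma G_sec_subgroup: "subgroup (G_sec M k U) (families U)"
proof -
  interpret K: group "families U" by (rule families_group)
  show ?thesis
  proof (rule K.subgroupI)
    show "G_sec M k U \<subseteq> carrier (families U)" using G_sec_families by blast
    have "\<one>\<^bsub>families U\<^esub> \<in> G_sec M k U" unfolding G_sec_iff
    proof (intro conjI ballI)
      have "sheaf_iso id U SM SM (\<lambda>V s. s)"
        by (rule sheaf_iso_idI) (auto simp del: split_model_simps intro!: salg_homI bij_betwI[of _ _ _ "\<lambda>s. s"])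
      then show "sheaf_iso id U SM SM \<one>\<^bsub>families U\<^esub>"
        by (rule sheaf_iso_cong[OF SM_closed]) (simp add: families_one opens_def)
    qed (simp_all add: families_one J_pow_zero)
    then show "G_sec M k U \<noteq> {}" by blast
  next
    fix \<alpha> assume a: "\<alpha> \<in> G_sec M k U"
    note fa = G_sec_families[OF a]
    show "inv\<^bsub>families U\<^esub> \<alpha> \<in> G_sec M k U" unfolding G_sec_iff
    proof (intro conjI ballI)
      show "inv\<^bsub>families U\<^esub> \<alpha> \<in> carrier (families U)" using fa by simp
      have "sheaf_iso id U SM SM (\<lambda>V. inv_into (carrier (salg SM V)) (\<alpha> V))"
        by (rule sheaf_iso_inverse[OF SM_closed]) (use a in \<open>simp add: G_sec_iff\<close>)
      then show "sheaf_iso id U SM SM (inv\<^bsub>families U\<^esub> \<alpha>)"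
        by (rule sheaf_iso_cong[OF SM_closed]) (simp add: families_inv(1)[OF fa] opens_def)
      fix V u assume V: "V \<in> opens U" "u \<in> sections V"
      let ?w = "(inv\<^bsub>families U\<^esub> \<alpha>) V u"
      have "(\<lambda>i x K. \<alpha> V ?w i x K - ?w i x K) \<in> J_pow M k V"
        by (rule G_sec_J[OF a V(1) families_inv(2)[OF fa V]])
      from J_pow_scal[OF this, of "- 1"]
      show "(\<lambda>i x K. ?w i x K - u i x K) \<in> J_pow M k V" by (simp add: families_inv(3)[OF fa V])
    qed
  next
    fix \<alpha> \<beta> assume a: "\<alpha> \<in> G_sec M k U" and b: "\<beta> \<in> G_sec M k U"
    note fa = G_sec_families[OF a] and fb = G_sec_families[OF b]
    show "\<alpha> \<otimes>\<^bsub>families U\<^esub> \<beta> \<in> G_sec M k U" unfolding G_sec_iff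
    proof (intro conjI ballI)
      show "\<alpha> \<otimes>\<^bsub>families U\<^esub> \<beta> \<in> carrier (families U)" using fa fb by simp
      have "sheaf_iso id U SM SM (\<lambda>V s. \<alpha> V (\<beta> V s))"
        by (rule sheaf_iso_comp[of U SM SM \<beta> SM \<alpha>]) (use a b in \<open>simp_all only: G_sec_iff\<close>)
      then show "sheaf_iso id U SM SM (\<alpha> \<otimes>\<^bsub>families U\<^esub> \<beta>)"
        by (rule sheaf_iso_cong[OF SM_closed]) (simp add: families_mult[OF fa fb] opens_def)
      fix V u assume V: "V \<in> opens U" "u \<in> sections V"
      have "\<beta> V u \<in> sections V" using G_sec_closed[OF b V] .
      from J_pow_add[OF G_sec_J[OF a V(1) this] G_sec_J[OF b V]]
      show "(\<lambda>i x K. (\<alpha> \<otimes>\<^bsub>families U\<^esub> \<beta>) V u i x K - u i x K) \<in> J_pow M k V"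
        by (simp add: families_mult[OF fa fb V])
    qed
  qed
qed

lemma G_sec_mono: "j \<le> k \<Longrightarrow> G_sec M k U \<subseteq> G_sec M j U"
  using J_pow_mono[of j k] by (auto simp: G_sec_iff) blast

lemma opens_mono: "V \<subseteq> U \<Longrightarrow> W \<in> opens V \<Longrightarrow> W \<in> opens U"
  by (auto simp: opens_def)

lemma G_sec_rs: 
  assumes "V \<subseteq> U" "\<alpha> \<in> G_sec M k U"
  shows "restrict \<alpha> (opens V) \<in> G_sec M k V"
  unfolding G_sec_iff
proof (intro conjI ballI)
  note f = G_sec_families[OF assms(2)]
  show "restrict \<alpha> (opens V) \<in> carrier (families V)"
    by (rule familiesI) (use familiesD[OF f] opens_mono[OF assms(1)] in auto)
  have "sheaf_iso id V SM SM \<alpha>" using assms sheaf_iso_subset by (auto simp: G_sec_iff)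
  then show "sheaf_iso id V SM SM (restrict \<alpha> (opens V))"
    by (rule sheaf_iso_cong[OF SM_closed]) (simp add: opens_def)
qed (use assms G_sec_J opens_mono in auto)

lemma G_sec_hom:
  assumes a: "\<alpha> \<in> G_sec M k U" and V: "V \<in> opens U"
  shows "u \<in> sections V \<Longrightarrow> v \<in> sections V \<Longrightarrow>
      \<alpha> V (\<lambda>i x. ext_mult (u i x) (v i x)) = (\<lambda>i x. ext_mult (\<alpha> V u i x) (\<alpha> V v i x))"
    and "u \<in> sections V \<Longrightarrow> v \<in> sections V \<Longrightarrow>
      \<alpha> V (\<lambda>i x K. u i x K + v i x K) = (\<lambda>i x K. \<alpha> V u i x K + \<alpha> V v i x K)"
    and "u \<in> sections V \<Longrightarrow> \<alpha> V (\<lambda>i x K. c * u i x K) = (\<lambda>i x K. c * \<alpha> V u i x K)"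
    and "u \<in> part (salg SM V) p \<Longrightarrow> \<alpha> V u \<in> part (salg SM V) p"
    and "u \<in> sections V \<Longrightarrow> W \<in> opens V \<Longrightarrow> sec_rs W (\<alpha> V u) = \<alpha> W (sec_rs W u)"
proof -
  have s: "sheaf_iso id U SM SM \<alpha>" "open V" "V \<subseteq> U" using a V by (auto simp: G_sec_iff opens_def)
  note h = salg_homD[OF sheaf_iso_idD(1)[OF s]]
  show "u \<in> sections V \<Longrightarrow> v \<in> sections V \<Longrightarrow>
      \<alpha> V (\<lambda>i x. ext_mult (u i x) (v i x)) = (\<lambda>i x. ext_mult (\<alpha> V u i x) (\<alpha> V v i x))"
    using h(2)[of u v] by simp
  show "u \<in> sections V \<Longrightarrow> v \<in> sections V \<Longrightarrow>
      \<alpha> V (\<lambda>i x K. u i x K + v i x K) = (\<lambda>i x K. \<alpha> V u i x K + \<alpha> V v i x K)"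
    using h(3)[of u v] by simp
  show "u \<in> sections V \<Longrightarrow> \<alpha> V (\<lambda>i x K. c * u i x K) = (\<lambda>i x K. c * \<alpha> V u i x K)"
    using h(5)[of u c] by simp
  show "u \<in> part (salg SM V) p \<Longrightarrow> \<alpha> V u \<in> part (salg SM V) p" by (rule h(6))
  show "u \<in> sections V \<Longrightarrow> W \<in> opens V \<Longrightarrow> sec_rs W (\<alpha> V u) = \<alpha> W (sec_rs W u)"
    using sheaf_iso_idD(3)[OF s(1) s(2), of W u] s(3)
    unfolding srs_split_model split_model_simps(1) opens_def by blast
qed

lemma G_sec_zero: "\<alpha> \<in> G_sec M k U \<Longrightarrow> V \<in> opens U \<Longrightarrow> \<alpha> V (\<lambda>i x K. 0) = (\<lambda>i x K. 0)"
  using G_sec_hom(3)[of \<alpha> k U V "\<lambda>i x K. 0" 0] sections_zero by simp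

lemma G_sec_diff:
  assumes "\<alpha> \<in> G_sec M k U" "V \<in> opens U" "u \<in> sections V" "v \<in> sections V"
  shows "\<alpha> V (\<lambda>i x K. u i x K - v i x K) = (\<lambda>i x K. \<alpha> V u i x K - \<alpha> V v i x K)"
  using G_sec_hom(2)[OF assms(1,2,3) sections_scal[OF assms(4), of "- 1"]]
    G_sec_hom(3)[OF assms(1,2,4), of "- 1"] by simp

lemma G_sec_sum:
  assumes "\<alpha> \<in> G_sec M k U" "V \<in> opens U" "\<And>q. q \<in> F \<Longrightarrow> f q \<in> sections V"
  shows "\<alpha> V (\<lambda>i x K. \<Sum>q\<in>F. f q i x K) = (\<lambda>i x K. \<Sum>q\<in>F. \<alpha> V (f q) i x K)"
  using assms(3)
proof (induction F rule: infinite_finite_induct)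
  case (insert q F)
  have "\<alpha> V (\<lambda>i x K. f q i x K + (\<Sum>q\<in>F. f q i x K)) =
    (\<lambda>i x K. \<alpha> V (f q) i x K + \<alpha> V (\<lambda>i x K. \<Sum>q\<in>F. f q i x K) i x K)"
    by (rule G_sec_hom(2)[OF assms(1,2)]) (use insert in \<open>auto intro!: sections_sum\<close>)
  then show ?case using insert by simp
qed (simp_all add: G_sec_zero[OF assms(1,2)])

lemma part_diff:
  assumes "u \<in> part (salg SM U) p" "v \<in> part (salg SM U) p"
  shows "(\<lambda>i x K. u i x K - v i x K) \<in> part (salg SM U) p"
  unfolding split_model_simps
proof (intro CollectI conjI sections_diff allI impI)
  fix i x K assume "u i x K - v i x K \<noteq> 0"
  then have "u i x K \<noteq> 0 \<or> v i x K \<noteq> 0" by auto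
  then show "odd (card K) = p" using assms unfolding split_model_simps by blast
qed (use assms in simp_all)

text \<open>The number of indices of an odd monomial is odd, so it is at least three once it is at least two.\<close>
lemma J_odd: "s \<in> J_pow M 2 U \<Longrightarrow> s \<in> part (salg SM U) True \<Longrightarrow> s \<in> J_pow M 3 U"
proof -
  assume h: "s \<in> J_pow M 2 U" "s \<in> part (salg SM U) True"
  have "3 \<le> card K" if "s i x K \<noteq> 0" for i x K
  proof -
    have "2 \<le> card K" "odd (card K)" using h that by (auto simp: J_pow_def)
    then show ?thesis by presburger
  qed
  then show ?thesis using h(1) by (simp add: J_pow_def)
qed

text \<open>
  The key estimate. For arbitrary sections it is the definition of the group; the displacement of a
  frame element is moreover odd, so it has order three. A section of order m + 1 is a
  combination of frame elements f with coefficients w of order m, and the displacement of a product is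
  (a f - f) (a w) + f (a w - w), where both summands have order m + 3.
\<close>
lemma G_sec_raise:
  assumes a: "\<alpha> \<in> G_sec M 2 U"
  shows "V \<in> opens U \<Longrightarrow> u \<in> J_pow M m V \<Longrightarrow> (\<lambda>i x K. \<alpha> V u i x K - u i x K) \<in> J_pow M (m + 2) V"
proof (induction m arbitrary: V u)
  case 0
  have "u \<in> sections V" using 0(2) unfolding J_pow_0 .
  from G_sec_J[OF a 0(1) this] show ?case by (simp only: add_0)
next
  case (Suc m)
  note us = J_pow_sections[OF Suc.prems(2)]
  show ?case
  proof (rule J_pow_local)
    show "(\<lambda>i x K. \<alpha> V u i x K - u i x K) \<in> sections V"
      by (intro sections_diff G_sec_closed[OF a] Suc.prems us)
    fix x assume x: "x \<in> V"
    obtain i where i: "i \<in> Idx" "x \<in> D i" by (rule D_cover)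
    define W where "W = V \<inter> D i"
    have W: "W \<in> opens V" "W \<in> opens U" "W \<subseteq> D i" "W \<subseteq> V" "x \<in> W"
      using Suc.prems(1) D_open[OF i(1)] i x by (auto simp: W_def opens_def)
    define v where "v = sec_rs W u"
    have v: "v \<in> J_pow M (Suc m) W" unfolding v_def by (rule J_pow_rs[OF Suc.prems(2) W(4)])
    obtain w where w: "\<And>k. w k \<in> J_pow M m W"
      "v = (\<lambda>j x K. \<Sum>k<r. ext_mult (frame i W k j x) (w k j x) K)"
      using J_pow_Suc_expand[OF i(1) W(3) v] by blast
    note ws = J_pow_sections[OF w(1)]
    let ?f = "frame i W"
    have fs: "?f k \<in> sections W" for k by (rule frame_sections[OF i(1) W(3)])
    let ?df = "\<lambda>k i x K. \<alpha> W (?f k) i x K - ?f k i x K" and ?dw = "\<lambda>k i x K. \<alpha> W (w k) i x K - w k i x K"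
    have dw: "?dw k \<in> J_pow M (m + 2) W" for k by (rule Suc.IH[OF W(2) w(1)])
    have df: "?df k \<in> J_pow M 3 W" for k
    proof (rule J_odd[OF G_sec_J[OF a W(2) fs]])
      have "\<alpha> W (?f k) \<in> part (salg SM W) True" by (rule G_sec_hom(4)[OF a W(2) frame_odd[OF i(1) W(3)]])
      then show "?df k \<in> part (salg SM W) True"
        by (rule part_diff[OF _ frame_odd[OF i(1) W(3)]])
    qed
    have aw: "\<alpha> W (w k) \<in> J_pow M m W" for k
    proof -
      have "?dw k \<in> J_pow M m W" using dw J_pow_mono[of m "m + 2" W] by auto
      from J_pow_add[OF this w(1)[of k]] show ?thesis by simp
    qed
    have "\<alpha> W v = (\<lambda>j x K. \<Sum>k<r. \<alpha> W (\<lambda>j x. ext_mult (?f k j x) (w k j x)) j x K)"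
      unfolding w(2) by (rule G_sec_sum[OF a W(2)]) (intro sections_mult fs ws)
    also have "\<dots> = (\<lambda>j x K. \<Sum>k<r. ext_mult (\<alpha> W (?f k) j x) (\<alpha> W (w k) j x) K)"
      by (simp add: G_sec_hom(1)[OF a W(2) fs ws])
    finally have "(\<lambda>j x K. \<alpha> W v j x K - v j x K) = (\<lambda>j x K. \<Sum>k<r.
      ext_mult (?df k j x) (\<alpha> W (w k) j x) K + ext_mult (?f k j x) (?dw k j x) K)"
      unfolding w(2) ext_mult_diff_left ext_mult_diff_right by (simp add: sum_subtractf[symmetric])
    moreover have "\<dots> \<in> J_pow M (Suc m + 2) W"
    proof (intro J_pow_sum J_pow_add)
      fix k
      show "(\<lambda>j x. ext_mult (?df k j x) (\<alpha> W (w k) j x)) \<in> J_pow M (Suc m + 2) W"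
        using J_pow_mult[OF df aw, of k k] by (simp add: eval_nat_numeral)
      show "(\<lambda>j x. ext_mult (?f k j x) (?dw k j x)) \<in> J_pow M (Suc m + 2) W"
        using J_pow_mult[OF frame_J[OF i(1) W(3)] dw, of k k] by simp
    qed
    ultimately have "(\<lambda>j x K. \<alpha> W v j x K - v j x K) \<in> J_pow M (Suc m + 2) W" by simp
    moreover have "sec_rs W (\<lambda>i x K. \<alpha> V u i x K - u i x K) = (\<lambda>j x K. \<alpha> W v j x K - v j x K)"
      unfolding v_def G_sec_hom(5)[OF a Suc.prems(1) us W(1), symmetric] by (auto simp: sec_rs_def fun_eq_iff)
    ultimately show "\<exists>W. x \<in> W \<and> sec_rs W (\<lambda>i x K. \<alpha> V u i x K - u i x K) \<in> J_pow M (Suc m + 2) W"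
      by (intro exI[of _ W] conjI W(5)) simp
  qed
qed

lemma G_sec_J_pow:
  assumes "\<alpha> \<in> G_sec M 2 U" "V \<in> opens U" "u \<in> J_pow M m V"
  shows "\<alpha> V u \<in> J_pow M m V"
proof -
  have "(\<lambda>i x K. \<alpha> V u i x K - u i x K) \<in> J_pow M m V"
    using G_sec_raise[OF assms] J_pow_mono[of m "m + 2" V] by auto
  from J_pow_add[OF this assms(3)] show ?thesis by simp
qed

lemma G_sec_restrict_ident:
  assumes "\<alpha> \<in> carrier (families U)" shows "restrict \<alpha> (opens U) = \<alpha>"
  using familiesD(3)[OF assms] by (simp add: extensional_restrict)

end

section \<open>Cech cohomology of presheaves of groups\<close>

locale grp_presheaf =
  fixes F :: "('x::topological_space, 'g) grp_sheaf"
  assumes grp: "open U \<Longrightarrow> group (grp F U)"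
    and rs_closed: "open U \<Longrightarrow> open V \<Longrightarrow> V \<subseteq> U \<Longrightarrow> f \<in> carrier (grp F U) \<Longrightarrow> grs F U V f \<in> carrier (grp F V)"
    and rs_mult: "open U \<Longrightarrow> open V \<Longrightarrow> V \<subseteq> U \<Longrightarrow> f \<in> carrier (grp F U) \<Longrightarrow> g \<in> carrier (grp F U) \<Longrightarrow>
      grs F U V (f \<otimes>\<^bsub>grp F U\<^esub> g) = grs F U V f \<otimes>\<^bsub>grp F V\<^esub> grs F U V g"
    and rs_rs: "open U \<Longrightarrow> open V \<Longrightarrow> open W \<Longrightarrow> W \<subseteq> V \<Longrightarrow> V \<subseteq> U \<Longrightarrow> f \<in> carrier (grp F U) \<Longrightarrow>
      grs F V W (grs F U V f) = grs F U W f"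
    and rs_id: "open U \<Longrightarrow> f \<in> carrier (grp F U) \<Longrightarrow> grs F U U f = f"
begin

lemma mult_closed: "open U \<Longrightarrow> f \<in> carrier (grp F U) \<Longrightarrow> g \<in> carrier (grp F U) \<Longrightarrow>
    f \<otimes>\<^bsub>grp F U\<^esub> g \<in> carrier (grp F U)"
  using grp group.is_monoid monoid.m_closed by metis

lemma one_closed: "open U \<Longrightarrow> \<one>\<^bsub>grp F U\<^esub> \<in> carrier (grp F U)"
  using grp group.is_monoid monoid.one_closed by metis

lemma inv_closed: "open U \<Longrightarrow> f \<in> carrier (grp F U) \<Longrightarrow> inv\<^bsub>grp F U\<^esub> f \<in> carrier (grp F U)"
  using grp group.inv_closed by metis

lemma rs_hom: "open U \<Longrightarrow> open V \<Longrightarrow> V \<subseteq> U \<Longrightarrow> group_hom (grp F U) (grp F V) (grs F U V)"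
  by (simp add: group_hom_def group_hom_axioms_def hom_def grp rs_closed rs_mult)

lemma rs_one: "open U \<Longrightarrow> open V \<Longrightarrow> V \<subseteq> U \<Longrightarrow> grs F U V \<one>\<^bsub>grp F U\<^esub> = \<one>\<^bsub>grp F V\<^esub>"
  using rs_hom group_hom.hom_one by metis

lemma rs_inv: "open U \<Longrightarrow> open V \<Longrightarrow> V \<subseteq> U \<Longrightarrow> f \<in> carrier (grp F U) \<Longrightarrow>
    grs F U V (inv\<^bsub>grp F U\<^esub> f) = inv\<^bsub>grp F V\<^esub> (grs F U V f)"
  using rs_hom group_hom.hom_inv by metis

lemma rs_eq:
  assumes eq: "grs F A Y a \<otimes>\<^bsub>grp F Y\<^esub> grs F B Y b = grs F C Y c \<otimes>\<^bsub>grp F Y\<^esub> grs F D Y d"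
    and "open A" "open B" "open C" "open D" "open Y" "open Z" "Z \<subseteq> Y"
    and "Y \<subseteq> A" "Y \<subseteq> B" "Y \<subseteq> C" "Y \<subseteq> D"
    and "a \<in> carrier (grp F A)" "b \<in> carrier (grp F B)" "c \<in> carrier (grp F C)" "d \<in> carrier (grp F D)"
  shows "grs F A Z a \<otimes>\<^bsub>grp F Z\<^esub> grs F B Z b = grs F C Z c \<otimes>\<^bsub>grp F Z\<^esub> grs F D Z d"
proof -
  have "grs F Y Z (grs F A Y a \<otimes>\<^bsub>grp F Y\<^esub> grs F B Y b) = grs F Y Z (grs F C Y c \<otimes>\<^bsub>grp F Y\<^esub> grs F D Y d)"
    by (simp add: eq)
  then show ?thesis using assms(2-) by (simp add: rs_mult rs_closed rs_rs)
qed

lemma Z1_open: "(\<U>, g) \<in> Z1 F \<Longrightarrow> U \<in> \<U> \<Longrightarrow> open U"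
  by (auto simp: Z1_def open_cover_def)

lemma Z1_closed: "(\<U>, g) \<in> Z1 F \<Longrightarrow> U \<in> \<U> \<Longrightarrow> V \<in> \<U> \<Longrightarrow> g U V \<in> carrier (grp F (U \<inter> V))"
  by (auto simp: Z1_def)

lemma Z1_cocycle:
  assumes Z: "(\<U>, g) \<in> Z1 F" and "U \<in> \<U>" "V \<in> \<U>" "W \<in> \<U>" and "open Y" "Y \<subseteq> U \<inter> V \<inter> W"
  shows "grs F (U \<inter> V) Y (g U V) \<otimes>\<^bsub>grp F Y\<^esub> grs F (V \<inter> W) Y (g V W) = grs F (U \<inter> W) Y (g U W)"
proof -
  note op = Z1_open[OF Z assms(2)] Z1_open[OF Z assms(3)] Z1_open[OF Z assms(4)]
  note cl = Z1_closed[OF Z assms(2,3)] Z1_closed[OF Z assms(3,4)] Z1_closed[OF Z assms(2,4)]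
  let ?I = "U \<inter> V \<inter> W"
  have "grs F (U \<inter> V) ?I (g U V) \<otimes>\<^bsub>grp F ?I\<^esub> grs F (V \<inter> W) ?I (g V W) = grs F (U \<inter> W) ?I (g U W)"
    using Z assms(2-4) by (auto simp: Z1_def)
  then have "grs F ?I Y (grs F (U \<inter> V) ?I (g U V) \<otimes>\<^bsub>grp F ?I\<^esub> grs F (V \<inter> W) ?I (g V W)) =
      grs F ?I Y (grs F (U \<inter> W) ?I (g U W))" by simp
  moreover have "?I \<subseteq> U \<inter> V" "?I \<subseteq> V \<inter> W" "?I \<subseteq> U \<inter> W" by auto
  ultimately show ?thesis using op cl assms(5,6)
    by (simp add: rs_mult rs_closed rs_rs open_Int)
qed

lemma Z1I:
  assumes "open_cover \<U>" "\<And>U V. U \<in> \<U> \<Longrightarrow> V \<in> \<U> \<Longrightarrow> g U V \<in> carrier (grp F (U \<inter> V))"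
    and "\<And>U V W. U \<in> \<U> \<Longrightarrow> V \<in> \<U> \<Longrightarrow> W \<in> \<U> \<Longrightarrow> grs F (U \<inter> V) (U \<inter> V \<inter> W) (g U V) \<otimes>\<^bsub>grp F (U \<inter> V \<inter> W)\<^esub>
        grs F (V \<inter> W) (U \<inter> V \<inter> W) (g V W) = grs F (U \<inter> W) (U \<inter> V \<inter> W) (g U W)"
  shows "(\<U>, g) \<in> Z1 F"
  using assms by (auto simp: Z1_def)

lemma Z1_base: "({UNIV}, \<lambda>U V. \<one>\<^bsub>grp F UNIV\<^esub>) \<in> Z1 F"
proof (rule Z1I)
  have "\<one>\<^bsub>grp F UNIV\<^esub> \<otimes>\<^bsub>grp F UNIV\<^esub> \<one>\<^bsub>grp F UNIV\<^esub> = \<one>\<^bsub>grp F UNIV\<^esub>"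
    by (simp add: grp group.is_monoid monoid.l_one one_closed)
  then show "grs F (U \<inter> V) (U \<inter> V \<inter> W) \<one>\<^bsub>grp F UNIV\<^esub> \<otimes>\<^bsub>grp F (U \<inter> V \<inter> W)\<^esub>
        grs F (V \<inter> W) (U \<inter> V \<inter> W) \<one>\<^bsub>grp F UNIV\<^esub> = grs F (U \<inter> W) (U \<inter> V \<inter> W) \<one>\<^bsub>grp F UNIV\<^esub>"
    if "U \<in> {UNIV}" "V \<in> {UNIV}" "W \<in> {UNIV}" for U V W
    using that by (simp add: rs_one)
qed (auto simp: open_cover_def one_closed)

lemma H1_relI:
  assumes "(\<U>, g) \<in> Z1 F" "(\<V>, h) \<in> Z1 F" "open_cover \<W>"
    and "\<And>W. W \<in> \<W> \<Longrightarrow> \<tau> W \<in> \<U> \<and> W \<subseteq> \<tau> W \<and> \<sigma> W \<in> \<V> \<and> W \<subseteq> \<sigma> W \<and> l W \<in> carrier (grp F W)"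
    and "\<And>W W'. W \<in> \<W> \<Longrightarrow> W' \<in> \<W> \<Longrightarrow>
          grs F (\<tau> W \<inter> \<tau> W') (W \<inter> W') (g (\<tau> W) (\<tau> W')) \<otimes>\<^bsub>grp F (W \<inter> W')\<^esub>
          grs F W' (W \<inter> W') (l W') =
          grs F W (W \<inter> W') (l W) \<otimes>\<^bsub>grp F (W \<inter> W')\<^esub>
          grs F (\<sigma> W \<inter> \<sigma> W') (W \<inter> W') (h (\<sigma> W) (\<sigma> W'))"
  shows "((\<U>, g), (\<V>, h)) \<in> H1_rel F"
  unfolding H1_rel_def using assms by blast

text \<open>A witness of a relation between two cocycles, with the relation stated on all smaller
  open sets at once.\<close>
definition H1_link where
  "H1_link \<U> g \<V> h \<W> \<tau> \<sigma> l \<longleftrightarrow> open_cover \<W> \<and>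
    (\<forall>W\<in>\<W>. open W \<and> \<tau> W \<in> \<U> \<and> W \<subseteq> \<tau> W \<and> \<sigma> W \<in> \<V> \<and> W \<subseteq> \<sigma> W \<and> l W \<in> carrier (grp F W)) \<and>
    (\<forall>W W' Y. W \<in> \<W> \<longrightarrow> W' \<in> \<W> \<longrightarrow> open Y \<longrightarrow> Y \<subseteq> W \<inter> W' \<longrightarrow>
          grs F (\<tau> W \<inter> \<tau> W') Y (g (\<tau> W) (\<tau> W')) \<otimes>\<^bsub>grp F Y\<^esub> grs F W' Y (l W') =
          grs F W Y (l W) \<otimes>\<^bsub>grp F Y\<^esub> grs F (\<sigma> W \<inter> \<sigma> W') Y (h (\<sigma> W) (\<sigma> W')))"

lemma H1_link_cover: "H1_link \<U> g \<V> h \<W> \<tau> \<sigma> l \<Longrightarrow> open_cover \<W>"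
  by (simp add: H1_link_def)

lemma H1_link_mem: "H1_link \<U> g \<V> h \<W> \<tau> \<sigma> l \<Longrightarrow> W \<in> \<W> \<Longrightarrow>
    open W \<and> \<tau> W \<in> \<U> \<and> W \<subseteq> \<tau> W \<and> \<sigma> W \<in> \<V> \<and> W \<subseteq> \<sigma> W \<and> l W \<in> carrier (grp F W)"
  by (simp add: H1_link_def)

lemma H1_link_eq: "H1_link \<U> g \<V> h \<W> \<tau> \<sigma> l \<Longrightarrow> W \<in> \<W> \<Longrightarrow> W' \<in> \<W> \<Longrightarrow> open Y \<Longrightarrow> Y \<subseteq> W \<inter> W' \<Longrightarrow>
          grs F (\<tau> W \<inter> \<tau> W') Y (g (\<tau> W) (\<tau> W')) \<otimes>\<^bsub>grp F Y\<^esub> grs F W' Y (l W') =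
          grs F W Y (l W) \<otimes>\<^bsub>grp F Y\<^esub> grs F (\<sigma> W \<inter> \<sigma> W') Y (h (\<sigma> W) (\<sigma> W'))"
  by (simp add: H1_link_def)

lemma H1_rel_Z1: "((\<U>, g), (\<V>, h)) \<in> H1_rel F \<Longrightarrow> (\<U>, g) \<in> Z1 F"
  "((\<U>, g), (\<V>, h)) \<in> H1_rel F \<Longrightarrow> (\<V>, h) \<in> Z1 F"
  by (simp_all add: H1_rel_def)

lemma H1_rel_link:
  assumes "((\<U>, g), (\<V>, h)) \<in> H1_rel F"
  shows "\<exists>\<W> \<tau> \<sigma> l. H1_link \<U> g \<V> h \<W> \<tau> \<sigma> l"
  using assms unfolding H1_rel_def mem_Collect_eq case_prod_conv
proof (elim exE conjE)
  fix \<W> \<tau> \<sigma> l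
  assume *: "(\<U>, g) \<in> Z1 F" "(\<V>, h) \<in> Z1 F" "open_cover \<W>"
    and mem: "\<forall>W\<in>\<W>. \<tau> W \<in> \<U> \<and> W \<subseteq> \<tau> W \<and> \<sigma> W \<in> \<V> \<and> W \<subseteq> \<sigma> W \<and> l W \<in> carrier (grp F W)"
    and eq: "\<forall>W\<in>\<W>. \<forall>W'\<in>\<W>.
          grs F (\<tau> W \<inter> \<tau> W') (W \<inter> W') (g (\<tau> W) (\<tau> W')) \<otimes>\<^bsub>grp F (W \<inter> W')\<^esub>
          grs F W' (W \<inter> W') (l W') =
          grs F W (W \<inter> W') (l W) \<otimes>\<^bsub>grp F (W \<inter> W')\<^esub>
          grs F (\<sigma> W \<inter> \<sigma> W') (W \<inter> W') (h (\<sigma> W) (\<sigma> W'))"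
  have op: "open W" if "W \<in> \<W>" for W using *(3) that by (auto simp: open_cover_def)
  have "H1_link \<U> g \<V> h \<W> \<tau> \<sigma> l"
    unfolding H1_link_def
  proof (intro conjI ballI allI impI)
    fix W W' Y assume W: "W \<in> \<W>" "W' \<in> \<W>" and Y: "open Y" "Y \<subseteq> W \<inter> W'"
    note t = bspec[OF mem W(1)] bspec[OF mem W(2)]
    have opn: "open (\<tau> W)" "open (\<tau> W')" "open (\<sigma> W)" "open (\<sigma> W')"
      using t Z1_open[OF *(1)] Z1_open[OF *(2)] by blast+
    have cl: "g (\<tau> W) (\<tau> W') \<in> carrier (grp F (\<tau> W \<inter> \<tau> W'))"
      "h (\<sigma> W) (\<sigma> W') \<in> carrier (grp F (\<sigma> W \<inter> \<sigma> W'))"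
      using t Z1_closed[OF *(1)] Z1_closed[OF *(2)] by blast+
    have sub: "W \<inter> W' \<subseteq> \<tau> W" "W \<inter> W' \<subseteq> \<tau> W'" "W \<inter> W' \<subseteq> \<sigma> W" "W \<inter> W' \<subseteq> \<sigma> W'"
      using t by blast+
    show "grs F (\<tau> W \<inter> \<tau> W') Y (g (\<tau> W) (\<tau> W')) \<otimes>\<^bsub>grp F Y\<^esub> grs F W' Y (l W') =
          grs F W Y (l W) \<otimes>\<^bsub>grp F Y\<^esub> grs F (\<sigma> W \<inter> \<sigma> W') Y (h (\<sigma> W) (\<sigma> W'))"
      by (rule rs_eq[OF bspec[OF bspec[OF eq W(1)] W(2)]])
         (use opn cl sub t op W Y in \<open>simp_all add: open_Int\<close>)
  qed (use * mem op in auto)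
  then show ?thesis by blast
qed

text \<open>The form in which representatives are changed below: with l a system of local lifts, it removes a
  trivial obstruction; with l trivial, it refines the cover; with g trivial, it yields coboundaries.\<close>
lemma H1_rel_refine:
  assumes Z: "(\<U>, g) \<in> Z1 F" and c: "open_cover \<W>"
    and t: "\<And>W. W \<in> \<W> \<Longrightarrow> \<tau> W \<in> \<U> \<and> W \<subseteq> \<tau> W \<and> l W \<in> carrier (grp F W)"
    and h: "\<And>W W'. W \<in> \<W> \<Longrightarrow> W' \<in> \<W> \<Longrightarrow> h W W' = inv\<^bsub>grp F (W \<inter> W')\<^esub> (grs F W (W \<inter> W') (l W)) \<otimes>\<^bsub>grp F (W \<inter> W')\<^esub>
       grs F (\<tau> W \<inter> \<tau> W') (W \<inter> W') (g (\<tau> W) (\<tau> W')) \<otimes>\<^bsub>grp F (W \<inter> W')\<^esub> grs F W' (W \<inter> W') (l W')"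
  shows "((\<U>, g), (\<W>, h)) \<in> H1_rel F"
proof -
  have op: "open W" if "W \<in> \<W>" for W using c that by (auto simp: open_cover_def)
  have opt: "open (\<tau> W)" if "W \<in> \<W>" for W using t[OF that] Z1_open[OF Z] by blast
  have gc: "g (\<tau> W) (\<tau> W') \<in> carrier (grp F (\<tau> W \<inter> \<tau> W'))" if "W \<in> \<W>" "W' \<in> \<W>" for W W'
    using that t Z1_closed[OF Z] by blast
  have g_rs: "grs F (\<tau> W \<inter> \<tau> W') Y (g (\<tau> W) (\<tau> W')) \<in> carrier (grp F Y)"
    if "W \<in> \<W>" "W' \<in> \<W>" "open Y" "Y \<subseteq> W \<inter> W'" for W W' Y
    by (rule rs_closed[OF _ _ _ gc]) (use that t[OF that(1)] t[OF that(2)] opt in auto)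
  have l_rs: "grs F W Y (l W) \<in> carrier (grp F Y)" if "W \<in> \<W>" "open Y" "Y \<subseteq> W" for W Y
    using that t op rs_closed by blast
  have cl: "h W W' \<in> carrier (grp F (W \<inter> W'))" if "W \<in> \<W>" "W' \<in> \<W>" for W W'
    unfolding h[OF that] using that op
    by (intro mult_closed inv_closed l_rs g_rs) auto
  have h_rs: "grs F (W \<inter> W') Y (h W W') = inv\<^bsub>grp F Y\<^esub> (grs F W Y (l W)) \<otimes>\<^bsub>grp F Y\<^esub>
      grs F (\<tau> W \<inter> \<tau> W') Y (g (\<tau> W) (\<tau> W')) \<otimes>\<^bsub>grp F Y\<^esub> grs F W' Y (l W')"
    if w: "W \<in> \<W>" "W' \<in> \<W>" and Y: "open Y" "Y \<subseteq> W \<inter> W'" for W W' Y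
  proof -
    have sub: "W \<inter> W' \<subseteq> \<tau> W \<inter> \<tau> W'" "W \<inter> W' \<subseteq> W" "W \<inter> W' \<subseteq> W'" using t w by auto
    have l: "l W \<in> carrier (grp F W)" "l W' \<in> carrier (grp F W')" using t w by auto
    show ?thesis unfolding h[OF w]
      using op[OF w(1)] op[OF w(2)] opt[OF w(1)] opt[OF w(2)] gc[OF w] l sub Y
      by (simp add: rs_mult mult_closed inv_closed rs_closed rs_inv rs_rs open_Int)
  qed
  have Zh: "(\<W>, h) \<in> Z1 F"
  proof (rule Z1I[OF c cl])
    fix A B C assume w: "A \<in> \<W>" "B \<in> \<W>" "C \<in> \<W>"
    let ?I = "A \<inter> B \<inter> C"
    have opI: "open ?I" using op w by auto
    interpret K: group "grp F ?I" using grp opI .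
    have sub: "?I \<subseteq> A \<inter> B" "?I \<subseteq> B \<inter> C" "?I \<subseteq> A \<inter> C" "?I \<subseteq> A" "?I \<subseteq> B" "?I \<subseteq> C" by auto
    have coc: "grs F (\<tau> A \<inter> \<tau> B) ?I (g (\<tau> A) (\<tau> B)) \<otimes>\<^bsub>grp F ?I\<^esub> grs F (\<tau> B \<inter> \<tau> C) ?I (g (\<tau> B) (\<tau> C))
       = grs F (\<tau> A \<inter> \<tau> C) ?I (g (\<tau> A) (\<tau> C))"
      by (rule Z1_cocycle[OF Z]) (use t w opI in auto)
    note lc = l_rs[OF w(1) opI sub(4)] l_rs[OF w(2) opI sub(5)] l_rs[OF w(3) opI sub(6)]
    note gcc = g_rs[OF w(1,2) opI sub(1)] g_rs[OF w(2,3) opI sub(2)] g_rs[OF w(1,3) opI sub(3)]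
    have "\<And>a b c x y. a \<in> carrier (grp F ?I) \<Longrightarrow> b \<in> carrier (grp F ?I) \<Longrightarrow> c \<in> carrier (grp F ?I) \<Longrightarrow>
      x \<in> carrier (grp F ?I) \<Longrightarrow> y \<in> carrier (grp F ?I) \<Longrightarrow>
      (inv\<^bsub>grp F ?I\<^esub> a \<otimes>\<^bsub>grp F ?I\<^esub> x \<otimes>\<^bsub>grp F ?I\<^esub> b) \<otimes>\<^bsub>grp F ?I\<^esub> (inv\<^bsub>grp F ?I\<^esub> b \<otimes>\<^bsub>grp F ?I\<^esub> y \<otimes>\<^bsub>grp F ?I\<^esub> c)
       = inv\<^bsub>grp F ?I\<^esub> a \<otimes>\<^bsub>grp F ?I\<^esub> (x \<otimes>\<^bsub>grp F ?I\<^esub> y) \<otimes>\<^bsub>grp F ?I\<^esub> c"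
    proof -
      fix a b c x y assume [simp]: "a \<in> carrier (grp F ?I)" "b \<in> carrier (grp F ?I)" "c \<in> carrier (grp F ?I)"
        "x \<in> carrier (grp F ?I)" "y \<in> carrier (grp F ?I)"
      have "b \<otimes>\<^bsub>grp F ?I\<^esub> (inv\<^bsub>grp F ?I\<^esub> b \<otimes>\<^bsub>grp F ?I\<^esub> z) = z" if "z \<in> carrier (grp F ?I)" for z
        using that by (simp add: K.m_assoc[symmetric])
      then show "(inv\<^bsub>grp F ?I\<^esub> a \<otimes>\<^bsub>grp F ?I\<^esub> x \<otimes>\<^bsub>grp F ?I\<^esub> b) \<otimes>\<^bsub>grp F ?I\<^esub> (inv\<^bsub>grp F ?I\<^esub> b \<otimes>\<^bsub>grp F ?I\<^esub> y \<otimes>\<^bsub>grp F ?I\<^esub> c)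
       = inv\<^bsub>grp F ?I\<^esub> a \<otimes>\<^bsub>grp F ?I\<^esub> (x \<otimes>\<^bsub>grp F ?I\<^esub> y) \<otimes>\<^bsub>grp F ?I\<^esub> c"
        by (simp add: K.m_assoc)
    qed
    from this[OF lc gcc(1,2)] coc
    show "grs F (A \<inter> B) ?I (h A B) \<otimes>\<^bsub>grp F ?I\<^esub> grs F (B \<inter> C) ?I (h B C) = grs F (A \<inter> C) ?I (h A C)"
      by (simp add: h_rs[OF w(1,2) opI sub(1)] h_rs[OF w(2,3) opI sub(2)] h_rs[OF w(1,3) opI sub(3)])
  qed
  show ?thesis
  proof (rule H1_relI[OF Z Zh c, of \<tau> "\<lambda>W. W" l])
    show "\<tau> W \<in> \<U> \<and> W \<subseteq> \<tau> W \<and> W \<in> \<W> \<and> W \<subseteq> W \<and> l W \<in> carrier (grp F W)" if "W \<in> \<W>" for W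
      using t that by blast
    fix A B assume w: "A \<in> \<W>" "B \<in> \<W>"
    let ?I = "A \<inter> B"
    have opI: "open ?I" using op w by auto
    interpret K: group "grp F ?I" using grp opI .
    have "h A B \<in> carrier (grp F ?I)" by (rule cl[OF w])
    then have "grs F ?I ?I (h A B) = h A B" using opI rs_id by blast
    moreover have "grs F A ?I (l A) \<in> carrier (grp F ?I)" "grs F B ?I (l B) \<in> carrier (grp F ?I)"
      "grs F (\<tau> A \<inter> \<tau> B) ?I (g (\<tau> A) (\<tau> B)) \<in> carrier (grp F ?I)"
      using l_rs[OF w(1) opI] l_rs[OF w(2) opI] g_rs[OF w opI] by auto
    moreover from this have "grs F A ?I (l A) \<otimes>\<^bsub>grp F ?I\<^esub> (inv\<^bsub>grp F ?I\<^esub> (grs F A ?I (l A)) \<otimes>\<^bsub>grp F ?I\<^esub>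
       grs F (\<tau> A \<inter> \<tau> B) ?I (g (\<tau> A) (\<tau> B)) \<otimes>\<^bsub>grp F ?I\<^esub> grs F B ?I (l B)) =
       grs F (\<tau> A \<inter> \<tau> B) ?I (g (\<tau> A) (\<tau> B)) \<otimes>\<^bsub>grp F ?I\<^esub> grs F B ?I (l B)"
      by (simp add: K.m_assoc[symmetric])
    ultimately show "grs F (\<tau> A \<inter> \<tau> B) ?I (g (\<tau> A) (\<tau> B)) \<otimes>\<^bsub>grp F ?I\<^esub> grs F B ?I (l B) =
       grs F A ?I (l A) \<otimes>\<^bsub>grp F ?I\<^esub> grs F ?I ?I (h A B)"
      by (simp add: h[OF w])
  qed
qed

lemma H1_rel_refl: "c \<in> Z1 F \<Longrightarrow> (c, c) \<in> H1_rel F"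
proof -
  assume "c \<in> Z1 F"
  moreover obtain \<U> g where [simp]: "c = (\<U>, g)" by (cases c)
  ultimately have Z: "(\<U>, g) \<in> Z1 F" by simp
  have c: "open_cover \<U>" using Z by (simp add: Z1_def)
  show ?thesis
  proof (simp, rule H1_rel_refine[OF Z c, of "\<lambda>U. U" "\<lambda>U. \<one>\<^bsub>grp F U\<^esub>"])
    show "W \<in> \<U> \<and> W \<subseteq> W \<and> \<one>\<^bsub>grp F W\<^esub> \<in> carrier (grp F W)" if "W \<in> \<U>" for W
      using that Z1_open[OF Z] one_closed by blast
    fix A B assume w: "A \<in> \<U>" "B \<in> \<U>"
    then have op: "open A" "open B" "open (A \<inter> B)" using Z1_open[OF Z] by auto
    interpret K: group "grp F (A \<inter> B)" using grp op(3) .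
    show "g A B = inv\<^bsub>grp F (A \<inter> B)\<^esub> grs F A (A \<inter> B) \<one>\<^bsub>grp F A\<^esub> \<otimes>\<^bsub>grp F (A \<inter> B)\<^esub>
       grs F (A \<inter> B) (A \<inter> B) (g A B) \<otimes>\<^bsub>grp F (A \<inter> B)\<^esub> grs F B (A \<inter> B) \<one>\<^bsub>grp F B\<^esub>"
      using op Z1_closed[OF Z w] by (simp add: rs_one rs_id)
  qed
qed

lemma H1_rel_sym:
  assumes "(c, d) \<in> H1_rel F"
  shows "(d, c) \<in> H1_rel F"
proof -
  obtain \<U> g \<V> h where [simp]: "c = (\<U>, g)" "d = (\<V>, h)" by (cases c, cases d)
  from assms have r: "((\<U>, g), (\<V>, h)) \<in> H1_rel F" by simp
  from H1_rel_link[OF r] obtain \<W> \<tau> \<sigma> l where L: "H1_link \<U> g \<V> h \<W> \<tau> \<sigma> l" by blast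
  note * = H1_rel_Z1[OF r] H1_link_cover[OF L] H1_link_mem[OF L] H1_link_eq[OF L]
  have "((\<V>, h), (\<U>, g)) \<in> H1_rel F"
  proof (rule H1_relI[OF *(2,1,3), of \<sigma> \<tau> "\<lambda>W. inv\<^bsub>grp F W\<^esub> (l W)"])
    show "\<sigma> W \<in> \<V> \<and> W \<subseteq> \<sigma> W \<and> \<tau> W \<in> \<U> \<and> W \<subseteq> \<tau> W \<and> inv\<^bsub>grp F W\<^esub> (l W) \<in> carrier (grp F W)"
      if "W \<in> \<W>" for W using *(4)[OF that] inv_closed by blast
    fix A B assume w: "A \<in> \<W>" "B \<in> \<W>"
    let ?I = "A \<inter> B"
    note t = *(4)[OF w(1)] *(4)[OF w(2)]
    have opI: "open ?I" using t by auto
    interpret K: group "grp F ?I" using grp opI .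
    have l: "grs F A ?I (l A) \<in> carrier (grp F ?I)" "grs F B ?I (l B) \<in> carrier (grp F ?I)"
      using t opI rs_closed by auto
    have gh: "grs F (\<tau> A \<inter> \<tau> B) ?I (g (\<tau> A) (\<tau> B)) \<in> carrier (grp F ?I)"
      "grs F (\<sigma> A \<inter> \<sigma> B) ?I (h (\<sigma> A) (\<sigma> B)) \<in> carrier (grp F ?I)"
      by (rule rs_closed; use t opI Z1_open[OF *(1)] Z1_open[OF *(2)] Z1_closed[OF *(1)] Z1_closed[OF *(2)] in auto)+
    have alg: "\<And>a b x y. a \<in> carrier (grp F ?I) \<Longrightarrow> b \<in> carrier (grp F ?I) \<Longrightarrow> x \<in> carrier (grp F ?I) \<Longrightarrow>
      y \<in> carrier (grp F ?I) \<Longrightarrow> x \<otimes>\<^bsub>grp F ?I\<^esub> b = a \<otimes>\<^bsub>grp F ?I\<^esub> y \<Longrightarrow>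
      y \<otimes>\<^bsub>grp F ?I\<^esub> inv\<^bsub>grp F ?I\<^esub> b = inv\<^bsub>grp F ?I\<^esub> a \<otimes>\<^bsub>grp F ?I\<^esub> x"
      by (metis K.inv_closed K.inv_solve_left K.inv_solve_right K.m_assoc K.m_closed)
    show "grs F (\<sigma> A \<inter> \<sigma> B) ?I (h (\<sigma> A) (\<sigma> B)) \<otimes>\<^bsub>grp F ?I\<^esub> grs F B ?I (inv\<^bsub>grp F B\<^esub> (l B)) =
       grs F A ?I (inv\<^bsub>grp F A\<^esub> (l A)) \<otimes>\<^bsub>grp F ?I\<^esub> grs F (\<tau> A \<inter> \<tau> B) ?I (g (\<tau> A) (\<tau> B))"
      using alg[OF l gh *(5)[OF w opI order_refl]] t opI by (simp add: rs_inv)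
  qed
  then show ?thesis by simp
qed

lemma common_refinement:
  assumes "open_cover \<A>" "open_cover \<B>"
  obtains \<C> p q where "open_cover \<C>" "\<And>C. C \<in> \<C> \<Longrightarrow> open C \<and> p C \<in> \<A> \<and> q C \<in> \<B> \<and> C \<subseteq> p C \<and> C \<subseteq> q C"
proof -
  define \<C> where "\<C> = {C. \<exists>A\<in>\<A>. \<exists>B\<in>\<B>. C = A \<inter> B}"
  have "\<forall>C\<in>\<C>. \<exists>p q. p \<in> \<A> \<and> q \<in> \<B> \<and> C = p \<inter> q" by (auto simp: \<C>_def)
  then obtain p q where pq: "\<And>C. C \<in> \<C> \<Longrightarrow> p C \<in> \<A> \<and> q C \<in> \<B> \<and> C = p C \<inter> q C" by metis
  have "open_cover \<C>" unfolding open_cover_def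
  proof
    show "\<forall>C\<in>\<C>. open C" using assms by (auto simp: \<C>_def open_cover_def)
    have "\<exists>C\<in>\<C>. x \<in> C" for x
    proof -
      have "x \<in> \<Union>\<A>" "x \<in> \<Union>\<B>" using assms unfolding open_cover_def by auto
      then show ?thesis unfolding \<C>_def by blast
    qed
    then show "\<Union>\<C> = UNIV" by blast
  qed
  moreover have "open C \<and> p C \<in> \<A> \<and> q C \<in> \<B> \<and> C \<subseteq> p C \<and> C \<subseteq> q C" if "C \<in> \<C>" for C
    using pq[OF that] assms that unfolding open_cover_def by (metis inf_le1 inf_le2 open_Int)
  ultimately show ?thesis using that by blast
qed

text \<open>
  On a common refinement of the two covers that witness the relations, the two maps to the middle
  cover differ; the middle cocycle itself supplies the correction between them.
\<close>
lemma H1_rel_trans: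
  assumes "(c, d) \<in> H1_rel F" "(d, e) \<in> H1_rel F"
  shows "(c, e) \<in> H1_rel F"
proof -
  obtain \<U> g \<V> h \<S> k where [simp]: "c = (\<U>, g)" "d = (\<V>, h)" "e = (\<S>, k)" by (cases c, cases d, cases e)
  from assms have r: "((\<U>, g), (\<V>, h)) \<in> H1_rel F" "((\<V>, h), (\<S>, k)) \<in> H1_rel F" by simp_all
  from H1_rel_link[OF r(1)] obtain \<A> \<tau> \<sigma> l where L: "H1_link \<U> g \<V> h \<A> \<tau> \<sigma> l" by blast
  note 1 = H1_rel_Z1[OF r(1)] H1_link_cover[OF L] H1_link_mem[OF L] H1_link_eq[OF L]
  from H1_rel_link[OF r(2)] obtain \<B> \<tau>' \<sigma>' l' where L': "H1_link \<V> h \<S> k \<B> \<tau>' \<sigma>' l'" by blast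
  note 2 = H1_rel_Z1[OF r(2)] H1_link_cover[OF L'] H1_link_mem[OF L'] H1_link_eq[OF L']
  obtain \<C> p q where C: "open_cover \<C>"
    "\<And>C. C \<in> \<C> \<Longrightarrow> open C \<and> p C \<in> \<A> \<and> q C \<in> \<B> \<and> C \<subseteq> p C \<and> C \<subseteq> q C"
    using common_refinement[OF 1(3) 2(3)] by blast
  have P: "open C \<and> open (p C) \<and> open (q C) \<and> C \<subseteq> p C \<and> C \<subseteq> q C \<and> C \<subseteq> \<tau> (p C) \<and> C \<subseteq> \<sigma> (p C) \<and>
     C \<subseteq> \<tau>' (q C) \<and> C \<subseteq> \<sigma>' (q C) \<and> \<tau> (p C) \<in> \<U> \<and> \<sigma> (p C) \<in> \<V> \<and> \<tau>' (q C) \<in> \<V> \<and> \<sigma>' (q C) \<in> \<S> \<and>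
     l (p C) \<in> carrier (grp F (p C)) \<and> l' (q C) \<in> carrier (grp F (q C))" if "C \<in> \<C>" for C
    using C(2)[OF that] 1(4)[of "p C"] 2(4)[of "q C"] by (meson subset_trans)
  define m where "m C = grs F (p C) C (l (p C)) \<otimes>\<^bsub>grp F C\<^esub>
     grs F (\<sigma> (p C) \<inter> \<tau>' (q C)) C (h (\<sigma> (p C)) (\<tau>' (q C))) \<otimes>\<^bsub>grp F C\<^esub> grs F (q C) C (l' (q C))" for C
  have h_rs: "grs F (A \<inter> B) Y (h A B) \<in> carrier (grp F Y)" if "A \<in> \<V>" "B \<in> \<V>" "open Y" "Y \<subseteq> A" "Y \<subseteq> B" for A B Y
    by (rule rs_closed) (use that Z1_open[OF 1(2)] Z1_closed[OF 1(2)] in auto)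
  have g_rs: "grs F (A \<inter> B) Y (g A B) \<in> carrier (grp F Y)" if "A \<in> \<U>" "B \<in> \<U>" "open Y" "Y \<subseteq> A" "Y \<subseteq> B" for A B Y
    by (rule rs_closed) (use that Z1_open[OF 1(1)] Z1_closed[OF 1(1)] in auto)
  have k_rs: "grs F (A \<inter> B) Y (k A B) \<in> carrier (grp F Y)" if "A \<in> \<S>" "B \<in> \<S>" "open Y" "Y \<subseteq> A" "Y \<subseteq> B" for A B Y
    by (rule rs_closed) (use that Z1_open[OF 2(2)] Z1_closed[OF 2(2)] in auto)
  have m_cl: "m C \<in> carrier (grp F C)" if "C \<in> \<C>" for C
    unfolding m_def using P[OF that] by (intro mult_closed h_rs rs_closed[of "p C"] rs_closed[of "q C"]) auto
  have m_rs: "grs F C Y (m C) = grs F (p C) Y (l (p C)) \<otimes>\<^bsub>grp F Y\<^esub>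
     grs F (\<sigma> (p C) \<inter> \<tau>' (q C)) Y (h (\<sigma> (p C)) (\<tau>' (q C))) \<otimes>\<^bsub>grp F Y\<^esub> grs F (q C) Y (l' (q C))"
    if "C \<in> \<C>" "open Y" "Y \<subseteq> C" for C Y
  proof -
    note P = P[OF that(1)]
    have "h (\<sigma> (p C)) (\<tau>' (q C)) \<in> carrier (grp F (\<sigma> (p C) \<inter> \<tau>' (q C)))" "open (\<sigma> (p C) \<inter> \<tau>' (q C))"
      using P Z1_closed[OF 1(2)] Z1_open[OF 1(2)] by auto
    then show ?thesis unfolding m_def
      using P that by (simp add: rs_mult mult_closed rs_closed rs_rs)
  qed
  have "((\<U>, g), (\<S>, k)) \<in> H1_rel F"
  proof (rule H1_relI[OF 1(1) 2(2) C(1), of "\<lambda>C. \<tau> (p C)" "\<lambda>C. \<sigma>' (q C)" m])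
    show "\<tau> (p W) \<in> \<U> \<and> W \<subseteq> \<tau> (p W) \<and> \<sigma>' (q W) \<in> \<S> \<and> W \<subseteq> \<sigma>' (q W) \<and> m W \<in> carrier (grp F W)"
      if "W \<in> \<C>" for W using P[OF that] m_cl[OF that] by blast
    fix A B assume w: "A \<in> \<C>" "B \<in> \<C>"
    note PA = P[OF w(1)] and PB = P[OF w(2)]
    let ?I = "A \<inter> B"
    have opI: "open ?I" using PA PB by auto
    interpret K: group "grp F ?I" using grp opI .
    have E1: "grs F (\<tau> (p A) \<inter> \<tau> (p B)) ?I (g (\<tau> (p A)) (\<tau> (p B))) \<otimes>\<^bsub>grp F ?I\<^esub> grs F (p B) ?I (l (p B)) =
          grs F (p A) ?I (l (p A)) \<otimes>\<^bsub>grp F ?I\<^esub> grs F (\<sigma> (p A) \<inter> \<sigma> (p B)) ?I (h (\<sigma> (p A)) (\<sigma> (p B)))"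
      by (rule 1(5)) (use C(2)[OF w(1)] C(2)[OF w(2)] opI in auto)
    have E2: "grs F (\<tau>' (q A) \<inter> \<tau>' (q B)) ?I (h (\<tau>' (q A)) (\<tau>' (q B))) \<otimes>\<^bsub>grp F ?I\<^esub> grs F (q B) ?I (l' (q B)) =
          grs F (q A) ?I (l' (q A)) \<otimes>\<^bsub>grp F ?I\<^esub> grs F (\<sigma>' (q A) \<inter> \<sigma>' (q B)) ?I (k (\<sigma>' (q A)) (\<sigma>' (q B)))"
      by (rule 2(5)) (use C(2)[OF w(1)] C(2)[OF w(2)] opI in auto)
    have C1: "grs F (\<sigma> (p A) \<inter> \<sigma> (p B)) ?I (h (\<sigma> (p A)) (\<sigma> (p B))) \<otimes>\<^bsub>grp F ?I\<^esub>
       grs F (\<sigma> (p B) \<inter> \<tau>' (q B)) ?I (h (\<sigma> (p B)) (\<tau>' (q B))) = grs F (\<sigma> (p A) \<inter> \<tau>' (q B)) ?I (h (\<sigma> (p A)) (\<tau>' (q B)))"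
      by (rule Z1_cocycle[OF 1(2)]) (use PA PB opI in auto)
    have C2: "grs F (\<sigma> (p A) \<inter> \<tau>' (q A)) ?I (h (\<sigma> (p A)) (\<tau>' (q A))) \<otimes>\<^bsub>grp F ?I\<^esub>
       grs F (\<tau>' (q A) \<inter> \<tau>' (q B)) ?I (h (\<tau>' (q A)) (\<tau>' (q B))) = grs F (\<sigma> (p A) \<inter> \<tau>' (q B)) ?I (h (\<sigma> (p A)) (\<tau>' (q B)))"
      by (rule Z1_cocycle[OF 1(2)]) (use PA PB opI in auto)
    have alg: "g0 \<otimes>\<^bsub>grp F ?I\<^esub> (x' \<otimes>\<^bsub>grp F ?I\<^esub> y' \<otimes>\<^bsub>grp F ?I\<^esub> z') = (x \<otimes>\<^bsub>grp F ?I\<^esub> y \<otimes>\<^bsub>grp F ?I\<^esub> z) \<otimes>\<^bsub>grp F ?I\<^esub> k0"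
      if e: "g0 \<otimes>\<^bsub>grp F ?I\<^esub> x' = x \<otimes>\<^bsub>grp F ?I\<^esub> h1" "h2 \<otimes>\<^bsub>grp F ?I\<^esub> z' = z \<otimes>\<^bsub>grp F ?I\<^esub> k0"
        "h1 \<otimes>\<^bsub>grp F ?I\<^esub> y' = h12" "y \<otimes>\<^bsub>grp F ?I\<^esub> h2 = h12"
      and [simp]: "g0 \<in> carrier (grp F ?I)" "x' \<in> carrier (grp F ?I)" "y' \<in> carrier (grp F ?I)" "z' \<in> carrier (grp F ?I)"
       "x \<in> carrier (grp F ?I)" "y \<in> carrier (grp F ?I)" "z \<in> carrier (grp F ?I)" "k0 \<in> carrier (grp F ?I)"
       "h1 \<in> carrier (grp F ?I)" "h2 \<in> carrier (grp F ?I)"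
      for g0 x' y' z' x y z k0 h1 h2 h12
    proof -
      have "g0 \<otimes>\<^bsub>grp F ?I\<^esub> (x' \<otimes>\<^bsub>grp F ?I\<^esub> y' \<otimes>\<^bsub>grp F ?I\<^esub> z') = (g0 \<otimes>\<^bsub>grp F ?I\<^esub> x') \<otimes>\<^bsub>grp F ?I\<^esub> (y' \<otimes>\<^bsub>grp F ?I\<^esub> z')"
        by (simp add: K.m_assoc)
      also have "\<dots> = x \<otimes>\<^bsub>grp F ?I\<^esub> (h1 \<otimes>\<^bsub>grp F ?I\<^esub> y') \<otimes>\<^bsub>grp F ?I\<^esub> z'"
        unfolding e(1) by (simp add: K.m_assoc)
      also have "\<dots> = x \<otimes>\<^bsub>grp F ?I\<^esub> (y \<otimes>\<^bsub>grp F ?I\<^esub> h2) \<otimes>\<^bsub>grp F ?I\<^esub> z'" by (simp only: e)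
      also have "\<dots> = x \<otimes>\<^bsub>grp F ?I\<^esub> y \<otimes>\<^bsub>grp F ?I\<^esub> (h2 \<otimes>\<^bsub>grp F ?I\<^esub> z')" by (simp add: K.m_assoc)
      also have "\<dots> = (x \<otimes>\<^bsub>grp F ?I\<^esub> y \<otimes>\<^bsub>grp F ?I\<^esub> z) \<otimes>\<^bsub>grp F ?I\<^esub> k0"
        unfolding e(2) by (simp add: K.m_assoc)
      finally show ?thesis .
    qed
    show "grs F (\<tau> (p A) \<inter> \<tau> (p B)) ?I (g (\<tau> (p A)) (\<tau> (p B))) \<otimes>\<^bsub>grp F ?I\<^esub> grs F B ?I (m B) =
       grs F A ?I (m A) \<otimes>\<^bsub>grp F ?I\<^esub> grs F (\<sigma>' (q A) \<inter> \<sigma>' (q B)) ?I (k (\<sigma>' (q A)) (\<sigma>' (q B)))"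
      unfolding m_rs[OF w(1) opI inf_le1] m_rs[OF w(2) opI inf_le2]
      by (rule alg[OF E1 E2 C1 C2])
         (use PA PB opI in \<open>auto intro!: g_rs h_rs k_rs rs_closed[of "p A"] rs_closed[of "p B"] rs_closed[of "q A"] rs_closed[of "q B"]\<close>)
  qed
  then show ?thesis by simp
qed

lemma H1_equiv: "equiv (Z1 F) (H1_rel F)"
proof (rule equivI)
  show "H1_rel F \<subseteq> Z1 F \<times> Z1 F" by (auto simp: H1_rel_def)
qed (auto simp: refl_on_def sym_def trans_def intro: H1_rel_refl H1_rel_sym H1_rel_trans)

lemma H1_class_eq: "(c, d) \<in> H1_rel F \<Longrightarrow> H1_class F c = H1_class F d"
  unfolding H1_class_def using equiv_class_eq[OF H1_equiv] .

lemma H1_class_eqD: "H1_class F c = H1_class F d \<Longrightarrow> c \<in> Z1 F \<Longrightarrow> d \<in> Z1 F \<Longrightarrow> (c, d) \<in> H1_rel F"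
  unfolding H1_class_def using eq_equiv_class[OF _ H1_equiv] by blast

lemma H1_class_mem: "d \<in> H1_class F c \<longleftrightarrow> (c, d) \<in> H1_rel F"
  by (simp add: H1_class_def)

lemma H1_class_carrier: "c \<in> Z1 F \<Longrightarrow> H1_class F c \<in> carrier (H1 F)"
  by (auto simp: H1_def H1_class_def quotientI)

lemma H1_carrierE:
  assumes "C \<in> carrier (H1 F)"
  obtains c where "c \<in> Z1 F" "C = H1_class F c"
  using assms by (auto simp: H1_def H1_class_def elim: quotientE)

lemma H1_base_carrier: "H1_base F \<in> carrier (H1 F)"
  unfolding H1_base_def by (rule H1_class_carrier[OF Z1_base])

lemma H1_rel_one: "open_cover \<U> \<Longrightarrow> (({UNIV}, \<lambda>U V. \<one>\<^bsub>grp F UNIV\<^esub>), (\<U>, \<lambda>U V. \<one>\<^bsub>grp F (U \<inter> V)\<^esub>)) \<in> H1_rel F"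
proof (rule H1_rel_refine[OF Z1_base, of _ "\<lambda>U. UNIV" "\<lambda>U. \<one>\<^bsub>grp F U\<^esub>"])
  assume c: "open_cover \<U>"
  then show "open_cover \<U>" .
  show "UNIV \<in> {UNIV} \<and> W \<subseteq> UNIV \<and> \<one>\<^bsub>grp F W\<^esub> \<in> carrier (grp F W)" if "W \<in> \<U>" for W
    using c that one_closed by (auto simp: open_cover_def)
  fix A B assume "A \<in> \<U>" "B \<in> \<U>"
  then have op: "open A" "open B" "open (A \<inter> B)" using c by (auto simp: open_cover_def)
  interpret K: group "grp F (A \<inter> B)" using grp op(3) .
  show "\<one>\<^bsub>grp F (A \<inter> B)\<^esub> = inv\<^bsub>grp F (A \<inter> B)\<^esub> grs F A (A \<inter> B) \<one>\<^bsub>grp F A\<^esub> \<otimes>\<^bsub>grp F (A \<inter> B)\<^esub>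
       grs F (UNIV \<inter> UNIV) (A \<inter> B) \<one>\<^bsub>grp F UNIV\<^esub> \<otimes>\<^bsub>grp F (A \<inter> B)\<^esub> grs F B (A \<inter> B) \<one>\<^bsub>grp F B\<^esub>"
    using op by (simp add: rs_one)
qed

text \<open>Commutativity makes the product of a cocycle with a coboundary cohomologous to the cocycle.\<close>
lemma H1_rel_mult_trivial:
  assumes comm: "\<And>U f g. open U \<Longrightarrow> f \<in> carrier (grp F U) \<Longrightarrow> g \<in> carrier (grp F U) \<Longrightarrow>
      f \<otimes>\<^bsub>grp F U\<^esub> g = g \<otimes>\<^bsub>grp F U\<^esub> f"
    and a: "(\<W>, a) \<in> H1_base F" and b: "(\<W>, b) \<in> Z1 F"
    and c: "\<And>U V. U \<in> \<W> \<Longrightarrow> V \<in> \<W> \<Longrightarrow> c U V = a U V \<otimes>\<^bsub>grp F (U \<inter> V)\<^esub> b U V"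
  shows "((\<W>, b), (\<W>, c)) \<in> H1_rel F"
proof -
  have Zc: "open_cover \<W>" using b by (simp add: Z1_def)
  from a have r: "(({UNIV}, \<lambda>U V. \<one>\<^bsub>grp F UNIV\<^esub>), (\<W>, a)) \<in> H1_rel F"
    by (simp add: H1_base_def H1_class_mem)
  from H1_rel_link[OF r] obtain \<S> \<tau> \<sigma> l
    where L: "H1_link {UNIV} (\<lambda>U V. \<one>\<^bsub>grp F UNIV\<^esub>) \<W> a \<S> \<tau> \<sigma> l" by blast
  note 1 = H1_rel_Z1(2)[OF r] H1_link_cover[OF L] H1_link_mem[OF L] H1_link_eq[OF L]
  have c_cl: "c U V \<in> carrier (grp F (U \<inter> V))" if "U \<in> \<W>" "V \<in> \<W>" for U V
    unfolding c[OF that]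
    by (rule mult_closed) (use that Z1_open[OF b] Z1_closed[OF b that] Z1_closed[OF 1(1) that] in auto)
  have c_rs: "grs F (U \<inter> V) Y (c U V) = grs F (U \<inter> V) Y (a U V) \<otimes>\<^bsub>grp F Y\<^esub> grs F (U \<inter> V) Y (b U V)"
    if "U \<in> \<W>" "V \<in> \<W>" "open Y" "Y \<subseteq> U \<inter> V" for U V Y
    unfolding c[OF that(1,2)]
    by (rule rs_mult) (use that Z1_open[OF b] Z1_closed[OF b] Z1_closed[OF 1(1)] in auto)
  have a_rs: "grs F (A \<inter> B) Y (a A B) \<in> carrier (grp F Y)" if "A \<in> \<W>" "B \<in> \<W>" "open Y" "Y \<subseteq> A" "Y \<subseteq> B" for A B Y
    by (rule rs_closed) (use that Z1_open[OF b] Z1_closed[OF 1(1)] in auto)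
  have b_rs: "grs F (A \<inter> B) Y (b A B) \<in> carrier (grp F Y)" if "A \<in> \<W>" "B \<in> \<W>" "open Y" "Y \<subseteq> A" "Y \<subseteq> B" for A B Y
    by (rule rs_closed) (use that Z1_open[OF b] Z1_closed[OF b] in auto)
  have Zcc: "(\<W>, c) \<in> Z1 F"
  proof (rule Z1I[OF Zc c_cl])
    fix U V W assume w: "U \<in> \<W>" "V \<in> \<W>" "W \<in> \<W>"
    let ?I = "U \<inter> V \<inter> W"
    have opI: "open ?I" using w Z1_open[OF b] by auto
    interpret K: group "grp F ?I" using grp opI .
    have ca: "grs F (U \<inter> V) ?I (a U V) \<otimes>\<^bsub>grp F ?I\<^esub> grs F (V \<inter> W) ?I (a V W) = grs F (U \<inter> W) ?I (a U W)"
      by (rule Z1_cocycle[OF 1(1) w opI]) auto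
    have cb: "grs F (U \<inter> V) ?I (b U V) \<otimes>\<^bsub>grp F ?I\<^esub> grs F (V \<inter> W) ?I (b V W) = grs F (U \<inter> W) ?I (b U W)"
      by (rule Z1_cocycle[OF b w opI]) auto
    have alg: "(x \<otimes>\<^bsub>grp F ?I\<^esub> x') \<otimes>\<^bsub>grp F ?I\<^esub> (y \<otimes>\<^bsub>grp F ?I\<^esub> y') = (x \<otimes>\<^bsub>grp F ?I\<^esub> y) \<otimes>\<^bsub>grp F ?I\<^esub> (x' \<otimes>\<^bsub>grp F ?I\<^esub> y')"
      if "x \<in> carrier (grp F ?I)" "x' \<in> carrier (grp F ?I)" "y \<in> carrier (grp F ?I)" "y' \<in> carrier (grp F ?I)" for x x' y y'
      using that comm[OF opI, of x' y] by (metis K.m_assoc K.m_closed)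
    have sub: "?I \<subseteq> U \<inter> V" "?I \<subseteq> V \<inter> W" "?I \<subseteq> U \<inter> W" "?I \<subseteq> U" "?I \<subseteq> V" "?I \<subseteq> W" by auto
    show "grs F (U \<inter> V) ?I (c U V) \<otimes>\<^bsub>grp F ?I\<^esub> grs F (V \<inter> W) ?I (c V W) = grs F (U \<inter> W) ?I (c U W)"
      unfolding c_rs[OF w(1,2) opI sub(1)] c_rs[OF w(2,3) opI sub(2)] c_rs[OF w(1,3) opI sub(3)]
      by (subst alg) (use a_rs b_rs w opI sub ca cb in auto)
  qed
  show ?thesis
  proof (rule H1_relI[OF b Zcc 1(2), of \<sigma> \<sigma> l])
    show "\<sigma> W \<in> \<W> \<and> W \<subseteq> \<sigma> W \<and> \<sigma> W \<in> \<W> \<and> W \<subseteq> \<sigma> W \<and> l W \<in> carrier (grp F W)" if "W \<in> \<S>" for W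
      using 1(3)[OF that] by blast
    fix A B assume w: "A \<in> \<S>" "B \<in> \<S>"
    note t = 1(3)[OF w(1)] 1(3)[OF w(2)]
    let ?I = "A \<inter> B"
    have opI: "open ?I" using t by auto
    interpret K: group "grp F ?I" using grp opI .
    let ?a = "grs F (\<sigma> A \<inter> \<sigma> B) ?I (a (\<sigma> A) (\<sigma> B))" and ?b = "grs F (\<sigma> A \<inter> \<sigma> B) ?I (b (\<sigma> A) (\<sigma> B))"
    have cl: "?a \<in> carrier (grp F ?I)" "?b \<in> carrier (grp F ?I)"
      "grs F A ?I (l A) \<in> carrier (grp F ?I)" "grs F B ?I (l B) \<in> carrier (grp F ?I)"
      using t opI by (auto intro!: a_rs b_rs rs_closed[of A] rs_closed[of B])
    have "grs F (\<tau> A \<inter> \<tau> B) ?I \<one>\<^bsub>grp F UNIV\<^esub> = \<one>\<^bsub>grp F ?I\<^esub>" using t opI by (simp add: rs_one)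
    then have lB: "grs F B ?I (l B) = grs F A ?I (l A) \<otimes>\<^bsub>grp F ?I\<^esub> ?a"
      using 1(4)[OF w opI order_refl] cl by simp
    have cr: "grs F (\<sigma> A \<inter> \<sigma> B) ?I (c (\<sigma> A) (\<sigma> B)) = ?a \<otimes>\<^bsub>grp F ?I\<^esub> ?b"
      by (rule c_rs) (use t opI in auto)
    have "?b \<otimes>\<^bsub>grp F ?I\<^esub> grs F B ?I (l B) = grs F B ?I (l B) \<otimes>\<^bsub>grp F ?I\<^esub> ?b"
      by (rule comm[OF opI]) (use cl in auto)
    then show "?b \<otimes>\<^bsub>grp F ?I\<^esub> grs F B ?I (l B) = grs F A ?I (l A) \<otimes>\<^bsub>grp F ?I\<^esub> grs F (\<sigma> A \<inter> \<sigma> B) ?I (c (\<sigma> A) (\<sigma> B))"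
      unfolding cr using cl by (simp add: lB K.m_assoc)
  qed
qed

text \<open>Products of classes are formed from representatives on a common cover. The base class has a
  representative on every cover, and multiplying by any such representative does not change a class.\<close>
lemma H1_one_unit:
  assumes comm: "\<And>U f g. open U \<Longrightarrow> f \<in> carrier (grp F U) \<Longrightarrow> g \<in> carrier (grp F U) \<Longrightarrow>
      f \<otimes>\<^bsub>grp F U\<^esub> g = g \<otimes>\<^bsub>grp F U\<^esub> f"
    and C: "C \<in> carrier (H1 F)"
  shows "\<one>\<^bsub>H1 F\<^esub> \<otimes>\<^bsub>H1 F\<^esub> C = C" "C \<otimes>\<^bsub>H1 F\<^esub> \<one>\<^bsub>H1 F\<^esub> = C"
proof -
  obtain \<U> g where Z: "(\<U>, g) \<in> Z1 F" and C_eq: "C = H1_class F (\<U>, g)"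
    using H1_carrierE[OF C] by (metis surj_pair)
  have cov: "open_cover \<U>" using Z by (simp add: Z1_def)
  have mem: "(\<U>, g) \<in> C" "(\<U>, \<lambda>U V. \<one>\<^bsub>grp F (U \<inter> V)\<^esub>) \<in> H1_base F"
    using H1_rel_refl[OF Z] H1_rel_one[OF cov] by (auto simp: C_eq H1_base_def H1_class_mem)
  have cls: "H1_class F (\<W>, c) = C"
    if "(\<W>, a) \<in> H1_base F" "(\<W>, b) \<in> C"
      "\<And>U V. U \<in> \<W> \<Longrightarrow> V \<in> \<W> \<Longrightarrow> c U V = a U V \<otimes>\<^bsub>grp F (U \<inter> V)\<^esub> b U V" for \<W> a b c
  proof -
    have r: "((\<U>, g), (\<W>, b)) \<in> H1_rel F" using that(2) by (simp add: C_eq H1_class_mem)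
    then have "(\<W>, b) \<in> Z1 F" by (simp add: H1_rel_def)
    from H1_rel_mult_trivial[OF comm that(1) this that(3)]
    have "((\<W>, b), (\<W>, c)) \<in> H1_rel F" .
    then show ?thesis unfolding C_eq using H1_rel_trans[OF r] H1_class_eq by blast
  qed
  have comm_on: "a U V \<otimes>\<^bsub>grp F (U \<inter> V)\<^esub> b U V = b U V \<otimes>\<^bsub>grp F (U \<inter> V)\<^esub> a U V"
    if "(\<W>, a) \<in> Z1 F" "(\<W>, b) \<in> Z1 F" "U \<in> \<W>" "V \<in> \<W>" for \<W> a b U V
    by (rule comm) (use that Z1_open[OF that(1)] Z1_closed[OF that(1)] Z1_closed[OF that(2)] in auto)
  have Zmem: "d \<in> Z1 F" if "d \<in> H1_base F \<or> d \<in> C" for d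
    using that by (auto simp: C_eq H1_base_def H1_class_mem H1_rel_def)
  have "\<one>\<^bsub>H1 F\<^esub> \<otimes>\<^bsub>H1 F\<^esub> C = \<Union>{H1_class F (\<W>, \<lambda>U V. a U V \<otimes>\<^bsub>grp F (U \<inter> V)\<^esub> b U V) | \<W> a b.
        (\<W>, a) \<in> H1_base F \<and> (\<W>, b) \<in> C}" by (simp add: H1_def)
  also have "\<dots> = \<Union>{C}"
  proof (rule arg_cong[where f = Union], intro equalityI subsetI)
    fix c assume "c \<in> {H1_class F (\<W>, \<lambda>U V. a U V \<otimes>\<^bsub>grp F (U \<inter> V)\<^esub> b U V) | \<W> a b.
        (\<W>, a) \<in> H1_base F \<and> (\<W>, b) \<in> C}"
    then show "c \<in> {C}" using cls by auto
  next
    fix c assume "c \<in> {C}"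
    then have "c = H1_class F (\<U>, \<lambda>U V. \<one>\<^bsub>grp F (U \<inter> V)\<^esub> \<otimes>\<^bsub>grp F (U \<inter> V)\<^esub> g U V)"
      using cls[OF mem(2,1) refl] by simp
    with mem show "c \<in> {H1_class F (\<W>, \<lambda>U V. a U V \<otimes>\<^bsub>grp F (U \<inter> V)\<^esub> b U V) | \<W> a b.
        (\<W>, a) \<in> H1_base F \<and> (\<W>, b) \<in> C}"
      by (intro CollectI exI[of _ \<U>] exI[of _ "\<lambda>U V. \<one>\<^bsub>grp F (U \<inter> V)\<^esub>"] exI[of _ g]) simp
  qed
  finally show "\<one>\<^bsub>H1 F\<^esub> \<otimes>\<^bsub>H1 F\<^esub> C = C" by simp
  have cls': "H1_class F (\<W>, \<lambda>U V. b U V \<otimes>\<^bsub>grp F (U \<inter> V)\<^esub> a U V) = C"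
    if "(\<W>, a) \<in> H1_base F" "(\<W>, b) \<in> C" for \<W> a b
    by (rule cls[OF that]) (use that comm_on Zmem in blast)
  have "C \<otimes>\<^bsub>H1 F\<^esub> \<one>\<^bsub>H1 F\<^esub> = \<Union>{H1_class F (\<W>, \<lambda>U V. b U V \<otimes>\<^bsub>grp F (U \<inter> V)\<^esub> a U V) | \<W> b a.
        (\<W>, b) \<in> C \<and> (\<W>, a) \<in> H1_base F}" by (simp add: H1_def)
  also have "\<dots> = \<Union>{C}"
  proof (rule arg_cong[where f = Union], intro equalityI subsetI)
    fix c assume "c \<in> {H1_class F (\<W>, \<lambda>U V. b U V \<otimes>\<^bsub>grp F (U \<inter> V)\<^esub> a U V) | \<W> b a.
        (\<W>, b) \<in> C \<and> (\<W>, a) \<in> H1_base F}"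
    then show "c \<in> {C}" using cls' by auto
  next
    fix c assume "c \<in> {C}"
    then have "c = H1_class F (\<U>, \<lambda>U V. g U V \<otimes>\<^bsub>grp F (U \<inter> V)\<^esub> \<one>\<^bsub>grp F (U \<inter> V)\<^esub>)"
      using cls'[OF mem(2,1)] by simp
    with mem show "c \<in> {H1_class F (\<W>, \<lambda>U V. b U V \<otimes>\<^bsub>grp F (U \<inter> V)\<^esub> a U V) | \<W> b a.
        (\<W>, b) \<in> C \<and> (\<W>, a) \<in> H1_base F}"
      by (intro CollectI exI[of _ \<U>] exI[of _ g] exI[of _ "\<lambda>U V. \<one>\<^bsub>grp F (U \<inter> V)\<^esub>"]) simp
  qed
  finally show "C \<otimes>\<^bsub>H1 F\<^esub> \<one>\<^bsub>H1 F\<^esub> = C" by simp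
qed

lemma Z2_one:
  assumes "open_cover \<U>" "\<And>U V W. U \<in> \<U> \<Longrightarrow> V \<in> \<U> \<Longrightarrow> W \<in> \<U> \<Longrightarrow> b U V W = \<one>\<^bsub>grp F (U \<inter> V \<inter> W)\<^esub>"
  shows "(\<U>, b) \<in> Z2 F"
proof -
  have op: "open U" if "U \<in> \<U>" for U using assms that by (auto simp: open_cover_def)
  have one: "grs F (U \<inter> V \<inter> W) Y (b U V W) = \<one>\<^bsub>grp F Y\<^esub>"
    if "U \<in> \<U>" "V \<in> \<U>" "W \<in> \<U>" "open Y" "Y \<subseteq> U \<inter> V \<inter> W" for U V W Y
    using that op by (simp add: assms(2) rs_one open_Int)
  have "grs F (V \<inter> W \<inter> S) I (b V W S) \<otimes>\<^bsub>grp F I\<^esub> grs F (U \<inter> V \<inter> S) I (b U V S) =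
        grs F (U \<inter> W \<inter> S) I (b U W S) \<otimes>\<^bsub>grp F I\<^esub> grs F (U \<inter> V \<inter> W) I (b U V W)"
    if w: "U \<in> \<U>" "V \<in> \<U>" "W \<in> \<U>" "S \<in> \<U>" and I: "I = U \<inter> V \<inter> W \<inter> S" for U V W S I
  proof -
    have sub: "I \<subseteq> V \<inter> W \<inter> S" "I \<subseteq> U \<inter> V \<inter> S" "I \<subseteq> U \<inter> W \<inter> S" "I \<subseteq> U \<inter> V \<inter> W" and oI: "open I"
      using op w by (auto simp: I)
    show ?thesis
      unfolding one[OF w(2,3,4) oI sub(1)] one[OF w(1,2,4) oI sub(2)] one[OF w(1,3,4) oI sub(3)]
        one[OF w(1,2,3) oI sub(4)] by (rule refl)
  qed
  moreover have "b U V W \<in> carrier (grp F (U \<inter> V \<inter> W))" if "U \<in> \<U>" "V \<in> \<U>" "W \<in> \<U>" for U V W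
    using that op by (simp add: assms(2) one_closed open_Int)
  ultimately show ?thesis unfolding Z2_def Let_def using assms(1) by auto
qed

text \<open>As for one-cocycles, the existential part of the relation is named.\<close>
definition H2_link where
  "H2_link \<U> b \<V> d \<W> \<tau> \<sigma> l \<longleftrightarrow> open_cover \<W> \<and>
       (\<forall>W\<in>\<W>. \<tau> W \<in> \<U> \<and> W \<subseteq> \<tau> W \<and> \<sigma> W \<in> \<V> \<and> W \<subseteq> \<sigma> W) \<and>
       (\<forall>W\<in>\<W>. \<forall>W'\<in>\<W>. l W W' \<in> carrier (grp F (W \<inter> W'))) \<and>
       (\<forall>W\<in>\<W>. \<forall>W'\<in>\<W>. \<forall>W''\<in>\<W>. let I = W \<inter> W' \<inter> W'' in
          grs F (\<sigma> W \<inter> \<sigma> W' \<inter> \<sigma> W'') I (d (\<sigma> W) (\<sigma> W') (\<sigma> W'')) \<otimes>\<^bsub>grp F I\<^esub>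
          grs F (W \<inter> W'') I (l W W'') =
          grs F (\<tau> W \<inter> \<tau> W' \<inter> \<tau> W'') I (b (\<tau> W) (\<tau> W') (\<tau> W'')) \<otimes>\<^bsub>grp F I\<^esub>
          (grs F (W' \<inter> W'') I (l W' W'') \<otimes>\<^bsub>grp F I\<^esub> grs F (W \<inter> W') I (l W W')))"

lemma H2_rel_link:
  "((\<U>, b), (\<V>, d)) \<in> H2_rel F \<longleftrightarrow>
     (\<U>, b) \<in> Z2 F \<and> (\<V>, d) \<in> Z2 F \<and> (\<exists>\<W> \<tau> \<sigma> l. H2_link \<U> b \<V> d \<W> \<tau> \<sigma> l)"
  unfolding H2_rel_def H2_link_def mem_Collect_eq case_prod_conv ..

text \<open>The connecting map records the class of a 2-cocycle on the cover at hand, so the zero class has to be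
  recognised on every cover.\<close>
lemma H2_class_one:
  assumes "open_cover \<U>"
  shows "H2_class F (\<U>, \<lambda>U V W. \<one>\<^bsub>grp F (U \<inter> V \<inter> W)\<^esub>) = H2_zero F"
proof -
  let ?b = "\<lambda>U V W. \<one>\<^bsub>grp F (U \<inter> V \<inter> W)\<^esub>" and ?z = "\<lambda>U V W. \<one>\<^bsub>grp F UNIV\<^esub>"
  have Z: "(\<U>, ?b) \<in> Z2 F" "({UNIV}, ?z) \<in> Z2 F"
  proof -
    show "(\<U>, ?b) \<in> Z2 F" by (rule Z2_one[OF assms]) simp
    show "({UNIV}, ?z) \<in> Z2 F" by (rule Z2_one) (auto simp: open_cover_def)
  qed
  have op: "open U" if "U \<in> \<U>" for U using assms that by (auto simp: open_cover_def)
  show ?thesis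
  proof (rule Set.set_eqI)
    fix d :: "('x, 'g) cocycle2"
    obtain \<V> e where [simp]: "d = (\<V>, e)" by (cases d)
    have "((\<U>, ?b), (\<V>, e)) \<in> H2_rel F \<longleftrightarrow> (({UNIV}, ?z), (\<V>, e)) \<in> H2_rel F"
    proof
      assume "((\<U>, ?b), (\<V>, e)) \<in> H2_rel F"
      then obtain \<W> \<tau> \<sigma> l where V: "(\<V>, e) \<in> Z2 F" and L: "H2_link \<U> ?b \<V> e \<W> \<tau> \<sigma> l"
        unfolding H2_rel_link by blast
      from L have 1: "open_cover \<W>"
        "\<And>W. W \<in> \<W> \<Longrightarrow> \<tau> W \<in> \<U> \<and> W \<subseteq> \<tau> W \<and> \<sigma> W \<in> \<V> \<and> W \<subseteq> \<sigma> W"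
        "\<And>W W'. W \<in> \<W> \<Longrightarrow> W' \<in> \<W> \<Longrightarrow> l W W' \<in> carrier (grp F (W \<inter> W'))"
        by (simp_all add: H2_link_def)
      note L4 = L[unfolded H2_link_def, THEN conjunct2, THEN conjunct2, THEN conjunct2,
          THEN bspec, THEN bspec, THEN bspec]
      have "let I = W \<inter> W' \<inter> W'' in
          grs F (\<sigma> W \<inter> \<sigma> W' \<inter> \<sigma> W'') I (e (\<sigma> W) (\<sigma> W') (\<sigma> W'')) \<otimes>\<^bsub>grp F I\<^esub>
          grs F (W \<inter> W'') I (l W W'') =
          grs F (UNIV \<inter> UNIV \<inter> UNIV) I \<one>\<^bsub>grp F UNIV\<^esub> \<otimes>\<^bsub>grp F I\<^esub>
          (grs F (W' \<inter> W'') I (l W' W'') \<otimes>\<^bsub>grp F I\<^esub> grs F (W \<inter> W') I (l W W'))"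
        if w: "W \<in> \<W>" "W' \<in> \<W>" "W'' \<in> \<W>" for W W' W''
      proof -
        have oI: "open (W \<inter> W' \<inter> W'')" using w 1(1) by (auto simp: open_cover_def)
        have "open (\<tau> W \<inter> \<tau> W' \<inter> \<tau> W'')" "W \<inter> W' \<inter> W'' \<subseteq> \<tau> W \<inter> \<tau> W' \<inter> \<tau> W''"
          using 1(2)[OF w(1)] 1(2)[OF w(2)] 1(2)[OF w(3)] op by auto
        then show ?thesis using L4[OF w] oI by (simp add: Let_def rs_one)
      qed
      then show "(({UNIV}, ?z), (\<V>, e)) \<in> H2_rel F"
        unfolding H2_rel_link using 1 Z V
        by (intro conjI exI[of _ \<W>] exI[of _ "\<lambda>W. UNIV"] exI[of _ \<sigma>] exI[of _ l]) (simp_all add: H2_link_def)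
    next
      assume "(({UNIV}, ?z), (\<V>, e)) \<in> H2_rel F"
      then obtain \<W> \<tau> \<sigma> l where V: "(\<V>, e) \<in> Z2 F" and L: "H2_link {UNIV} ?z \<V> e \<W> \<tau> \<sigma> l"
        unfolding H2_rel_link by blast
      from L have 1: "open_cover \<W>"
        "\<And>W. W \<in> \<W> \<Longrightarrow> \<tau> W = UNIV \<and> \<sigma> W \<in> \<V> \<and> W \<subseteq> \<sigma> W"
        "\<And>W W'. W \<in> \<W> \<Longrightarrow> W' \<in> \<W> \<Longrightarrow> l W W' \<in> carrier (grp F (W \<inter> W'))"
        by (simp_all add: H2_link_def)
      note L4 = L[unfolded H2_link_def, THEN conjunct2, THEN conjunct2, THEN conjunct2,
          THEN bspec, THEN bspec, THEN bspec]
      have opW: "open W" if "W \<in> \<W>" for W using 1(1) that by (auto simp: open_cover_def)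
      have V_op: "open V" if "V \<in> \<V>" for V using V that by (auto simp: Z2_def open_cover_def)
      have e_cl: "e A B C \<in> carrier (grp F (A \<inter> B \<inter> C))" if "A \<in> \<V>" "B \<in> \<V>" "C \<in> \<V>" for A B C
        using V that by (auto simp: Z2_def)
      obtain \<C> p q where C: "open_cover \<C>"
        "\<And>C. C \<in> \<C> \<Longrightarrow> open C \<and> p C \<in> \<W> \<and> q C \<in> \<U> \<and> C \<subseteq> p C \<and> C \<subseteq> q C"
        using common_refinement[OF 1(1) assms] by blast
      let ?l = "\<lambda>C C'. grs F (p C \<inter> p C') (C \<inter> C') (l (p C) (p C'))"
      have 2: "?l A B \<in> carrier (grp F (A \<inter> B))" if "A \<in> \<C>" "B \<in> \<C>" for A B
        by (rule rs_closed[OF _ _ _ 1(3)]) (use C(2)[OF that(1)] C(2)[OF that(2)] opW in auto)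
      have 3: "let I = A \<inter> B \<inter> C in
          grs F (\<sigma> (p A) \<inter> \<sigma> (p B) \<inter> \<sigma> (p C)) I (e (\<sigma> (p A)) (\<sigma> (p B)) (\<sigma> (p C))) \<otimes>\<^bsub>grp F I\<^esub>
          grs F (A \<inter> C) I (?l A C) =
          grs F (q A \<inter> q B \<inter> q C) I \<one>\<^bsub>grp F (q A \<inter> q B \<inter> q C)\<^esub> \<otimes>\<^bsub>grp F I\<^esub>
          (grs F (B \<inter> C) I (?l B C) \<otimes>\<^bsub>grp F I\<^esub> grs F (A \<inter> B) I (?l A B))"
        if w: "A \<in> \<C>" "B \<in> \<C>" "C \<in> \<C>" for A B C
      proof -
        let ?I = "A \<inter> B \<inter> C" and ?J = "p A \<inter> p B \<inter> p C"
        note t = C(2)[OF w(1)] C(2)[OF w(2)] C(2)[OF w(3)]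
        have pw: "p A \<in> \<W>" "p B \<in> \<W>" "p C \<in> \<W>" using t by auto
        note s = 1(2)[OF pw(1)] 1(2)[OF pw(2)] 1(2)[OF pw(3)]
        have ops: "open ?I" "open ?J" "?I \<subseteq> ?J" "open (p A)" "open (p B)" "open (p C)" "open A" "open B" "open C"
          using t opW pw by auto
        have opv: "open (\<sigma> (p A) \<inter> \<sigma> (p B) \<inter> \<sigma> (p C))" "?J \<subseteq> \<sigma> (p A) \<inter> \<sigma> (p B) \<inter> \<sigma> (p C)"
          "e (\<sigma> (p A)) (\<sigma> (p B)) (\<sigma> (p C)) \<in> carrier (grp F (\<sigma> (p A) \<inter> \<sigma> (p B) \<inter> \<sigma> (p C)))"
          using s V_op e_cl by auto
        have opu: "open (q A \<inter> q B \<inter> q C)" "?I \<subseteq> q A \<inter> q B \<inter> q C" using t op by auto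
        have J: "?J \<subseteq> p A \<inter> p B" "?J \<subseteq> p B \<inter> p C" "?J \<subseteq> p A \<inter> p C"
          "?I \<subseteq> A \<inter> B" "?I \<subseteq> B \<inter> C" "?I \<subseteq> A \<inter> C" "A \<inter> B \<subseteq> p A \<inter> p B" "B \<inter> C \<subseteq> p B \<inter> p C" "A \<inter> C \<subseteq> p A \<inter> p C"
          using t by auto
        note lc = 1(3)[OF pw(1,2)] 1(3)[OF pw(2,3)] 1(3)[OF pw(1,3)]
        have "grs F (\<sigma> (p A) \<inter> \<sigma> (p B) \<inter> \<sigma> (p C)) ?J (e (\<sigma> (p A)) (\<sigma> (p B)) (\<sigma> (p C))) \<otimes>\<^bsub>grp F ?J\<^esub>
          grs F (p A \<inter> p C) ?J (l (p A) (p C)) = \<one>\<^bsub>grp F ?J\<^esub> \<otimes>\<^bsub>grp F ?J\<^esub>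
          (grs F (p B \<inter> p C) ?J (l (p B) (p C)) \<otimes>\<^bsub>grp F ?J\<^esub> grs F (p A \<inter> p B) ?J (l (p A) (p B)))"
          using L4[OF pw] s ops by (simp add: Let_def rs_one)
        then have "grs F ?J ?I (grs F (\<sigma> (p A) \<inter> \<sigma> (p B) \<inter> \<sigma> (p C)) ?J (e (\<sigma> (p A)) (\<sigma> (p B)) (\<sigma> (p C))) \<otimes>\<^bsub>grp F ?J\<^esub>
          grs F (p A \<inter> p C) ?J (l (p A) (p C))) = grs F ?J ?I (\<one>\<^bsub>grp F ?J\<^esub> \<otimes>\<^bsub>grp F ?J\<^esub>
          (grs F (p B \<inter> p C) ?J (l (p B) (p C)) \<otimes>\<^bsub>grp F ?J\<^esub> grs F (p A \<inter> p B) ?J (l (p A) (p B))))"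
          by simp
        then show ?thesis unfolding Let_def
          using ops opv opu J lc
          by (simp add: rs_one rs_mult rs_closed mult_closed one_closed rs_rs open_Int)
      qed
      have "H2_link \<U> ?b \<V> e \<C> q (\<lambda>C. \<sigma> (p C)) ?l"
        unfolding H2_link_def
      proof (intro conjI ballI)
        show "q W \<in> \<U>" "W \<subseteq> q W" "\<sigma> (p W) \<in> \<V>" "W \<subseteq> \<sigma> (p W)" if "W \<in> \<C>" for W
          using C(2)[OF that] 1(2)[of "p W"] by auto
      qed (use C 2 3 in simp_all)
      then show "((\<U>, ?b), (\<V>, e)) \<in> H2_rel F"
        unfolding H2_rel_link using Z V by blast
    qed
    then show "d \<in> H2_class F (\<U>, ?b) \<longleftrightarrow> d \<in> H2_zero F"
      by (simp add: H2_zero_def H2_class_def)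
  qed
qed

end

section \<open>Quotient sheaves of groups\<close>

locale quot_presheaf = grp_presheaf F for F :: "('x::topological_space, 'g) grp_sheaf" +
  fixes N :: "'x set \<Rightarrow> 'g set"
  assumes N_normal: "open U \<Longrightarrow> N U \<lhd> grp F U"
    and N_rs: "open U \<Longrightarrow> open V \<Longrightarrow> V \<subseteq> U \<Longrightarrow> n \<in> N U \<Longrightarrow> grs F U V n \<in> N V"
begin

abbreviation gc where "gc \<equiv> germ_class F N"
abbreviation Q where "Q \<equiv> quot_sheaf F N"

lemma N_subgroup: "open U \<Longrightarrow> subgroup (N U) (grp F U)"
  using N_normal normal_imp_subgroup by blast

lemma N_sub: "open U \<Longrightarrow> n \<in> N U \<Longrightarrow> n \<in> carrier (grp F U)"
  using N_subgroup subgroup.mem_carrier by metis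

lemma N_one: "open U \<Longrightarrow> \<one>\<^bsub>grp F U\<^esub> \<in> N U"
  using N_subgroup subgroup.one_closed by metis

lemma N_mult: "open U \<Longrightarrow> n \<in> N U \<Longrightarrow> n' \<in> N U \<Longrightarrow> n \<otimes>\<^bsub>grp F U\<^esub> n' \<in> N U"
  using N_subgroup subgroup.m_closed by metis

lemma N_inv: "open U \<Longrightarrow> n \<in> N U \<Longrightarrow> inv\<^bsub>grp F U\<^esub> n \<in> N U"
  using N_subgroup subgroup.m_inv_closed by metis

lemma N_conj: "open U \<Longrightarrow> n \<in> N U \<Longrightarrow> f \<in> carrier (grp F U) \<Longrightarrow>
    inv\<^bsub>grp F U\<^esub> f \<otimes>\<^bsub>grp F U\<^esub> n \<otimes>\<^bsub>grp F U\<^esub> f \<in> N U"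
  using N_normal normal.inv_op_closed1 by metis

text \<open>Equality in the quotient of the stalks at x. It compares two sections directly, whereas
  \<^const>\<open>germ_class\<close> encodes an element of the quotient as the set of all its representatives.\<close>
definition gcong where
  "gcong x V f W g \<longleftrightarrow> (\<exists>Z. open Z \<and> x \<in> Z \<and> Z \<subseteq> V \<inter> W \<and>
     (\<exists>n\<in>N Z. grs F W Z g = grs F V Z f \<otimes>\<^bsub>grp F Z\<^esub> n))"

lemma gc_iff: "(W, g) \<in> gc x (V, f) \<longleftrightarrow> open W \<and> x \<in> W \<and> g \<in> carrier (grp F W) \<and> gcong x V f W g"
  by (simp add: germ_class_def gcong_def)

lemma gcongI:
  assumes "open Z" "x \<in> Z" "Z \<subseteq> V" "Z \<subseteq> W" "n \<in> N Z" "grs F W Z g = grs F V Z f \<otimes>\<^bsub>grp F Z\<^esub> n"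
  shows "gcong x V f W g"
  unfolding gcong_def using assms by blast

lemma gcongE:
  assumes "gcong x V f W g"
  obtains Z n where "open Z" "x \<in> Z" "Z \<subseteq> V" "Z \<subseteq> W" "n \<in> N Z" "grs F W Z g = grs F V Z f \<otimes>\<^bsub>grp F Z\<^esub> n"
  using assms unfolding gcong_def by (metis le_inf_iff)

lemma gcong_restrict: "open V \<Longrightarrow> f \<in> carrier (grp F V) \<Longrightarrow> open W \<Longrightarrow> W \<subseteq> V \<Longrightarrow> x \<in> W \<Longrightarrow>
    gcong x V f W (grs F V W f)"
proof (rule gcongI[of W])
  assume h: "open V" "f \<in> carrier (grp F V)" "open W" "W \<subseteq> V" "x \<in> W"
  interpret K: group "grp F W" using grp h by blast
  have "grs F V W f \<in> carrier (grp F W)" using h rs_closed by blast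
  then show "grs F W W (grs F V W f) = grs F V W f \<otimes>\<^bsub>grp F W\<^esub> \<one>\<^bsub>grp F W\<^esub>"
    using h by (simp add: rs_id)
qed (auto intro: N_one)

lemma gcong_refl: "open V \<Longrightarrow> f \<in> carrier (grp F V) \<Longrightarrow> x \<in> V \<Longrightarrow> gcong x V f V f"
  using gcong_restrict[of V f V x] by (simp add: rs_id)

lemma gcong_sym:
  assumes "open V" "f \<in> carrier (grp F V)" "open W" "g \<in> carrier (grp F W)" "gcong x V f W g"
  shows "gcong x W g V f"
proof -
  obtain Z n where Z: "open Z" "x \<in> Z" "Z \<subseteq> V" "Z \<subseteq> W" "n \<in> N Z" "grs F W Z g = grs F V Z f \<otimes>\<^bsub>grp F Z\<^esub> n"
    using assms(5) by (rule gcongE)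
  interpret K: group "grp F Z" using grp Z by blast
  have cl: "grs F V Z f \<in> carrier (grp F Z)" "n \<in> carrier (grp F Z)" using assms Z rs_closed N_sub by blast+
  show ?thesis
    by (rule gcongI[of Z x W V "inv\<^bsub>grp F Z\<^esub> n"]) (use Z cl N_inv in \<open>simp_all add: K.m_assoc\<close>)
qed

lemma gcong_trans:
  assumes "open U" "e \<in> carrier (grp F U)" "open V" "f \<in> carrier (grp F V)" "open W" "g \<in> carrier (grp F W)"
    and "gcong x U e V f" "gcong x V f W g"
  shows "gcong x U e W g"
proof -
  obtain Z n where Z: "open Z" "x \<in> Z" "Z \<subseteq> U" "Z \<subseteq> V" "n \<in> N Z" "grs F V Z f = grs F U Z e \<otimes>\<^bsub>grp F Z\<^esub> n"
    using assms(7) by (rule gcongE)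
  obtain Z' n' where Z': "open Z'" "x \<in> Z'" "Z' \<subseteq> V" "Z' \<subseteq> W" "n' \<in> N Z'" "grs F W Z' g = grs F V Z' f \<otimes>\<^bsub>grp F Z'\<^esub> n'"
    using assms(8) by (rule gcongE)
  let ?Y = "Z \<inter> Z'"
  have Y: "open ?Y" "?Y \<subseteq> Z" "?Y \<subseteq> Z'" "?Y \<subseteq> U" "?Y \<subseteq> V" "?Y \<subseteq> W" using Z Z' by auto
  interpret K: group "grp F ?Y" using grp Y(1) .
  have n: "grs F Z ?Y n \<in> N ?Y" "grs F Z' ?Y n' \<in> N ?Y"
    by (rule N_rs[OF Z(1) Y(1,2) Z(5)], rule N_rs[OF Z'(1) Y(1,3) Z'(5)])
  have nc: "n \<in> carrier (grp F Z)" "n' \<in> carrier (grp F Z')" using Z Z' N_sub by auto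
  have "grs F Z ?Y (grs F V Z f) = grs F Z ?Y (grs F U Z e \<otimes>\<^bsub>grp F Z\<^esub> n)" using Z(6) by simp
  then have 1: "grs F V ?Y f = grs F U ?Y e \<otimes>\<^bsub>grp F ?Y\<^esub> grs F Z ?Y n"
    using Z(1-5) Y nc assms by (simp add: rs_mult rs_closed rs_rs)
  have "grs F Z' ?Y (grs F W Z' g) = grs F Z' ?Y (grs F V Z' f \<otimes>\<^bsub>grp F Z'\<^esub> n')" using Z'(6) by simp
  then have 2: "grs F W ?Y g = grs F V ?Y f \<otimes>\<^bsub>grp F ?Y\<^esub> grs F Z' ?Y n'"
    using Z'(1-5) Y nc assms by (simp add: rs_mult rs_closed rs_rs)
  have "grs F U ?Y e \<in> carrier (grp F ?Y)" using assms Y rs_closed by blast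
  then have "grs F W ?Y g = grs F U ?Y e \<otimes>\<^bsub>grp F ?Y\<^esub> (grs F Z ?Y n \<otimes>\<^bsub>grp F ?Y\<^esub> grs F Z' ?Y n')"
    unfolding 2 1 using n N_sub[OF Y(1)] by (simp add: K.m_assoc)
  then show ?thesis
    by (intro gcongI[OF Y(1) _ Y(4,6) N_mult[OF Y(1) n]]) (use Z Z' in auto)
qed

lemma gc_eq:
  assumes "open V" "f \<in> carrier (grp F V)" "open W" "g \<in> carrier (grp F W)" "gcong x V f W g"
  shows "gc x (V, f) = gc x (W, g)"
proof -
  have s: "gcong x W g V f" using gcong_sym assms by blast
  have "(Y, h) \<in> gc x (V, f) \<longleftrightarrow> (Y, h) \<in> gc x (W, g)" for Y h
    unfolding gc_iff using gcong_trans[OF assms(1-4)] gcong_trans[OF assms(3,4,1,2)] assms s by blast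
  then show ?thesis by auto
qed

lemma gc_eq_iff:
  assumes "open V" "f \<in> carrier (grp F V)" "open W" "g \<in> carrier (grp F W)" "x \<in> W"
  shows "gc x (V, f) = gc x (W, g) \<longleftrightarrow> gcong x V f W g"
  using gc_eq[OF assms(1-4)] gc_iff gcong_refl[OF assms(3-5)] assms by blast

lemma gcong_mult:
  assumes V: "open V" "f \<in> carrier (grp F V)" "g \<in> carrier (grp F V)"
    and W: "open W" "f' \<in> carrier (grp F W)" "g' \<in> carrier (grp F W)"
    and "gcong x V f W f'" "gcong x V g W g'"
  shows "gcong x V (f \<otimes>\<^bsub>grp F V\<^esub> g) W (f' \<otimes>\<^bsub>grp F W\<^esub> g')"
proof -
  obtain Z n where Z: "open Z" "x \<in> Z" "Z \<subseteq> V" "Z \<subseteq> W" "n \<in> N Z" "grs F W Z f' = grs F V Z f \<otimes>\<^bsub>grp F Z\<^esub> n"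
    using assms(7) by (rule gcongE)
  obtain Z' n' where Z': "open Z'" "x \<in> Z'" "Z' \<subseteq> V" "Z' \<subseteq> W" "n' \<in> N Z'" "grs F W Z' g' = grs F V Z' g \<otimes>\<^bsub>grp F Z'\<^esub> n'"
    using assms(8) by (rule gcongE)
  let ?Y = "Z \<inter> Z'"
  have Y: "open ?Y" "?Y \<subseteq> Z" "?Y \<subseteq> Z'" "?Y \<subseteq> V" "?Y \<subseteq> W" using Z Z' by auto
  interpret K: group "grp F ?Y" using grp Y(1) .
  define m where "m = grs F Z ?Y n"
  define m' where "m' = grs F Z' ?Y n'"
  define a where "a = grs F V ?Y f"
  define b where "b = grs F V ?Y g"
  have n: "m \<in> N ?Y" "m' \<in> N ?Y" unfolding m_def m'_def
    by (rule N_rs[OF Z(1) Y(1,2) Z(5)], rule N_rs[OF Z'(1) Y(1,3) Z'(5)])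
  have nc: "n \<in> carrier (grp F Z)" "n' \<in> carrier (grp F Z')" using Z Z' N_sub by auto
  have "grs F Z ?Y (grs F W Z f') = grs F Z ?Y (grs F V Z f \<otimes>\<^bsub>grp F Z\<^esub> n)" using Z(6) by simp
  then have 1: "grs F W ?Y f' = a \<otimes>\<^bsub>grp F ?Y\<^esub> m"
    unfolding a_def m_def using Z(1-5) Y nc assms by (simp add: rs_mult rs_closed rs_rs)
  have "grs F Z' ?Y (grs F W Z' g') = grs F Z' ?Y (grs F V Z' g \<otimes>\<^bsub>grp F Z'\<^esub> n')" using Z'(6) by simp
  then have 2: "grs F W ?Y g' = b \<otimes>\<^bsub>grp F ?Y\<^esub> m'"
    unfolding b_def m'_def using Z'(1-5) Y nc assms by (simp add: rs_mult rs_closed rs_rs)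
  have cl: "a \<in> carrier (grp F ?Y)" "b \<in> carrier (grp F ?Y)" "m \<in> carrier (grp F ?Y)" "m' \<in> carrier (grp F ?Y)"
    unfolding a_def b_def using assms Y rs_closed n N_sub[OF Y(1)] by auto
  have "(a \<otimes>\<^bsub>grp F ?Y\<^esub> m) \<otimes>\<^bsub>grp F ?Y\<^esub> (b \<otimes>\<^bsub>grp F ?Y\<^esub> m') =
    (a \<otimes>\<^bsub>grp F ?Y\<^esub> b) \<otimes>\<^bsub>grp F ?Y\<^esub> ((inv\<^bsub>grp F ?Y\<^esub> b \<otimes>\<^bsub>grp F ?Y\<^esub> m \<otimes>\<^bsub>grp F ?Y\<^esub> b) \<otimes>\<^bsub>grp F ?Y\<^esub> m')"
  proof -
    have "b \<otimes>\<^bsub>grp F ?Y\<^esub> (inv\<^bsub>grp F ?Y\<^esub> b \<otimes>\<^bsub>grp F ?Y\<^esub> z) = z" if "z \<in> carrier (grp F ?Y)" for z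
      using that cl by (simp add: K.m_assoc[symmetric])
    then show ?thesis using cl by (simp add: K.m_assoc)
  qed
  then have "grs F W ?Y (f' \<otimes>\<^bsub>grp F W\<^esub> g') = grs F V ?Y (f \<otimes>\<^bsub>grp F V\<^esub> g) \<otimes>\<^bsub>grp F ?Y\<^esub>
     ((inv\<^bsub>grp F ?Y\<^esub> b \<otimes>\<^bsub>grp F ?Y\<^esub> m \<otimes>\<^bsub>grp F ?Y\<^esub> b) \<otimes>\<^bsub>grp F ?Y\<^esub> m')"
    using assms Y by (simp add: rs_mult 1 2 a_def[symmetric] b_def[symmetric])
  then show ?thesis
    by (intro gcongI[OF Y(1) _ Y(4,5) N_mult[OF Y(1) N_conj[OF Y(1) n(1) cl(2)] n(2)]]) (use Z Z' in auto)
qed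

lemma gcong_inv:
  assumes "open V" "f \<in> carrier (grp F V)" "open W" "g \<in> carrier (grp F W)" "gcong x V f W g"
  shows "gcong x V (inv\<^bsub>grp F V\<^esub> f) W (inv\<^bsub>grp F W\<^esub> g)"
proof -
  obtain Z n where Z: "open Z" "x \<in> Z" "Z \<subseteq> V" "Z \<subseteq> W" "n \<in> N Z" "grs F W Z g = grs F V Z f \<otimes>\<^bsub>grp F Z\<^esub> n"
    using assms(5) by (rule gcongE)
  interpret K: group "grp F Z" using grp Z by blast
  define a where "a = grs F V Z f"
  have cl: "a \<in> carrier (grp F Z)" "n \<in> carrier (grp F Z)" using assms Z rs_closed N_sub unfolding a_def by blast+
  have c: "inv\<^bsub>grp F Z\<^esub> (inv\<^bsub>grp F Z\<^esub> a) \<otimes>\<^bsub>grp F Z\<^esub> inv\<^bsub>grp F Z\<^esub> n \<otimes>\<^bsub>grp F Z\<^esub> inv\<^bsub>grp F Z\<^esub> a \<in> N Z"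
    by (intro N_conj N_inv Z) (use cl in auto)
  have "inv\<^bsub>grp F Z\<^esub> a \<otimes>\<^bsub>grp F Z\<^esub> (inv\<^bsub>grp F Z\<^esub> (inv\<^bsub>grp F Z\<^esub> a) \<otimes>\<^bsub>grp F Z\<^esub> inv\<^bsub>grp F Z\<^esub> n \<otimes>\<^bsub>grp F Z\<^esub> inv\<^bsub>grp F Z\<^esub> a)
     = inv\<^bsub>grp F Z\<^esub> (a \<otimes>\<^bsub>grp F Z\<^esub> n)"
    using cl by (simp add: K.m_assoc[symmetric] K.inv_mult_group)
  then show ?thesis
    using Z assms by (intro gcongI[OF Z(1-4) c]) (simp add: rs_inv a_def)
qed

subsection \<open>Sections of the quotient sheaf\<close>

lemma Q_simps:
  "s \<otimes>\<^bsub>grp Q U\<^esub> t = (\<lambda>x\<in>U. \<Union>{gc x (V, f \<otimes>\<^bsub>grp F V\<^esub> g) | V f g. (V, f) \<in> s x \<and> (V, g) \<in> t x})"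
  "\<one>\<^bsub>grp Q U\<^esub> = quot_proj F N U \<one>\<^bsub>grp F U\<^esub>"
  "grs Q U V s = restrict s V"
  by (simp_all add: quot_sheaf_def)

text \<open>Sections of the quotient sheaf are handled only through representatives, which are compatible with
  products and restrictions.\<close>
definition qrep where
  "qrep s V f \<longleftrightarrow> open V \<and> f \<in> carrier (grp F V) \<and> (\<forall>x\<in>V. s x = gc x (V, f))"

lemma Q_carrier:
  "s \<in> carrier (grp Q U) \<longleftrightarrow> s \<in> extensional U \<and> (\<forall>x\<in>U. \<exists>V f. x \<in> V \<and> V \<subseteq> U \<and> qrep s V f)"
proof -
  have "restrict s V = quot_proj F N V f \<longleftrightarrow> (\<forall>x\<in>V. s x = gc x (V, f))" for V f
    by (auto simp: quot_proj_def restrict_def fun_eq_iff)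
  then show ?thesis by (simp add: quot_sheaf_def qrep_def conj_ac)
qed

lemma qrep_proj: "open U \<Longrightarrow> f \<in> carrier (grp F U) \<Longrightarrow> qrep (quot_proj F N U f) U f"
  by (simp add: qrep_def quot_proj_def)

lemma qrep_subset:
  assumes "qrep s V f" "open W" "W \<subseteq> V"
  shows "qrep s W (grs F V W f)"
  unfolding qrep_def
proof (intro conjI ballI)
  have V: "open V" "f \<in> carrier (grp F V)" using assms by (auto simp: qrep_def)
  then show cl: "grs F V W f \<in> carrier (grp F W)" using assms rs_closed by blast
  fix x assume "x \<in> W"
  then have "gc x (V, f) = gc x (W, grs F V W f)"
    by (intro gc_eq V assms cl gcong_restrict)
  then show "s x = gc x (W, grs F V W f)" using assms \<open>x \<in> W\<close> by (auto simp: qrep_def)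
qed (use assms in auto)

lemma qrep_cong: "qrep s V f \<Longrightarrow> (\<And>x. x \<in> V \<Longrightarrow> s x = t x) \<Longrightarrow> qrep t V f"
  by (simp add: qrep_def)

lemma qrep_restrict: "qrep s W f \<Longrightarrow> W \<subseteq> V \<Longrightarrow> qrep (restrict s V) W f"
  by (erule qrep_cong) auto

lemma qrep_one: "open U \<Longrightarrow> open V \<Longrightarrow> V \<subseteq> U \<Longrightarrow> qrep (\<one>\<^bsub>grp Q U\<^esub>) V \<one>\<^bsub>grp F V\<^esub>"
  using qrep_subset[OF qrep_proj[OF _ one_closed], of U V] rs_one[of U V] by (simp add: Q_simps)

lemma qrep_mult:
  assumes "qrep s V f" "qrep t V g" "V \<subseteq> U"
  shows "qrep (s \<otimes>\<^bsub>grp Q U\<^esub> t) V (f \<otimes>\<^bsub>grp F V\<^esub> g)"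
  unfolding qrep_def
proof (intro conjI ballI)
  have V: "open V" "f \<in> carrier (grp F V)" "g \<in> carrier (grp F V)" using assms by (auto simp: qrep_def)
  show "open V" by (rule V)
  show cl: "f \<otimes>\<^bsub>grp F V\<^esub> g \<in> carrier (grp F V)" using V mult_closed by blast
  fix x assume x: "x \<in> V"
  have sx: "s x = gc x (V, f)" "t x = gc x (V, g)" using assms x by (auto simp: qrep_def)
  have self: "(V, f) \<in> s x" "(V, g) \<in> t x" using V x gcong_refl by (auto simp: sx gc_iff)
  have "gc x (W, f' \<otimes>\<^bsub>grp F W\<^esub> g') = gc x (V, f \<otimes>\<^bsub>grp F V\<^esub> g)"
    if "(W, f') \<in> s x" "(W, g') \<in> t x" for W f' g'
  proof -
    have W: "open W" "f' \<in> carrier (grp F W)" "g' \<in> carrier (grp F W)"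
      "gcong x V f W f'" "gcong x V g W g'" using that by (auto simp: sx gc_iff)
    show ?thesis
      by (rule gc_eq[symmetric]) (use V W cl mult_closed gcong_mult in auto)
  qed
  then have "{gc x (W, f' \<otimes>\<^bsub>grp F W\<^esub> g') | W f' g'. (W, f') \<in> s x \<and> (W, g') \<in> t x} = {gc x (V, f \<otimes>\<^bsub>grp F V\<^esub> g)}"
    using self by blast
  then show "(s \<otimes>\<^bsub>grp Q U\<^esub> t) x = gc x (V, f \<otimes>\<^bsub>grp F V\<^esub> g)" using x assms(3) by (auto simp: Q_simps)
qed

lemma Q_extensional: "s \<otimes>\<^bsub>grp Q U\<^esub> t \<in> extensional U" "\<one>\<^bsub>grp Q U\<^esub> \<in> extensional U"
  "s \<in> carrier (grp Q U) \<Longrightarrow> s \<in> extensional U"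
  by (simp_all add: Q_simps quot_proj_def Q_carrier)

lemma Q_eqI:
  assumes "s \<in> extensional U" "t \<in> extensional U"
    and "\<And>x. x \<in> U \<Longrightarrow> \<exists>V f. x \<in> V \<and> qrep s V f \<and> qrep t V f"
  shows "s = t"
proof (rule extensionalityI[OF assms(1,2)])
  fix x assume "x \<in> U"
  then obtain V f where "x \<in> V" "qrep s V f" "qrep t V f" using assms(3) by blast
  then show "s x = t x" by (simp add: qrep_def)
qed

lemma Q_rep1:
  assumes "open U" "s \<in> carrier (grp Q U)" "x \<in> U"
  obtains V f where "open V" "x \<in> V" "V \<subseteq> U" "f \<in> carrier (grp F V)" "qrep s V f"
  using assms unfolding Q_carrier qrep_def by blast

lemma Q_rep2:
  assumes "open U" "s \<in> carrier (grp Q U)" "t \<in> carrier (grp Q U)" "x \<in> U"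
  obtains V f g where "open V" "x \<in> V" "V \<subseteq> U" "f \<in> carrier (grp F V)" "g \<in> carrier (grp F V)"
    "qrep s V f" "qrep t V g"
proof -
  obtain V f where V: "open V" "x \<in> V" "V \<subseteq> U" "f \<in> carrier (grp F V)" "qrep s V f"
    using Q_rep1[OF assms(1,2,4)] by blast
  obtain W g where W: "open W" "x \<in> W" "W \<subseteq> U" "g \<in> carrier (grp F W)" "qrep t W g"
    using Q_rep1[OF assms(1,3,4)] by blast
  have o: "open (V \<inter> W)" "V \<inter> W \<subseteq> V" "V \<inter> W \<subseteq> W" using V W by auto
  show ?thesis
    by (rule that[OF o(1) _ _ _ _ qrep_subset[OF V(5) o(1,2)] qrep_subset[OF W(5) o(1,3)]])
       (use V W o rs_closed in auto)
qed

lemma Q_mult_closed: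
  assumes "open U" "s \<in> carrier (grp Q U)" "t \<in> carrier (grp Q U)"
  shows "s \<otimes>\<^bsub>grp Q U\<^esub> t \<in> carrier (grp Q U)"
  unfolding Q_carrier
proof (intro conjI ballI Q_extensional)
  fix x assume "x \<in> U"
  then obtain V f g where V: "x \<in> V" "V \<subseteq> U" "qrep s V f" "qrep t V g"
    using Q_rep2[OF assms] by metis
  show "\<exists>V f. x \<in> V \<and> V \<subseteq> U \<and> qrep (s \<otimes>\<^bsub>grp Q U\<^esub> t) V f"
    by (intro exI[of _ V] exI[of _ "f \<otimes>\<^bsub>grp F V\<^esub> g"] conjI qrep_mult V)
qed

lemma Q_one_closed: "open U \<Longrightarrow> \<one>\<^bsub>grp Q U\<^esub> \<in> carrier (grp Q U)"
  unfolding Q_carrier using qrep_one[of U U] Q_extensional(2) by blast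

lemma Q_proj_closed: "open U \<Longrightarrow> f \<in> carrier (grp F U) \<Longrightarrow> quot_proj F N U f \<in> carrier (grp Q U)"
  unfolding Q_carrier using qrep_proj by (auto simp: quot_proj_def)

text \<open>Each group law is checked on local representatives; the inverse is glued from the inverses of
  representatives.\<close>
lemma Q_group: 
  assumes U: "open U"
  shows "group (grp Q U)"
proof (rule groupI)
  show "s \<otimes>\<^bsub>grp Q U\<^esub> t \<in> carrier (grp Q U)" if "s \<in> carrier (grp Q U)" "t \<in> carrier (grp Q U)" for s t
    by (rule Q_mult_closed[OF U that])
  show "\<one>\<^bsub>grp Q U\<^esub> \<in> carrier (grp Q U)" by (rule Q_one_closed[OF U])
next
  fix s t u assume h: "s \<in> carrier (grp Q U)" "t \<in> carrier (grp Q U)" "u \<in> carrier (grp Q U)"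
  show "s \<otimes>\<^bsub>grp Q U\<^esub> t \<otimes>\<^bsub>grp Q U\<^esub> u = s \<otimes>\<^bsub>grp Q U\<^esub> (t \<otimes>\<^bsub>grp Q U\<^esub> u)"
  proof (rule Q_eqI[OF Q_extensional(1,1)])
    fix x assume x: "x \<in> U"
    obtain V f g where V: "open V" "x \<in> V" "V \<subseteq> U" "f \<in> carrier (grp F V)" "g \<in> carrier (grp F V)"
      "qrep s V f" "qrep t V g" using Q_rep2[OF U h(1,2) x] by blast
    obtain W k where W: "open W" "x \<in> W" "W \<subseteq> U" "k \<in> carrier (grp F W)" "qrep u W k"
      using Q_rep1[OF U h(3) x] by blast
    let ?Y = "V \<inter> W"
    have o: "open ?Y" "?Y \<subseteq> V" "?Y \<subseteq> W" "?Y \<subseteq> U" using V W by auto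
    interpret K: group "grp F ?Y" using grp o(1) .
    note r = qrep_subset[OF V(6) o(1,2)] qrep_subset[OF V(7) o(1,2)] qrep_subset[OF W(5) o(1,3)]
    have cl: "grs F V ?Y f \<in> carrier (grp F ?Y)" "grs F V ?Y g \<in> carrier (grp F ?Y)" "grs F W ?Y k \<in> carrier (grp F ?Y)"
      using V W o rs_closed by auto
    have "qrep (s \<otimes>\<^bsub>grp Q U\<^esub> t \<otimes>\<^bsub>grp Q U\<^esub> u) ?Y (grs F V ?Y f \<otimes>\<^bsub>grp F ?Y\<^esub> grs F V ?Y g \<otimes>\<^bsub>grp F ?Y\<^esub> grs F W ?Y k)"
      by (intro qrep_mult r o)
    moreover have "qrep (s \<otimes>\<^bsub>grp Q U\<^esub> (t \<otimes>\<^bsub>grp Q U\<^esub> u)) ?Y (grs F V ?Y f \<otimes>\<^bsub>grp F ?Y\<^esub> (grs F V ?Y g \<otimes>\<^bsub>grp F ?Y\<^esub> grs F W ?Y k))"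
      by (intro qrep_mult r o)
    ultimately show "\<exists>V f. x \<in> V \<and> qrep (s \<otimes>\<^bsub>grp Q U\<^esub> t \<otimes>\<^bsub>grp Q U\<^esub> u) V f \<and> qrep (s \<otimes>\<^bsub>grp Q U\<^esub> (t \<otimes>\<^bsub>grp Q U\<^esub> u)) V f"
      using V W cl K.m_assoc by (metis IntI)
  qed
next
  fix s assume s: "s \<in> carrier (grp Q U)"
  show "\<one>\<^bsub>grp Q U\<^esub> \<otimes>\<^bsub>grp Q U\<^esub> s = s"
  proof (rule Q_eqI[OF Q_extensional(1) Q_extensional(3)[OF s]])
    fix x assume x: "x \<in> U"
    obtain V f where V: "open V" "x \<in> V" "V \<subseteq> U" "f \<in> carrier (grp F V)" "qrep s V f"
      using Q_rep1[OF U s x] by blast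
    interpret K: group "grp F V" using grp V(1) .
    have "qrep (\<one>\<^bsub>grp Q U\<^esub> \<otimes>\<^bsub>grp Q U\<^esub> s) V (\<one>\<^bsub>grp F V\<^esub> \<otimes>\<^bsub>grp F V\<^esub> f)"
      by (intro qrep_mult qrep_one U V)
    then show "\<exists>V f. x \<in> V \<and> qrep (\<one>\<^bsub>grp Q U\<^esub> \<otimes>\<^bsub>grp Q U\<^esub> s) V f \<and> qrep s V f"
      using V by (metis K.l_one)
  qed
  define t where "t = (\<lambda>x\<in>U. \<Union>{gc x (V, inv\<^bsub>grp F V\<^esub> f) | V f. (V, f) \<in> s x})"
  have t: "qrep t V (inv\<^bsub>grp F V\<^esub> f)" if V: "open V" "V \<subseteq> U" "f \<in> carrier (grp F V)" "qrep s V f" for V f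
    unfolding qrep_def
  proof (intro conjI ballI V)
    show cl: "inv\<^bsub>grp F V\<^esub> f \<in> carrier (grp F V)" using V inv_closed by blast
    fix x assume x: "x \<in> V"
    have sx: "s x = gc x (V, f)" using V x by (auto simp: qrep_def)
    have "(V, f) \<in> s x" using V x gcong_refl by (auto simp: sx gc_iff)
    moreover have "gc x (W, inv\<^bsub>grp F W\<^esub> g) = gc x (V, inv\<^bsub>grp F V\<^esub> f)" if "(W, g) \<in> s x" for W g
      by (rule gc_eq[symmetric]) (use that V cl inv_closed gcong_inv sx gc_iff in auto)
    ultimately have "{gc x (W, inv\<^bsub>grp F W\<^esub> g) | W g. (W, g) \<in> s x} = {gc x (V, inv\<^bsub>grp F V\<^esub> f)}"
      by blast
    then show "t x = gc x (V, inv\<^bsub>grp F V\<^esub> f)" using x V(2) by (auto simp: t_def)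
  qed
  have "t \<in> carrier (grp Q U)" unfolding Q_carrier
  proof (intro conjI ballI)
    fix x assume x: "x \<in> U"
    obtain V f where V: "open V" "x \<in> V" "V \<subseteq> U" "f \<in> carrier (grp F V)" "qrep s V f"
      using Q_rep1[OF U s x] by blast
    then show "\<exists>V f. x \<in> V \<and> V \<subseteq> U \<and> qrep t V f" using t by blast
  qed (simp add: t_def)
  moreover have "t \<otimes>\<^bsub>grp Q U\<^esub> s = \<one>\<^bsub>grp Q U\<^esub>"
  proof (rule Q_eqI[OF Q_extensional(1,2)])
    fix x assume x: "x \<in> U"
    obtain V f where V: "open V" "x \<in> V" "V \<subseteq> U" "f \<in> carrier (grp F V)" "qrep s V f"
      using Q_rep1[OF U s x] by blast
    interpret K: group "grp F V" using grp V(1) .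
    have "qrep (t \<otimes>\<^bsub>grp Q U\<^esub> s) V (inv\<^bsub>grp F V\<^esub> f \<otimes>\<^bsub>grp F V\<^esub> f)"
      by (intro qrep_mult t V)
    then show "\<exists>V f. x \<in> V \<and> qrep (t \<otimes>\<^bsub>grp Q U\<^esub> s) V f \<and> qrep \<one>\<^bsub>grp Q U\<^esub> V f"
      using V qrep_one[OF U V(1,3)] by (metis K.l_inv)
  qed
  ultimately show "\<exists>t\<in>carrier (grp Q U). t \<otimes>\<^bsub>grp Q U\<^esub> s = \<one>\<^bsub>grp Q U\<^esub>" by blast
qed

lemma Q_comm:
  assumes U: "open U" and s: "s \<in> carrier (grp Q U)" and t: "t \<in> carrier (grp Q U)"
    and comm: "\<And>V f g. open V \<Longrightarrow> f \<in> carrier (grp F V) \<Longrightarrow> g \<in> carrier (grp F V) \<Longrightarrow>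
      \<exists>n\<in>N V. f \<otimes>\<^bsub>grp F V\<^esub> g = g \<otimes>\<^bsub>grp F V\<^esub> f \<otimes>\<^bsub>grp F V\<^esub> n"
  shows "s \<otimes>\<^bsub>grp Q U\<^esub> t = t \<otimes>\<^bsub>grp Q U\<^esub> s"
proof (rule extensionalityI[OF Q_extensional(1,1)])
  fix x assume x: "x \<in> U"
  obtain V f g where V: "open V" "x \<in> V" "V \<subseteq> U" "f \<in> carrier (grp F V)" "g \<in> carrier (grp F V)"
    "qrep s V f" "qrep t V g" using Q_rep2[OF U s t x] by blast
  obtain n where n: "n \<in> N V" "f \<otimes>\<^bsub>grp F V\<^esub> g = g \<otimes>\<^bsub>grp F V\<^esub> f \<otimes>\<^bsub>grp F V\<^esub> n"
    using comm[OF V(1,4,5)] by blast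
  have cl: "f \<otimes>\<^bsub>grp F V\<^esub> g \<in> carrier (grp F V)" "g \<otimes>\<^bsub>grp F V\<^esub> f \<in> carrier (grp F V)"
    using V mult_closed by auto
  have "gcong x V (g \<otimes>\<^bsub>grp F V\<^esub> f) V (f \<otimes>\<^bsub>grp F V\<^esub> g)"
    by (rule gcongI[OF V(1,2) order_refl order_refl n(1)]) (use n V cl in \<open>simp add: rs_id\<close>)
  then have "gc x (V, g \<otimes>\<^bsub>grp F V\<^esub> f) = gc x (V, f \<otimes>\<^bsub>grp F V\<^esub> g)"
    by (intro gc_eq V cl)
  moreover have "(s \<otimes>\<^bsub>grp Q U\<^esub> t) x = gc x (V, f \<otimes>\<^bsub>grp F V\<^esub> g)" "(t \<otimes>\<^bsub>grp Q U\<^esub> s) x = gc x (V, g \<otimes>\<^bsub>grp F V\<^esub> f)"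
    using qrep_mult[OF V(6,7,3)] qrep_mult[OF V(7,6,3)] V(2) unfolding qrep_def by blast+
  ultimately show "(s \<otimes>\<^bsub>grp Q U\<^esub> t) x = (t \<otimes>\<^bsub>grp Q U\<^esub> s) x" by simp
qed

lemma Q_rs_closed:
  assumes "open U" "open V" "V \<subseteq> U" "s \<in> carrier (grp Q U)"
  shows "restrict s V \<in> carrier (grp Q V)"
  unfolding Q_carrier
proof (intro conjI ballI)
  fix x assume x: "x \<in> V"
  obtain W f where W: "open W" "x \<in> W" "W \<subseteq> U" "f \<in> carrier (grp F W)" "qrep s W f"
    using Q_rep1[OF assms(1,4)] x assms(3) by blast
  have "qrep (restrict s V) (W \<inter> V) (grs F W (W \<inter> V) f)"
    by (intro qrep_restrict qrep_subset W) (use W assms in auto)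
  then show "\<exists>W f. x \<in> W \<and> W \<subseteq> V \<and> qrep (restrict s V) W f" using x W by blast
qed auto

lemma Q_presheaf: "grp_presheaf Q"
proof (rule grp_presheaf.intro)
  show "group (grp Q U)" if "open U" for U by (rule Q_group[OF that])
  show "grs Q U V s \<in> carrier (grp Q V)" if "open U" "open V" "V \<subseteq> U" "s \<in> carrier (grp Q U)" for U V s
    using Q_rs_closed[OF that] by (simp add: Q_simps)
  show "grs Q U V (s \<otimes>\<^bsub>grp Q U\<^esub> t) = grs Q U V s \<otimes>\<^bsub>grp Q V\<^esub> grs Q U V t"
    if "V \<subseteq> U" for U V s t
    using that by (auto simp: Q_simps restrict_def fun_eq_iff)
  show "grs Q V W (grs Q U V s) = grs Q U W s" if "W \<subseteq> V" for U V W s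
    using that by (simp add: Q_simps Int_absorb1)
  show "grs Q U U s = s" if "s \<in> carrier (grp Q U)" for U s
    using Q_extensional(3)[OF that] by (simp add: Q_simps extensional_restrict)
qed

text \<open>The refinement consists of all open sets on which one of the given sections has a representative.\<close>
lemma lift_cover:
  assumes "open_cover \<U>" "\<And>U. U \<in> \<U> \<Longrightarrow> q U \<in> carrier (grp Q U)"
  shows "\<exists>\<W> \<tau> T. open_cover \<W> \<and> (\<forall>W\<in>\<W>. open W \<and> \<tau> W \<in> \<U> \<and> W \<subseteq> \<tau> W \<and>
    T W \<in> carrier (grp F W) \<and> qrep (q (\<tau> W)) W (T W))"
proof -
  define \<W> where "\<W> = {W. open W \<and> (\<exists>U f. U \<in> \<U> \<and> W \<subseteq> U \<and> f \<in> carrier (grp F W) \<and> qrep (q U) W f)}"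
  have "\<exists>W\<in>\<W>. x \<in> W" for x
  proof -
    have "x \<in> \<Union>\<U>" using assms(1) by (simp add: open_cover_def)
    then obtain U where U: "U \<in> \<U>" "x \<in> U" by blast
    then have "open U" using assms(1) by (simp add: open_cover_def)
    obtain V f where "open V" "x \<in> V" "V \<subseteq> U" "f \<in> carrier (grp F V)" "qrep (q U) V f"
      using Q_rep1[OF \<open>open U\<close> assms(2)[OF U(1)] U(2)] by blast
    then show ?thesis using U unfolding \<W>_def by blast
  qed
  then have "open_cover \<W>" unfolding open_cover_def by (auto simp: \<W>_def)
  moreover have "\<forall>W\<in>\<W>. \<exists>U f. U \<in> \<U> \<and> W \<subseteq> U \<and> f \<in> carrier (grp F W) \<and> qrep (q U) W f"
    unfolding \<W>_def by blast
  then obtain \<tau> T where "\<forall>W\<in>\<W>. \<tau> W \<in> \<U> \<and> W \<subseteq> \<tau> W \<and> T W \<in> carrier (grp F W) \<and> qrep (q (\<tau> W)) W (T W)"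
    by metis
  moreover have "\<forall>W\<in>\<W>. open W" by (simp add: \<W>_def)
  ultimately show ?thesis by (intro exI[of _ \<W>] exI[of _ \<tau>] exI[of _ T]) simp
qed

lemma proj_Z1:
  assumes Z: "(\<U>, g) \<in> Z1 F"
  shows "(\<U>, \<lambda>U V. quot_proj F N (U \<inter> V) (g U V)) \<in> Z1 Q"
proof (rule grp_presheaf.Z1I[OF Q_presheaf])
  show "open_cover \<U>" using Z by (simp add: Z1_def)
  show "quot_proj F N (U \<inter> V) (g U V) \<in> carrier (grp Q (U \<inter> V))" if "U \<in> \<U>" "V \<in> \<U>" for U V
    using that Z1_open[OF Z] Z1_closed[OF Z] by (intro Q_proj_closed) auto
  fix U V W assume w: "U \<in> \<U>" "V \<in> \<U>" "W \<in> \<U>"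
  let ?I = "U \<inter> V \<inter> W"
  have o: "open U" "open V" "open W" "open ?I" using w Z1_open[OF Z] by auto
  have sub: "?I \<subseteq> U \<inter> V" "?I \<subseteq> V \<inter> W" "?I \<subseteq> U \<inter> W" by auto
  have r: "qrep (restrict (quot_proj F N (A \<inter> B) (g A B)) ?I) ?I (grs F (A \<inter> B) ?I (g A B))"
    if "A \<in> \<U>" "B \<in> \<U>" "?I \<subseteq> A \<inter> B" for A B
    by (intro qrep_restrict qrep_subset[of _ "A \<inter> B"] qrep_proj o that)
       (use that Z1_open[OF Z] Z1_closed[OF Z] in auto)
  have q: "qrep (restrict (quot_proj F N (U \<inter> V) (g U V)) ?I \<otimes>\<^bsub>grp Q ?I\<^esub> restrict (quot_proj F N (V \<inter> W) (g V W)) ?I) ?I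
     (grs F (U \<inter> V) ?I (g U V) \<otimes>\<^bsub>grp F ?I\<^esub> grs F (V \<inter> W) ?I (g V W))"
    by (intro qrep_mult r w sub) auto
  have coc: "grs F (U \<inter> V) ?I (g U V) \<otimes>\<^bsub>grp F ?I\<^esub> grs F (V \<inter> W) ?I (g V W) = grs F (U \<inter> W) ?I (g U W)"
    by (rule Z1_cocycle[OF Z w o(4)]) simp
  show "grs Q (U \<inter> V) ?I (quot_proj F N (U \<inter> V) (g U V)) \<otimes>\<^bsub>grp Q ?I\<^esub>
      grs Q (V \<inter> W) ?I (quot_proj F N (V \<inter> W) (g V W)) = grs Q (U \<inter> W) ?I (quot_proj F N (U \<inter> W) (g U W))"
    unfolding Q_simps(3)
  proof (intro Q_eqI[of _ ?I] Q_extensional(1) restrict_extensional)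
    fix x assume "x \<in> ?I"
    with r[OF w(1,3) sub(3)] q[unfolded coc]
    show "\<exists>Y f. x \<in> Y \<and> qrep (restrict (quot_proj F N (U \<inter> V) (g U V)) ?I \<otimes>\<^bsub>grp Q ?I\<^esub>
        restrict (quot_proj F N (V \<inter> W) (g V W)) ?I) Y f \<and> qrep (restrict (quot_proj F N (U \<inter> W) (g U W)) ?I) Y f"
      by (intro exI[of _ ?I] exI conjI)
  qed
qed

end

section \<open>Lifting cocycles along a filtration\<close>

text \<open>The properties of the filtration by automorphism groups that the climbing uses: S j is the j-th step
  inside P, and the quotients of step j by steps j + 1 and j + 2 are commutative.\<close>
locale grp_filtration = P: grp_presheaf P for P :: "('x::topological_space, 'g) grp_sheaf" +
  fixes S :: "nat \<Rightarrow> 'x set \<Rightarrow> 'g set"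
  assumes S_top: "S 2 U = carrier (grp P U)"
    and S_normal: "2 \<le> j \<Longrightarrow> open U \<Longrightarrow> S j U \<lhd> grp P U"
    and S_antimono: "2 \<le> j \<Longrightarrow> j \<le> m \<Longrightarrow> open U \<Longrightarrow> S m U \<subseteq> S j U"
    and S_rs: "2 \<le> j \<Longrightarrow> open U \<Longrightarrow> open V \<Longrightarrow> V \<subseteq> U \<Longrightarrow> f \<in> S j U \<Longrightarrow> grs P U V f \<in> S j V"
    and S_comm: "2 \<le> j \<Longrightarrow> open U \<Longrightarrow> f \<in> S j U \<Longrightarrow> g \<in> S j U \<Longrightarrow>
      \<exists>n\<in>S (j + 2) U. f \<otimes>\<^bsub>grp P U\<^esub> g = g \<otimes>\<^bsub>grp P U\<^esub> f \<otimes>\<^bsub>grp P U\<^esub> n"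
    and S_local: "2 \<le> j \<Longrightarrow> open U \<Longrightarrow> f \<in> carrier (grp P U) \<Longrightarrow>
      (\<And>x. x \<in> U \<Longrightarrow> \<exists>Z. open Z \<and> x \<in> Z \<and> Z \<subseteq> U \<and> grs P U Z f \<in> S j Z) \<Longrightarrow> f \<in> S j U"
begin

definition G where "G j = \<lparr>grp = (\<lambda>U. (grp P U)\<lparr>carrier := S j U\<rparr>), grs = grs P\<rparr>"

lemma G_simps [simp]:
  "carrier (grp (G j) U) = S j U"
  "monoid.mult (grp (G j) U) = monoid.mult (grp P U)"
  "\<one>\<^bsub>grp (G j) U\<^esub> = \<one>\<^bsub>grp P U\<^esub>"
  "grs (G j) = grs P"
  by (simp_all add: G_def)

lemma G_2: "G 2 = P"
  by (simp add: G_def S_top)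

lemma S_subgroup: "2 \<le> j \<Longrightarrow> open U \<Longrightarrow> subgroup (S j U) (grp P U)"
  using S_normal normal_imp_subgroup by blast

lemma S_sub: "2 \<le> j \<Longrightarrow> open U \<Longrightarrow> f \<in> S j U \<Longrightarrow> f \<in> carrier (grp P U)"
  using S_subgroup subgroup.mem_carrier by metis

lemma S_mult: "2 \<le> j \<Longrightarrow> open U \<Longrightarrow> f \<in> S j U \<Longrightarrow> g \<in> S j U \<Longrightarrow> f \<otimes>\<^bsub>grp P U\<^esub> g \<in> S j U"
  using S_subgroup subgroup.m_closed by metis

lemma G_presheaf: "2 \<le> j \<Longrightarrow> grp_presheaf (G j)"
proof (rule grp_presheaf.intro)
  assume j: "2 \<le> j"
  show "group (grp (G j) U)" if "open U" for U
    unfolding G_def using subgroup.subgroup_is_group[OF S_subgroup[OF j that] P.grp[OF that]] by simp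
qed (simp_all add: S_rs P.rs_mult[OF _ _ _ S_sub S_sub] P.rs_rs[OF _ _ _ _ _ S_sub] P.rs_id[OF _ S_sub])

lemma G_quot: "2 \<le> j \<Longrightarrow> j \<le> m \<Longrightarrow> quot_presheaf (G j) (S m)"
proof (rule quot_presheaf.intro[OF G_presheaf], simp, rule quot_presheaf_axioms.intro)
  assume jm: "2 \<le> j" "j \<le> m"
  show "S m U \<lhd> grp (G j) U" if "open U" for U
  proof -
    interpret K: group "grp P U" using P.grp that .
    show ?thesis unfolding G_def
      using K.normal_restrict_supergroup[OF S_subgroup[OF jm(1) that] S_normal[OF _ that] S_antimono[OF jm that]] jm
      by simp
  qed
  show "grs (G j) U V n \<in> S m V" if "open U" "open V" "V \<subseteq> U" "n \<in> S m U" for U V n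
    using S_rs[OF _ that] jm by simp
qed

abbreviation Q where "Q j m \<equiv> quot_sheaf (G j) (S m)"

abbreviation qmap where "qmap j m \<equiv> quot_map (G j) (S m)"

lemma Z1_G:
  assumes "(\<W>, h) \<in> Z1 (G j)" "\<And>A B. A \<in> \<W> \<Longrightarrow> B \<in> \<W> \<Longrightarrow> h A B \<in> S m (A \<inter> B)"
  shows "(\<W>, h) \<in> Z1 (G m)"
  using assms by (simp add: Z1_def)

lemma Z1_mono: "2 \<le> j \<Longrightarrow> j \<le> m \<Longrightarrow> c \<in> Z1 (G m) \<Longrightarrow> c \<in> Z1 (G j)"
proof -
  assume jm: "2 \<le> j" "j \<le> m" and c: "c \<in> Z1 (G m)"
  obtain \<U> g where [simp]: "c = (\<U>, g)" by (cases c)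
  show ?thesis
    using c S_antimono[OF jm] by (auto intro!: Z1_G[of _ _ m]) (auto simp: Z1_def open_cover_def, blast)
qed

lemma H1_rel_mono:
  assumes jm: "2 \<le> j" "j \<le> m" and r: "(c, d) \<in> H1_rel (G m)"
  shows "(c, d) \<in> H1_rel (G j)"
proof -
  interpret Gm: grp_presheaf "G m" using G_presheaf jm by simp
  interpret Gj: grp_presheaf "G j" using G_presheaf jm by simp
  obtain \<U> g \<V> h where [simp]: "c = (\<U>, g)" "d = (\<V>, h)" by (cases c, cases d)
  have r': "((\<U>, g), (\<V>, h)) \<in> H1_rel (G m)" using r by simp
  obtain \<W> \<tau> \<sigma> l where L: "Gm.H1_link \<U> g \<V> h \<W> \<tau> \<sigma> l" using Gm.H1_rel_link[OF r'] by blast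
  note mem = Gm.H1_link_mem[OF L] and eq = Gm.H1_link_eq[OF L]
  have "((\<U>, g), (\<V>, h)) \<in> H1_rel (G j)"
  proof (rule Gj.H1_relI[of _ _ _ _ \<W> \<tau> \<sigma> l])
    show "\<tau> W \<in> \<U> \<and> W \<subseteq> \<tau> W \<and> \<sigma> W \<in> \<V> \<and> W \<subseteq> \<sigma> W \<and> l W \<in> carrier (grp (G j) W)" if "W \<in> \<W>" for W
      using mem[OF that] S_antimono[OF jm] by auto
    show "grs (G j) (\<tau> W \<inter> \<tau> W') (W \<inter> W') (g (\<tau> W) (\<tau> W')) \<otimes>\<^bsub>grp (G j) (W \<inter> W')\<^esub> grs (G j) W' (W \<inter> W') (l W') =
          grs (G j) W (W \<inter> W') (l W) \<otimes>\<^bsub>grp (G j) (W \<inter> W')\<^esub>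
          grs (G j) (\<sigma> W \<inter> \<sigma> W') (W \<inter> W') (h (\<sigma> W) (\<sigma> W'))" if "W \<in> \<W>" "W' \<in> \<W>" for W W'
      using eq[OF that, of "W \<inter> W'"] mem[OF that(1)] mem[OF that(2)] by (simp add: open_Int)
  qed (use Gm.H1_rel_Z1[OF r'] Z1_mono[OF jm] Gm.H1_link_cover[OF L] in auto)
  then show ?thesis by simp
qed

lemma Q_commute:
  assumes j: "2 \<le> j" "j \<le> m" "m \<le> j + 2" and "open U" "s \<in> carrier (grp (Q j m) U)" "t \<in> carrier (grp (Q j m) U)"
  shows "s \<otimes>\<^bsub>grp (Q j m) U\<^esub> t = t \<otimes>\<^bsub>grp (Q j m) U\<^esub> s"
proof -
  interpret Q: quot_presheaf "G j" "S m" using G_quot j by simp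
  have "2 \<le> m" using j by simp
  show ?thesis
    by (rule Q.Q_comm[OF assms(4-6)])
       (use S_comm[OF j(1)] S_antimono[OF \<open>2 \<le> m\<close> j(3)] in \<open>simp, meson subsetD\<close>)
qed

lemma qmap_rep:
  assumes jm: "2 \<le> j'" "j' \<le> j" "j \<le> m" "j' \<le> m'" "m' \<le> m" and "V \<subseteq> U"
    and s: "quot_presheaf.qrep (G j) (S m) s V f"
  shows "quot_presheaf.qrep (G j') (S m') (qmap j' m' U s) V f"
proof -
  interpret A: quot_presheaf "G j" "S m" using G_quot jm by simp
  interpret B: quot_presheaf "G j'" "S m'" using G_quot jm by simp
  have m': "2 \<le> m'" using jm by simp
  have V: "open V" "f \<in> S j V" using s by (auto simp: A.qrep_def)
  have up: "g \<in> S j' W" if "g \<in> S j W" "open W" for g W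
    using S_antimono[OF jm(1,2) that(2)] that by blast
  show ?thesis unfolding B.qrep_def
  proof (intro conjI ballI V)
    show "f \<in> carrier (grp (G j') V)" using up V by simp
    fix x assume x: "x \<in> V"
    have sx: "s x = A.gc x (V, f)" using s x by (simp add: A.qrep_def)
    have c: "B.gc x p = B.gc x (V, f)" if p: "p \<in> s x" for p
    proof -
      obtain W g where [simp]: "p = (W, g)" by (cases p)
      have "(W, g) \<in> s x" using p by simp
      then have W: "open W" "g \<in> S j W" "A.gcong x V f W g" by (auto simp: sx A.gc_iff)
      from W(3) obtain Z n where Z: "open Z" "x \<in> Z" "Z \<subseteq> V" "Z \<subseteq> W" "n \<in> S m Z"
        "grs P W Z g = grs P V Z f \<otimes>\<^bsub>grp P Z\<^esub> n" by (rule A.gcongE) simp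
      have n: "n \<in> S m' Z" using S_antimono[OF m' jm(5) Z(1)] Z by blast
      have "B.gcong x V f W g" by (rule B.gcongI[OF Z(1-4) n]) (use Z in simp)
      then have "B.gc x (V, f) = B.gc x (W, g)" by (intro B.gc_eq) (use V W up in auto)
      then show ?thesis by simp
    qed
    have "(V, f) \<in> s x" using x V A.gcong_refl[of V f x] by (simp add: sx A.gc_iff)
    then have "\<Union> (B.gc x ` s x) = B.gc x (V, f)" by (intro SUP_eq_const c) auto
    then show "qmap j' m' U s x = B.gc x (V, f)"
      using x assms(6) by (auto simp: quot_map_def)
  qed
qed

lemma qmap_proj:
  assumes jm: "2 \<le> j'" "j' \<le> j" "j \<le> m" "j' \<le> m'" "m' \<le> m" and U: "open U" "f \<in> S j U"
  shows "qmap j' m' U (quot_proj (G j) (S m) U f) = quot_proj (G j') (S m') U f"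
proof -
  interpret A: quot_presheaf "G j" "S m" using G_quot jm by simp
  interpret B: quot_presheaf "G j'" "S m'" using G_quot jm by simp
  have "f \<in> S j' U" using S_antimono[OF jm(1,2) U(1)] U(2) by blast
  then have r: "B.qrep (quot_proj (G j') (S m') U f) U f" using B.qrep_proj U by simp
  have q: "B.qrep (qmap j' m' U (quot_proj (G j) (S m) U f)) U f"
    by (rule qmap_rep[OF jm order_refl A.qrep_proj]) (use U in auto)
  show ?thesis
    by (rule B.Q_eqI[of _ U]) (use r q in \<open>auto simp: quot_map_def quot_proj_def\<close>)
qed

lemma qmap_one:
  assumes jm: "2 \<le> j'" "j' \<le> j" "j \<le> m" "j' \<le> m'" "m' \<le> m" and U: "open U"
  shows "qmap j' m' U \<one>\<^bsub>grp (Q j m) U\<^esub> = \<one>\<^bsub>grp (Q j' m') U\<^esub>"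
proof -
  interpret A: quot_presheaf "G j" "S m" using G_quot jm by simp
  interpret B: quot_presheaf "G j'" "S m'" using G_quot jm by simp
  show ?thesis using qmap_proj[OF jm U A.one_closed[OF U, unfolded G_simps]]
    by (simp add: A.Q_simps B.Q_simps)
qed

text \<open>
  If the class of the projected cocycle is trivial, the trivialising sections of the quotient
  sheaf lift locally, and correcting the cocycle by the lifts moves it into the next step of the
  filtration; it arrives there because membership in that step is a local condition.
\<close>
lemma lift_cocycle:
  assumes j: "2 \<le> j" and Z: "(\<U>, g) \<in> Z1 (G j)"
    and eq: "H1_class (Q j (j + 1)) (\<U>, \<lambda>U V. quot_proj (G j) (S (j + 1)) (U \<inter> V) (g U V)) = H1_base (Q j (j + 1))"
  shows "\<exists>c \<in> Z1 (G (j + 1)). ((\<U>, g), c) \<in> H1_rel (G j)"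
proof -
  interpret Q: quot_presheaf "G j" "S (j + 1)" using G_quot[of j "j + 1"] j by simp
  interpret QQ: grp_presheaf "Q j (j + 1)" by (rule Q.Q_presheaf)
  let ?p = "\<lambda>U V. quot_proj (G j) (S (j + 1)) (U \<inter> V) (g U V)"
  have r: "((\<U>, ?p), ({UNIV}, \<lambda>U V. \<one>\<^bsub>grp (Q j (j + 1)) UNIV\<^esub>)) \<in> H1_rel (Q j (j + 1))"
    by (rule QQ.H1_class_eqD[OF eq[unfolded H1_base_def] Q.proj_Z1[OF Z] QQ.Z1_base])
  obtain \<W> \<tau> \<sigma> l where L: "QQ.H1_link \<U> ?p {UNIV} (\<lambda>U V. \<one>\<^bsub>grp (Q j (j + 1)) UNIV\<^esub>) \<W> \<tau> \<sigma> l"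
    using QQ.H1_rel_link[OF r] by blast
  note mem = QQ.H1_link_mem[OF L]
  have "\<exists>\<W>' \<rho> T. open_cover \<W>' \<and> (\<forall>W\<in>\<W>'. open W \<and> \<rho> W \<in> \<W> \<and> W \<subseteq> \<rho> W \<and>
    T W \<in> carrier (grp (G j) W) \<and> Q.qrep (l (\<rho> W)) W (T W))"
    by (rule Q.lift_cover[OF QQ.H1_link_cover[OF L]]) (use mem in blast)
  then obtain \<W>' \<rho> T where W'c: "open_cover \<W>'"
    and W': "\<And>W. W \<in> \<W>' \<Longrightarrow> open W \<and> \<rho> W \<in> \<W> \<and> W \<subseteq> \<rho> W \<and>
      T W \<in> carrier (grp (G j) W) \<and> Q.qrep (l (\<rho> W)) W (T W)" by blast
  define h where "h A B = inv\<^bsub>grp (G j) (A \<inter> B)\<^esub> (grs (G j) A (A \<inter> B) (T A)) \<otimes>\<^bsub>grp (G j) (A \<inter> B)\<^esub>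
       grs (G j) (\<tau> (\<rho> A) \<inter> \<tau> (\<rho> B)) (A \<inter> B) (g (\<tau> (\<rho> A)) (\<tau> (\<rho> B))) \<otimes>\<^bsub>grp (G j) (A \<inter> B)\<^esub>
       grs (G j) B (A \<inter> B) (T B)" for A B
  have rel: "((\<U>, g), (\<W>', h)) \<in> H1_rel (G j)"
  proof (rule Q.H1_rel_refine[OF Z W'c, of "\<lambda>A. \<tau> (\<rho> A)" T])
    show "\<tau> (\<rho> W) \<in> \<U> \<and> W \<subseteq> \<tau> (\<rho> W) \<and> T W \<in> carrier (grp (G j) W)" if "W \<in> \<W>'" for W
      using W'[OF that] mem[of "\<rho> W"] by blast
  qed (rule h_def)
  have "h A B \<in> S (j + 1) (A \<inter> B)" if w: "A \<in> \<W>'" "B \<in> \<W>'" for A B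
  proof (rule S_local)
    let ?I = "A \<inter> B"
    note wA = W'[OF w(1)] and wB = W'[OF w(2)]
    have mA: "open (\<rho> A) \<and> \<tau> (\<rho> A) \<in> \<U> \<and> \<rho> A \<subseteq> \<tau> (\<rho> A) \<and> \<sigma> (\<rho> A) = UNIV"
      and mB: "open (\<rho> B) \<and> \<tau> (\<rho> B) \<in> \<U> \<and> \<rho> B \<subseteq> \<tau> (\<rho> B) \<and> \<sigma> (\<rho> B) = UNIV"
      using mem[of "\<rho> A"] mem[of "\<rho> B"] wA wB by auto
    show opI: "open ?I" using wA wB by auto
    have opt: "open (\<tau> (\<rho> A) \<inter> \<tau> (\<rho> B))" "?I \<subseteq> \<tau> (\<rho> A) \<inter> \<tau> (\<rho> B)" "?I \<subseteq> \<rho> A" "?I \<subseteq> \<rho> B"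
      "?I \<subseteq> A" "?I \<subseteq> B" "?I \<subseteq> \<rho> A \<inter> \<rho> B"
      using mA mB wA wB Q.Z1_open[OF Z] by auto
    have gcl: "g (\<tau> (\<rho> A)) (\<tau> (\<rho> B)) \<in> carrier (grp (G j) (\<tau> (\<rho> A) \<inter> \<tau> (\<rho> B)))"
      using Q.Z1_closed[OF Z] mA mB by blast
    define a where "a = grs (G j) (\<tau> (\<rho> A) \<inter> \<tau> (\<rho> B)) ?I (g (\<tau> (\<rho> A)) (\<tau> (\<rho> B)))"
    define tA where "tA = grs (G j) A ?I (T A)"
    define tB where "tB = grs (G j) B ?I (T B)"
    interpret K: group "grp (G j) ?I" using Q.grp opI .
    have cl: "a \<in> carrier (grp (G j) ?I)" "tA \<in> carrier (grp (G j) ?I)" "tB \<in> carrier (grp (G j) ?I)"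
      unfolding a_def tA_def tB_def
      by (rule Q.rs_closed[OF opt(1) opI opt(2) gcl], rule Q.rs_closed[OF _ opI opt(5)], simp_all only: wA,
          rule Q.rs_closed[OF _ opI opt(6)], simp_all only: wB)
    have hAB: "h A B = inv\<^bsub>grp (G j) ?I\<^esub> tA \<otimes>\<^bsub>grp (G j) ?I\<^esub> a \<otimes>\<^bsub>grp (G j) ?I\<^esub> tB"
      by (simp only: h_def a_def tA_def tB_def)
    then have hcl: "h A B \<in> carrier (grp (G j) ?I)" using cl by (simp only: K.m_closed K.inv_closed)
    then show "h A B \<in> carrier (grp P ?I)" using S_sub[OF j opI] by simp
    have ra: "Q.qrep (restrict (?p (\<tau> (\<rho> A)) (\<tau> (\<rho> B))) ?I) ?I a"
      unfolding a_def by (intro Q.qrep_restrict Q.qrep_subset[OF Q.qrep_proj] opt gcl opI) auto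
    have rA: "Q.qrep (restrict (l (\<rho> A)) ?I) ?I tA" and rB: "Q.qrep (restrict (l (\<rho> B)) ?I) ?I tB"
    proof -
      have "Q.qrep (l (\<rho> A)) A (T A)" "Q.qrep (l (\<rho> B)) B (T B)" using wA wB by blast+
      note q = this
      show "Q.qrep (restrict (l (\<rho> A)) ?I) ?I tA" unfolding tA_def
        by (rule Q.qrep_restrict[OF Q.qrep_subset[OF q(1) opI opt(5)] order_refl])
      show "Q.qrep (restrict (l (\<rho> B)) ?I) ?I tB" unfolding tB_def
        by (rule Q.qrep_restrict[OF Q.qrep_subset[OF q(2) opI opt(6)] order_refl])
    qed
    have r1: "Q.qrep (restrict \<one>\<^bsub>grp (Q j (j + 1)) UNIV\<^esub> ?I) ?I \<one>\<^bsub>grp (G j) ?I\<^esub>"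
      by (intro Q.qrep_restrict Q.qrep_one opI) auto
    have E: "restrict (?p (\<tau> (\<rho> A)) (\<tau> (\<rho> B))) ?I \<otimes>\<^bsub>grp (Q j (j + 1)) ?I\<^esub> restrict (l (\<rho> B)) ?I =
        restrict (l (\<rho> A)) ?I \<otimes>\<^bsub>grp (Q j (j + 1)) ?I\<^esub> restrict \<one>\<^bsub>grp (Q j (j + 1)) UNIV\<^esub> ?I"
      using QQ.H1_link_eq[OF L _ _ opI opt(7)] wA wB unfolding Q.Q_simps(3) by blast
    note q1 = Q.qrep_mult[OF ra rB order_refl] and q2 = Q.qrep_mult[OF rA r1 order_refl, folded E]
    fix x assume x: "x \<in> ?I"
    have "Q.gc x (?I, tA \<otimes>\<^bsub>grp (G j) ?I\<^esub> \<one>\<^bsub>grp (G j) ?I\<^esub>) = Q.gc x (?I, a \<otimes>\<^bsub>grp (G j) ?I\<^esub> tB)"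
      using q1 q2 x unfolding Q.qrep_def by metis
    then have "Q.gcong x ?I tA ?I (a \<otimes>\<^bsub>grp (G j) ?I\<^esub> tB)"
      using Q.gc_eq_iff[OF opI cl(2) opI _ x] cl by (simp only: K.r_one K.m_closed)
    then obtain Z n where Zn: "open Z" "x \<in> Z" "Z \<subseteq> ?I" "n \<in> S (j + 1) Z"
      "grs (G j) ?I Z (a \<otimes>\<^bsub>grp (G j) ?I\<^esub> tB) = grs (G j) ?I Z tA \<otimes>\<^bsub>grp (G j) Z\<^esub> n"
      by (rule Q.gcongE)
    interpret KZ: group "grp (G j) Z" using Q.grp Zn(1) .
    have nc: "n \<in> carrier (grp (G j) Z)" by (rule Q.N_sub[OF Zn(1,4)])
    have tz: "grs (G j) ?I Z tA \<in> carrier (grp (G j) Z)" using Q.rs_closed[OF opI Zn(1,3) cl(2)] .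
    have "grs (G j) ?I Z (h A B) = grs (G j) ?I Z (inv\<^bsub>grp (G j) ?I\<^esub> tA \<otimes>\<^bsub>grp (G j) ?I\<^esub> (a \<otimes>\<^bsub>grp (G j) ?I\<^esub> tB))"
      unfolding hAB using cl by (simp only: K.m_assoc K.inv_closed)
    also have "\<dots> = inv\<^bsub>grp (G j) Z\<^esub> (grs (G j) ?I Z tA) \<otimes>\<^bsub>grp (G j) Z\<^esub> (grs (G j) ?I Z tA \<otimes>\<^bsub>grp (G j) Z\<^esub> n)"
      unfolding Zn(5)[symmetric] using cl opI Zn(1,3)
      by (simp only: Q.rs_mult Q.rs_inv K.inv_closed K.m_closed)
    also have "\<dots> = n" using nc tz by (simp only: KZ.m_assoc[symmetric] KZ.inv_closed KZ.l_inv KZ.l_one)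
    finally have "grs P ?I Z (h A B) \<in> S (j + 1) Z" using Zn(4) by simp
    then show "\<exists>Z. open Z \<and> x \<in> Z \<and> Z \<subseteq> ?I \<and> grs P ?I Z (h A B) \<in> S (j + 1) Z"
      using Zn by blast
  qed (use j in simp)
  then have "(\<W>', h) \<in> Z1 (G (j + 1))"
    using Z1_G Q.H1_rel_Z1(2)[OF rel] by blast
  then show ?thesis using rel by blast
qed

text \<open>The cocycle itself is a lift of its obstruction to the next quotient, where commutativity turns the cocycle identity into the vanishing of the coboundary.\<close>
lemma obstruction_closed:
  assumes j: "2 \<le> j" and Z: "(\<U>, g) \<in> Z1 (G j)" and w: "U \<in> \<U>" "V \<in> \<U>" "W \<in> \<U>" and I: "I = U \<inter> V \<inter> W"
  defines "t \<equiv> \<lambda>U V. quot_proj (G j) (S (j + 2)) (U \<inter> V) (g U V)"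
  shows "grs (Q j (j + 2)) (V \<inter> W) I (t V W) \<otimes>\<^bsub>grp (Q j (j + 2)) I\<^esub> grs (Q j (j + 2)) (U \<inter> V) I (t U V) =
     grs (Q j (j + 2)) (U \<inter> W) I (t U W) \<otimes>\<^bsub>grp (Q j (j + 2)) I\<^esub> qmap j (j + 2) I \<one>\<^bsub>grp (Q (j + 1) (j + 2)) I\<^esub>"
proof -
  interpret Q: quot_presheaf "G j" "S (j + 2)" using G_quot[of j "j + 2"] j by simp
  interpret QQ: grp_presheaf "Q j (j + 2)" by (rule Q.Q_presheaf)
  have o: "open U" "open V" "open W" "open I" using w Q.Z1_open[OF Z] by (auto simp: I)
  have sub: "I \<subseteq> V \<inter> W" "I \<subseteq> U \<inter> V" "I \<subseteq> U \<inter> W" by (auto simp: I)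
  have Zt: "(\<U>, t) \<in> Z1 (Q j (j + 2))" unfolding t_def by (rule Q.proj_Z1[OF Z])
  have tc: "grs (Q j (j + 2)) (A \<inter> B) I (t A B) \<in> carrier (grp (Q j (j + 2)) I)"
    if "A \<in> \<U>" "B \<in> \<U>" "I \<subseteq> A \<inter> B" for A B
    by (rule QQ.rs_closed) (use that o QQ.Z1_open[OF Zt] QQ.Z1_closed[OF Zt] in auto)
  have "qmap j (j + 2) I \<one>\<^bsub>grp (Q (j + 1) (j + 2)) I\<^esub> = \<one>\<^bsub>grp (Q j (j + 2)) I\<^esub>"
    by (rule qmap_one) (use j o in auto)
  moreover have "grs (Q j (j + 2)) (U \<inter> V) I (t U V) \<otimes>\<^bsub>grp (Q j (j + 2)) I\<^esub> grs (Q j (j + 2)) (V \<inter> W) I (t V W)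
     = grs (Q j (j + 2)) (U \<inter> W) I (t U W)"
    by (rule QQ.Z1_cocycle[OF Zt w o(4)]) (simp add: I)
  moreover have "grs (Q j (j + 2)) (V \<inter> W) I (t V W) \<otimes>\<^bsub>grp (Q j (j + 2)) I\<^esub> grs (Q j (j + 2)) (U \<inter> V) I (t U V) =
     grs (Q j (j + 2)) (U \<inter> V) I (t U V) \<otimes>\<^bsub>grp (Q j (j + 2)) I\<^esub> grs (Q j (j + 2)) (V \<inter> W) I (t V W)"
    by (rule Q_commute) (use j o tc w sub in auto)
  moreover have "grs (Q j (j + 2)) (U \<inter> W) I (t U W) \<otimes>\<^bsub>grp (Q j (j + 2)) I\<^esub> \<one>\<^bsub>grp (Q j (j + 2)) I\<^esub> = grs (Q j (j + 2)) (U \<inter> W) I (t U W)"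
    by (rule monoid.r_one[OF group.is_monoid[OF QQ.grp[OF o(4)]] tc[OF w(1,3) sub(3)]])
  ultimately show ?thesis by (simp only:)
qed

text \<open>
  Lift the sections t to P on a finer cover and take the coboundary e of the lifts. It is trivial in P
  by construction, and the equation between t and a says that it represents a modulo S (k + 2); as a has
  values in step k + 1, so does e.
\<close>
lemma connecting_image:
  assumes k: "2 \<le> k" and Z: "(\<U>, a) \<in> Z1 (Q (k + 1) (k + 2))"
    and t: "\<And>U. U \<in> \<U> \<Longrightarrow> t U \<in> carrier (grp (Q k (k + 2)) U)"
    and eq: "\<And>U V. U \<in> \<U> \<Longrightarrow> V \<in> \<U> \<Longrightarrow>
      grs (Q k (k + 2)) U (U \<inter> V) (t U) \<otimes>\<^bsub>grp (Q k (k + 2)) (U \<inter> V)\<^esub> qmap k (k + 2) (U \<inter> V) (a U V) =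
      grs (Q k (k + 2)) V (U \<inter> V) (t V)"
  shows "\<exists>\<W> e. (\<W>, e) \<in> Z1 (G (k + 1)) \<and> H1_class P (\<W>, e) = H1_base P \<and>
     H1_class (Q (k + 1) (k + 2)) (\<W>, \<lambda>U V. quot_proj (G (k + 1)) (S (k + 2)) (U \<inter> V) (e U V)) =
     H1_class (Q (k + 1) (k + 2)) (\<U>, a)"
proof -
  interpret Q: quot_presheaf "G k" "S (k + 2)" using G_quot[of k "k + 2"] k by simp
  interpret R: quot_presheaf "G (k + 1)" "S (k + 2)" using G_quot[of "k + 1" "k + 2"] k by simp
  interpret RR: grp_presheaf "Q (k + 1) (k + 2)" by (rule R.Q_presheaf)
  have cov: "open_cover \<U>" using Z by (simp add: Z1_def)
  have "\<exists>\<W> \<tau> T. open_cover \<W> \<and> (\<forall>W\<in>\<W>. open W \<and> \<tau> W \<in> \<U> \<and> W \<subseteq> \<tau> W \<and>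
    T W \<in> carrier (grp (G k) W) \<and> Q.qrep (t (\<tau> W)) W (T W))"
    by (rule Q.lift_cover[OF cov]) (rule t)
  then obtain \<W> \<tau> T where Wc: "open_cover \<W>"
    and W: "\<And>W. W \<in> \<W> \<Longrightarrow> open W \<and> \<tau> W \<in> \<U> \<and> W \<subseteq> \<tau> W \<and>
      T W \<in> carrier (grp (G k) W) \<and> Q.qrep (t (\<tau> W)) W (T W)" by blast
  define e where "e A B = inv\<^bsub>grp P (A \<inter> B)\<^esub> (grs P A (A \<inter> B) (T A)) \<otimes>\<^bsub>grp P (A \<inter> B)\<^esub>
       grs P (UNIV \<inter> UNIV) (A \<inter> B) \<one>\<^bsub>grp P UNIV\<^esub> \<otimes>\<^bsub>grp P (A \<inter> B)\<^esub>
       grs P B (A \<inter> B) (T B)" for A B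
  have TP: "T W \<in> carrier (grp P W)" if "W \<in> \<W>" for W using W[OF that] S_sub[OF k] by simp
  have rel: "(({UNIV}, \<lambda>U V. \<one>\<^bsub>grp P UNIV\<^esub>), (\<W>, e)) \<in> H1_rel P"
    by (rule P.H1_rel_refine[OF P.Z1_base Wc, of "\<lambda>W. UNIV" T]) (use TP e_def in auto)
  have key: "e A B \<in> S (k + 1) (A \<inter> B) \<and> R.qrep (a (\<tau> A) (\<tau> B)) (A \<inter> B) (e A B)"
    if w: "A \<in> \<W>" "B \<in> \<W>" for A B
  proof -
    let ?I = "A \<inter> B" and ?J = "\<tau> A \<inter> \<tau> B"
    note wA = W[OF w(1)] and wB = W[OF w(2)]
    have o: "open A" "open B" "open ?I" "open (\<tau> A)" "open (\<tau> B)" "open ?J" "?I \<subseteq> ?J" "?I \<subseteq> A" "?I \<subseteq> B"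
      using wA wB cov by (auto simp: open_cover_def)
    interpret K: group "grp P ?I" using P.grp o(3) .
    define tA where "tA = grs P A ?I (T A)"
    define tB where "tB = grs P B ?I (T B)"
    have tcl: "tA \<in> carrier (grp P ?I)" "tB \<in> carrier (grp P ?I)"
      unfolding tA_def tB_def
      by (rule P.rs_closed[OF o(1,3,8) TP[OF w(1)]], rule P.rs_closed[OF o(2,3,9) TP[OF w(2)]])
    have eAB: "e A B = inv\<^bsub>grp P ?I\<^esub> tA \<otimes>\<^bsub>grp P ?I\<^esub> tB"
      unfolding e_def tA_def[symmetric] tB_def[symmetric] using tcl o by (simp add: P.rs_one)
    then have ecl: "e A B \<in> carrier (grp P ?I)" using tcl by simp
    have acl: "a (\<tau> A) (\<tau> B) \<in> carrier (grp (Q (k + 1) (k + 2)) ?J)"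
      using RR.Z1_closed[OF Z] wA wB by blast
    have loc: "\<exists>Z V f n. open Z \<and> x \<in> Z \<and> Z \<subseteq> ?I \<and> Z \<subseteq> V \<and> R.qrep (a (\<tau> A) (\<tau> B)) V f \<and> n \<in> S (k + 2) Z \<and>
        grs P ?I Z (e A B) = grs P V Z f \<otimes>\<^bsub>grp P Z\<^esub> n" if x: "x \<in> ?I" for x
    proof -
      obtain V f where V: "open V" "x \<in> V" "V \<subseteq> ?J" "f \<in> carrier (grp (G (k + 1)) V)" "R.qrep (a (\<tau> A) (\<tau> B)) V f"
        using R.Q_rep1[OF o(6) acl] x o(7) by blast
      let ?Y = "V \<inter> ?I"
      have Y: "open ?Y" "?Y \<subseteq> V" "?Y \<subseteq> ?I" "?Y \<subseteq> A" "?Y \<subseteq> B" "?Y \<subseteq> ?J" "x \<in> ?Y" using V o x by auto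
      have fk: "f \<in> carrier (grp (G k) V)" using V S_antimono[OF k, of "k + 1" V] by auto
      have q1: "Q.qrep (qmap k (k + 2) ?J (a (\<tau> A) (\<tau> B))) ?Y (grs (G k) V ?Y f)"
        by (rule Q.qrep_subset[OF qmap_rep[OF k _ _ _ _ V(3,5)] Y(1,2)]) auto
      have q2: "Q.qrep (restrict (t (\<tau> A)) ?J) ?Y (grs (G k) A ?Y (T A))"
        and q3: "Q.qrep (restrict (t (\<tau> B)) ?J) ?Y (grs (G k) B ?Y (T B))"
      proof -
        have "Q.qrep (t (\<tau> A)) A (T A)" "Q.qrep (t (\<tau> B)) B (T B)" using wA wB by blast+
        note q = this
        show "Q.qrep (restrict (t (\<tau> A)) ?J) ?Y (grs (G k) A ?Y (T A))"
          by (rule Q.qrep_restrict[OF Q.qrep_subset[OF q(1) Y(1,4)] Y(6)])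
        show "Q.qrep (restrict (t (\<tau> B)) ?J) ?Y (grs (G k) B ?Y (T B))"
          by (rule Q.qrep_restrict[OF Q.qrep_subset[OF q(2) Y(1,5)] Y(6)])
      qed
      have E: "restrict (t (\<tau> A)) ?J \<otimes>\<^bsub>grp (Q k (k + 2)) ?J\<^esub> qmap k (k + 2) ?J (a (\<tau> A) (\<tau> B)) = restrict (t (\<tau> B)) ?J"
        using eq[of "\<tau> A" "\<tau> B"] wA wB unfolding Q.Q_simps(3) by blast
      note q4 = Q.qrep_mult[OF q2 q1 Y(6), unfolded E]
      define f' where "f' = grs P V ?Y f"
      define uA where "uA = grs P A ?Y (T A)"
      define uB where "uB = grs P B ?Y (T B)"
      have cl: "f' \<in> S k ?Y" "uA \<in> S k ?Y" "uB \<in> S k ?Y"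
        using q1 q2 q3 unfolding f'_def uA_def uB_def Q.qrep_def by simp_all
      have "Q.gc x (?Y, uA \<otimes>\<^bsub>grp P ?Y\<^esub> f') = Q.gc x (?Y, uB)"
        using q3 q4 Y(7) unfolding Q.qrep_def f'_def uA_def uB_def by simp
      then have "Q.gcong x ?Y (uA \<otimes>\<^bsub>grp P ?Y\<^esub> f') ?Y uB"
        using Q.gc_eq_iff[OF Y(1) _ Y(1) _ Y(7), of "uA \<otimes>\<^bsub>grp P ?Y\<^esub> f'" uB] cl S_mult[OF k Y(1)] by simp
      then obtain Z n where Zn: "open Z" "x \<in> Z" "Z \<subseteq> ?Y" "n \<in> S (k + 2) Z"
        "grs P ?Y Z uB = grs P ?Y Z (uA \<otimes>\<^bsub>grp P ?Y\<^esub> f') \<otimes>\<^bsub>grp P Z\<^esub> n"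
        by (rule Q.gcongE) simp
      interpret KZ: group "grp P Z" using P.grp Zn(1) .
      have fP: "f \<in> carrier (grp P V)" using fk S_sub[OF k V(1)] by simp
      have zz: "Z \<subseteq> A" "Z \<subseteq> B" "Z \<subseteq> ?I" "Z \<subseteq> V" using Zn Y by auto
      have cz: "grs P A Z (T A) \<in> carrier (grp P Z)" "grs P V Z f \<in> carrier (grp P Z)" "n \<in> carrier (grp P Z)"
        using P.rs_closed o TP w V fP Zn zz S_sub[of "k + 2" Z n] by auto
      have "grs P B Z (T B) = grs P A Z (T A) \<otimes>\<^bsub>grp P Z\<^esub> grs P V Z f \<otimes>\<^bsub>grp P Z\<^esub> n"
        using Zn(5) Zn(1,3) Y V(1) o TP w fP zz unfolding uA_def uB_def f'_def
        by (simp add: P.rs_mult P.rs_closed P.rs_rs)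
      moreover have "grs P ?I Z (e A B) = inv\<^bsub>grp P Z\<^esub> (grs P A Z (T A)) \<otimes>\<^bsub>grp P Z\<^esub> grs P B Z (T B)"
        unfolding eAB tA_def tB_def using Zn(1) zz o TP w
        by (simp add: P.rs_mult P.rs_closed P.rs_rs P.rs_inv P.inv_closed)
      ultimately have "grs P ?I Z (e A B) = inv\<^bsub>grp P Z\<^esub> (grs P A Z (T A)) \<otimes>\<^bsub>grp P Z\<^esub>
          (grs P A Z (T A) \<otimes>\<^bsub>grp P Z\<^esub> grs P V Z f \<otimes>\<^bsub>grp P Z\<^esub> n)" by simp
      also have "\<dots> = grs P V Z f \<otimes>\<^bsub>grp P Z\<^esub> n"
        using cz by (simp add: KZ.m_assoc[symmetric])
      finally show ?thesis using Zn zz V by blast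
    qed
    have eS: "e A B \<in> S (k + 1) ?I"
    proof (rule S_local[OF _ o(3) ecl])
      fix x assume "x \<in> ?I"
      from loc[OF this] obtain Z V f n where z: "open Z" "x \<in> Z" "Z \<subseteq> ?I" "Z \<subseteq> V" "R.qrep (a (\<tau> A) (\<tau> B)) V f" "n \<in> S (k + 2) Z"
        "grs P ?I Z (e A B) = grs P V Z f \<otimes>\<^bsub>grp P Z\<^esub> n" by (elim exE conjE) (rule that)
      have "open V" "f \<in> S (k + 1) V" using z(5) unfolding R.qrep_def G_simps by blast+
      then have "grs P V Z f \<in> S (k + 1) Z" using z(1,4) k by (intro S_rs) auto
      moreover have "n \<in> S (k + 1) Z" using z S_antimono[of "k + 1" "k + 2" Z] k by auto
      ultimately have "grs P ?I Z (e A B) \<in> S (k + 1) Z" using S_mult[of "k + 1" Z] k z by simp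
      then show "\<exists>Z. open Z \<and> x \<in> Z \<and> Z \<subseteq> ?I \<and> grs P ?I Z (e A B) \<in> S (k + 1) Z" using z by blast
    qed (use k in simp)
    moreover have "R.qrep (a (\<tau> A) (\<tau> B)) ?I (e A B)"
      unfolding R.qrep_def
    proof (intro conjI ballI)
      fix x assume x: "x \<in> ?I"
      from loc[OF this] obtain Z V f n where z: "open Z" "x \<in> Z" "Z \<subseteq> ?I" "Z \<subseteq> V" "R.qrep (a (\<tau> A) (\<tau> B)) V f" "n \<in> S (k + 2) Z"
        "grs P ?I Z (e A B) = grs P V Z f \<otimes>\<^bsub>grp P Z\<^esub> n" by (elim exE conjE) (rule that)
      have "R.gcong x V f ?I (e A B)" by (rule R.gcongI[OF z(1,2,4,3,6)]) (use z in simp)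
      moreover have "open V" "f \<in> S (k + 1) V" using z(5) unfolding R.qrep_def G_simps by blast+
      ultimately have "R.gc x (V, f) = R.gc x (?I, e A B)"
        by (intro R.gc_eq) (use eS o in auto)
      moreover have "a (\<tau> A) (\<tau> B) x = R.gc x (V, f)" using z(2,4,5) unfolding R.qrep_def by blast
      ultimately show "a (\<tau> A) (\<tau> B) x = R.gc x (?I, e A B)" by simp
    qed (use o eS in auto)
    ultimately show ?thesis ..
  qed
  have "(\<W>, e) \<in> Z1 (G 2)" using P.H1_rel_Z1(2)[OF rel] by (simp only: G_2)
  then have Ze: "(\<W>, e) \<in> Z1 (G (k + 1))" by (rule Z1_G) (use key in blast)
  have r: "((\<U>, a), (\<W>, \<lambda>U V. quot_proj (G (k + 1)) (S (k + 2)) (U \<inter> V) (e U V))) \<in> H1_rel (Q (k + 1) (k + 2))"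
  proof (rule RR.H1_rel_refine[OF Z Wc, of \<tau> "\<lambda>W. \<one>\<^bsub>grp (Q (k + 1) (k + 2)) W\<^esub>"])
    show "\<tau> W \<in> \<U> \<and> W \<subseteq> \<tau> W \<and> \<one>\<^bsub>grp (Q (k + 1) (k + 2)) W\<^esub> \<in> carrier (grp (Q (k + 1) (k + 2)) W)" if "W \<in> \<W>" for W
      using W[OF that] RR.one_closed by blast
    fix A B assume w: "A \<in> \<W>" "B \<in> \<W>"
    let ?I = "A \<inter> B" and ?J = "\<tau> A \<inter> \<tau> B"
    have o: "open A" "open B" "open ?I" "open ?J" "?I \<subseteq> ?J" "?I \<subseteq> A" "?I \<subseteq> B"
      using W[OF w(1)] W[OF w(2)] cov by (auto simp: open_cover_def)
    interpret K: group "grp (Q (k + 1) (k + 2)) ?I" using RR.grp o(3) .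
    have acl: "a (\<tau> A) (\<tau> B) \<in> carrier (grp (Q (k + 1) (k + 2)) ?J)"
      using RR.Z1_closed[OF Z] W[OF w(1)] W[OF w(2)] by blast
    have "quot_proj (G (k + 1)) (S (k + 2)) ?I (e A B) = restrict (a (\<tau> A) (\<tau> B)) ?I"
      unfolding quot_proj_def
    proof (rule restrict_ext)
      fix x assume "x \<in> ?I"
      then show "R.gc x (?I, e A B) = a (\<tau> A) (\<tau> B) x"
        using key[OF w] unfolding R.qrep_def by metis
    qed
    then show "quot_proj (G (k + 1)) (S (k + 2)) ?I (e A B) =
       inv\<^bsub>grp (Q (k + 1) (k + 2)) ?I\<^esub> grs (Q (k + 1) (k + 2)) A ?I \<one>\<^bsub>grp (Q (k + 1) (k + 2)) A\<^esub>
       \<otimes>\<^bsub>grp (Q (k + 1) (k + 2)) ?I\<^esub> grs (Q (k + 1) (k + 2)) ?J ?I (a (\<tau> A) (\<tau> B))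
       \<otimes>\<^bsub>grp (Q (k + 1) (k + 2)) ?I\<^esub> grs (Q (k + 1) (k + 2)) B ?I \<one>\<^bsub>grp (Q (k + 1) (k + 2)) B\<^esub>"
      unfolding RR.rs_one[OF o(1,3,6)] RR.rs_one[OF o(2,3,7)]
      using RR.rs_closed[OF o(4,3,5) acl]
      by (simp only: K.inv_one K.l_one K.r_one R.Q_simps(3))
  qed
  show ?thesis
    using RR.H1_class_eq[OF r] P.H1_class_eq[OF rel] Ze
    by (intro exI[of _ \<W>] exI[of _ e]) (simp only: H1_base_def simp_thms)
qed

end

section \<open>The filtration by automorphism groups and the obstruction complex\<close>

context bundle_model
begin

lemma G_carrier: "carrier (grp (G_sheaf M k) U) = G_sec M k U"
  by (simp add: G_sec_def)

lemma G_sheaf_presheaf: "grp_presheaf (G_sheaf M k)"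
proof (rule grp_presheaf.intro)
  show "group (grp (G_sheaf M k) U)" for U
    unfolding G_sheaf_grp by (rule subgroup.subgroup_is_group[OF G_sec_subgroup families_group])
  fix U V :: "'x set" and f assume V: "V \<subseteq> U" and f: "f \<in> carrier (grp (G_sheaf M k) U)"
  then have f': "f \<in> G_sec M k U" by (simp add: G_carrier)
  show "grs (G_sheaf M k) U V f \<in> carrier (grp (G_sheaf M k) V)"
    unfolding G_carrier G_sheaf_grs by (rule G_sec_rs[OF V f'])
  show "grs (G_sheaf M k) V W (grs (G_sheaf M k) U V f) = grs (G_sheaf M k) U W f" if "W \<subseteq> V" for W
  proof -
    have "opens V \<inter> opens W = opens W" using that by (auto simp: opens_def)
    then show ?thesis by (simp add: G_sheaf_grs)
  qed
  fix g assume g: "g \<in> carrier (grp (G_sheaf M k) U)"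
  then have g': "g \<in> G_sec M k U" by (simp add: G_carrier)
  note fg = G_sec_families[OF f'] G_sec_families[OF g']
  have "f \<otimes>\<^bsub>families U\<^esub> g \<in> G_sec M k U" by (rule subgroup.m_closed[OF G_sec_subgroup f' g'])
  note m = G_sec_families[OF G_sec_rs[OF V this]]
  note r = G_sec_families[OF G_sec_rs[OF V f']] G_sec_families[OF G_sec_rs[OF V g']]
  have "restrict (f \<otimes>\<^bsub>families U\<^esub> g) (opens V) = restrict f (opens V) \<otimes>\<^bsub>families V\<^esub> restrict g (opens V)"
  proof (rule families_eqI[OF m])
    show "restrict f (opens V) \<otimes>\<^bsub>families V\<^esub> restrict g (opens V) \<in> carrier (families V)"
      using group.is_monoid[OF families_group] r by (rule monoid.m_closed)
    fix W u assume W: "W \<in> opens V" "u \<in> sections W"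
    then show "restrict (f \<otimes>\<^bsub>families U\<^esub> g) (opens V) W u =
      (restrict f (opens V) \<otimes>\<^bsub>families V\<^esub> restrict g (opens V)) W u"
      by (simp add: families_mult[OF r W] families_mult[OF fg opens_mono[OF V W(1)] W(2)])
  qed
  then show "grs (G_sheaf M k) U V (f \<otimes>\<^bsub>grp (G_sheaf M k) U\<^esub> g) =
    grs (G_sheaf M k) U V f \<otimes>\<^bsub>grp (G_sheaf M k) V\<^esub> grs (G_sheaf M k) U V g"
    unfolding G_sheaf_grs G_sheaf_grp by simp
next
  fix U f assume "f \<in> carrier (grp (G_sheaf M k) U)"
  then show "grs (G_sheaf M k) U U f = f"
    unfolding G_sheaf_grs G_carrier using G_sec_restrict_ident[OF G_sec_families] by blast
qed

lemma G2_inv: "\<alpha> \<in> G_sec M 2 U \<Longrightarrow> inv\<^bsub>grp (G_sheaf M 2) U\<^esub> \<alpha> = inv\<^bsub>families U\<^esub> \<alpha>"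
  unfolding G_sheaf_grp by (rule group.m_inv_consistent[OF families_group G_sec_subgroup])

lemma G2_mult: "\<alpha> \<otimes>\<^bsub>grp (G_sheaf M 2) U\<^esub> \<beta> = \<alpha> \<otimes>\<^bsub>families U\<^esub> \<beta>"
  by (simp add: G_sheaf_grp)

lemma G_sec_inv: "\<alpha> \<in> G_sec M k U \<Longrightarrow> inv\<^bsub>families U\<^esub> \<alpha> \<in> G_sec M k U"
  by (rule subgroup.m_inv_closed[OF G_sec_subgroup])

lemma G_sec_mult: "\<alpha> \<in> G_sec M k U \<Longrightarrow> \<beta> \<in> G_sec M k U \<Longrightarrow> \<alpha> \<otimes>\<^bsub>families U\<^esub> \<beta> \<in> G_sec M k U"
  by (rule subgroup.m_closed[OF G_sec_subgroup])

lemma G_sec_raiseI: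
  assumes "\<alpha> \<in> G_sec M 2 U"
    and "\<And>V u. V \<in> opens U \<Longrightarrow> u \<in> sections V \<Longrightarrow> (\<lambda>i x K. \<alpha> V u i x K - u i x K) \<in> J_pow M k V"
  shows "\<alpha> \<in> G_sec M k U"
  using assms by (simp add: G_sec_iff)

text \<open>A conjugate of b, minus the identity, is a applied to the displacement of some section under b; and a
  preserves the order of sections.\<close>
lemma G_sec_normal:
  assumes j: "2 \<le> j"
  shows "G_sec M j U \<lhd> grp (G_sheaf M 2) U"
proof -
  interpret K: group "grp (G_sheaf M 2) U"
    unfolding G_sheaf_grp by (rule subgroup.subgroup_is_group[OF G_sec_subgroup families_group])
  show ?thesis unfolding K.normal_inv_iff
  proof (intro conjI ballI)
    show "subgroup (G_sec M j U) (grp (G_sheaf M 2) U)"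
      unfolding G_sheaf_grp
      by (rule group.subgroup_incl[OF families_group G_sec_subgroup G_sec_subgroup G_sec_mono[OF j]])
    fix \<alpha> \<beta> assume "\<alpha> \<in> carrier (grp (G_sheaf M 2) U)" and b: "\<beta> \<in> G_sec M j U"
    then have a: "\<alpha> \<in> G_sec M 2 U" by (simp add: G_carrier)
    have b2: "\<beta> \<in> G_sec M 2 U" using b G_sec_mono[OF j] by blast
    let ?c = "\<alpha> \<otimes>\<^bsub>families U\<^esub> \<beta> \<otimes>\<^bsub>families U\<^esub> inv\<^bsub>families U\<^esub> \<alpha>"
    have ab: "\<alpha> \<otimes>\<^bsub>families U\<^esub> \<beta> \<in> G_sec M 2 U" and ai: "inv\<^bsub>families U\<^esub> \<alpha> \<in> G_sec M 2 U"
      using G_sec_mult[OF a b2] G_sec_inv[OF a] .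
    have "?c \<in> G_sec M j U"
    proof (rule G_sec_raiseI)
      show "?c \<in> G_sec M 2 U" by (rule G_sec_mult[OF ab ai])
      fix V u assume V: "V \<in> opens U" "u \<in> sections V"
      define w where "w = (inv\<^bsub>families U\<^esub> \<alpha>) V u"
      have w: "w \<in> sections V" "\<alpha> V w = u"
        unfolding w_def using families_inv(2,3)[OF G_sec_families[OF a] V] by auto
      have "?c V u = \<alpha> V (\<beta> V w)"
        unfolding w_def using G_sec_families[OF ab] G_sec_families[OF ai] G_sec_families[OF a] G_sec_families[OF b2]
          V w[unfolded w_def] by (simp add: families_mult)
      then have "(\<lambda>i x K. ?c V u i x K - u i x K) = \<alpha> V (\<lambda>i x K. \<beta> V w i x K - w i x K)"
        using G_sec_diff[OF a V(1) G_sec_closed[OF b V(1) w(1)] w(1)] w(2) by simp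
      also have "\<dots> \<in> J_pow M j V" by (rule G_sec_J_pow[OF a V(1) G_sec_J[OF b V(1) w(1)]])
      finally show "(\<lambda>i x K. ?c V u i x K - u i x K) \<in> J_pow M j V" .
    qed
    then show "\<alpha> \<otimes>\<^bsub>grp (G_sheaf M 2) U\<^esub> \<beta> \<otimes>\<^bsub>grp (G_sheaf M 2) U\<^esub> inv\<^bsub>grp (G_sheaf M 2) U\<^esub> \<alpha> \<in> G_sec M j U"
      by (simp add: G2_mult G2_inv[OF a])
  qed
qed

text \<open>
  With D = f - 1 and E = g - 1, the difference of the two products is D E - E D. Both D and E send
  every section to order j, and a further application raises the order by two.
\<close>
lemma G_sec_commutator:
  assumes j: "2 \<le> j" and f: "f \<in> G_sec M j U" and g: "g \<in> G_sec M j U"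
  shows "\<exists>n\<in>G_sec M (j + 2) U. f \<otimes>\<^bsub>grp (G_sheaf M 2) U\<^esub> g =
     g \<otimes>\<^bsub>grp (G_sheaf M 2) U\<^esub> f \<otimes>\<^bsub>grp (G_sheaf M 2) U\<^esub> n"
proof -
  interpret K: group "families U" by (rule families_group)
  have f2: "f \<in> G_sec M 2 U" and g2: "g \<in> G_sec M 2 U" using f g G_sec_mono[OF j] by blast+
  note ff = G_sec_families[OF f] and fg = G_sec_families[OF g]
  let ?fg = "f \<otimes>\<^bsub>families U\<^esub> g" and ?gf = "g \<otimes>\<^bsub>families U\<^esub> f"
  let ?n = "inv\<^bsub>families U\<^esub> ?gf \<otimes>\<^bsub>families U\<^esub> ?fg"
  have m: "?fg \<in> G_sec M 2 U" "?gf \<in> G_sec M 2 U" "inv\<^bsub>families U\<^esub> ?gf \<in> G_sec M 2 U"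
    using G_sec_mult[OF f2 g2] G_sec_mult[OF g2 f2] G_sec_inv[OF G_sec_mult[OF g2 f2]] .
  have "?n \<in> G_sec M (j + 2) U"
  proof (rule G_sec_raiseI)
    show "?n \<in> G_sec M 2 U" by (rule G_sec_mult[OF m(3,1)])
    fix V u assume V: "V \<in> opens U" "u \<in> sections V"
    note fu = G_sec_closed[OF f V] and gu = G_sec_closed[OF g V]
    note fgu = G_sec_closed[OF f V(1) gu] and gfu = G_sec_closed[OF g V(1) fu]
    let ?D = "\<lambda>i x K. f V u i x K - u i x K" and ?E = "\<lambda>i x K. g V u i x K - u i x K"
    have D: "?D \<in> J_pow M j V" and E: "?E \<in> J_pow M j V" using G_sec_J[OF f V] G_sec_J[OF g V] .
    have 1: "(\<lambda>i x K. f V ?E i x K - ?E i x K) \<in> J_pow M (j + 2) V" by (rule G_sec_raise[OF f2 V(1) E])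
    have 2: "(\<lambda>i x K. g V ?D i x K - ?D i x K) \<in> J_pow M (j + 2) V" by (rule G_sec_raise[OF g2 V(1) D])
    have eq: "(\<lambda>i x K. f V (g V u) i x K - g V (f V u) i x K) =
      (\<lambda>i x K. (f V ?E i x K - ?E i x K) - (g V ?D i x K - ?D i x K))"
      unfolding G_sec_diff[OF f V(1) gu V(2)] G_sec_diff[OF g V(1) fu V(2)] by (simp add: fun_eq_iff)
    have w: "(\<lambda>i x K. f V (g V u) i x K - g V (f V u) i x K) \<in> J_pow M (j + 2) V"
      unfolding eq by (rule J_pow_diff[OF 1 2])
    have "?n V u = (inv\<^bsub>families U\<^esub> ?gf) V (f V (g V u))"
      using families_mult[OF G_sec_families[OF m(3)] G_sec_families[OF m(1)] V] families_mult[OF ff fg V] by simp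
    moreover have "(inv\<^bsub>families U\<^esub> ?gf) V (g V (f V u)) = u"
    proof -
      have "(inv\<^bsub>families U\<^esub> ?gf \<otimes>\<^bsub>families U\<^esub> ?gf) V u = u"
        using ff fg by (simp add: families_one V)
      then show ?thesis
        using families_mult[OF G_sec_families[OF m(3)] G_sec_families[OF m(2)] V] families_mult[OF fg ff V] by simp
    qed
    ultimately have "(\<lambda>i x K. ?n V u i x K - u i x K) =
      (inv\<^bsub>families U\<^esub> ?gf) V (\<lambda>i x K. f V (g V u) i x K - g V (f V u) i x K)"
      using G_sec_diff[OF m(3) V(1) fgu gfu] by simp
    also have "\<dots> \<in> J_pow M (j + 2) V" by (rule G_sec_J_pow[OF m(3) V(1) w])
    finally show "(\<lambda>i x K. ?n V u i x K - u i x K) \<in> J_pow M (j + 2) V" .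
  qed
  moreover have "?fg = ?gf \<otimes>\<^bsub>families U\<^esub> ?n" using ff fg by (simp add: K.m_assoc[symmetric])
  ultimately show ?thesis unfolding G2_mult by blast
qed

lemma G_sec_local:
  assumes f: "f \<in> G_sec M 2 U"
    and loc: "\<And>x. x \<in> U \<Longrightarrow> \<exists>Z. open Z \<and> x \<in> Z \<and> Z \<subseteq> U \<and> restrict f (opens Z) \<in> G_sec M j Z"
  shows "f \<in> G_sec M j U"
proof (rule G_sec_raiseI[OF f])
  fix V u assume V: "V \<in> opens U" "u \<in> sections V"
  note fu = G_sec_closed[OF f V]
  show "(\<lambda>i x K. f V u i x K - u i x K) \<in> J_pow M j V"
  proof (rule J_pow_local[OF sections_diff[OF fu V(2)]])
    fix x assume x: "x \<in> V"
    then obtain Z where Z: "open Z" "x \<in> Z" "Z \<subseteq> U" "restrict f (opens Z) \<in> G_sec M j Z"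
      using loc[of x] V by (auto simp: opens_def)
    let ?W = "V \<inter> Z"
    have W: "?W \<in> opens V" "?W \<in> opens Z" "?W \<subseteq> V" using V Z by (auto simp: opens_def)
    have "(\<lambda>i x K. restrict f (opens Z) ?W (sec_rs ?W u) i x K - sec_rs ?W u i x K) \<in> J_pow M j ?W"
      by (rule G_sec_J[OF Z(4) W(2) sec_rs_sections[OF V(2) W(3)]])
    moreover have "sec_rs ?W (\<lambda>i x K. f V u i x K - u i x K) =
      (\<lambda>i x K. restrict f (opens Z) ?W (sec_rs ?W u) i x K - sec_rs ?W u i x K)"
      using G_sec_hom(5)[OF f V W(1), symmetric] W(2) by (auto simp: sec_rs_def fun_eq_iff)
    ultimately show "\<exists>W. x \<in> W \<and> sec_rs W (\<lambda>i x K. f V u i x K - u i x K) \<in> J_pow M j W"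
      using x Z(2) by (intro exI[of _ ?W]) simp
  qed
qed

lemma G_sec_trivial:
  assumes "r < j" "f \<in> G_sec M j U" "V \<in> opens U" "u \<in> sections V"
  shows "f V u = u"
proof -
  have "(\<lambda>i x K. f V u i x K - u i x K) = (\<lambda>i x K. 0)"
    by (rule J_pow_above_rank[OF assms(1) G_sec_J[OF assms(2-4)]])
  then show ?thesis by (simp add: fun_eq_iff)
qed

sublocale filt: grp_filtration "G_sheaf M 2" "G_sec M"
proof (intro grp_filtration.intro G_sheaf_presheaf grp_filtration_axioms.intro)
  show "G_sec M 2 U = carrier (grp (G_sheaf M 2) U)" for U by (simp add: G_carrier)
  show "G_sec M j U \<lhd> grp (G_sheaf M 2) U" if "2 \<le> j" for j U by (rule G_sec_normal[OF that])
  show "G_sec M m U \<subseteq> G_sec M j U" if "j \<le> m" for j m U by (rule G_sec_mono[OF that])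
  show "grs (G_sheaf M 2) U V f \<in> G_sec M j V" if "V \<subseteq> U" "f \<in> G_sec M j U" for j U V f
    unfolding G_sheaf_grs by (rule G_sec_rs[OF that])
  show "\<exists>n\<in>G_sec M (j + 2) U. f \<otimes>\<^bsub>grp (G_sheaf M 2) U\<^esub> g =
     g \<otimes>\<^bsub>grp (G_sheaf M 2) U\<^esub> f \<otimes>\<^bsub>grp (G_sheaf M 2) U\<^esub> n"
    if "2 \<le> j" "f \<in> G_sec M j U" "g \<in> G_sec M j U" for j U f g
    by (rule G_sec_commutator[OF that])
  show "f \<in> G_sec M j U" if "f \<in> carrier (grp (G_sheaf M 2) U)"
    "\<And>x. x \<in> U \<Longrightarrow> \<exists>Z. open Z \<and> x \<in> Z \<and> Z \<subseteq> U \<and> grs (G_sheaf M 2) U Z f \<in> G_sec M j Z" for j U f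
    by (rule G_sec_local) (use that in \<open>auto simp: G_carrier G_sheaf_grs\<close>)
qed

lemma G_eq: "filt.G j = G_sheaf M j"
proof (rule grp_sheaf.equality)
  show "grp (filt.G j) = grp (G_sheaf M j)" by (rule ext) (simp add: filt.G_def G_sheaf_grp)
  show "grs (filt.G j) = grs (G_sheaf M j)" by (simp add: filt.G_def fun_eq_iff G_sheaf_grs)
qed simp

lemma G_quot_eq: "G_quot M j m = filt.Q j m"
  by (simp add: G_quot_def G_eq)

lemma obstr_sheaf_eq: "2 \<le> j \<Longrightarrow> obstr_sheaf M (int j) = filt.Q j (j + 1)"
  by (simp add: obstr_sheaf_def G_quot_eq)

lemma obstr_sheaf_Suc: "2 \<le> j \<Longrightarrow> obstr_sheaf M (int j + 1) = filt.Q (j + 1) (j + 2)"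
  using obstr_sheaf_eq[of "j + 1"] by (simp add: add.commute)

lemma trivial_presheaf: "grp_presheaf (trivial_sheaf :: ('x, ('x, ('x, 'i) aut) quot) grp_sheaf)"
proof (rule grp_presheaf.intro)
  show "group (grp (trivial_sheaf :: ('x, ('x, ('x, 'i) aut) quot) grp_sheaf) U)" for U
    by (rule groupI) (auto simp: trivial_sheaf_def)
qed (auto simp: trivial_sheaf_def fun_eq_iff)

lemma obstr_presheaf: "grp_presheaf (obstr_sheaf M j)"
proof (cases "2 \<le> j")
  case True
  then have "obstr_sheaf M j = filt.Q (nat j) (nat j + 1)" using obstr_sheaf_eq[of "nat j"] by simp
  moreover have "quot_presheaf (filt.G (nat j)) (G_sec M (nat j + 1))"
    by (rule filt.G_quot) (use True in auto)
  ultimately show ?thesis using quot_presheaf.Q_presheaf by metis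
next
  case False
  then show ?thesis by (simp add: obstr_sheaf_def trivial_presheaf)
qed

lemma obstr_comm:
  assumes "open U" "s \<in> carrier (grp (obstr_sheaf M j) U)" "t \<in> carrier (grp (obstr_sheaf M j) U)"
  shows "s \<otimes>\<^bsub>grp (obstr_sheaf M j) U\<^esub> t = t \<otimes>\<^bsub>grp (obstr_sheaf M j) U\<^esub> s"
proof (cases "2 \<le> j")
  case True
  then have e: "obstr_sheaf M j = filt.Q (nat j) (nat j + 1)" using obstr_sheaf_eq[of "nat j"] by simp
  show ?thesis unfolding e
    by (rule filt.Q_commute) (use True assms e in auto)
next
  case False
  then show ?thesis by (simp add: obstr_sheaf_def trivial_sheaf_def)
qed

lemma H1_unit:
  assumes "C \<in> carrier (H1 (obstr_sheaf M j))"
  shows "\<one>\<^bsub>H1 (obstr_sheaf M j)\<^esub> \<otimes>\<^bsub>H1 (obstr_sheaf M j)\<^esub> C = C" "C \<otimes>\<^bsub>H1 (obstr_sheaf M j)\<^esub> \<one>\<^bsub>H1 (obstr_sheaf M j)\<^esub> = C"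
  using grp_presheaf.H1_one_unit[OF obstr_presheaf obstr_comm assms] by blast+

lemma H1_one_eq: "\<one>\<^bsub>H1 F\<^esub> = H1_base F"
  by (simp add: H1_def)

subsection \<open>The obstruction complex near a cocycle\<close>

lemma obstruction_eq:
  assumes "2 \<le> j"
  shows "obstruction M j (\<U>, g) = H1_class (filt.Q j (j + 1))
     (\<U>, \<lambda>U V. quot_proj (filt.G j) (G_sec M (j + 1)) (U \<inter> V) (g U V))"
  using assms by (simp add: obstruction_def obstr_sheaf_eq[of j, simplified] G_eq)

lemma conn1_eq:
  assumes "2 \<le> k"
  shows "conn1 M (int k) = {(H1_class (filt.Q k (k + 1)) (\<U>, a), H2_class (filt.Q (k + 1) (k + 2)) (\<U>, b)) | \<U> a b.
           (\<U>, a) \<in> Z1 (filt.Q k (k + 1)) \<and> (\<U>, b) \<in> Z2 (filt.Q (k + 1) (k + 2)) \<and>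
           (\<exists>t. (\<forall>U\<in>\<U>. \<forall>V\<in>\<U>. t U V \<in> carrier (grp (filt.Q k (k + 2)) (U \<inter> V)) \<and>
                   filt.qmap k (k + 1) (U \<inter> V) (t U V) = a U V) \<and>
                (\<forall>U\<in>\<U>. \<forall>V\<in>\<U>. \<forall>W\<in>\<U>. let I = U \<inter> V \<inter> W in
                   grs (filt.Q k (k + 2)) (V \<inter> W) I (t V W) \<otimes>\<^bsub>grp (filt.Q k (k + 2)) I\<^esub> grs (filt.Q k (k + 2)) (U \<inter> V) I (t U V) =
                   grs (filt.Q k (k + 2)) (U \<inter> W) I (t U W) \<otimes>\<^bsub>grp (filt.Q k (k + 2)) I\<^esub>
                   filt.qmap k (k + 2) I (b U V W)))}"
proof -
  have "obstr_sheaf M (int k + 1) = filt.Q (k + 1) (k + 2)" by (rule obstr_sheaf_Suc[OF assms])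
  moreover have "\<not> int k < 2" using assms by simp
  ultimately show ?thesis
    unfolding conn1_def Let_def nat_int G_quot_eq obstr_sheaf_eq[OF assms] by (simp only: if_False G_eq)
qed

lemma conn0_eq:
  assumes "2 \<le> k"
  shows "conn0 M (int k) = {(\<theta>, H1_class (filt.Q (k + 1) (k + 2)) (\<U>, a)) | \<theta> \<U> a.
           \<theta> \<in> carrier (grp (filt.Q k (k + 1)) UNIV) \<and>
           (\<U>, a) \<in> Z1 (filt.Q (k + 1) (k + 2)) \<and>
           (\<exists>t. (\<forall>U\<in>\<U>. t U \<in> carrier (grp (filt.Q k (k + 2)) U) \<and>
                   filt.qmap k (k + 1) U (t U) = grs (filt.Q k (k + 1)) UNIV U \<theta>) \<and>
                (\<forall>U\<in>\<U>. \<forall>V\<in>\<U>.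
                   grs (filt.Q k (k + 2)) U (U \<inter> V) (t U) \<otimes>\<^bsub>grp (filt.Q k (k + 2)) (U \<inter> V)\<^esub>
                   filt.qmap k (k + 2) (U \<inter> V) (a U V) =
                   grs (filt.Q k (k + 2)) V (U \<inter> V) (t V)))}"
proof -
  have "obstr_sheaf M (int k + 1) = filt.Q (k + 1) (k + 2)" by (rule obstr_sheaf_Suc[OF assms])
  moreover have "\<not> int k < 2" using assms by simp
  ultimately show ?thesis
    unfolding conn0_def Let_def nat_int G_quot_eq obstr_sheaf_eq[OF assms] by (simp only: if_False G_eq)
qed

lemma obstruction_ker1:
  assumes j: "2 \<le> j" and c: "c \<in> Z1 (G_sheaf M j)"
  shows "obstruction M j c \<in> ker1 M (int j)"
proof -
  obtain \<U> g where [simp]: "c = (\<U>, g)" by (cases c)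
  have Z: "(\<U>, g) \<in> Z1 (filt.G j)" using c by (simp add: G_eq)
  interpret Q1: quot_presheaf "filt.G j" "G_sec M (j + 1)" using filt.G_quot[of j "j + 1"] j by simp
  interpret Q2: quot_presheaf "filt.G j" "G_sec M (j + 2)" using filt.G_quot[of j "j + 2"] j by simp
  interpret Q3: quot_presheaf "filt.G (j + 1)" "G_sec M (j + 2)" using filt.G_quot[of "j + 1" "j + 2"] j by simp
  interpret QQ3: grp_presheaf "filt.Q (j + 1) (j + 2)" by (rule Q3.Q_presheaf)
  interpret QQ2: grp_presheaf "filt.Q j (j + 2)" by (rule Q2.Q_presheaf)
  interpret QQ1: grp_presheaf "filt.Q j (j + 1)" by (rule Q1.Q_presheaf)
  define a where "a = (\<lambda>U V. quot_proj (filt.G j) (G_sec M (j + 1)) (U \<inter> V) (g U V))"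
  define b where "b = (\<lambda>U V W. \<one>\<^bsub>grp (filt.Q (j + 1) (j + 2)) (U \<inter> V \<inter> W)\<^esub>)"
  define t where "t = (\<lambda>U V. quot_proj (filt.G j) (G_sec M (j + 2)) (U \<inter> V) (g U V))"
  have cov: "open_cover \<U>" using Z by (simp add: Z1_def)
  have Za: "(\<U>, a) \<in> Z1 (filt.Q j (j + 1))" unfolding a_def by (rule Q1.proj_Z1[OF Z])
  have Zt: "(\<U>, t) \<in> Z1 (filt.Q j (j + 2))" unfolding t_def by (rule Q2.proj_Z1[OF Z])
  have Zb: "(\<U>, b) \<in> Z2 (filt.Q (j + 1) (j + 2))" unfolding b_def by (rule QQ3.Z2_one[OF cov]) simp
  have e: "obstr_sheaf M (int j + 1) = filt.Q (j + 1) (j + 2)" by (rule obstr_sheaf_Suc[OF j])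
  have H2: "H2_zero (obstr_sheaf M (int j + 1)) = H2_class (filt.Q (j + 1) (j + 2)) (\<U>, b)"
    unfolding e b_def by (rule QQ3.H2_class_one[OF cov, symmetric])
  have ob: "obstruction M j c = H1_class (filt.Q j (j + 1)) (\<U>, a)"
    unfolding a_def by (simp add: obstruction_eq[OF j])
  have t1: "t U V \<in> carrier (grp (filt.Q j (j + 2)) (U \<inter> V)) \<and> filt.qmap j (j + 1) (U \<inter> V) (t U V) = a U V"
    if "U \<in> \<U>" "V \<in> \<U>" for U V
  proof
    show "t U V \<in> carrier (grp (filt.Q j (j + 2)) (U \<inter> V))" by (rule QQ2.Z1_closed[OF Zt that])
    have o: "open (U \<inter> V)" using that QQ2.Z1_open[OF Zt] by auto
    have "g U V \<in> G_sec M j (U \<inter> V)" using Q1.Z1_closed[OF Z that] by simp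
    then show "filt.qmap j (j + 1) (U \<inter> V) (t U V) = a U V"
      unfolding t_def a_def by (intro filt.qmap_proj o) (use j in auto)
  qed
  have t2: "let I = U \<inter> V \<inter> W in
       grs (filt.Q j (j + 2)) (V \<inter> W) I (t V W) \<otimes>\<^bsub>grp (filt.Q j (j + 2)) I\<^esub> grs (filt.Q j (j + 2)) (U \<inter> V) I (t U V) =
       grs (filt.Q j (j + 2)) (U \<inter> W) I (t U W) \<otimes>\<^bsub>grp (filt.Q j (j + 2)) I\<^esub> filt.qmap j (j + 2) I (b U V W)"
    if "U \<in> \<U>" "V \<in> \<U>" "W \<in> \<U>" for U V W
    unfolding Let_def b_def t_def by (rule filt.obstruction_closed[OF j Z that refl])
  have "(obstruction M j c, H2_zero (obstr_sheaf M (int j + 1))) \<in> conn1 M (int j)"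
    unfolding conn1_eq[OF j] ob H2 using Za Zb t1 t2 by blast
  moreover have "obstruction M j c \<in> carrier (H1 (obstr_sheaf M (int j)))"
    unfolding ob obstr_sheaf_eq[OF j] by (rule QQ1.H1_class_carrier[OF Za])
  ultimately show ?thesis by (simp add: ker1_def)
qed

lemma ker1_one: "\<one>\<^bsub>H1 (obstr_sheaf M j)\<^esub> \<in> ker1 M j"
proof (cases "2 \<le> j")
  case True
  define k where "k = nat j"
  have k: "j = int k" "2 \<le> k" using True by (auto simp: k_def)
  interpret Gk: grp_presheaf "filt.G k" using filt.G_presheaf[OF k(2)] .
  interpret Q1: quot_presheaf "filt.G k" "G_sec M (k + 1)" using filt.G_quot[of k "k + 1"] k by simp
  have Z: "({UNIV}, \<lambda>U V. \<one>\<^bsub>grp (filt.G k) UNIV\<^esub>) \<in> Z1 (filt.G k)" by (rule Gk.Z1_base)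
  have "(\<one>\<^bsub>H1 (obstr_sheaf M j)\<^esub>) = obstruction M k ({UNIV}, \<lambda>U V. \<one>\<^bsub>grp (filt.G k) UNIV\<^esub>)"
  proof -
    let ?a = "\<lambda>U V. quot_proj (filt.G k) (G_sec M (k + 1)) (U \<inter> V) \<one>\<^bsub>grp (filt.G k) UNIV\<^esub>"
    interpret QQ1: grp_presheaf "filt.Q k (k + 1)" by (rule Q1.Q_presheaf)
    have "(({UNIV}, \<lambda>U V. \<one>\<^bsub>grp (filt.Q k (k + 1)) UNIV\<^esub>), ({UNIV}, ?a)) \<in> H1_rel (filt.Q k (k + 1))"
    proof (rule QQ1.H1_rel_refine[OF QQ1.Z1_base, of _ "\<lambda>U. UNIV" "\<lambda>U. \<one>\<^bsub>grp (filt.Q k (k + 1)) UNIV\<^esub>"])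
      show "open_cover {UNIV :: 'x set}" by (simp add: open_cover_def)
      interpret K: group "grp (filt.Q k (k + 1)) UNIV" by (rule QQ1.grp) simp
      have r: "grs (filt.Q k (k + 1)) UNIV UNIV \<one>\<^bsub>grp (filt.Q k (k + 1)) UNIV\<^esub> = \<one>\<^bsub>grp (filt.Q k (k + 1)) UNIV\<^esub>"
        by (rule QQ1.rs_one) auto
      show "UNIV \<in> {UNIV} \<and> W \<subseteq> UNIV \<and> \<one>\<^bsub>grp (filt.Q k (k + 1)) UNIV\<^esub> \<in> carrier (grp (filt.Q k (k + 1)) W)"
        if "W \<in> {UNIV}" for W using that QQ1.one_closed[OF open_UNIV] by simp
      fix A B :: "'x set" assume "A \<in> {UNIV}" "B \<in> {UNIV}"
      then have [simp]: "A = UNIV" "B = UNIV" by auto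
      show "?a A B = inv\<^bsub>grp (filt.Q k (k + 1)) (A \<inter> B)\<^esub> grs (filt.Q k (k + 1)) A (A \<inter> B) \<one>\<^bsub>grp (filt.Q k (k + 1)) UNIV\<^esub>
        \<otimes>\<^bsub>grp (filt.Q k (k + 1)) (A \<inter> B)\<^esub> grs (filt.Q k (k + 1)) (UNIV \<inter> UNIV) (A \<inter> B) \<one>\<^bsub>grp (filt.Q k (k + 1)) UNIV\<^esub>
        \<otimes>\<^bsub>grp (filt.Q k (k + 1)) (A \<inter> B)\<^esub> grs (filt.Q k (k + 1)) B (A \<inter> B) \<one>\<^bsub>grp (filt.Q k (k + 1)) UNIV\<^esub>"
        unfolding \<open>A = UNIV\<close> \<open>B = UNIV\<close> Int_UNIV_left Q1.Q_simps(2)[symmetric]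
        by (simp only: r K.inv_one K.l_one K.one_closed)
    qed
    from QQ1.H1_class_eq[OF this] show ?thesis
      unfolding obstruction_eq[OF k(2)] H1_one_eq k(1) obstr_sheaf_eq[OF k(2)] H1_base_def .
  qed
  also have "\<dots> \<in> ker1 M (int k)" by (rule obstruction_ker1[OF k(2)]) (use Z in \<open>simp only: G_eq\<close>)
  finally show ?thesis by (simp add: k)
next
  case False
  have "H1_base (obstr_sheaf M j) \<in> carrier (H1 (obstr_sheaf M j))"
    by (rule grp_presheaf.H1_base_carrier[OF obstr_presheaf])
  then show ?thesis using False by (simp add: ker1_def conn1_def H1_one_eq)
qed

lemma im0_one: "\<one>\<^bsub>H1 (obstr_sheaf M j)\<^esub> \<in> im0 M j"
proof (cases "2 \<le> j - 1")
  case True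
  define k where "k = nat (j - 1)"
  have k: "j - 1 = int k" "2 \<le> k" "j = int (k + 1)" using True by (auto simp: k_def)
  interpret Q1: quot_presheaf "filt.G k" "G_sec M (k + 1)" using filt.G_quot[of k "k + 1"] k by simp
  interpret Q2: quot_presheaf "filt.G k" "G_sec M (k + 2)" using filt.G_quot[of k "k + 2"] k by simp
  interpret Q3: quot_presheaf "filt.G (k + 1)" "G_sec M (k + 2)" using filt.G_quot[of "k + 1" "k + 2"] k by simp
  interpret QQ1: grp_presheaf "filt.Q k (k + 1)" by (rule Q1.Q_presheaf)
  interpret QQ2: grp_presheaf "filt.Q k (k + 2)" by (rule Q2.Q_presheaf)
  interpret QQ3: grp_presheaf "filt.Q (k + 1) (k + 2)" by (rule Q3.Q_presheaf)
  interpret K: group "grp (filt.Q k (k + 2)) UNIV" by (rule QQ2.grp) simp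
  let ?t = "\<lambda>U :: 'x set. \<one>\<^bsub>grp (filt.Q k (k + 2)) UNIV\<^esub>" and ?a = "\<lambda>U V :: 'x set. \<one>\<^bsub>grp (filt.Q (k + 1) (k + 2)) UNIV\<^esub>"
  have e: "obstr_sheaf M j = filt.Q (k + 1) (k + 2)" using obstr_sheaf_eq[of "k + 1"] k by simp
  have q: "filt.qmap k (k + 1) UNIV \<one>\<^bsub>grp (filt.Q k (k + 2)) UNIV\<^esub> = \<one>\<^bsub>grp (filt.Q k (k + 1)) UNIV\<^esub>"
    "filt.qmap k (k + 2) UNIV \<one>\<^bsub>grp (filt.Q (k + 1) (k + 2)) UNIV\<^esub> = \<one>\<^bsub>grp (filt.Q k (k + 2)) UNIV\<^esub>"
    by (rule filt.qmap_one; use k in simp)+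
  have rs: "grs (filt.Q k (k + 1)) UNIV UNIV \<one>\<^bsub>grp (filt.Q k (k + 1)) UNIV\<^esub> = \<one>\<^bsub>grp (filt.Q k (k + 1)) UNIV\<^esub>"
    "grs (filt.Q k (k + 2)) UNIV UNIV \<one>\<^bsub>grp (filt.Q k (k + 2)) UNIV\<^esub> = \<one>\<^bsub>grp (filt.Q k (k + 2)) UNIV\<^esub>"
    by (rule QQ1.rs_one QQ2.rs_one; simp)+
  have m: "(\<one>\<^bsub>grp (filt.Q k (k + 1)) UNIV\<^esub>, H1_class (filt.Q (k + 1) (k + 2)) ({UNIV}, ?a)) \<in> conn0 M (int k)"
    unfolding conn0_eq[OF k(2)]
  proof (intro CollectI exI conjI)
    show "\<one>\<^bsub>grp (filt.Q k (k + 1)) UNIV\<^esub> \<in> carrier (grp (filt.Q k (k + 1)) UNIV)" by (rule QQ1.one_closed) simp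
    show "({UNIV}, ?a) \<in> Z1 (filt.Q (k + 1) (k + 2))" by (rule QQ3.Z1_base)
    show "\<forall>U\<in>{UNIV}. ?t U \<in> carrier (grp (filt.Q k (k + 2)) U) \<and>
        filt.qmap k (k + 1) U (?t U) = grs (filt.Q k (k + 1)) UNIV U \<one>\<^bsub>grp (filt.Q k (k + 1)) UNIV\<^esub>"
      unfolding ball_simps(5) ball_simps(7) using K.one_closed q(1) rs(1) by (simp only: ball_simps simp_thms)
    show "\<forall>U\<in>{UNIV}. \<forall>V\<in>{UNIV}. grs (filt.Q k (k + 2)) U (U \<inter> V) (?t U) \<otimes>\<^bsub>grp (filt.Q k (k + 2)) (U \<inter> V)\<^esub>
        filt.qmap k (k + 2) (U \<inter> V) (?a U V) = grs (filt.Q k (k + 2)) V (U \<inter> V) (?t V)"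
      using K.l_one[OF K.one_closed] by (simp only: ball_simps simp_thms Int_UNIV_left q(2) rs(2))
  qed simp
  have c: "H1_class (filt.Q (k + 1) (k + 2)) ({UNIV}, ?a) = \<one>\<^bsub>H1 (obstr_sheaf M j)\<^esub>"
    unfolding H1_one_eq e H1_base_def ..
  have "\<one>\<^bsub>grp (filt.Q k (k + 1)) UNIV\<^esub> \<in> carrier (grp (obstr_sheaf M (int k)) UNIV)"
    unfolding obstr_sheaf_eq[OF k(2)] by (rule QQ1.one_closed) simp
  from ImageI[OF m this] show ?thesis unfolding im0_def k(1) c .
next
  case False
  have "\<one>\<^bsub>grp (obstr_sheaf M (j - 1)) UNIV\<^esub> \<in> carrier (grp (obstr_sheaf M (j - 1)) UNIV)"
    by (rule grp_presheaf.one_closed[OF obstr_presheaf]) simp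
  then show ?thesis using False by (auto simp: im0_def conn0_def)
qed

lemma im0_carrier: "C \<in> im0 M j \<Longrightarrow> C \<in> carrier (H1 (obstr_sheaf M j))"
proof (cases "2 \<le> j - 1")
  case True
  assume C: "C \<in> im0 M j"
  define k where "k = nat (j - 1)"
  have k: "j - 1 = int k" "2 \<le> k" "j = int (k + 1)" using True by (auto simp: k_def)
  have e: "obstr_sheaf M j = filt.Q (k + 1) (k + 2)" using obstr_sheaf_eq[of "k + 1"] k by simp
  from C obtain \<U> a where "(\<U>, a) \<in> Z1 (filt.Q (k + 1) (k + 2))" "C = H1_class (filt.Q (k + 1) (k + 2)) (\<U>, a)"
    unfolding im0_def k(1) conn0_eq[OF k(2)] by blast
  then show ?thesis using grp_presheaf.H1_class_carrier[OF obstr_presheaf, of "(\<U>, a)" j] e by simp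
next
  case False
  assume "C \<in> im0 M j"
  then have "C = H1_base (obstr_sheaf M j)" using False by (auto simp: im0_def conn0_def H1_one_eq)
  then show ?thesis using grp_presheaf.H1_base_carrier[OF obstr_presheaf] by simp
qed

text \<open>
  Vanishing of the direct sum gives vanishing of each summand: a coset in degree j extends by
  the unit cosets in the other degrees to an element of the sum.
\<close>
lemma ker1_im0:
  assumes van: "carrier (first_obstruction_cohomology M) = {\<one>\<^bsub>first_obstruction_cohomology M\<^esub>}"
    and C: "C \<in> ker1 M j"
  shows "C \<in> im0 M j"
proof -
  let ?H = "\<lambda>j. (H1 (obstr_sheaf M j))\<lparr>carrier := ker1 M j\<rparr>"
  let ?Q = "\<lambda>j. ?H j Mod im0 M j"
  have one: "\<one>\<^bsub>?Q i\<^esub> = im0 M i" for i by (simp add: FactGroup_def)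
  have one_mem: "im0 M i \<in> carrier (?Q i)" for i
  proof -
    have "im0 M i #>\<^bsub>?H i\<^esub> \<one>\<^bsub>H1 (obstr_sheaf M i)\<^esub> = im0 M i"
      unfolding r_coset_def using H1_unit(2)[OF im0_carrier[of _ i]] by auto
    then show ?thesis using ker1_one[of i] by (auto simp: FactGroup_def RCOSETS_def)
  qed
  define f where "f = (\<lambda>i. if i = j then im0 M j #>\<^bsub>?H j\<^esub> C else im0 M i)"
  have fc: "f i \<in> carrier (?Q i)" for i
    using one_mem C by (auto simp: f_def FactGroup_def RCOSETS_def)
  have "finite {i \<in> UNIV. f i \<noteq> \<one>\<^bsub>?Q i\<^esub>}"
    by (rule finite_subset[of _ "{j}"]) (auto simp: f_def one)
  then have "f \<in> {x \<in> \<Pi>\<^sub>E i\<in>UNIV. carrier (?Q i). finite {i \<in> UNIV. x i \<noteq> \<one>\<^bsub>?Q i\<^esub>}}"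
    using fc by (simp add: PiE_iff)
  moreover from this have "f \<in> carrier (product_group UNIV ?Q)" by simp
  ultimately have "f \<in> carrier (first_obstruction_cohomology M)"
    unfolding first_obstruction_cohomology_def sum_group_def subgroup_generated_def
    by (simp add: generate.incl)
  then have "f = \<one>\<^bsub>first_obstruction_cohomology M\<^esub>" using van by blast
  then have "f j = im0 M j"
    by (simp add: first_obstruction_cohomology_def one)
  then have e: "im0 M j #>\<^bsub>?H j\<^esub> C = im0 M j" by (simp add: f_def)
  have "C \<in> carrier (H1 (obstr_sheaf M j))" using C by (simp add: ker1_def)
  from H1_unit(1)[OF this] have "C \<in> im0 M j #>\<^bsub>?H j\<^esub> C"
    unfolding r_coset_def using im0_one[of j] by force
  then show ?thesis by (simp only: e)
qed

text \<open>The values of the connecting map in degree zero are obstructions of strongly split atlases. In degree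
  j = 2 the map starts from the zero sheaf.\<close>
lemma good_im0_trivial:
  assumes good: "good_model M" and j: "2 \<le> j" and C: "C \<in> im0 M (int j)"
  shows "C = \<one>\<^bsub>H1 (obstr_sheaf M (int j))\<^esub>"
proof (cases "j = 2")
  case True
  then show ?thesis using C by (auto simp: im0_def conn0_def)
next
  case False
  define k where "k = j - 1"
  have k: "int j - 1 = int k" "2 \<le> k" "j = k + 1" using j False by (auto simp: k_def)
  from C obtain \<U> a t where a: "(\<U>, a) \<in> Z1 (filt.Q (k + 1) (k + 2))"
    and t: "\<forall>U\<in>\<U>. t U \<in> carrier (grp (filt.Q k (k + 2)) U)"
      "\<forall>U\<in>\<U>. \<forall>V\<in>\<U>. grs (filt.Q k (k + 2)) U (U \<inter> V) (t U) \<otimes>\<^bsub>grp (filt.Q k (k + 2)) (U \<inter> V)\<^esub>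
         filt.qmap k (k + 2) (U \<inter> V) (a U V) = grs (filt.Q k (k + 2)) V (U \<inter> V) (t V)"
    and Ca: "C = H1_class (filt.Q (k + 1) (k + 2)) (\<U>, a)"
    unfolding im0_def k(1) conn0_eq[OF k(2)] by blast
  obtain \<W> e where e: "(\<W>, e) \<in> Z1 (filt.G (k + 1))" "H1_class (G_sheaf M 2) (\<W>, e) = H1_base (G_sheaf M 2)"
    "H1_class (filt.Q (k + 1) (k + 2)) (\<W>, \<lambda>U V. quot_proj (filt.G (k + 1)) (G_sec M (k + 2)) (U \<inter> V) (e U V)) =
     H1_class (filt.Q (k + 1) (k + 2)) (\<U>, a)"
    using filt.connecting_image[OF k(2) a] t by blast
  have "obstruction M j (\<W>, e) = C"
    using obstruction_eq[OF j, of \<W> e] e(3) Ca k(3) by simp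
  moreover have "supermanifold_atlas M j (\<W>, e)"
    using e(1) j by (simp add: supermanifold_atlas_def G_eq k(3))
  moreover have "strongly_split M (\<W>, e)" using e(2) by (simp add: strongly_split_def)
  ultimately show ?thesis using good unfolding good_model_def exotic_def by blast
qed

text \<open>At each step the obstruction is closed, hence exact by the
  vanishing of cohomology, hence zero because the model is good.\<close>
lemma climb:
  assumes good: "good_model M"
    and van: "carrier (first_obstruction_cohomology M) = {\<one>\<^bsub>first_obstruction_cohomology M\<^esub>}"
    and c: "c \<in> Z1 (G_sheaf M 2)"
  shows "\<exists>d\<in>Z1 (G_sheaf M (2 + n)). (c, d) \<in> H1_rel (G_sheaf M 2)"
proof (induction n)
  case 0
  then show ?case using c grp_presheaf.H1_rel_refl[OF G_sheaf_presheaf c] by auto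
next
  case (Suc n)
  then obtain d where d: "d \<in> Z1 (G_sheaf M (2 + n))" "(c, d) \<in> H1_rel (G_sheaf M 2)" by blast
  let ?j = "2 + n"
  have j: "2 \<le> ?j" by simp
  obtain \<U> g where dg: "d = (\<U>, g)" by (cases d)
  have "obstruction M ?j d = \<one>\<^bsub>H1 (obstr_sheaf M (int ?j))\<^esub>"
    by (rule good_im0_trivial[OF good j ker1_im0[OF van obstruction_ker1[OF j d(1)]]])
  then have H: "H1_class (filt.Q ?j (?j + 1)) (\<U>, \<lambda>U V. quot_proj (filt.G ?j) (G_sec M (?j + 1)) (U \<inter> V) (g U V))
     = H1_base (filt.Q ?j (?j + 1))"
    unfolding dg obstruction_eq[OF j] H1_one_eq obstr_sheaf_eq[OF j] .
  have Z: "(\<U>, g) \<in> Z1 (filt.G ?j)" using d(1) by (simp only: dg G_eq)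
  obtain d' where d': "d' \<in> Z1 (filt.G (?j + 1))" "((\<U>, g), d') \<in> H1_rel (filt.G ?j)"
    using filt.lift_cocycle[OF j Z H] by blast
  have "((\<U>, g), d') \<in> H1_rel (filt.G 2)" by (rule filt.H1_rel_mono[OF order_refl j d'(2)])
  then have "(c, d') \<in> H1_rel (G_sheaf M 2)"
    using grp_presheaf.H1_rel_trans[OF G_sheaf_presheaf d(2)] by (simp add: dg G_eq)
  then show ?case using d'(1) by (auto simp: G_eq)
qed

end

section \<open>Local isomorphisms of a supermanifold with the split model\<close>

lemma struct_sheaf_simps:
  "f \<otimes>\<^bsub>salg (struct_sheaf M) U\<^esub> g = (\<lambda>x. f x * g x)"
  "\<one>\<^bsub>salg (struct_sheaf M) U\<^esub> = (\<lambda>x. if x \<in> U then 1 else 0)"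
  "\<zero>\<^bsub>salg (struct_sheaf M) U\<^esub> = (\<lambda>x. 0)"
  "f \<oplus>\<^bsub>salg (struct_sheaf M) U\<^esub> g = (\<lambda>x. f x + g x)"
  "scal (salg (struct_sheaf M) U) c f = (\<lambda>x. c * f x)"
  "srs (struct_sheaf M) U V f = (\<lambda>x. if x \<in> V then f x else 0)"
  by (simp_all add: struct_sheaf_def Let_def)

lemma ext_order_1: "a \<in> Ext r \<Longrightarrow> ext_order 1 a \<longleftrightarrow> a {} = 0"
proof
  assume a: "a \<in> Ext r" "a {} = 0"
  show "ext_order 1 a" unfolding ext_order_def
  proof (intro allI impI)
    fix K assume n: "a K \<noteq> 0"
    then have "K \<subseteq> {..<r}" "K \<noteq> {}" using a ExtD by auto
    then show "1 \<le> card K" using finite_subset[of K "{..<r}"] by (simp add: Suc_le_eq card_gt_0_iff)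
  qed
qed (auto simp: ext_order_def)

lemma ext_order_2:
  assumes "a \<in> Ext r" "a {} = 0" "\<And>k. k < r \<Longrightarrow> a {k} = 0"
  shows "ext_order 2 a"
  unfolding ext_order_def
proof (intro allI impI)
  fix K assume n: "a K \<noteq> 0"
  then have K: "K \<subseteq> {..<r}" using ExtD[OF assms(1)] by blast
  then have "card K \<noteq> 0" using n assms(2) finite_subset[OF K] by auto
  moreover have "card K \<noteq> 1"
  proof
    assume "card K = 1"
    then obtain k where "K = {k}" by (rule card_1_singletonE)
    then show False using n K assms(3)[of k] by auto
  qed
  ultimately show "2 \<le> card K" by linarith
qed

lemma ext_map_body: "(ext_map r g a) {} = a {}"
proof -
  have "ext_map r g a {} = (\<Sum>J\<in>Pow {..<r}. if J = {} then a {} else 0)"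
    unfolding ext_map_prod
  proof (rule sum.cong[OF refl])
    fix J assume "J \<in> Pow {..<r}"
    then have J: "J \<subseteq> {..<r}" "finite J" using finite_subset by auto
    show "a J * ext_prod (ext_column r g) J {} = (if J = {} then a {} else 0)"
      using ext_prod_column_neq0[OF J(1), of g "{}"] J(2) by (auto simp: ext_one_def)
  qed
  then show ?thesis by (simp add: sum.delta)
qed

lemma ext_map_singleton:
  assumes a: "a \<in> Ext r" and "k < r"
  shows "ext_map r g a {k} = (\<Sum>l<r. g k l * a {l})"
proof -
  let ?v = "ext_filter (\<lambda>d. d = 1) a"
  have v: "ext_hom 1 ?v" "?v \<in> Ext r" using a by (auto simp: ext_filter_def ext_hom_def Ext_def)
  have "ext_map r g a {k} = ext_filter (\<lambda>d. d = 1) (ext_map r g a) {k}" by (simp add: ext_filter_def)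
  also have "\<dots> = ext_map r g ?v {k}" by (simp only: ext_map_filter)
  also have "\<dots> = (\<Sum>l<r. g k l * a {l})"
    unfolding ext_map_degree_one[OF v] using \<open>k < r\<close>
    by (simp add: ext_column_singleton ext_filter_def mult.commute)
  finally show ?thesis .
qed

context bundle_model
begin

lemma partI:
  assumes "s \<in> sections U" "\<And>x. x \<in> U \<Longrightarrow> \<exists>i\<in>Idx. x \<in> D i \<and> ext_parity p (s i x)"
  shows "s \<in> part (salg SM U) p"
  unfolding part_split_model
proof (intro CollectI conjI allI assms(1))
  fix j x
  show "ext_parity p (s j x)"
  proof (cases "j \<in> Idx \<and> x \<in> U \<and> x \<in> D j")
    case True
    then obtain i where "i \<in> Idx" "x \<in> D i" "ext_parity p (s i x)" using assms(2) by blast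
    then show ?thesis using True sections_tr[OF assms(1), of j i x] ext_map_parity by metis
  next
    case False
    then show ?thesis using sections_out[OF assms(1)] by (simp add: ext_parity_def)
  qed
qed

text \<open>An invertible holomorphic matrix on a trivialised open set acts on the exterior algebra by
  automorphisms.\<close>
definition matrix_map :: "'i \<Rightarrow> ('x \<Rightarrow> nat \<Rightarrow> nat \<Rightarrow> complex) \<Rightarrow> 'x set \<Rightarrow> ('x, 'i) ext_section \<Rightarrow> ('x, 'i) ext_section" where
  "matrix_map i g V s = triv_section M i V (\<lambda>y. ext_map r (g y) (s i y))"

lemma matrix_map:
  assumes i: "i \<in> Idx" and V: "V \<subseteq> D i"
    and g: "\<And>k l. k < r \<Longrightarrow> l < r \<Longrightarrow> hol V (\<lambda>y. g y k l)" and s: "s \<in> sections V"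
  shows "matrix_map i g V s \<in> sections V"
    and "y \<in> V \<Longrightarrow> matrix_map i g V s i y = ext_map r (g y) (s i y)"
proof -
  have "hol V (\<lambda>x. s i x K)" for K using sections_hol[OF s i, of K] V by (simp add: inf.absorb1)
  then show "matrix_map i g V s \<in> sections V"
    unfolding matrix_map_def by (intro triv_section i V holo_on_ext_map g)
  show "y \<in> V \<Longrightarrow> matrix_map i g V s i y = ext_map r (g y) (s i y)"
    unfolding matrix_map_def by (rule triv_section_same[OF i V]) (auto intro: ext_map_Ext)
qed

text \<open>The inverse is given by the matrix v, because a one-sided inverse of a square matrix is two-sided.\<close>
lemma sheaf_iso_matrix_map:
  assumes i: "i \<in> Idx" and Y: "Y \<subseteq> D i"
    and g: "\<And>k l. k < r \<Longrightarrow> l < r \<Longrightarrow> hol Y (\<lambda>y. g y k l)" and v: "\<And>k l. k < r \<Longrightarrow> l < r \<Longrightarrow> hol Y (\<lambda>y. v y k l)"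
    and gv: "\<And>y k l. y \<in> Y \<Longrightarrow> k < r \<Longrightarrow> l < r \<Longrightarrow> (\<Sum>p<r. g y k p * v y p l) = (if k = l then 1 else 0)"
  shows "sheaf_iso id Y SM SM (matrix_map i g)"
proof -
  have vg: "(\<Sum>p<r. v y k p * g y p l) = (if k = l then 1 else 0)" if "y \<in> Y" "k < r" "l < r" for y k l
    by (rule matrix_right_inverse_left[OF gv[OF that(1)] that(2,3)])
  have gV: "hol V (\<lambda>y. g y k l)" "hol V (\<lambda>y. v y k l)" if "V \<subseteq> Y" "k < r" "l < r" for V k l
    using holo_on_subset[OF g[OF that(2,3)] that(1)] holo_on_subset[OF v[OF that(2,3)] that(1)] .
  have G: "matrix_map i g W s \<in> sections W" "y \<in> W \<Longrightarrow> matrix_map i g W s i y = ext_map r (g y) (s i y)"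
    "matrix_map i v W s \<in> sections W" "y \<in> W \<Longrightarrow> matrix_map i v W s i y = ext_map r (v y) (s i y)"
    if "W \<subseteq> D i" "W \<subseteq> Y" "s \<in> sections W" for W s y
  proof -
    have gW: "\<And>k l. k < r \<Longrightarrow> l < r \<Longrightarrow> hol W (\<lambda>y. g y k l)" "\<And>k l. k < r \<Longrightarrow> l < r \<Longrightarrow> hol W (\<lambda>y. v y k l)"
      using gV that(2) by blast+
    show "matrix_map i g W s \<in> sections W" "y \<in> W \<Longrightarrow> matrix_map i g W s i y = ext_map r (g y) (s i y)"
      using matrix_map[where g = g, OF i that(1) gW(1) that(3)] by blast+
    show "matrix_map i v W s \<in> sections W" "y \<in> W \<Longrightarrow> matrix_map i v W s i y = ext_map r (v y) (s i y)"
      using matrix_map[where g = v, OF i that(1) gW(2) that(3)] by blast+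
  qed
  have eqI: "s = t" if "s \<in> sections V" "t \<in> sections V" "V \<subseteq> Y" "\<And>y. y \<in> V \<Longrightarrow> s i y = t i y" for s t V
    by (rule sections_eqI[OF that(1,2)]) (use that i Y in blast)
  show ?thesis
  proof (rule sheaf_iso_idI)
    fix W assume W: "open W" "W \<subseteq> Y"
    then have WD: "W \<subseteq> D i" using Y by blast
    note g1 = G(1)[OF WD W(2)] and g2 = G(2)[OF WD W(2)] and v1 = G(3)[OF WD W(2)] and v2 = G(4)[OF WD W(2)]
    show "matrix_map i g W \<in> salg_hom (salg SM W) (salg SM W)"
    proof (rule salg_homI)
      show "matrix_map i g W a \<in> carrier (salg SM W)" if "a \<in> carrier (salg SM W)" for a using that g1 by simp
      fix a b assume "a \<in> carrier (salg SM W)" "b \<in> carrier (salg SM W)"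
      then have ab: "a \<in> sections W" "b \<in> sections W" by auto
      have "matrix_map i g W (\<lambda>i x. ext_mult (a i x) (b i x)) =
        (\<lambda>j x. ext_mult (matrix_map i g W a j x) (matrix_map i g W b j x))"
        by (rule eqI[OF g1[OF sections_mult[OF ab]] sections_mult[OF g1[OF ab(1)] g1[OF ab(2)]] W(2)])
           (simp add: g2 ab sections_mult ext_map_mult sections_Ext[OF ab(1)] sections_Ext[OF ab(2)])
      then show "matrix_map i g W (a \<otimes>\<^bsub>salg SM W\<^esub> b) = matrix_map i g W a \<otimes>\<^bsub>salg SM W\<^esub> matrix_map i g W b"
        by simp
      have "matrix_map i g W (\<lambda>i x K. a i x K + b i x K) = (\<lambda>j x K. matrix_map i g W a j x K + matrix_map i g W b j x K)"
        by (rule eqI[OF g1[OF sections_add[OF ab]] sections_add[OF g1[OF ab(1)] g1[OF ab(2)]] W(2)])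
           (simp add: g2 ab sections_add ext_map_add)
      then show "matrix_map i g W (a \<oplus>\<^bsub>salg SM W\<^esub> b) = matrix_map i g W a \<oplus>\<^bsub>salg SM W\<^esub> matrix_map i g W b"
        by simp
    next
      have o: "\<one>\<^bsub>salg SM W\<^esub> \<in> sections W" unfolding split_model_simps by (rule sections_one)
      show "matrix_map i g W \<one>\<^bsub>salg SM W\<^esub> = \<one>\<^bsub>salg SM W\<^esub>"
      proof (rule eqI[OF g1[OF o] o W(2)])
        fix y assume y: "y \<in> W"
        have "\<one>\<^bsub>salg SM W\<^esub> i y = ext_one" using y i WD by auto
        then show "matrix_map i g W \<one>\<^bsub>salg SM W\<^esub> i y = \<one>\<^bsub>salg SM W\<^esub> i y"
          unfolding g2[OF o y] by (simp only: ext_map_one)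
      qed
      fix a c assume "a \<in> carrier (salg SM W)"
      then have a: "a \<in> sections W" by simp
      have "matrix_map i g W (\<lambda>i x K. c * a i x K) = (\<lambda>j x K. c * matrix_map i g W a j x K)"
        by (rule eqI[OF g1[OF sections_scal[OF a]] sections_scal[OF g1[OF a]] W(2)])
           (simp add: g2 a sections_scal ext_map_scal)
      then show "matrix_map i g W (scal (salg SM W) c a) = scal (salg SM W) c (matrix_map i g W a)" by simp
    next
      fix a p assume a: "a \<in> part (salg SM W) p"
      then have as: "a \<in> sections W" "\<And>i x. ext_parity p (a i x)" unfolding part_split_model by auto
      show "matrix_map i g W a \<in> part (salg SM W) p"
        by (rule partI[OF g1[OF as(1)]]) (use i WD in \<open>auto intro!: bexI[of _ i] simp: g2 as ext_map_parity\<close>)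
    qed
    show "bij_betw (matrix_map i g W) (carrier (salg SM W)) (carrier (salg SM W))"
    proof (rule bij_betw_byWitness[of _ "matrix_map i v W"])
      show "\<forall>a\<in>carrier (salg SM W). matrix_map i v W (matrix_map i g W a) = a"
      proof
        fix a assume "a \<in> carrier (salg SM W)"
        then have a: "a \<in> sections W" by simp
        show "matrix_map i v W (matrix_map i g W a) = a"
        proof (rule eqI[OF v1[OF g1[OF a]] a W(2)])
          fix y assume y: "y \<in> W"
          then show "matrix_map i v W (matrix_map i g W a) i y = a i y"
            unfolding v2[OF g1[OF a] y] g2[OF a y] ext_map_comp
            by (intro ext_map_id[OF sections_Ext[OF a]] vg) (use W in auto)
        qed
      qed
      show "\<forall>a\<in>carrier (salg SM W). matrix_map i g W (matrix_map i v W a) = a"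
      proof
        fix a assume "a \<in> carrier (salg SM W)"
        then have a: "a \<in> sections W" by simp
        show "matrix_map i g W (matrix_map i v W a) = a"
        proof (rule eqI[OF g1[OF v1[OF a]] a W(2)])
          fix y assume y: "y \<in> W"
          then show "matrix_map i g W (matrix_map i v W a) i y = a i y"
            unfolding g2[OF v1[OF a] y] v2[OF a y] ext_map_comp
            by (intro ext_map_id[OF sections_Ext[OF a]] gv) (use W in auto)
        qed
      qed
    qed (use g1 v1 in auto)
    fix W' s assume W': "open W'" "W' \<subseteq> W" "s \<in> carrier (salg SM W)"
    then have s: "s \<in> sections W" by simp
    have WD': "W' \<subseteq> D i" "W' \<subseteq> Y" using WD W' W by auto
    show "srs SM W W' (matrix_map i g W s) = matrix_map i g W' (srs SM W W' s)"
      unfolding srs_split_model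
    proof (rule eqI[OF sec_rs_sections[OF g1[OF s] W'(2)] G(1)[OF WD' sec_rs_sections[OF s W'(2)]] WD'(2)])
      fix y assume y: "y \<in> W'"
      then have "y \<in> W" using W' by blast
      then show "sec_rs W' (matrix_map i g W s) i y = matrix_map i g W' (sec_rs W' s) i y"
        unfolding G(2)[OF WD' sec_rs_sections[OF s W'(2)] y] using y g2[OF s] by (simp add: sec_rs_def)
    qed
  qed
qed

end

locale supermfd = bundle_model M for M :: "('x::{t2_space,second_countable_topology}, 'i) model" +
  fixes F :: "('x, 's) salg_sheaf" and \<pi> :: "'x set \<Rightarrow> 's \<Rightarrow> 'x \<Rightarrow> complex"
    and \<tau> :: "'x set \<Rightarrow> 's \<Rightarrow> ('x, 'i) ext_section"
  assumes sheaf: "is_salg_sheaf F" and lr: "locally_ringed F"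
    and red: "reduction M F \<pi>" and con: "conormal M F \<pi> \<tau>"
    and locally_split: "\<And>x. \<exists>U h. open U \<and> x \<in> U \<and> sheaf_iso id U F (split_model M) h"
begin

abbreviation C where "C U \<equiv> carrier (salg F U)"

lemmas sheaf_props = sheaf[unfolded is_salg_sheaf_def]
lemmas red_props = red[unfolded reduction_def]
lemmas con_props = con[unfolded conormal_def]

lemma F_super: "open U \<Longrightarrow> superalgebra (salg F U)"
  by (rule sheaf_props[THEN conjunct1, rule_format])

lemma F_closed: "presheaf_closed F"
  by (rule salg_sheaf_closed[OF sheaf])

lemma F_rs: "open U \<Longrightarrow> open V \<Longrightarrow> V \<subseteq> U \<Longrightarrow> srs F U V \<in> salg_hom (salg F U) (salg F V)"
  by (rule sheaf_props[THEN conjunct2, THEN conjunct1, rule_format]) simp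

lemma F_id: "open U \<Longrightarrow> s \<in> C U \<Longrightarrow> srs F U U s = s"
  by (rule sheaf_props[THEN conjunct2, THEN conjunct2, THEN conjunct1, rule_format])

lemma F_comp: "open U \<Longrightarrow> open V \<Longrightarrow> open W \<Longrightarrow> W \<subseteq> V \<Longrightarrow> V \<subseteq> U \<Longrightarrow> s \<in> C U \<Longrightarrow>
    srs F V W (srs F U V s) = srs F U W s"
  by (rule sheaf_props[THEN conjunct2, THEN conjunct2, THEN conjunct2, THEN conjunct1, rule_format]) simp_all

lemma F_glue:
  assumes "\<And>W. W \<in> \<W> \<Longrightarrow> open W \<and> s W \<in> C W"
    and "\<And>W W'. W \<in> \<W> \<Longrightarrow> W' \<in> \<W> \<Longrightarrow> srs F W (W \<inter> W') (s W) = srs F W' (W \<inter> W') (s W')"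
  shows "\<exists>!t. t \<in> C (\<Union>\<W>) \<and> (\<forall>W\<in>\<W>. srs F (\<Union>\<W>) W t = s W)"
  by (rule sheaf_props[THEN conjunct2, THEN conjunct2, THEN conjunct2, THEN conjunct2, rule_format])
     (use assms in blast)

lemma pi_hom: "open V \<Longrightarrow> \<pi> V \<in> salg_hom (salg F V) (salg (struct_sheaf M) V)"
  by (rule red_props[THEN conjunct1, rule_format])

lemma pi_rs: "open V \<Longrightarrow> open W \<Longrightarrow> W \<subseteq> V \<Longrightarrow> s \<in> C V \<Longrightarrow> x \<in> W \<Longrightarrow> \<pi> W (srs F V W s) x = \<pi> V s x"
proof -
  assume h: "open V" "open W" "W \<subseteq> V" "s \<in> C V" "x \<in> W"
  have "srs (struct_sheaf M) V W (\<pi> V s) = \<pi> W (srs F V W s)"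
    by (rule red_props[THEN conjunct2, THEN conjunct1, rule_format]) (use h in simp_all)
  then have "srs (struct_sheaf M) V W (\<pi> V s) x = \<pi> W (srs F V W s) x" by simp
  then show ?thesis using h(5) by (simp add: struct_sheaf_simps)
qed

lemma odd_ideal_iff: "open V \<Longrightarrow> s \<in> odd_ideal F V \<longleftrightarrow> s \<in> C V \<and> \<pi> V s = (\<lambda>x. 0)"
proof -
  assume "open V"
  then have "{s \<in> C V. \<pi> V s = \<zero>\<^bsub>salg (struct_sheaf M) V\<^esub>} = odd_ideal F V"
    by (rule red_props[THEN conjunct2, THEN conjunct2, THEN conjunct2, rule_format])
  then show ?thesis by (auto simp: struct_sheaf_simps)
qed

lemma tau_bundle: "open V \<Longrightarrow> s \<in> odd_ideal F V \<Longrightarrow> \<tau> V s \<in> bundle_sections M V"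
  using con_props[THEN conjunct1, rule_format, of V] by (simp add: image_subset_iff)

lemma tau_add: "open V \<Longrightarrow> s \<in> odd_ideal F V \<Longrightarrow> t \<in> odd_ideal F V \<Longrightarrow>
    \<tau> V (s \<oplus>\<^bsub>salg F V\<^esub> t) = (\<lambda>i x K. \<tau> V s i x K + \<tau> V t i x K)"
proof -
  assume h: "open V" "s \<in> odd_ideal F V" "t \<in> odd_ideal F V"
  then have "s \<in> C V" using odd_ideal_iff by blast
  from con_props[THEN conjunct2, THEN conjunct1, rule_format, OF h this, THEN conjunct1] show ?thesis .
qed

lemma tau_mult: "open V \<Longrightarrow> s \<in> odd_ideal F V \<Longrightarrow> a \<in> C V \<Longrightarrow>
    \<tau> V (a \<otimes>\<^bsub>salg F V\<^esub> s) = (\<lambda>i x K. \<pi> V a x * \<tau> V s i x K)"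
proof -
  assume h: "open V" "s \<in> odd_ideal F V" "a \<in> C V"
  from con_props[THEN conjunct2, THEN conjunct1, rule_format, OF h(1,2,2,3), THEN conjunct2] show ?thesis .
qed

lemma tau_rs: "open V \<Longrightarrow> open W \<Longrightarrow> W \<subseteq> V \<Longrightarrow> s \<in> odd_ideal F V \<Longrightarrow> sec_rs W (\<tau> V s) = \<tau> W (srs F V W s)"
  using con_props[THEN conjunct2, THEN conjunct2, THEN conjunct1, rule_format, of V W s]
  unfolding srs_split_model by simp

lemma tau_surj: "open V \<Longrightarrow> v \<in> bundle_sections M V \<Longrightarrow> x \<in> V \<Longrightarrow>
    \<exists>W. open W \<and> x \<in> W \<and> W \<subseteq> V \<and> sec_rs W v \<in> \<tau> W ` odd_ideal F W"
  using con_props[THEN conjunct2, THEN conjunct2, THEN conjunct2, THEN conjunct1, rule_format, of V v x]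
  unfolding srs_split_model by simp

subsection \<open>Gluing isomorphisms given on small open sets\<close>

text \<open>The target glues the local images of a section, the source glues local preimages. The family B is
  closed under passing to smaller open sets, which makes the overlaps members of it.\<close>
lemma glue_iso:
  assumes B_open: "\<And>Y. Y \<in> B \<Longrightarrow> open Y" and B_sub: "\<And>Y Z. Y \<in> B \<Longrightarrow> open Z \<Longrightarrow> Z \<subseteq> Y \<Longrightarrow> Z \<in> B"
    and B_cover: "\<Union>B = UNIV"
    and K_hom: "\<And>Y. Y \<in> B \<Longrightarrow> K Y \<in> salg_hom (salg F Y) (salg SM Y)"
    and K_bij: "\<And>Y. Y \<in> B \<Longrightarrow> bij_betw (K Y) (C Y) (sections Y)"
    and K_rs: "\<And>Y Z s. Y \<in> B \<Longrightarrow> Z \<in> B \<Longrightarrow> Z \<subseteq> Y \<Longrightarrow> s \<in> C Y \<Longrightarrow> sec_rs Z (K Y s) = K Z (srs F Y Z s)"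
  shows "\<exists>h. sheaf_iso id UNIV F SM h"
proof -
  define BV where "BV V = {Y \<in> B. Y \<subseteq> V}" for V
  have BVo: "Y \<in> B \<and> open Y \<and> Y \<subseteq> V" if "Y \<in> BV V" for Y V using that B_open by (auto simp: BV_def)
  have BVint: "Y \<inter> Y' \<in> BV V" if "Y \<in> BV V" "Y' \<in> BV V" for Y Y' V
    using that B_sub[of Y "Y \<inter> Y'"] B_open by (auto simp: BV_def)
  have BVc: "\<exists>Y\<in>BV V. x \<in> Y" if V: "open V" "x \<in> V" for V x
  proof -
    have "x \<in> \<Union>B" by (simp add: B_cover)
    then obtain Y where Y: "Y \<in> B" "x \<in> Y" by (rule UnionE)
    then have "Y \<inter> V \<in> BV V" using B_sub[of Y "Y \<inter> V"] B_open V by (auto simp: BV_def)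
    then show ?thesis using Y V by blast
  qed
  have BVU: "\<Union>(BV V) = V" if "open V" for V using BVc[OF that] BVo by blast
  note Kc = salg_homD[OF K_hom]
  have srs_c: "srs F V Y s \<in> C Y" if "open V" "Y \<in> BV V" "s \<in> C V" for V Y s
    using presheaf_closedD(2)[OF F_closed] BVo[OF that(2)] that by blast
  have ex: "\<exists>t\<in>sections V. \<forall>Y\<in>BV V. sec_rs Y t = K Y (srs F V Y s)" if V: "open V" and s: "s \<in> C V" for V s
  proof -
    have agree: "K Y (srs F V Y s) i x = K Y' (srs F V Y' s) i x"
      if Y: "Y \<in> BV V" "Y' \<in> BV V" and x: "x \<in> Y" "x \<in> Y'" for Y Y' x i
    proof -
      have I: "Y \<inter> Y' \<in> B" "open (Y \<inter> Y')" using BVint[OF Y] BVo by blast+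
      have "sec_rs (Y \<inter> Y') (K Y (srs F V Y s)) = K (Y \<inter> Y') (srs F V (Y \<inter> Y') s)"
        using K_rs[of Y "Y \<inter> Y'" "srs F V Y s"] BVo[OF Y(1)] I srs_c[OF V Y(1) s] F_comp[of V Y "Y \<inter> Y'" s] V s by auto
      moreover have "sec_rs (Y \<inter> Y') (K Y' (srs F V Y' s)) = K (Y \<inter> Y') (srs F V (Y \<inter> Y') s)"
        using K_rs[of Y' "Y \<inter> Y'" "srs F V Y' s"] BVo[OF Y(2)] I srs_c[OF V Y(2) s] F_comp[of V Y' "Y \<inter> Y'" s] V s by auto
      ultimately have "sec_rs (Y \<inter> Y') (K Y (srs F V Y s)) i x = sec_rs (Y \<inter> Y') (K Y' (srs F V Y' s)) i x" by simp
      then show ?thesis using x by (simp add: sec_rs_def)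
    qed
    have mem: "K Y (srs F V Y s) \<in> sections Y" if "Y \<in> BV V" for Y
      using Kc(1)[of Y "srs F V Y s"] BVo[OF that] srs_c[OF V that s] by simp
    have "\<exists>t\<in>sections (\<Union>Y\<in>BV V. Y). \<forall>Y\<in>BV V. sec_rs Y t = K Y (srs F V Y s)"
    proof (rule sections_glue[of "BV V" "\<lambda>Y. Y" "\<lambda>Y. K Y (srs F V Y s)"])
      show "open Y" if "Y \<in> BV V" for Y using BVo[OF that] by blast
      show "K Y (srs F V Y s) \<in> sections Y" if "Y \<in> BV V" for Y by (rule mem[OF that])
      show "K Y (srs F V Y s) i x = K Y' (srs F V Y' s) i x"
        if "Y \<in> BV V" "Y' \<in> BV V" "x \<in> Y" "x \<in> Y'" for Y Y' x i by (rule agree[OF that])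
      fix t assume "t \<in> sections (\<Union>Y\<in>BV V. Y)" "\<And>Y. Y \<in> BV V \<Longrightarrow> sec_rs Y t = K Y (srs F V Y s)"
      then show ?thesis by (intro bexI[of _ t] ballI)
    qed
    then show ?thesis using BVU[OF V] by simp
  qed
  define h where "h V s = (SOME t. t \<in> sections V \<and> (\<forall>Y\<in>BV V. sec_rs Y t = K Y (srs F V Y s)))" for V s
  have h: "h V s \<in> sections V \<and> (\<forall>Y\<in>BV V. sec_rs Y (h V s) = K Y (srs F V Y s))" if "open V" "s \<in> C V" for V s
  proof -
    have "\<exists>t. t \<in> sections V \<and> (\<forall>Y\<in>BV V. sec_rs Y t = K Y (srs F V Y s))" using ex[OF that] by blast
    from someI_ex[OF this] show ?thesis unfolding h_def .
  qed
  have hs: "h V s \<in> sections V" if "open V" "s \<in> C V" for V s using h[OF that] by blast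
  have hK: "sec_rs Y (h V s) = K Y (srs F V Y s)" if "open V" "s \<in> C V" "Y \<in> BV V" for V s Y using h[OF that(1,2)] that(3) by blast
  have hI: "h V s = t" if V: "open V" "s \<in> C V" and t: "t \<in> sections V" "\<And>Y. Y \<in> BV V \<Longrightarrow> sec_rs Y t = K Y (srs F V Y s)" for V s t
  proof (rule sec_rs_eqI[OF hs[OF V] t(1)])
    fix x assume "x \<in> V"
    then obtain Y where "Y \<in> BV V" "x \<in> Y" using BVc[OF V(1)] by blast
    then show "\<exists>Y. x \<in> Y \<and> sec_rs Y (h V s) = sec_rs Y t" using hK[OF V] t(2) by metis
  qed
  have "sheaf_iso id UNIV F SM h"
  proof (rule sheaf_iso_idI)
    fix V :: "'x set" assume V: "open V"
    note cl = salg_closedD[OF presheaf_closedD(1)[OF F_closed V]]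
    have rsh: "srs F V Y \<in> salg_hom (salg F V) (salg F Y)" if "Y \<in> BV V" for Y
      using F_rs[OF V] BVo[OF that] by blast
    show "h V \<in> salg_hom (salg F V) (salg SM V)"
    proof (rule salg_homI)
      show "h V a \<in> carrier (salg SM V)" if "a \<in> C V" for a using hs[OF V that] by simp
      fix a b assume ab: "a \<in> C V" "b \<in> C V"
      note ha = hs[OF V ab(1)] and hb = hs[OF V ab(2)]
      have "h V (a \<otimes>\<^bsub>salg F V\<^esub> b) = (\<lambda>i x. ext_mult (h V a i x) (h V b i x))"
      proof (rule hI[OF V cl(1)[OF ab] sections_mult[OF ha hb]])
        fix Y assume Y: "Y \<in> BV V"
        have "sec_rs Y (\<lambda>i x. ext_mult (h V a i x) (h V b i x)) =
          (\<lambda>i x. ext_mult (sec_rs Y (h V a) i x) (sec_rs Y (h V b) i x))" by (auto simp: sec_rs_def fun_eq_iff)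
        also have "\<dots> = K Y (srs F V Y (a \<otimes>\<^bsub>salg F V\<^esub> b))"
          using Kc(2)[of Y "srs F V Y a" "srs F V Y b"] BVo[OF Y] srs_c[OF V Y] ab salg_homD(2)[OF rsh[OF Y] ab]
          by (simp add: hK[OF V ab(1) Y] hK[OF V ab(2) Y])
        finally show "sec_rs Y (\<lambda>i x. ext_mult (h V a i x) (h V b i x)) = K Y (srs F V Y (a \<otimes>\<^bsub>salg F V\<^esub> b))" .
      qed
      then show "h V (a \<otimes>\<^bsub>salg F V\<^esub> b) = h V a \<otimes>\<^bsub>salg SM V\<^esub> h V b" by simp
      have "h V (a \<oplus>\<^bsub>salg F V\<^esub> b) = (\<lambda>i x K. h V a i x K + h V b i x K)"
      proof (rule hI[OF V cl(2)[OF ab] sections_add[OF ha hb]])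
        fix Y assume Y: "Y \<in> BV V"
        have "sec_rs Y (\<lambda>i x K. h V a i x K + h V b i x K) =
          (\<lambda>i x K. sec_rs Y (h V a) i x K + sec_rs Y (h V b) i x K)" by (auto simp: sec_rs_def fun_eq_iff)
        also have "\<dots> = K Y (srs F V Y (a \<oplus>\<^bsub>salg F V\<^esub> b))"
          using Kc(3)[of Y "srs F V Y a" "srs F V Y b"] BVo[OF Y] srs_c[OF V Y] ab salg_homD(3)[OF rsh[OF Y] ab]
          by (simp add: hK[OF V ab(1) Y] hK[OF V ab(2) Y])
        finally show "sec_rs Y (\<lambda>i x K. h V a i x K + h V b i x K) = K Y (srs F V Y (a \<oplus>\<^bsub>salg F V\<^esub> b))" .
      qed
      then show "h V (a \<oplus>\<^bsub>salg F V\<^esub> b) = h V a \<oplus>\<^bsub>salg SM V\<^esub> h V b" by simp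
    next
      show "h V \<one>\<^bsub>salg F V\<^esub> = \<one>\<^bsub>salg SM V\<^esub>"
      proof (rule hI[OF V cl(3)])
        show "\<one>\<^bsub>salg SM V\<^esub> \<in> sections V" unfolding split_model_simps by (rule sections_one)
        fix Y assume Y: "Y \<in> BV V"
        have "sec_rs Y \<one>\<^bsub>salg SM V\<^esub> = \<one>\<^bsub>salg SM Y\<^esub>" using BVo[OF Y] by (auto simp: sec_rs_def fun_eq_iff)
        then show "sec_rs Y \<one>\<^bsub>salg SM V\<^esub> = K Y (srs F V Y \<one>\<^bsub>salg F V\<^esub>)"
          using salg_homD(4)[OF rsh[OF Y]] Kc(4)[of Y] BVo[OF Y] by (simp del: split_model_simps)
      qed
      fix a c assume a: "a \<in> C V"
      note ha = hs[OF V a]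
      have "h V (scal (salg F V) c a) = (\<lambda>i x K. c * h V a i x K)"
      proof (rule hI[OF V cl(4)[OF a] sections_scal[OF ha]])
        fix Y assume Y: "Y \<in> BV V"
        have "sec_rs Y (\<lambda>i x K. c * h V a i x K) = (\<lambda>i x K. c * sec_rs Y (h V a) i x K)"
          by (auto simp: sec_rs_def fun_eq_iff)
        also have "\<dots> = K Y (srs F V Y (scal (salg F V) c a))"
          using Kc(5)[of Y "srs F V Y a" c] BVo[OF Y] srs_c[OF V Y a] salg_homD(5)[OF rsh[OF Y] a]
          by (simp add: hK[OF V a Y])
        finally show "sec_rs Y (\<lambda>i x K. c * h V a i x K) = K Y (srs F V Y (scal (salg F V) c a))" .
      qed
      then show "h V (scal (salg F V) c a) = scal (salg SM V) c (h V a)" by simp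
    next
      fix a p assume a: "a \<in> part (salg F V) p"
      note ac = cl(5)[OF a]
      show "h V a \<in> part (salg SM V) p"
      proof (rule partI[OF hs[OF V ac]])
        fix x assume "x \<in> V"
        then obtain Y where Y: "Y \<in> BV V" "x \<in> Y" using BVc[OF V] by blast
        obtain i where i: "i \<in> Idx" "x \<in> D i" by (rule D_cover)
        have "sec_rs Y (h V a) \<in> part (salg SM Y) p"
          unfolding hK[OF V ac Y(1)] using Kc(6)[of Y] BVo[OF Y(1)] salg_homD(6)[OF rsh[OF Y(1)] a] by blast
        then have "ext_parity p (sec_rs Y (h V a) i x)" unfolding part_split_model by blast
        then show "\<exists>i\<in>Idx. x \<in> D i \<and> ext_parity p (h V a i x)" using i Y(2) by (auto simp: sec_rs_def)
      qed
    qed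
    show "bij_betw (h V) (C V) (carrier (salg SM V))"
      unfolding bij_betw_def
    proof
      show "inj_on (h V) (C V)"
      proof (rule inj_onI)
        fix a b assume ab: "a \<in> C V" "b \<in> C V" "h V a = h V b"
        have e: "srs F V Y a = srs F V Y b" if Y: "Y \<in> BV V" for Y
        proof -
          have "K Y (srs F V Y a) = K Y (srs F V Y b)" using hK[OF V _ Y] ab by metis
          then show ?thesis using K_bij[of Y] BVo[OF Y] srs_c[OF V Y] ab by (metis bij_betw_def inj_onD)
        qed
        have "\<exists>!t. t \<in> C (\<Union>(BV V)) \<and> (\<forall>Y\<in>BV V. srs F (\<Union>(BV V)) Y t = srs F V Y a)"
        proof (rule F_glue)
          show "open Y \<and> srs F V Y a \<in> C Y" if "Y \<in> BV V" for Y using BVo[OF that] srs_c[OF V that ab(1)] by blast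
          show "srs F Y (Y \<inter> Y') (srs F V Y a) = srs F Y' (Y \<inter> Y') (srs F V Y' a)"
            if Y: "Y \<in> BV V" "Y' \<in> BV V" for Y Y'
          proof -
            have "open (Y \<inter> Y')" using BVo[OF Y(1)] BVo[OF Y(2)] by auto
            then show ?thesis
              using F_comp[of V Y "Y \<inter> Y'" a] F_comp[of V Y' "Y \<inter> Y'" a] BVo[OF Y(1)] BVo[OF Y(2)] V ab(1) by simp
          qed
        qed
        then show "a = b" unfolding BVU[OF V] using ab e by metis
      qed
      show "h V ` C V = carrier (salg SM V)"
      proof
        show "h V ` C V \<subseteq> carrier (salg SM V)" using hs[OF V] by auto
        show "carrier (salg SM V) \<subseteq> h V ` C V"
        proof
          fix t assume "t \<in> carrier (salg SM V)"
          then have t: "t \<in> sections V" by simp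
          define s where "s Y = inv_into (C Y) (K Y) (sec_rs Y t)" for Y
          have s: "s Y \<in> C Y \<and> K Y (s Y) = sec_rs Y t" if Y: "Y \<in> BV V" for Y
          proof -
            have "sec_rs Y t \<in> sections Y" using sec_rs_sections[OF t] BVo[OF Y] by blast
            then show ?thesis unfolding s_def using K_bij[of Y] BVo[OF Y]
              by (metis bij_betw_def inv_into_into bij_betw_inv_into_right)
          qed
          have srs_s: "srs F Y Z (s Y) = s Z" if Y: "Y \<in> BV V" and Z: "Z \<in> BV V" "Z \<subseteq> Y" for Y Z
          proof -
            have "sec_rs Z (sec_rs Y t) = sec_rs Z t" using Z by (auto simp: sec_rs_def fun_eq_iff)
            then have "K Z (srs F Y Z (s Y)) = K Z (s Z)"
              using K_rs[of Y Z "s Y"] s[OF Y] s[OF Z(1)] BVo[OF Y] BVo[OF Z(1)] Z(2) by simp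
            moreover have "srs F Y Z (s Y) \<in> C Z"
              using presheaf_closedD(2)[OF F_closed] BVo[OF Y] BVo[OF Z(1)] Z(2) s[OF Y] by blast
            ultimately show ?thesis using K_bij[of Z] BVo[OF Z(1)] s[OF Z(1)] by (metis bij_betw_def inj_onD)
          qed
          have "\<exists>!a. a \<in> C (\<Union>(BV V)) \<and> (\<forall>Y\<in>BV V. srs F (\<Union>(BV V)) Y a = s Y)"
          proof (rule F_glue)
            show "open Y \<and> s Y \<in> C Y" if "Y \<in> BV V" for Y using BVo[OF that] s[OF that] by blast
            show "srs F Y (Y \<inter> Y') (s Y) = srs F Y' (Y \<inter> Y') (s Y')"
              if Y: "Y \<in> BV V" "Y' \<in> BV V" for Y Y'
              using srs_s[OF Y(1) BVint[OF Y]] srs_s[OF Y(2) BVint[OF Y]] by simp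
          qed
          then obtain a where a: "a \<in> C V" "\<And>Y. Y \<in> BV V \<Longrightarrow> srs F V Y a = s Y"
            unfolding BVU[OF V] by blast
          have "h V a = t" by (rule hI[OF V a(1) t]) (simp add: a(2) s)
          then show "t \<in> h V ` C V" using a(1) by blast
        qed
      qed
    qed
    fix W s assume W: "open W" "W \<subseteq> V" and s: "s \<in> C V"
    have sW: "srs F V W s \<in> C W" using presheaf_closedD(2)[OF F_closed V W s] .
    have "h W (srs F V W s) = sec_rs W (h V s)"
    proof (rule hI[OF W(1) sW sec_rs_sections[OF hs[OF V s] W(2)]])
      fix Y assume Y: "Y \<in> BV W"
      then have Y': "Y \<in> BV V" using W by (auto simp: BV_def)
      have "sec_rs Y (sec_rs W (h V s)) = sec_rs Y (h V s)" using BVo[OF Y] by (auto simp: sec_rs_def fun_eq_iff)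
      then show "sec_rs Y (sec_rs W (h V s)) = K Y (srs F W Y (srs F V W s))"
        using hK[OF V s Y'] F_comp[of V W Y s] V W s BVo[OF Y] by simp
    qed
    then show "srs SM V W (h V s) = h W (srs F V W s)" unfolding srs_split_model by simp
  qed
  then show ?thesis by blast
qed

end

section \<open>Reduction and conormal map in a local isomorphism\<close>

lemma superalgebra_scal:
  assumes "superalgebra A" "a \<in> carrier A" "b \<in> carrier A"
  shows "scal A c a \<in> carrier A" and "scal A (c + d) a = scal A c a \<oplus>\<^bsub>A\<^esub> scal A d a"
    and "scal A (c * d) a = scal A c (scal A d a)" and "scal A 1 a = a"
    and "scal A c a \<otimes>\<^bsub>A\<^esub> b = scal A c (a \<otimes>\<^bsub>A\<^esub> b)" and "a \<otimes>\<^bsub>A\<^esub> scal A c b = scal A c (a \<otimes>\<^bsub>A\<^esub> b)"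
proof -
  have "\<forall>c d. \<forall>a\<in>carrier A. \<forall>b\<in>carrier A.
        scal A c a \<in> carrier A \<and>
        scal A c (a \<oplus>\<^bsub>A\<^esub> b) = scal A c a \<oplus>\<^bsub>A\<^esub> scal A c b \<and>
        scal A (c + d) a = scal A c a \<oplus>\<^bsub>A\<^esub> scal A d a \<and>
        scal A (c * d) a = scal A c (scal A d a) \<and>
        scal A 1 a = a \<and>
        scal A c a \<otimes>\<^bsub>A\<^esub> b = scal A c (a \<otimes>\<^bsub>A\<^esub> b) \<and>
        a \<otimes>\<^bsub>A\<^esub> scal A c b = scal A c (a \<otimes>\<^bsub>A\<^esub> b)"
    by (rule assms(1)[unfolded superalgebra_def, THEN conjunct2, THEN conjunct1])
  note * = this[rule_format, OF assms(2,3)]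
  show "scal A c a \<in> carrier A" "scal A (c + d) a = scal A c a \<oplus>\<^bsub>A\<^esub> scal A d a"
    "scal A (c * d) a = scal A c (scal A d a)" "scal A 1 a = a"
    "scal A c a \<otimes>\<^bsub>A\<^esub> b = scal A c (a \<otimes>\<^bsub>A\<^esub> b)" "a \<otimes>\<^bsub>A\<^esub> scal A c b = scal A c (a \<otimes>\<^bsub>A\<^esub> b)"
    using * by simp_all
qed

locale local_iso = supermfd M F \<pi> \<tau>
  for M :: "('x::{t2_space,second_countable_topology}, 'i) model" and F :: "('x, 's) salg_sheaf" and \<pi> \<tau> +
  fixes U :: "'x set" and h :: "'x set \<Rightarrow> 's \<Rightarrow> ('x, 'i) ext_section"
  assumes iso: "sheaf_iso id U F (split_model M) h"
begin

lemma h_hom: "V \<in> opens U \<Longrightarrow> h V \<in> salg_hom (salg F V) (salg SM V)"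
  using sheaf_iso_idD(1)[OF iso] by (simp add: opens_def)

lemma h_bij: "V \<in> opens U \<Longrightarrow> bij_betw (h V) (C V) (sections V)"
  using sheaf_iso_idD(2)[OF iso] by (simp add: opens_def)

lemma h_closed: "V \<in> opens U \<Longrightarrow> s \<in> C V \<Longrightarrow> h V s \<in> sections V"
  using salg_homD(1)[OF h_hom] by simp

lemma h_rs: "V \<in> opens U \<Longrightarrow> W \<in> opens V \<Longrightarrow> s \<in> C V \<Longrightarrow> sec_rs W (h V s) = h W (srs F V W s)"
  using sheaf_iso_idD(3)[OF iso, of V W s] unfolding srs_split_model opens_def by blast

definition k where "k V = inv_into (C V) (h V)"

lemma k_iso: "sheaf_iso id U SM F k"
  using sheaf_iso_inverse[OF F_closed iso] by (simp add: k_def[abs_def])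

lemma k_hom: "V \<in> opens U \<Longrightarrow> k V \<in> salg_hom (salg SM V) (salg F V)"
  using sheaf_iso_idD(1)[OF k_iso] by (simp add: opens_def)

lemma k_closed: "V \<in> opens U \<Longrightarrow> u \<in> sections V \<Longrightarrow> k V u \<in> C V"
  using salg_homD(1)[OF k_hom] by simp

lemma h_k: "V \<in> opens U \<Longrightarrow> u \<in> sections V \<Longrightarrow> h V (k V u) = u"
  unfolding k_def by (rule bij_betw_inv_into_right[OF h_bij])

lemma k_h: "V \<in> opens U \<Longrightarrow> s \<in> C V \<Longrightarrow> k V (h V s) = s"
  unfolding k_def by (rule bij_betw_inv_into_left[OF h_bij])

lemma k_rs: "V \<in> opens U \<Longrightarrow> W \<in> opens V \<Longrightarrow> u \<in> sections V \<Longrightarrow> srs F V W (k V u) = k W (sec_rs W u)"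
  using sheaf_iso_idD(3)[OF k_iso, of V W u] unfolding srs_split_model opens_def by simp

lemma k_add: "V \<in> opens U \<Longrightarrow> u \<in> sections V \<Longrightarrow> v \<in> sections V \<Longrightarrow>
    k V (\<lambda>i x K. u i x K + v i x K) = k V u \<oplus>\<^bsub>salg F V\<^esub> k V v"
  using salg_homD(3)[OF k_hom, of V u v] by simp

lemma k_mult: "V \<in> opens U \<Longrightarrow> u \<in> sections V \<Longrightarrow> v \<in> sections V \<Longrightarrow>
    k V (\<lambda>i x. ext_mult (u i x) (v i x)) = k V u \<otimes>\<^bsub>salg F V\<^esub> k V v"
  using salg_homD(2)[OF k_hom, of V u v] by simp

text \<open>
  This is where the stalks have to be local rings. Let c be the constant term of s at x and suppose that
  the reduction takes another value b + c there. The sections s - c and (b + c) - s add up to the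
  non-zero constant b, so one of them is a unit in the stalk. But the first has constant term zero at x,
  and the reduction of the second vanishes at x, whereas homomorphisms preserve units.
\<close>
lemma body:
  assumes V: "V \<in> opens U" and s: "s \<in> C V" and x: "x \<in> V" and i: "i \<in> Idx" "x \<in> D i"
  shows "h V s i x {} = \<pi> V s x"
proof (rule ccontr)
  assume neq: "h V s i x {} \<noteq> \<pi> V s x"
  have oV: "open V" using V by (simp add: opens_def)
  let ?R = "salg F V"
  have sup: "superalgebra ?R" by (rule F_super[OF oV])
  then have "ring ?R" by (simp add: superalgebra_def)
  then interpret R: ring ?R .
  note cl = salg_closedD[OF presheaf_closedD(1)[OF F_closed oV]]
  define c where "c = h V s i x {}"
  define b where "b = \<pi> V s x - c"
  have b: "b \<noteq> 0" using neq by (simp add: b_def c_def)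
  define a where "a = s \<oplus>\<^bsub>?R\<^esub> scal ?R (- c) \<one>\<^bsub>?R\<^esub>"
  define a' where "a' = scal ?R (b + c) \<one>\<^bsub>?R\<^esub> \<oplus>\<^bsub>?R\<^esub> scal ?R (- 1) s"
  note sc1 = superalgebra_scal[OF sup R.one_closed R.one_closed] and scs = superalgebra_scal[OF sup s s]
  have ac: "a \<in> C V" "a' \<in> C V" unfolding a_def a'_def using s cl(4) by auto
  have zero: "s \<oplus>\<^bsub>?R\<^esub> scal ?R (- 1) s = \<zero>\<^bsub>?R\<^esub>"
  proof -
    have "scal ?R 0 s = scal ?R 0 s \<oplus>\<^bsub>?R\<^esub> scal ?R 0 s" using scs(2)[of 0 0] by simp
    then have "scal ?R 0 s = \<zero>\<^bsub>?R\<^esub>" using scs(1)[of 0] by (simp add: R.add.l_cancel_one)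
    moreover have "scal ?R (1 + - 1) s = s \<oplus>\<^bsub>?R\<^esub> scal ?R (- 1) s" unfolding scs(2) scs(4) ..
    ultimately show ?thesis by simp
  qed
  have "a \<oplus>\<^bsub>?R\<^esub> a' = (s \<oplus>\<^bsub>?R\<^esub> scal ?R (- 1) s) \<oplus>\<^bsub>?R\<^esub> (scal ?R (- c) \<one>\<^bsub>?R\<^esub> \<oplus>\<^bsub>?R\<^esub> scal ?R (b + c) \<one>\<^bsub>?R\<^esub>)"
    unfolding a_def a'_def using s scs(1) sc1(1) by (simp add: R.add.m_ac)
  also have "\<dots> = scal ?R (- c + (b + c)) \<one>\<^bsub>?R\<^esub>" unfolding zero sc1(2) using sc1(1) by simp
  finally have sum: "a \<oplus>\<^bsub>?R\<^esub> a' = scal ?R b \<one>\<^bsub>?R\<^esub>" by simp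
  have inv: "scal ?R d \<one>\<^bsub>?R\<^esub> \<otimes>\<^bsub>?R\<^esub> scal ?R e \<one>\<^bsub>?R\<^esub> = \<one>\<^bsub>?R\<^esub>" if "d * e = 1" for d e
  proof -
    have "scal ?R d \<one>\<^bsub>?R\<^esub> \<otimes>\<^bsub>?R\<^esub> scal ?R e \<one>\<^bsub>?R\<^esub> = scal ?R d (\<one>\<^bsub>?R\<^esub> \<otimes>\<^bsub>?R\<^esub> scal ?R e \<one>\<^bsub>?R\<^esub>)"
      by (rule superalgebra_scal(5)[OF sup R.one_closed sc1(1)])
    also have "\<dots> = scal ?R (d * e) \<one>\<^bsub>?R\<^esub>" unfolding sc1(3) using sc1(1) by simp
    finally show ?thesis using that sc1(4) by simp
  qed
  have "scal ?R b \<one>\<^bsub>?R\<^esub> \<in> Units ?R"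
    unfolding Units_def using inv[of b "1 / b"] inv[of "1 / b" b] b sc1(1) by force
  then have "unit_at F x V (a \<oplus>\<^bsub>?R\<^esub> a')"
    unfolding sum unit_at_def using oV x F_id[OF oV sc1(1)] by (intro exI[of _ V]) simp
  then have "unit_at F x V a \<or> unit_at F x V a'"
    using lr oV x ac unfolding locally_ringed_def by blast
  moreover have "\<not> unit_at F x V a'"
  proof
    assume "unit_at F x V a'"
    then obtain W where W: "open W" "x \<in> W" "W \<subseteq> V" "srs F V W a' \<in> Units (salg F W)"
      unfolding unit_at_def by blast
    then obtain w where w: "w \<in> C W" "srs F V W a' \<in> C W" "srs F V W a' \<otimes>\<^bsub>salg F W\<^esub> w = \<one>\<^bsub>salg F W\<^esub>"
      unfolding Units_def by blast
    note pW = salg_homD[OF pi_hom[OF W(1)], unfolded struct_sheaf_simps]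
      and pV = salg_homD[OF pi_hom[OF oV], unfolded struct_sheaf_simps]
    have "\<pi> V a' x = 0"
      unfolding a'_def using pV(3)[OF sc1(1)[of "b + c"] scs(1)[of "- 1"]] pV(5)[OF R.one_closed, of "b + c"]
        pV(5)[OF s, of "- 1"] pV(4) x by (simp add: b_def)
    then have "\<pi> W (srs F V W a') x = 0" using pi_rs[OF oV W(1,3) ac(2) W(2)] by simp
    moreover have "\<pi> W (srs F V W a') x * \<pi> W w x = 1"
      using pW(2)[OF w(2,1)] pW(4) w(3) W(2) by (metis (mono_tags, lifting))
    ultimately show False by simp
  qed
  moreover have "\<not> unit_at F x V a"
  proof
    assume "unit_at F x V a"
    then obtain W where W: "open W" "x \<in> W" "W \<subseteq> V" "srs F V W a \<in> Units (salg F W)"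
      unfolding unit_at_def by blast
    then obtain w where w: "w \<in> C W" "srs F V W a \<in> C W" "srs F V W a \<otimes>\<^bsub>salg F W\<^esub> w = \<one>\<^bsub>salg F W\<^esub>"
      unfolding Units_def by blast
    have WU: "W \<in> opens U" "W \<in> opens V" using W V by (auto simp: opens_def)
    note hV = salg_homD[OF h_hom[OF V], unfolded split_model_simps]
      and hW = salg_homD[OF h_hom[OF WU(1)], unfolded split_model_simps]
    have "h V a i x {} = 0"
      unfolding a_def using hV(3)[OF s sc1(1)[of "- c"]] hV(5)[OF R.one_closed, of "- c"] hV(4) x i
      by (simp add: ext_one_def c_def)
    then have "h W (srs F V W a) i x {} = 0"
      using h_rs[OF V WU(2) ac(1)] W(2) by (metis sec_rs_def)
    moreover have "h W (srs F V W a) i x {} * h W w i x {} = 1"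
    proof -
      have "ext_mult (h W (srs F V W a) i x) (h W w i x) = ext_one"
        using fun_cong[OF fun_cong[OF hW(2)[OF w(2,1)]], of i x] hW(4) w(3) i W(2) by simp
      from fun_cong[OF this, of "{}"] show ?thesis by (simp add: ext_mult_body ext_one_def)
    qed
    ultimately show False by simp
  qed
  ultimately show False by blast
qed

text \<open>Both conditions say that the constant term vanishes, by \<open>body\<close>.\<close>
lemma odd_iff: "V \<in> opens U \<Longrightarrow> s \<in> C V \<Longrightarrow> s \<in> odd_ideal F V \<longleftrightarrow> h V s \<in> J_pow M 1 V"
proof -
  assume V: "V \<in> opens U" and s: "s \<in> C V"
  have oV: "open V" using V by (simp add: opens_def)
  note hs = h_closed[OF V s]
  show ?thesis
  proof
    assume "s \<in> odd_ideal F V"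
    then have z: "\<pi> V s = (\<lambda>x. 0)" using odd_ideal_iff[OF oV] by blast
    show "h V s \<in> J_pow M 1 V"
    proof (rule J_powI[OF hs])
      fix x assume x: "x \<in> V"
      obtain i where i: "i \<in> Idx" "x \<in> D i" by (rule D_cover)
      have "h V s i x {} = 0" using body[OF V s x i] z by simp
      then show "\<exists>i\<in>Idx. x \<in> D i \<and> ext_order 1 (h V s i x)"
        using ext_order_1[OF sections_Ext[OF hs]] i by blast
    qed
  next
    assume J: "h V s \<in> J_pow M 1 V"
    have "\<pi> V s x = 0" for x
    proof (cases "x \<in> V")
      case True
      obtain i where i: "i \<in> Idx" "x \<in> D i" by (rule D_cover)
      have "ext_order 1 (h V s i x)" using J by (simp add: J_pow_order)
      then show ?thesis using ext_order_1[OF sections_Ext[OF hs]] body[OF V s True i] by metis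
    next
      case False
      have "\<pi> V s \<in> carrier (salg (struct_sheaf M) V)" by (rule salg_homD(1)[OF pi_hom[OF oV] s])
      then show ?thesis using False by (simp add: struct_sheaf_def Let_def)
    qed
    then show "s \<in> odd_ideal F V" using odd_ideal_iff[OF oV] s by auto
  qed
qed

lemma k_odd: "V \<in> opens U \<Longrightarrow> v \<in> J_pow M 1 V \<Longrightarrow> k V v \<in> odd_ideal F V"
  using odd_iff[OF _ k_closed] h_k J_pow_sections by metis

subsection \<open>The conormal map in coordinates\<close>

text \<open>The conormal map transported to the split model.\<close>
definition T where "T V v = \<tau> V (k V v)"

lemma opens_open: "V \<in> opens W \<Longrightarrow> open V \<and> V \<subseteq> W"
  by (simp add: opens_def)

lemma T_bundle: "V \<in> opens U \<Longrightarrow> v \<in> J_pow M 1 V \<Longrightarrow> T V v \<in> bundle_sections M V"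
  unfolding T_def using tau_bundle k_odd opens_open by blast

lemma T_sections: "V \<in> opens U \<Longrightarrow> v \<in> J_pow M 1 V \<Longrightarrow> T V v \<in> sections V"
  using T_bundle by (auto simp: bundle_sections_def)

lemma T_add: "V \<in> opens U \<Longrightarrow> v \<in> J_pow M 1 V \<Longrightarrow> w \<in> J_pow M 1 V \<Longrightarrow>
    T V (\<lambda>i x K. v i x K + w i x K) = (\<lambda>i x K. T V v i x K + T V w i x K)"
  unfolding T_def k_add[OF _ J_pow_sections J_pow_sections]
  by (rule tau_add) (simp_all add: k_odd opens_def)

lemma T_mult: "V \<in> opens U \<Longrightarrow> u \<in> sections V \<Longrightarrow> v \<in> J_pow M 1 V \<Longrightarrow>
    T V (\<lambda>i x. ext_mult (u i x) (v i x)) = (\<lambda>i x K. \<pi> V (k V u) x * T V v i x K)"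
  unfolding T_def k_mult[OF _ _ J_pow_sections]
  by (rule tau_mult) (simp_all add: k_odd k_closed opens_def)

lemma T_rs: "V \<in> opens U \<Longrightarrow> W \<in> opens V \<Longrightarrow> v \<in> J_pow M 1 V \<Longrightarrow> sec_rs W (T V v) = T W (sec_rs W v)"
  unfolding T_def using tau_rs[OF _ _ _ k_odd, of V W v] k_rs[OF _ _ J_pow_sections, of V W v 1] by (simp add: opens_def)

lemma T_zero: "V \<in> opens U \<Longrightarrow> T V (\<lambda>i x K. 0) = (\<lambda>i x K. 0)"
  using T_add[OF _ J_pow_zero J_pow_zero, of V] by (simp add: fun_eq_iff)

lemma T_sum:
  assumes V: "V \<in> opens U" and f: "\<And>q. q \<in> A \<Longrightarrow> f q \<in> J_pow M 1 V"
  shows "T V (\<lambda>i x K. \<Sum>q\<in>A. f q i x K) = (\<lambda>i x K. \<Sum>q\<in>A. T V (f q) i x K)"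
  using f
proof (induction A rule: infinite_finite_induct)
  case (insert q A)
  have "T V (\<lambda>i x K. f q i x K + (\<Sum>q\<in>A. f q i x K)) =
    (\<lambda>i x K. T V (f q) i x K + T V (\<lambda>i x K. \<Sum>q\<in>A. f q i x K) i x K)"
    by (rule T_add[OF V]) (use insert in \<open>auto intro!: J_pow_sum\<close>)
  then show ?case using insert by simp
qed (simp_all add: T_zero[OF V])

text \<open>Near a point the section is a combination of frame elements with coefficients of order one. The conormal
  map is linear over all sections through their reduction, and frame elements reduce to zero.\<close>
lemma T_J2:
  assumes V: "V \<in> opens U" and v: "v \<in> J_pow M 2 V"
  shows "T V v = (\<lambda>i x K. 0)"
proof -
  have v1: "v \<in> J_pow M 1 V" using v J_pow_mono[of 1 2 V] by auto
  show ?thesis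
  proof (rule sec_rs_eqI[OF T_sections[OF V v1] sections_zero])
    fix x assume x: "x \<in> V"
    obtain i where i: "i \<in> Idx" "x \<in> D i" by (rule D_cover)
    define W where "W = V \<inter> D i"
    have W: "W \<in> opens V" "W \<in> opens U" "W \<subseteq> D i" "W \<subseteq> V" "x \<in> W" "open W"
      using V D_open[OF i(1)] i x by (auto simp: W_def opens_def)
    have "sec_rs W v \<in> J_pow M (Suc 1) W" using J_pow_rs[OF v W(4)] by (simp add: numeral_2_eq_2)
    then obtain w where w: "\<And>k. w k \<in> J_pow M 1 W"
      "sec_rs W v = (\<lambda>j x K. \<Sum>k<r. ext_mult (frame i W k j x) (w k j x) K)"
      using J_pow_Suc_expand[OF i(1) W(3)] by blast
    note fs = frame_sections[OF i(1) W(3)] and fJ = frame_J[OF i(1) W(3)]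
    have p: "\<pi> W (k W (frame i W l)) = (\<lambda>x. 0)" for l
      using k_odd[OF W(2) fJ] odd_ideal_iff[OF W(6)] by blast
    have fw: "(\<lambda>j x. ext_mult (frame i W l j x) (w l j x)) \<in> J_pow M 1 W" for l
      using J_pow_mult[OF fJ w(1), of l l] J_pow_mono[of 1 "1 + 1" W] by auto
    have "sec_rs W (T V v) = T W (sec_rs W v)" by (rule T_rs[OF V W(1) v1])
    also have "\<dots> = (\<lambda>j x K. \<Sum>k<r. T W (\<lambda>j x. ext_mult (frame i W k j x) (w k j x)) j x K)"
      unfolding w(2) by (rule T_sum[OF W(2) fw])
    also have "\<dots> = (\<lambda>j x K. 0)" by (simp add: T_mult[OF W(2) fs w(1)] p)
    also have "\<dots> = sec_rs W (\<lambda>j x K. 0)" by (simp add: sec_rs_def fun_eq_iff)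
    finally show "\<exists>W. x \<in> W \<and> sec_rs W (T V v) = sec_rs W (\<lambda>i x K. 0)" using W(5) by blast
  qed
qed

lemma frame_rs: "V \<subseteq> W \<Longrightarrow> sec_rs V (frame i W l) = frame i V l"
  by (auto simp: frame_def sec_rs_def triv_section_def fun_eq_iff)

definition conormal_matrix where
  "conormal_matrix i W y p l = T W (frame i W l) i y {p}"

lemma conormal_matrix_hol:
  assumes W: "W \<in> opens U" and i: "i \<in> Idx" "W \<subseteq> D i"
  shows "hol W (\<lambda>y. conormal_matrix i W y p l)"
  using sections_hol[OF T_sections[OF W frame_J[OF i, of l]] i(1), of "{p}"] i(2)
  by (simp add: conormal_matrix_def inf.absorb1)

text \<open>By linearity over functions, and because it kills sections of order two, the conormal map
  is given on degree-one parts by the matrix of its values on the frame.\<close>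
lemma T_coord:
  assumes W: "W \<in> opens U" and i: "i \<in> Idx" "W \<subseteq> D i" and V: "V \<in> opens W"
    and v: "v \<in> J_pow M 1 V" and y: "y \<in> V" and p: "p < r"
  shows "T V v i y {p} = (\<Sum>l<r. conormal_matrix i W y p l * v i y {l})"
proof -
  have VU: "V \<in> opens U" and VD: "V \<subseteq> D i" and VW: "V \<subseteq> W" and oV: "open V"
    using V W i by (auto simp: opens_def)
  note vs = J_pow_sections[OF v]
  define f where "f l = triv_section M i V (\<lambda>x K. v i x {l} * ext_one K)" for l
  have holc: "hol V (\<lambda>x. v i x {l} * ext_one K)" for l K
  proof -
    have "hol V (\<lambda>x. v i x {l})" using sections_hol[OF vs i(1), of "{l}"] VD by (simp add: inf.absorb1)
    then show ?thesis by (intro holo_on_mult holo_on_const)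
  qed
  have fs: "f l \<in> sections V" for l unfolding f_def by (intro triv_section i(1) VD holc)
  have fi: "f l i x = (\<lambda>K. v i x {l} * ext_one K)" if "x \<in> V" for l x
    unfolding f_def by (rule triv_section_same[OF i(1) VD that]) (auto simp: Ext_def ext_one_def)
  note frs = frame_sections[OF i(1) VD] and fJ = frame_J[OF i(1) VD]
  have fJ1: "(\<lambda>j x. ext_mult (f l j x) (frame i V l j x)) \<in> J_pow M 1 V" for l
    using J_pow_mult[of "f l" 0 V "frame i V l" 1] fs fJ by (simp add: J_pow_0)
  let ?w = "\<lambda>j x K. \<Sum>l<r. ext_mult (f l j x) (frame i V l j x) K"
  have w: "?w \<in> J_pow M 1 V" by (rule J_pow_sum[OF fJ1])
  have wi: "?w i x K = (\<Sum>l<r. v i x {l} * ext_gen {l} K)" if x: "x \<in> V" for x K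
  proof (rule sum.cong[OF refl])
    fix l assume "l \<in> {..<r}"
    then have "l < r" by simp
    then show "ext_mult (f l i x) (frame i V l i x) K = v i x {l} * ext_gen {l} K"
      by (simp add: fi[OF x] frame_same[OF i(1) VD x] ext_mult_scal_left ext_mult_one_left[OF ext_gen_Ext[of "{l}" r]])
  qed
  have d: "(\<lambda>j x K. v j x K - ?w j x K) \<in> J_pow M 2 V"
  proof (rule J_powI[OF sections_diff[OF vs J_pow_sections[OF w]]])
    fix x assume x: "x \<in> V"
    have "ext_order 2 (\<lambda>K. v i x K - ?w i x K)"
    proof (rule ext_order_2)
      show "(\<lambda>K. v i x K - ?w i x K) \<in> Ext r"
        by (rule sections_Ext[OF sections_diff[OF vs J_pow_sections[OF w]]])
      have "v i x {} = 0" using v ext_order_1[OF sections_Ext[OF vs, of i x]] by (simp add: J_pow_order)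
      moreover have "?w i x {} = 0" unfolding wi[OF x] by (simp add: ext_gen_def)
      ultimately show "v i x {} - ?w i x {} = 0" by simp
      fix k assume "k < r"
      have "?w i x {k} = (\<Sum>l<r. if l = k then v i x {l} else 0)"
        unfolding wi[OF x] by (rule sum.cong) (auto simp: ext_gen_def)
      then show "v i x {k} - ?w i x {k} = 0" using \<open>k < r\<close> by (simp add: sum.delta)
    qed
    then show "\<exists>i\<in>Idx. x \<in> D i \<and> ext_order 2 (\<lambda>K. v i x K - ?w i x K)" using i VD x by blast
  qed
  have d1: "(\<lambda>j x K. v j x K - ?w j x K) \<in> J_pow M 1 V" using d J_pow_mono[of 1 2 V] by auto
  have "T V (\<lambda>j x K. (v j x K - ?w j x K) + ?w j x K) = (\<lambda>j x K. T V (\<lambda>j x K. v j x K - ?w j x K) j x K + T V ?w j x K)"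
    by (rule T_add[OF VU d1 w])
  then have "T V v = T V ?w" unfolding T_J2[OF VU d] by simp
  also have "\<dots> = (\<lambda>j x K. \<Sum>l<r. T V (\<lambda>j x. ext_mult (f l j x) (frame i V l j x)) j x K)"
    by (rule T_sum[OF VU fJ1])
  finally have Tv: "T V v i y {p} = (\<Sum>l<r. \<pi> V (k V (f l)) y * T V (frame i V l) i y {p})"
    by (simp add: T_mult[OF VU fs fJ])
  have "\<pi> V (k V (f l)) y = v i y {l}" for l
  proof -
    have "h V (k V (f l)) i y {} = \<pi> V (k V (f l)) y"
      by (rule body[OF VU k_closed[OF VU fs] y i(1)]) (use VD y in blast)
    then show ?thesis unfolding h_k[OF VU fs] using fi[OF y] by (simp add: ext_one_def)
  qed
  moreover have "T V (frame i V l) i y {p} = conormal_matrix i W y p l" for l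
  proof -
    have "sec_rs V (T W (frame i W l)) = T V (frame i V l)"
      using T_rs[OF W V frame_J[OF i]] by (simp add: frame_rs[OF VW])
    then have "sec_rs V (T W (frame i W l)) i y {p} = T V (frame i V l) i y {p}" by simp
    then show ?thesis using y by (simp add: sec_rs_def conormal_matrix_def)
  qed
  ultimately show ?thesis unfolding Tv by (simp add: mult.commute)
qed

text \<open>Local surjectivity of the conormal map provides, near each point, a holomorphic right inverse of its
  matrix.\<close>
lemma conormal_matrix_inverse:
  assumes W: "W \<in> opens U" and i: "i \<in> Idx" "W \<subseteq> D i" and x: "x \<in> W"
  shows "\<exists>Y v. Y \<in> opens W \<and> x \<in> Y \<and> (\<forall>k<r. \<forall>l<r. hol Y (\<lambda>y. v y k l)) \<and>
     (\<forall>y\<in>Y. \<forall>k<r. \<forall>l<r. (\<Sum>p<r. conormal_matrix i W y k p * v y p l) = (if k = l then 1 else 0))"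
proof -
  have oW: "open W" using W by (simp add: opens_def)
  have "\<exists>p. fst p \<in> opens W \<and> x \<in> fst p \<and> snd p \<in> J_pow M 1 (fst p) \<and> T (fst p) (snd p) = frame i (fst p) l" for l
  proof -
    have "frame i W l \<in> bundle_sections M W"
      using frame_sections[OF i, of l] frame_hom[of i W l] by (auto simp: bundle_sections_def ext_hom_def)
    from tau_surj[OF oW this x] obtain Y where Y: "open Y" "x \<in> Y" "Y \<subseteq> W" "sec_rs Y (frame i W l) \<in> \<tau> Y ` odd_ideal F Y"
      by (elim exE conjE) (rule that)
    then obtain s where s: "s \<in> odd_ideal F Y" "\<tau> Y s = frame i Y l" unfolding frame_rs[OF Y(3)] by auto
    have YU: "Y \<in> opens U" "Y \<in> opens W" using Y W by (auto simp: opens_def)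
    have sc: "s \<in> C Y" using s(1) odd_ideal_iff[OF Y(1)] by blast
    have "h Y s \<in> J_pow M 1 Y" using odd_iff[OF YU(1) sc] s(1) by blast
    moreover have "T Y (h Y s) = frame i Y l" by (simp add: T_def k_h[OF YU(1) sc] s(2))
    ultimately show ?thesis using YU(2) Y(2) by (intro exI[of _ "(Y, h Y s)"]) simp
  qed
  then have "\<forall>l. \<exists>p. fst p \<in> opens W \<and> x \<in> fst p \<and> snd p \<in> J_pow M 1 (fst p) \<and> T (fst p) (snd p) = frame i (fst p) l"
    by (rule allI)
  from choice[OF this] obtain q where q: "\<forall>l. fst (q l) \<in> opens W \<and> x \<in> fst (q l) \<and> snd (q l) \<in> J_pow M 1 (fst (q l)) \<and>
      T (fst (q l)) (snd (q l)) = frame i (fst (q l)) l" ..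
  define Y where "Y l = fst (q l)" for l
  define w where "w l = snd (q l)" for l
  note q' = q[rule_format, folded Y_def w_def]
  have Y: "\<And>l. Y l \<in> opens W" "\<And>l. x \<in> Y l" "\<And>l. w l \<in> J_pow M 1 (Y l)" "\<And>l. T (Y l) (w l) = frame i (Y l) l"
    by (rule q'[THEN conjunct1], rule q'[THEN conjunct2, THEN conjunct1],
        rule q'[THEN conjunct2, THEN conjunct2, THEN conjunct1], rule q'[THEN conjunct2, THEN conjunct2, THEN conjunct2])
  define Z where "Z = W \<inter> (\<Inter>l<r. Y l)"
  have oZ: "open Z" unfolding Z_def using oW Y(1) by (intro open_Int open_INT) (auto simp: opens_def)
  have Z: "Z \<in> opens W" "x \<in> Z" "Z \<in> opens U" "Z \<subseteq> D i"
    using oZ x Y(2) W i by (auto simp: Z_def opens_def)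
  have ZY: "Z \<subseteq> Y l" "Z \<in> opens (Y l)" if "l < r" for l using that oZ by (auto simp: Z_def opens_def)
  have YU: "Y l \<in> opens U" for l using Y(1)[of l] W by (auto simp: opens_def)
  define v where "v y p l = sec_rs Z (w l) i y {p}" for y p l
  have wZ: "sec_rs Z (w l) \<in> J_pow M 1 Z" if "l < r" for l by (rule J_pow_rs[OF Y(3) ZY(1)[OF that]])
  have "hol Z (\<lambda>y. v y k l)" if "l < r" for k l
    unfolding v_def using sections_hol[OF J_pow_sections[OF wZ[OF that]] i(1), of "{k}"] Z(4) by (simp add: inf.absorb1)
  moreover have "(\<Sum>p<r. conormal_matrix i W y k p * v y p l) = (if k = l then 1 else 0)"
    if y: "y \<in> Z" and kl: "k < r" "l < r" for y k l
  proof -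
    have "T Z (sec_rs Z (w l)) = sec_rs Z (T (Y l) (w l))" using T_rs[OF YU ZY(2)[OF kl(2)] Y(3)] by simp
    also have "\<dots> = frame i Z l" by (simp add: Y(4) frame_rs[OF ZY(1)[OF kl(2)]])
    finally have "T Z (sec_rs Z (w l)) i y {k} = ext_gen {l} {k}"
      using frame_same[OF i(1) Z(4) y kl(2)] by simp
    then show ?thesis
      using T_coord[OF W i Z(1) wZ[OF kl(2)] y kl(1)] by (simp add: v_def ext_gen_def)
  qed
  ultimately show ?thesis using Z(1,2) by blast
qed

end

section \<open>The transition cocycle and the splitting\<close>

context supermfd
begin

text \<open>Isomorphisms with the split model that induce the given identification of the conormal sheaf with the
  bundle, expressed without forming quotients.\<close>
definition normalized where
  "normalized Y h \<longleftrightarrow> sheaf_iso id Y F SM h \<and>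
     (\<forall>V\<in>opens Y. \<forall>s\<in>odd_ideal F V. (\<lambda>i x K. h V s i x K - \<tau> V s i x K) \<in> J_pow M 2 V)"

lemma normalized_iso: "normalized Y h \<Longrightarrow> sheaf_iso id Y F SM h"
  by (simp add: normalized_def)

lemma normalized_local: "normalized Y h \<Longrightarrow> local_iso M F \<pi> \<tau> Y h"
  by (simp add: local_iso_def local_iso_axioms_def supermfd_axioms normalized_def)

lemma normalized_subset: "normalized Y h \<Longrightarrow> Z \<subseteq> Y \<Longrightarrow> normalized Z h"
  unfolding normalized_def using sheaf_iso_subset opens_mono by blast

text \<open>Composing a local isomorphism with the automorphism given by the matrix of the conormal map makes it
  compatible with the given identification of the conormal sheaf.\<close>
lemma normalized_exists: "\<exists>Y h. open Y \<and> x \<in> Y \<and> normalized Y h"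
proof -
  obtain U h where U: "open U" "x \<in> U" "sheaf_iso id U F SM h" using locally_split by blast
  interpret L: local_iso M F \<pi> \<tau> U h by unfold_locales (rule U(3))
  obtain i where i: "i \<in> Idx" "x \<in> D i" by (rule D_cover)
  define W where "W = U \<inter> D i"
  have W: "W \<in> opens U" "W \<subseteq> D i" "x \<in> W" using U D_open[OF i(1)] i by (auto simp: W_def opens_def)
  obtain Y v where Y: "Y \<in> opens W" "x \<in> Y" "\<forall>k<r. \<forall>l<r. hol Y (\<lambda>y. v y k l)"
    "\<forall>y\<in>Y. \<forall>k<r. \<forall>l<r. (\<Sum>p<r. L.conormal_matrix i W y k p * v y p l) = (if k = l then 1 else 0)"
    using L.conormal_matrix_inverse[OF W(1) i(1) W(2,3)] by blast
  let ?g = "L.conormal_matrix i W"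
  have YW: "Y \<subseteq> W" "Y \<subseteq> D i" "open Y" "Y \<subseteq> U" using Y(1) W by (auto simp: opens_def)
  have g_hol: "hol V (\<lambda>y. ?g y k l)" if "V \<subseteq> W" for V k l
    by (rule holo_on_subset[OF L.conormal_matrix_hol[OF W(1) i(1) W(2)] that])
  have A: "sheaf_iso id Y SM SM (matrix_map i ?g)"
    by (rule sheaf_iso_matrix_map[OF i(1) YW(2) g_hol[OF YW(1)], of v]) (use Y in auto)
  let ?h = "\<lambda>V s. matrix_map i ?g V (h V s)"
  have iso: "sheaf_iso id Y F SM ?h" by (rule sheaf_iso_comp[OF sheaf_iso_subset[OF U(3) YW(4)] A])
  have "(\<lambda>i x K. ?h V s i x K - \<tau> V s i x K) \<in> J_pow M 2 V" if V: "V \<in> opens Y" and s: "s \<in> odd_ideal F V" for V s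
  proof -
    have VU: "V \<in> opens U" "V \<in> opens W" "V \<subseteq> W" "V \<subseteq> D i" "open V" using V Y(1) W by (auto simp: opens_def)
    have sc: "s \<in> C V" using s odd_ideal_iff[OF VU(5)] by blast
    have hJ: "h V s \<in> J_pow M 1 V" using L.odd_iff[OF VU(1) sc] s by blast
    note hs = J_pow_sections[OF hJ]
    have mm: "?h V s \<in> sections V" "\<And>y. y \<in> V \<Longrightarrow> ?h V s i y = ext_map r (?g y) (h V s i y)"
      using matrix_map[where g = ?g, OF i(1) VU(4) g_hol[OF VU(3)] hs] by blast+
    have tb: "\<tau> V s \<in> bundle_sections M V" by (rule tau_bundle[OF VU(5) s])
    then have ts: "\<tau> V s \<in> sections V" by (simp add: bundle_sections_def)
    note ds = sections_diff[OF mm(1) ts]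
    show ?thesis
    proof (rule J_powI[OF ds])
      fix y assume y: "y \<in> V"
      have "ext_order 2 (\<lambda>K. ?h V s i y K - \<tau> V s i y K)"
      proof (rule ext_order_2[OF sections_Ext[OF ds]])
        have "h V s i y {} = 0" using hJ ext_order_1[OF sections_Ext[OF hs, of i y]] by (simp add: J_pow_order)
        moreover have "\<tau> V s i y {} = 0"
        proof (rule ccontr)
          assume "\<tau> V s i y {} \<noteq> 0"
          then have "card ({} :: nat set) = 1" using tb unfolding bundle_sections_def by blast
          then show False by simp
        qed
        ultimately show "?h V s i y {} - \<tau> V s i y {} = 0" using mm(2)[OF y] by (simp add: ext_map_body)
        fix k assume k: "k < r"
        have "?h V s i y {k} = (\<Sum>l<r. ?g y k l * h V s i y {l})"
          unfolding mm(2)[OF y] by (rule ext_map_singleton[OF sections_Ext[OF hs] k])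
        also have "\<dots> = L.T V (h V s) i y {k}" by (rule L.T_coord[OF W(1) i(1) W(2) VU(2) hJ y k, symmetric])
        also have "\<dots> = \<tau> V s i y {k}" by (simp add: L.T_def L.k_h[OF VU(1) sc])
        finally show "?h V s i y {k} - \<tau> V s i y {k} = 0" by simp
      qed
      then show "\<exists>i\<in>Idx. y \<in> D i \<and> ext_order 2 (\<lambda>K. ?h V s i y K - \<tau> V s i y K)" using i(1) VU(4) y by blast
    qed
  qed
  then have "normalized Y ?h" using iso by (simp add: normalized_def)
  then show ?thesis using YW Y(2) by blast
qed

definition transition where
  "transition Y h h' = (\<lambda>V\<in>opens Y. \<lambda>u\<in>sections V. h V (inv_into (C V) (h' V) u))"

text \<open>
  Two normalized isomorphisms agree modulo order two: on even sections because both reduce to the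
  same function, on odd sections because both induce the same conormal map.
\<close>
lemma transition_G:
  assumes n: "normalized Y h" "normalized Y h'"
  shows "transition Y h h' \<in> G_sec M 2 Y"
proof -
  interpret L: local_iso M F \<pi> \<tau> Y h by (rule normalized_local[OF n(1)])
  interpret L': local_iso M F \<pi> \<tau> Y h' by (rule normalized_local[OF n(2)])
  have iso: "sheaf_iso id Y SM SM (\<lambda>V u. h V (L'.k V u))" by (rule sheaf_iso_comp[OF L'.k_iso L.iso])
  have eq: "transition Y h h' V u = h V (L'.k V u)" if "V \<in> opens Y" "u \<in> sections V" for V u
    using that by (simp add: transition_def L'.k_def)
  have tiso: "sheaf_iso id Y SM SM (transition Y h h')"
    by (rule sheaf_iso_cong[OF SM_closed iso]) (simp add: eq opens_def)
  show ?thesis unfolding G_sec_iff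
  proof (intro conjI ballI tiso)
    show "transition Y h h' \<in> carrier (families Y)"
    proof (rule familiesI)
      fix V assume "V \<in> opens Y"
      then show "bij_betw (transition Y h h' V) (sections V) (sections V)"
        using sheaf_iso_idD(2)[OF tiso, of V] by (simp add: opens_def)
    qed (auto simp: transition_def)
    fix V u assume V: "V \<in> opens Y" and u: "u \<in> sections V"
    have oV: "open V" using V by (simp add: opens_def)
    define w where "w = L'.k V u"
    have wc: "w \<in> C V" and hw: "h' V w = u" unfolding w_def by (rule L'.k_closed[OF V u], rule L'.h_k[OF V u])
    note cl = salg_closedD[OF presheaf_closedD(1)[OF F_closed oV]]
    obtain w0 w1 where ww: "w0 \<in> part (salg F V) False" "w1 \<in> part (salg F V) True" "w = w0 \<oplus>\<^bsub>salg F V\<^esub> w1"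
      using cl(6)[OF wc] by blast
    note c0 = cl(5)[OF ww(1)] and c1 = cl(5)[OF ww(2)]
    note hh = salg_homD[OF L.h_hom[OF V]] and hh' = salg_homD[OF L'.h_hom[OF V]]
    have split: "h V w = (\<lambda>i x K. h V w0 i x K + h V w1 i x K)" "h' V w = (\<lambda>i x K. h' V w0 i x K + h' V w1 i x K)"
      unfolding ww(3) using hh(3)[OF c0 c1] hh'(3)[OF c0 c1] by simp_all
    have even: "(\<lambda>i x K. h V w0 i x K - h' V w0 i x K) \<in> J_pow M 2 V"
    proof -
      have p: "(\<lambda>i x K. h V w0 i x K - h' V w0 i x K) \<in> part (salg SM V) False"
        by (rule part_diff[OF hh(6)[OF ww(1)] hh'(6)[OF ww(1)]])
      then have ps: "(\<lambda>i x K. h V w0 i x K - h' V w0 i x K) \<in> sections V" by simp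
      show ?thesis
      proof (rule J_powI[OF ps])
        fix x assume x: "x \<in> V"
        obtain i where i: "i \<in> Idx" "x \<in> D i" by (rule D_cover)
        let ?e = "\<lambda>K. h V w0 i x K - h' V w0 i x K"
        have "ext_order 2 ?e"
        proof (rule ext_order_2)
          show "?e \<in> Ext r" by (rule sections_Ext[OF ps])
          show "?e {} = 0" using L.body[OF V c0 x i] L'.body[OF V c0 x i] by simp
          show "?e {k} = 0" for k
          proof (rule ccontr)
            assume "?e {k} \<noteq> 0"
            then have "odd (card {k}) = False" using p unfolding split_model_simps by blast
            then show False by simp
          qed
        qed
        then show "\<exists>i\<in>Idx. x \<in> D i \<and> ext_order 2 (\<lambda>K. h V w0 i x K - h' V w0 i x K)" using i by blast
      qed
    qed
    have odd: "(\<lambda>i x K. h V w1 i x K - h' V w1 i x K) \<in> J_pow M 2 V"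
    proof -
      have "h V w1 \<in> part (salg SM V) True" by (rule hh(6)[OF ww(2)])
      then have "h V w1 \<in> J_pow M 1 V"
        unfolding J_pow_def split_model_simps using odd_pos by (auto simp: Suc_le_eq)
      then have o: "w1 \<in> odd_ideal F V" using L.odd_iff[OF V c1] by blast
      have "(\<lambda>i x K. h V w1 i x K - \<tau> V w1 i x K) \<in> J_pow M 2 V" "(\<lambda>i x K. h' V w1 i x K - \<tau> V w1 i x K) \<in> J_pow M 2 V"
        using n V o unfolding normalized_def by blast+
      from J_pow_diff[OF this] show ?thesis by simp
    qed
    from J_pow_add[OF even odd]
    show "(\<lambda>i x K. transition Y h h' V u i x K - u i x K) \<in> J_pow M 2 V"
      unfolding eq[OF V u] w_def[symmetric] split(1) by (simp add: hw[symmetric] split(2) algebra_simps)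
  qed
qed

text \<open>The transition automorphisms of the normalized isomorphisms form a cocycle in G 2. Climbing past
  the rank turns it into a cocycle of identities.\<close>
lemma split_of_vanishing:
  assumes good: "good_model M"
    and van: "carrier (first_obstruction_cohomology M) = {\<one>\<^bsub>first_obstruction_cohomology M\<^esub>}"
  shows "\<exists>h. sheaf_iso id UNIV F SM h"
proof -
  define \<U> where "\<U> = {Y. open Y \<and> (\<exists>h. normalized Y h)}"
  define H where "H Y = (SOME h. normalized Y h)" for Y
  have H: "normalized Y (H Y)" "open Y" if "Y \<in> \<U>" for Y
    using that someI_ex[of "normalized Y"] by (auto simp: \<U>_def H_def)
  have cov: "open_cover \<U>" 
  proof -
    have "x \<in> \<Union>\<U>" for x using normalized_exists[of x] unfolding \<U>_def by blast
    then show ?thesis unfolding open_cover_def by (auto simp: \<U>_def)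
  qed
  define g where "g A B = transition (A \<inter> B) (H A) (H B)" for A B
  have gG: "g A B \<in> G_sec M 2 (A \<inter> B)" if "A \<in> \<U>" "B \<in> \<U>" for A B
    unfolding g_def by (intro transition_G normalized_subset[OF H(1)] that) auto
  have g_eval: "g A B V u = H A V (inv_into (C V) (H B V) u)" if "V \<in> opens (A \<inter> B)" "u \<in> sections V" for A B V u
    using that by (simp add: g_def transition_def)
  have Z: "(\<U>, g) \<in> Z1 (G_sheaf M 2)"
  proof (rule filt.P.Z1I[OF cov])
    show "g A B \<in> carrier (grp (G_sheaf M 2) (A \<inter> B))" if "A \<in> \<U>" "B \<in> \<U>" for A B
      unfolding G_carrier by (rule gG[OF that])
    fix A B E assume w: "A \<in> \<U>" "B \<in> \<U>" "E \<in> \<U>"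
    let ?I = "A \<inter> B \<inter> E"
    have sub: "?I \<subseteq> A \<inter> B" "?I \<subseteq> B \<inter> E" "?I \<subseteq> A \<inter> E" by auto
    note r = G_sec_rs[OF sub(1) gG[OF w(1,2)]] G_sec_rs[OF sub(2) gG[OF w(2,3)]] G_sec_rs[OF sub(3) gG[OF w(1,3)]]
    note rf = G_sec_families[OF r(1)] G_sec_families[OF r(2)] G_sec_families[OF r(3)]
    have "restrict (g A B) (opens ?I) \<otimes>\<^bsub>families ?I\<^esub> restrict (g B E) (opens ?I) = restrict (g A E) (opens ?I)"
    proof (rule families_eqI[OF G_sec_families[OF G_sec_mult[OF r(1,2)]] rf(3)])
      fix V u assume V: "V \<in> opens ?I" "u \<in> sections V"
      have VI: "V \<in> opens (A \<inter> B)" "V \<in> opens (B \<inter> E)" "V \<in> opens (A \<inter> E)" "V \<in> opens B" "V \<in> opens E"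
        using V(1) by (auto simp: opens_def)
      interpret LB: local_iso M F \<pi> \<tau> B "H B" by (rule normalized_local[OF H(1)[OF w(2)]])
      interpret LE: local_iso M F \<pi> \<tau> E "H E" by (rule normalized_local[OF H(1)[OF w(3)]])
      have k: "LE.k V u \<in> C V" by (rule LE.k_closed[OF VI(5) V(2)])
      have "g B E V u = H B V (LE.k V u)" unfolding g_eval[OF VI(2) V(2)] LE.k_def ..
      then have "g A B V (g B E V u) = H A V (LB.k V (H B V (LE.k V u)))"
        using g_eval[OF VI(1) LB.h_closed[OF VI(4) k]] by (simp add: LB.k_def)
      also have "\<dots> = g A E V u" unfolding LB.k_h[OF VI(4) k] by (simp add: g_eval[OF VI(3) V(2)] LE.k_def)
      finally show "(restrict (g A B) (opens ?I) \<otimes>\<^bsub>families ?I\<^esub> restrict (g B E) (opens ?I)) V u =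
        restrict (g A E) (opens ?I) V u"
        using V by (simp add: families_mult[OF rf(1,2) V])
    qed
    then show "grs (G_sheaf M 2) (A \<inter> B) ?I (g A B) \<otimes>\<^bsub>grp (G_sheaf M 2) ?I\<^esub> grs (G_sheaf M 2) (B \<inter> E) ?I (g B E) =
       grs (G_sheaf M 2) (A \<inter> E) ?I (g A E)"
      by (simp add: G_sheaf_grs G2_mult)
  qed
  \<comment> \<open>The step 2 + r exceeds the rank, so its sections are identities.\<close>
  obtain d where d: "d \<in> Z1 (G_sheaf M (2 + r))" "((\<U>, g), d) \<in> H1_rel (G_sheaf M 2)"
    using climb[OF good van Z, of r] by blast
  obtain \<V> e where de: "d = (\<V>, e)" by (cases d)
  have rel: "((\<U>, g), (\<V>, e)) \<in> H1_rel (G_sheaf M 2)" using d(2) by (simp add: de)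
  obtain \<W> \<rho> \<sigma> l where L: "filt.P.H1_link \<U> g \<V> e \<W> \<rho> \<sigma> l" using filt.P.H1_rel_link[OF rel] by blast
  note mem = filt.P.H1_link_mem[OF L]
  interpret GR: grp_presheaf "G_sheaf M (2 + r)" by (rule G_sheaf_presheaf)
  have Ze: "(\<V>, e) \<in> Z1 (G_sheaf M (2 + r))" using d(1) by (simp add: de)
  have l: "l W \<in> G_sec M 2 W" if "W \<in> \<W>" for W using mem[OF that] by (simp add: G_carrier)
  have Hr: "normalized W (H (\<rho> W))" if "W \<in> \<W>" for W
    using mem[OF that] H(1) normalized_subset by blast
  \<comment> \<open>Since the cocycle now takes values in the trivial group, correcting each chart by the automorphism
    that trivialises the cocycle makes the charts agree on overlaps.\<close>
  define K where "K W V s = inv_into (sections V) (l W V) (H (\<rho> W) V s)" for W V s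
  have K_iso: "sheaf_iso id W F SM (K W)" if W: "W \<in> \<W>" for W
  proof -
    have "sheaf_iso id W SM SM (\<lambda>V. inv_into (carrier (salg SM V)) (l W V))"
      by (rule sheaf_iso_inverse[OF SM_closed]) (use l[OF W] in \<open>simp add: G_sec_iff\<close>)
    from sheaf_iso_comp[OF normalized_iso[OF Hr[OF W]] this] show ?thesis by (simp add: K_def[abs_def])
  qed
  have l_bij: "bij_betw (l W V) (sections V) (sections V)" if "W \<in> \<W>" "V \<in> opens W" for W V
    by (rule familiesD(1)[OF G_sec_families[OF l[OF that(1)]] that(2)])
  have agree: "K W V s = K W' V s"
    if W: "W \<in> \<W>" "W' \<in> \<W>" and V: "open V" "V \<subseteq> W" "V \<subseteq> W'" and s: "s \<in> C V" for W W' V s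
  proof -
    note m = mem[OF W(1)] mem[OF W(2)]
    have VI: "V \<in> opens W" "V \<in> opens W'" "V \<in> opens (W \<inter> W')" "V \<in> opens V" "V \<in> opens (\<rho> W \<inter> \<rho> W')"
      "V \<in> opens (\<sigma> W \<inter> \<sigma> W')" "V \<in> opens (\<rho> W')" "V \<subseteq> \<rho> W \<inter> \<rho> W'" "V \<subseteq> \<sigma> W \<inter> \<sigma> W'"
      using V m by (auto simp: opens_def)
    interpret LW: local_iso M F \<pi> \<tau> W "H (\<rho> W)" by (rule normalized_local[OF Hr[OF W(1)]])
    interpret LW': local_iso M F \<pi> \<tau> W' "H (\<rho> W')" by (rule normalized_local[OF Hr[OF W(2)]])
    have hs: "H (\<rho> W) V s \<in> sections V" "H (\<rho> W') V s \<in> sections V"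
      using LW.h_closed[OF VI(1) s] LW'.h_closed[OF VI(2) s] .
    define u where "u = K W' V s"
    have u: "u \<in> sections V" "l W' V u = H (\<rho> W') V s"
      unfolding u_def K_def using l_bij[OF W(2) VI(2)] hs(2)
      by (metis bij_betw_def inv_into_into, metis bij_betw_inv_into_right)
    have eqn: "grs (G_sheaf M 2) (\<rho> W \<inter> \<rho> W') V (g (\<rho> W) (\<rho> W')) \<otimes>\<^bsub>grp (G_sheaf M 2) V\<^esub> grs (G_sheaf M 2) W' V (l W') =
          grs (G_sheaf M 2) W V (l W) \<otimes>\<^bsub>grp (G_sheaf M 2) V\<^esub> grs (G_sheaf M 2) (\<sigma> W \<inter> \<sigma> W') V (e (\<sigma> W) (\<sigma> W'))"
      by (rule filt.P.H1_link_eq[OF L W V(1)]) (use V in blast)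
    have eG: "e (\<sigma> W) (\<sigma> W') \<in> G_sec M (2 + r) (\<sigma> W \<inter> \<sigma> W')"
      using GR.Z1_closed[OF Ze] m unfolding G_carrier by blast
    have eG2: "e (\<sigma> W) (\<sigma> W') \<in> G_sec M 2 (\<sigma> W \<inter> \<sigma> W')" using eG G_sec_mono[of 2 "2 + r"] by auto
    have gG': "g (\<rho> W) (\<rho> W') \<in> G_sec M 2 (\<rho> W \<inter> \<rho> W')" using gG m by blast
    note f = G_sec_families[OF G_sec_rs[OF VI(8) gG']] G_sec_families[OF G_sec_rs[OF V(3) l[OF W(2)]]]
      G_sec_families[OF G_sec_rs[OF V(2) l[OF W(1)]]] G_sec_families[OF G_sec_rs[OF VI(9) eG2]]
    have "g (\<rho> W) (\<rho> W') V (l W' V u) = l W V (e (\<sigma> W) (\<sigma> W') V u)"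
      using fun_cong[OF fun_cong[OF eqn], of V u] families_mult[OF f(1,2) VI(4) u(1)] families_mult[OF f(3,4) VI(4) u(1)] VI(4)
      by (simp add: G_sheaf_grs G2_mult)
    moreover have "e (\<sigma> W) (\<sigma> W') V u = u" by (rule G_sec_trivial[OF _ eG VI(6) u(1)]) simp
    moreover have "g (\<rho> W) (\<rho> W') V (l W' V u) = H (\<rho> W) V s"
      unfolding u(2) g_eval[OF VI(5) hs(2)] using LW'.k_h[OF VI(2) s] by (simp add: LW'.k_def)
    ultimately have "l W V u = H (\<rho> W) V s" by simp
    then have "K W V s = u" unfolding K_def using bij_betw_inv_into_left[OF l_bij[OF W(1) VI(1)] u(1)] by simp
    then show ?thesis by (simp add: u_def)
  qed
  \<comment> \<open>Each sufficiently small open set gets the corrected chart of some member of the cover; by agree, the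
    choice does not matter.\<close>
  define B where "B = {Y. open Y \<and> (\<exists>W\<in>\<W>. Y \<subseteq> W)}"
  define c where "c Y = (SOME W. W \<in> \<W> \<and> Y \<subseteq> W)" for Y
  have c: "c Y \<in> \<W> \<and> Y \<subseteq> c Y" if "Y \<in> B" for Y
    unfolding c_def by (rule someI_ex) (use that in \<open>auto simp: B_def\<close>)
  note Kd = sheaf_iso_idD[OF K_iso]
  show ?thesis
  proof (rule glue_iso[of B "\<lambda>Y. K (c Y) Y"])
    show oB: "open Y" if "Y \<in> B" for Y using that by (simp add: B_def)
    show "Z \<in> B" if "Y \<in> B" "open Z" "Z \<subseteq> Y" for Y Z using that by (auto simp: B_def)
    have "\<W> \<subseteq> B" using mem by (auto simp: B_def)
    moreover have "\<Union>\<W> = UNIV" using filt.P.H1_link_cover[OF L] by (simp add: open_cover_def)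
    ultimately show "\<Union>B = UNIV" by blast
    fix Y assume Y: "Y \<in> B"
    note cY = c[OF Y]
    show "K (c Y) Y \<in> salg_hom (salg F Y) (salg SM Y)" using Kd(1)[of "c Y" Y] cY oB[OF Y] by blast
    show "bij_betw (K (c Y) Y) (C Y) (sections Y)" using Kd(2)[of "c Y" Y] cY oB[OF Y] by simp
    fix Z s assume Z: "Z \<in> B" "Z \<subseteq> Y" and s: "s \<in> C Y"
    note cZ = c[OF Z(1)]
    have "sec_rs Z (K (c Y) Y s) = K (c Y) Z (srs F Y Z s)"
      using Kd(3)[of "c Y" Y Z s] cY oB[OF Y] oB[OF Z(1)] Z(2) s unfolding srs_split_model by blast
    also have "\<dots> = K (c Z) Z (srs F Y Z s)"
      by (rule agree) (use cY cZ oB[OF Y] oB[OF Z(1)] Z(2) s presheaf_closedD(2)[OF F_closed] in auto)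
    finally show "sec_rs Z (K (c Y) Y s) = K (c Z) Z (srs F Y Z s)" .
  qed
qed

end

theorem theorem6p17:
  fixes M :: "('x::{t2_space,second_countable_topology}, 'i) model"
  assumes "is_model M"
    and "good_model M"
    and "carrier (first_obstruction_cohomology M) = {\<one>\<^bsub>first_obstruction_cohomology M\<^esub>}"
  shows "\<forall>\<XX> :: ('x, 's) salg_sheaf. supermanifold M \<XX> \<longrightarrow> is_split M \<XX>"
proof (intro allI impI)
  fix \<XX> :: "('x, 's) salg_sheaf"
  assume X: "supermanifold M \<XX>"
  then obtain \<pi> \<tau> where "reduction M \<XX> \<pi>" "conormal M \<XX> \<pi> \<tau>" unfolding supermanifold_def by blast
  then interpret supermfd M \<XX> \<pi> \<tau>
    using X assms(1) by unfold_locales (auto simp: supermanifold_def)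
  obtain h where h: "sheaf_iso id UNIV \<XX> (split_model M) h" using split_of_vanishing[OF assms(2,3)] by blast
  have "homeomorphism (UNIV :: 'x set) UNIV id id" by (simp add: homeomorphism_def)
  then show "is_split M \<XX>" unfolding is_split_def using h by blast
qed

end
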